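(* Let $q\in\mathbb{C}$ with $0<|q|<1$. Then the tuple $(\mathcal{A}_f,\ \mathcal{H}\otimes\mathbb{C}^2,\ \pi_{eq},\ \mathscr{D},\ \gamma)$ (with the unitary representation $\mathbb{U}\otimes I_2$ of $\mathbb{T}^3$ on $\mathcal{H}\otimes\mathbb{C}^2$) is a $\mathbb{T}^3$-equivariant, $3^+$-summable, even spectral triple for the $C^*$-dynamical system $(C(U_q(2)),\mathbb{T}^3,\alpha)$.
   Context: Here $\mathbb{N}=\{0,1,2,\dots\}$. For non-zero complex $q$, $C(U_q(2))$ denotes the universal unital $C^*$-algebra generated by $a,b,D$ satisfying $$ba=q\,ab,\quad a^*b=q\,ba^*,\quad bb^*=b^*b,\quad aa^*+bb^*=1,$$ $$aD=Da,\quad bD=q^2|q|^{-2}Db,\quad DD^*=D^*D=1,\quad a^*a+|q|^2b^*b=1,$$ and $\mathcal{A}_f$ is the (dense, unital) $*$-subalgebra generated by $a,b,D$. Let $\theta=\frac1\pi\arg(q)$ and $\mathcal{H}=\ell^2(\mathbb{N})\otimes\ell^2(\mathbb{Z})\otimes\ell^2(\mathbb{Z})$ with standard orthonormal basis $\{e_{i,j,k}:i\in\mathbb{N},\ j,k\in\mathbb{Z}\}$. The representation $\pi$ of $C(U_q(2))$ on $\mathcal{H}$ is $$\pi(a)e_{i,j,k}=\sqrt{1-|q|^{2i+2}}\,e_{i+1,j,k},\quad \pi(b)e_{i,j,k}=q^i e_{i,j+1,k},\quad \pi(D)e_{i,j,k}=e^{-2\pi\sqrt{-1}\,\theta j}e_{i,j,k+1}.$$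 The action $\alpha$ of $\mathbb{T}^3$ on $C(U_q(2))$ is given by $\alpha_{(z_1,z_2,z_3)}:a\mapsto z_1a,\ b\mapsto z_2b,\ D\mapsto z_3D$, and the unitary representation $\mathbb{U}$ of $\mathbb{T}^3$ on $\mathcal{H}$ by $\mathbb{U}_{(z_1,z_2,z_3)}e_{i,j,k}=z_1^iz_2^jz_3^ke_{i,j,k}$. Let $T$ be the unbounded operator on $\mathcal{H}$ with $Te_{i,j,k}=d(i,j,k)e_{i,j,k}$, where $d(i,j,k)=i+j+\sqrt{-1}k$ if $j\ge0$ and $d(i,j,k)=-i+j+\sqrt{-1}k$ if $j<0$. On $\mathcal{H}\otimes\mathbb{C}^2$ put $$\pi_{eq}(x)=\begin{pmatrix} \pi(x) & 0 \\ 0 & \pi(x) \end{pmatrix},\quad \mathscr{D}=\begin{pmatrix} 0 & T^* \\ T & 0 \end{pmatrix},\quad \gamma=\begin{pmatrix} 1 & 0 \\ 0 & -1 \end{pmatrix},$$ where $\mathscr{D}$ denotes the unique self-adjoint extension from the span of the standard basis vectors. Definitions. For a unital $C^*$-algebra $\mathscr{A}$ with a dense unital $*$-subalgebra $\mathcal{A}$, an even spectral triple consists of a separable Hilbert space on which $\mathcal{A}$ acts by bounded operators, an unbounded self-adjoint operator $\mathscr{D}$ with compact resolvent such that $[\mathscr{D},x]$ extends to a bounded operator for every $x\in\mathcal{A}$, and a $\mathbb{Z}_2$-grading operator $\gamma$ commuting with $\mathcal{A}$ and anticommuting with $\mathscr{D}$. It is $p^+$-summable if $|\mathscr{D}|^{-p}$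 (taken on the orthogonal complement of the finite-dimensional kernel of $\mathscr{D}$) lies in the Dixmier ideal $\mathcal{L}^{(1,\infty)}$, the ideal of compact operators with singular values $\mu_0\ge\mu_1\ge\cdots$ satisfying $\sup_{n\ge2}\frac{1}{\log n}\sum_{m<n}\mu_m<\infty$. For a $C^*$-dynamical system $(\mathscr{A},\mathbb{G},\alpha)$ ($\mathbb{G}$ a compact group, $\alpha$ a strongly continuous action on $\mathscr{A}$), an even $\mathbb{G}$-equivariant spectral triple is a tuple $(\pi,\mathbb{U},\mathscr{H},\mathscr{D},\gamma)$ such that: (i) $\pi$ is a unital $*$-representation of $\mathscr{A}$ and $\mathbb{U}$ a unitary representation of $\mathbb{G}$ on the separable Hilbert space $\mathscr{H}$ with $\pi(\alpha_g(x))=\mathbb{U}_g\pi(x)\mathbb{U}_g^*$ for all $x\in\mathscr{A}$, $g\in\mathbb{G}$; (ii) $\pi$ is faithful; (iii) $(\pi,\mathscr{H},\mathscr{D},\gamma)$ is an even spectral triple for $\mathscr{A}$; (iv) $\mathbb{U}_g\mathscr{D}\mathbb{U}_g^*=\mathscr{D}$ and $[\mathbb{U}_g,\gamma]=0$ for all $g\in\mathbb{G}$. *)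

theory Defs
  imports "HOL-Analysis.Analysis" "HOL-Algebra.Ring" "HOL-Library.Poly_Mapping"
begin

section \<open>Complex Hilbert spaces\<close>

text \<open>The inner product is linear in its first argument.  The real structure (norm, topology,
  completeness) is the one of the library classes.\<close>

class complex_hilbert_space = real_inner + complete_space +
  fixes scaleC :: "complex \<Rightarrow> 'a \<Rightarrow> 'a" (infixr "*\<^sub>C" 75)
    and cinner :: "'a \<Rightarrow> 'a \<Rightarrow> complex"
  assumes scaleC_add_right: "c *\<^sub>C (x + y) = c *\<^sub>C x + c *\<^sub>C y"
    and scaleC_add_left: "(c + d) *\<^sub>C x = c *\<^sub>C x + d *\<^sub>C x"
    and scaleC_scaleC: "c *\<^sub>C d *\<^sub>C x = (c * d) *\<^sub>C x"
    and scaleC_of_real: "complex_of_real r *\<^sub>C x = r *\<^sub>R x"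
    and cinner_add_left: "cinner (x + y) z = cinner x z + cinner y z"
    and cinner_scaleC_left: "cinner (c *\<^sub>C x) y = c * cinner x y"
    and cinner_commute: "cinner x y = cnj (cinner y x)"
    and inner_eq_Re_cinner: "inner x y = Re (cinner x y)"

lemma scaleC_one: "1 *\<^sub>C (x :: 'a :: complex_hilbert_space) = x"
  using scaleC_of_real[of 1 x] by simp

global_interpretation complex_vector: vector_space "scaleC :: complex \<Rightarrow> 'a \<Rightarrow> 'a :: complex_hilbert_space"
  defines cspan = complex_vector.span and csubspace = complex_vector.subspace
  by unfold_locales (simp_all add: scaleC_add_right scaleC_add_left scaleC_scaleC scaleC_one)

text \<open>Pairs carry the Hilbert sum; in particular \<open>'h \<times> 'h\<close> is \<open>'h \<otimes> \<complex>\<^sup>2\<close>.\<close>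

instantiation prod :: (complex_hilbert_space, complex_hilbert_space) complex_hilbert_space
begin

definition scaleC_prod :: "complex \<Rightarrow> 'a \<times> 'b \<Rightarrow> 'a \<times> 'b"
  where "c *\<^sub>C z = (c *\<^sub>C fst z, c *\<^sub>C snd z)"

definition cinner_prod :: "'a \<times> 'b \<Rightarrow> 'a \<times> 'b \<Rightarrow> complex"
  where "cinner z w = cinner (fst z) (fst w) + cinner (snd z) (snd w)"

instance
proof
  fix c d :: complex and r :: real and x y z :: "'a \<times> 'b"
  show "c *\<^sub>C (x + y) = c *\<^sub>C x + c *\<^sub>C y" "(c + d) *\<^sub>C x = c *\<^sub>C x + d *\<^sub>C x"
    "c *\<^sub>C d *\<^sub>C x = (c * d) *\<^sub>C x" "complex_of_real r *\<^sub>C x = r *\<^sub>R x"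
    by (simp_all add: scaleC_prod_def scaleC_add_right scaleC_add_left scaleC_scaleC scaleC_of_real
        prod_eq_iff)
  show "cinner (x + y) z = cinner x z + cinner y z" "cinner (c *\<^sub>C x) y = c * cinner x y"
    "inner x y = Re (cinner x y)"
    by (simp_all add: scaleC_prod_def cinner_prod_def cinner_add_left cinner_scaleC_left
        inner_eq_Re_cinner inner_prod_def algebra_simps)
  show "cinner x y = cnj (cinner y x)"
    unfolding cinner_prod_def complex_cnj_add by (metis cinner_commute)
qed

end

text \<open>\<open>\<ell>\<^sup>2\<close> over an arbitrary index type, with orthonormal basis \<open>ket\<close> (defined below).\<close>

typedef 'a ell2 = "{f :: 'a \<Rightarrow> complex. (\<lambda>x. (cmod (f x))\<^sup>2) summable_on UNIV}"
  by (rule exI[of _ "\<lambda>_. 0"]) simp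

setup_lifting type_definition_ell2

lemma ell2_prod_summable:
  fixes f g :: "'a \<Rightarrow> complex"
  assumes "(\<lambda>x. (cmod (f x))\<^sup>2) summable_on UNIV" "(\<lambda>x. (cmod (g x))\<^sup>2) summable_on UNIV"
  shows "(\<lambda>x. f x * cnj (g x)) summable_on UNIV"
proof -
  have s: "(\<lambda>x. (cmod (f x))\<^sup>2 + (cmod (g x))\<^sup>2) summable_on UNIV"
    by (rule summable_on_add[OF assms])
  have b: "cmod (f x * cnj (g x)) \<le> (cmod (f x))\<^sup>2 + (cmod (g x))\<^sup>2" for x
  proof -
    have "2 * (cmod (f x) * cmod (g x)) \<le> (cmod (f x))\<^sup>2 + (cmod (g x))\<^sup>2"
      using sum_squares_bound[of "cmod (f x)" "cmod (g x)"] by simp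
    moreover have "0 \<le> cmod (f x) * cmod (g x)" by simp
    ultimately show ?thesis unfolding norm_mult complex_mod_cnj by linarith
  qed
  have "(\<lambda>x. cmod (f x * cnj (g x))) summable_on UNIV"
    by (rule summable_on_comparison_test[OF s]) (use b in auto)
  thus ?thesis by (rule abs_summable_summable)
qed

lemma ell2_add_summable:
  fixes f g :: "'a \<Rightarrow> complex"
  assumes "(\<lambda>x. (cmod (f x))\<^sup>2) summable_on UNIV" "(\<lambda>x. (cmod (g x))\<^sup>2) summable_on UNIV"
  shows "(\<lambda>x. (cmod (f x + g x))\<^sup>2) summable_on UNIV"
proof -
  have s: "(\<lambda>x. 2 * (cmod (f x))\<^sup>2 + 2 * (cmod (g x))\<^sup>2) summable_on UNIV"
    by (intro summable_on_add summable_on_cmult_right assms)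
  have b: "(cmod (f x + g x))\<^sup>2 \<le> 2 * (cmod (f x))\<^sup>2 + 2 * (cmod (g x))\<^sup>2" for x
  proof -
    have "(cmod (f x + g x))\<^sup>2 \<le> (cmod (f x) + cmod (g x))\<^sup>2"
      by (intro power_mono norm_triangle_ineq) simp
    also have "\<dots> \<le> 2 * (cmod (f x))\<^sup>2 + 2 * (cmod (g x))\<^sup>2"
      using sum_squares_bound[of "cmod (f x)" "cmod (g x)"] by (simp add: power2_sum)
    finally show ?thesis .
  qed
  show ?thesis by (rule summable_on_comparison_test[OF s]) (use b in auto)
qed

lemma ell2_scale_summable:
  fixes f :: "'a \<Rightarrow> complex"
  assumes "(\<lambda>x. (cmod (f x))\<^sup>2) summable_on UNIV"
  shows "(\<lambda>x. (cmod (c * f x))\<^sup>2) summable_on UNIV"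
  using summable_on_cmult_right[OF assms, of "(cmod c)\<^sup>2"] by (simp add: norm_mult power_mult_distrib)

lemma ell2_self_inner:
  fixes f :: "'a \<Rightarrow> complex"
  assumes "(\<lambda>x. (cmod (f x))\<^sup>2) summable_on UNIV"
  shows "Re (\<Sum>\<^sub>\<infinity>x. f x * cnj (f x)) = (\<Sum>\<^sub>\<infinity>x. (cmod (f x))\<^sup>2)"
proof -
  have "Re (f x * cnj (f x)) = (cmod (f x))\<^sup>2" for x
    by (simp only: complex_norm_square[symmetric] Re_complex_of_real)
  with infsum_Re[OF ell2_prod_summable[OF assms assms]] show ?thesis by simp
qed

lemma ell2_inner_cnj: "(\<Sum>\<^sub>\<infinity>x. f x * cnj (g x)) = cnj (\<Sum>\<^sub>\<infinity>x. g x * cnj (f x))"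
  by (subst infsum_cnj[symmetric]) (simp add: mult.commute)

instantiation ell2 :: (type) real_inner
begin

lift_definition zero_ell2 :: "'a ell2" is "\<lambda>_. 0" by simp
lift_definition plus_ell2 :: "'a ell2 \<Rightarrow> 'a ell2 \<Rightarrow> 'a ell2" is "\<lambda>f g x. f x + g x"
  by (rule ell2_add_summable)
lift_definition uminus_ell2 :: "'a ell2 \<Rightarrow> 'a ell2" is "\<lambda>f x. - f x" by simp
lift_definition minus_ell2 :: "'a ell2 \<Rightarrow> 'a ell2 \<Rightarrow> 'a ell2" is "\<lambda>f g x. f x - g x"
  subgoal for f g using ell2_add_summable[of f "\<lambda>x. - g x"] by simp
  done
lift_definition scaleR_ell2 :: "real \<Rightarrow> 'a ell2 \<Rightarrow> 'a ell2" is "\<lambda>r f x. complex_of_real r * f x"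
  by (rule ell2_scale_summable)
lift_definition inner_ell2 :: "'a ell2 \<Rightarrow> 'a ell2 \<Rightarrow> real"
  is "\<lambda>f g. Re (\<Sum>\<^sub>\<infinity>x. f x * cnj (g x))" .

definition norm_ell2 :: "'a ell2 \<Rightarrow> real" where "norm (x :: 'a ell2) = sqrt (inner x x)"
definition dist_ell2 :: "'a ell2 \<Rightarrow> 'a ell2 \<Rightarrow> real" where "dist (x :: 'a ell2) y = norm (x - y)"
definition sgn_ell2 :: "'a ell2 \<Rightarrow> 'a ell2" where "sgn (x :: 'a ell2) = inverse (norm x) *\<^sub>R x"
definition uniformity_ell2 :: "('a ell2 \<times> 'a ell2) filter"
  where "(uniformity :: ('a ell2 \<times> 'a ell2) filter) = (INF e\<in>{0 <..}. principal {(x :: 'a ell2, y). dist x y < e})"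
definition open_ell2 :: "'a ell2 set \<Rightarrow> bool"
  where "open (S :: 'a ell2 set) \<longleftrightarrow> (\<forall>x\<in>S. \<forall>\<^sub>F (x', y) in uniformity. x' = x \<longrightarrow> y \<in> S)"

instance
proof
  fix x y z :: "'a ell2" and r s :: real
  show "x + y + z = x + (y + z)" "x + y = y + x" "0 + x = x" "- x + x = 0" "x - y = x + - y"
    "r *\<^sub>R (x + y) = r *\<^sub>R x + r *\<^sub>R y" "(r + s) *\<^sub>R x = r *\<^sub>R x + s *\<^sub>R x"
    "r *\<^sub>R s *\<^sub>R x = (r * s) *\<^sub>R x" "1 *\<^sub>R x = x"
    by (transfer; simp add: algebra_simps)+
  show "dist x y = norm (x - y)" by (rule dist_ell2_def)
  show "sgn x = inverse (norm x) *\<^sub>R x" by (rule sgn_ell2_def)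
  show "uniformity = (INF e\<in>{0 <..}. principal {(x :: 'a ell2, y). dist x y < e})"
    by (rule uniformity_ell2_def)
  show "open U \<longleftrightarrow> (\<forall>x\<in>U. \<forall>\<^sub>F (x', y) in uniformity. x' = x \<longrightarrow> y \<in> U)" for U :: "'a ell2 set"
    by (rule open_ell2_def)
  show "norm x = sqrt (inner x x)" by (rule norm_ell2_def)
  show "inner x y = inner y x"
  proof transfer
    fix f g :: "'a \<Rightarrow> complex"
    show "Re (\<Sum>\<^sub>\<infinity>x. f x * cnj (g x)) = Re (\<Sum>\<^sub>\<infinity>x. g x * cnj (f x))"
      by (subst ell2_inner_cnj) simp
  qed
  show "inner (x + y) z = inner x z + inner y z"
    by transfer (simp add: distrib_right infsum_add ell2_prod_summable)
  show "inner (r *\<^sub>R x) y = r * inner x y"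
    by transfer (simp add: mult.assoc infsum_cmult_right')
  have sq: "Re (\<Sum>\<^sub>\<infinity>x. f x * cnj (f x)) = (\<Sum>\<^sub>\<infinity>x. (cmod (f x))\<^sup>2)"
    if "(\<lambda>x. (cmod (f x))\<^sup>2) summable_on UNIV" for f :: "'a \<Rightarrow> complex"
    by (rule ell2_self_inner[OF that])
  show "0 \<le> inner x x"
    by transfer (simp only: sq, simp add: infsum_nonneg)
  show "inner x x = 0 \<longleftrightarrow> x = 0"
  proof transfer
    fix f :: "'a \<Rightarrow> complex"
    assume s: "(\<lambda>x. (cmod (f x))\<^sup>2) summable_on UNIV"
    show "Re (\<Sum>\<^sub>\<infinity>x. f x * cnj (f x)) = 0 \<longleftrightarrow> f = (\<lambda>_. 0)"
    proof
      assume "Re (\<Sum>\<^sub>\<infinity>x. f x * cnj (f x)) = 0"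
      hence "(\<Sum>\<^sub>\<infinity>x. (cmod (f x))\<^sup>2) \<le> 0" unfolding sq[OF s] by simp
      hence "(cmod (f x))\<^sup>2 = 0" for x
        by (rule nonneg_infsum_le_0D[where A = UNIV]) (use s in auto)
      thus "f = (\<lambda>_. 0)" by (simp add: fun_eq_iff)
    qed simp
  qed
qed

end

lemma norm_ell2_sq: "(norm x)\<^sup>2 = (\<Sum>\<^sub>\<infinity>i. (cmod (Rep_ell2 x i))\<^sup>2)"
  using ell2_self_inner[of "Rep_ell2 x"] Rep_ell2[of x]
  by (simp add: power2_norm_eq_inner inner_ell2.rep_eq)

lemma sum_le_norm_ell2:
  assumes "finite F" shows "(\<Sum>i\<in>F. (cmod (Rep_ell2 x i))\<^sup>2) \<le> (norm x)\<^sup>2"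
  unfolding norm_ell2_sq
  by (rule finite_sum_le_infsum) (use Rep_ell2[of x] assms in auto)

instance ell2 :: (type) complete_space
proof
  fix X :: "nat \<Rightarrow> 'a ell2"
  assume C: "Cauchy X"
  define c where "c n i = Rep_ell2 (X n) i" for n i
  have diff: "Rep_ell2 (x - y) i = Rep_ell2 x i - Rep_ell2 y i" for x y :: "'a ell2" and i
    by (simp add: minus_ell2.rep_eq)
  have "Cauchy (\<lambda>n. c n i)" for i
  proof (rule metric_CauchyI)
    fix e :: real assume "e > 0"
    then obtain M where M: "\<forall>m\<ge>M. \<forall>n\<ge>M. dist (X m) (X n) < e"
      using metric_CauchyD[OF C] by blast
    have "dist (c m i) (c n i) \<le> dist (X m) (X n)" for m n
    proof -
      have "(cmod (c m i - c n i))\<^sup>2 \<le> (norm (X m - X n))\<^sup>2"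
        using sum_le_norm_ell2[of "{i}" "X m - X n"] by (simp add: c_def diff)
      thus ?thesis unfolding dist_norm by (rule power2_le_imp_le) simp
    qed
    hence "dist (c m i) (c n i) < e" if "m \<ge> M" "n \<ge> M" for m n
      using M that by (blast intro: le_less_trans)
    thus "\<exists>M. \<forall>m\<ge>M. \<forall>n\<ge>M. dist (c m i) (c n i) < e" by blast
  qed
  hence conv: "convergent (\<lambda>n. c n i)" for i by (rule Cauchy_convergent)
  define l where "l i = lim (\<lambda>n. c n i)" for i
  have l: "(\<lambda>n. c n i) \<longlonglongrightarrow> l i" for i
    using conv[of i] unfolding l_def by (simp only: convergent_LIMSEQ_iff)
  have key: "(\<Sum>i\<in>F. (cmod (c m i - l i))\<^sup>2) \<le> e\<^sup>2"
    if "finite F" "\<forall>n\<ge>M. dist (X m) (X n) < e" "e > 0" for F m e M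
  proof (rule tendsto_upperbound)
    show "(\<lambda>n. \<Sum>i\<in>F. (cmod (c m i - c n i))\<^sup>2) \<longlonglongrightarrow> (\<Sum>i\<in>F. (cmod (c m i - l i))\<^sup>2)"
      by (intro tendsto_intros l)
    show "\<forall>\<^sub>F n in sequentially. (\<Sum>i\<in>F. (cmod (c m i - c n i))\<^sup>2) \<le> e\<^sup>2"
    proof (rule eventually_sequentiallyI[of M])
      fix n assume "n \<ge> M"
      hence "norm (X m - X n) < e" using that by (simp add: dist_norm)
      hence "(norm (X m - X n))\<^sup>2 \<le> e\<^sup>2" by (intro power_mono) auto
      thus "(\<Sum>i\<in>F. (cmod (c m i - c n i))\<^sup>2) \<le> e\<^sup>2"
        using sum_le_norm_ell2[OF that(1), of "X m - X n"] by (simp add: diff c_def)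
    qed
  qed simp
  have sum_d: "(\<lambda>i. (cmod (c m i - l i))\<^sup>2) summable_on UNIV"
    if "\<forall>n\<ge>M. dist (X m) (X n) < e" "e > 0" for m e M
    by (rule nonneg_bdd_above_summable_on) (use key[OF _ that] in \<open>auto simp: bdd_above_def\<close>)
  obtain M where M: "\<forall>m\<ge>M. \<forall>n\<ge>M. dist (X m) (X n) < 1"
    using metric_CauchyD[OF C, of 1] by auto
  have "(\<lambda>i. (cmod (l i - c M i))\<^sup>2) summable_on UNIV"
    using sum_d[of M M 1] M by (simp add: norm_minus_commute)
  from ell2_add_summable[OF this, of "c M"] Rep_ell2[of "X M"]
  have ls: "(\<lambda>i. (cmod (l i))\<^sup>2) summable_on UNIV" by (simp add: c_def)
  define L where "L = Abs_ell2 l"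
  have L: "Rep_ell2 L = l" unfolding L_def using ls by (simp add: Abs_ell2_inverse)
  have "X \<longlonglongrightarrow> L"
  proof (rule metric_LIMSEQ_I)
    fix e :: real assume "e > 0"
    then obtain M where M: "\<forall>m\<ge>M. \<forall>n\<ge>M. dist (X m) (X n) < e / 2"
      using metric_CauchyD[OF C, of "e / 2"] by auto
    have "dist (X m) L < e" if "m \<ge> M" for m
    proof -
      have m: "\<forall>n\<ge>M. dist (X m) (X n) < e / 2" using M that by blast
      have "(norm (X m - L))\<^sup>2 \<le> (e / 2)\<^sup>2"
        unfolding norm_ell2_sq diff L c_def[symmetric]
        using sum_d[OF m] key[OF _ m] \<open>e > 0\<close> by (intro infsum_le_finite_sums) auto
      hence "norm (X m - L) \<le> e / 2" by (rule power2_le_imp_le) (use \<open>e > 0\<close> in simp)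
      thus ?thesis using \<open>e > 0\<close> by (simp add: dist_norm)
    qed
    thus "\<exists>M. \<forall>m\<ge>M. dist (X m) L < e" by blast
  qed
  thus "convergent X" by (auto simp: convergent_def)
qed

instantiation ell2 :: (type) complex_hilbert_space
begin

lift_definition scaleC_ell2 :: "complex \<Rightarrow> 'a ell2 \<Rightarrow> 'a ell2" is "\<lambda>c f x. c * f x"
  by (rule ell2_scale_summable)
lift_definition cinner_ell2 :: "'a ell2 \<Rightarrow> 'a ell2 \<Rightarrow> complex"
  is "\<lambda>f g. \<Sum>\<^sub>\<infinity>x. f x * cnj (g x)" .

instance
proof
  fix c d :: complex and r :: real and x y z :: "'a ell2"
  show "c *\<^sub>C (x + y) = c *\<^sub>C x + c *\<^sub>C y" "(c + d) *\<^sub>C x = c *\<^sub>C x + d *\<^sub>C x"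
    "c *\<^sub>C d *\<^sub>C x = (c * d) *\<^sub>C x" "complex_of_real r *\<^sub>C x = r *\<^sub>R x"
    by (transfer; simp add: algebra_simps)+
  show "cinner (x + y) z = cinner x z + cinner y z"
    by transfer (simp add: distrib_right infsum_add ell2_prod_summable)
  show "cinner (c *\<^sub>C x) y = c * cinner x y"
    by transfer (simp add: mult.assoc infsum_cmult_right')
  show "cinner x y = cnj (cinner y x)"
    by transfer (rule ell2_inner_cnj)
  show "inner x y = Re (cinner x y)"
    by transfer simp
qed

end

lift_definition ket :: "'a \<Rightarrow> 'a ell2" is "\<lambda>x y. if y = x then 1 else 0"
  by (rule finite_nonzero_values_imp_summable_on) simp


section \<open>Bounded operators\<close>

definition bounded_clinear :: "('h::complex_hilbert_space \<Rightarrow> 'k::complex_hilbert_space) \<Rightarrow> bool"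
  where "bounded_clinear f \<longleftrightarrow> bounded_linear f \<and> (\<forall>c x. f (c *\<^sub>C x) = c *\<^sub>C f x)"

definition cadjoint :: "('h::complex_hilbert_space \<Rightarrow> 'h) \<Rightarrow> 'h \<Rightarrow> 'h"
  where "cadjoint f = (THE g. \<forall>x y. cinner (f x) y = cinner x (g y))"

definition unitary :: "('h::complex_hilbert_space \<Rightarrow> 'h) \<Rightarrow> bool"
  where "unitary V \<longleftrightarrow> bounded_clinear V \<and> V \<circ> cadjoint V = id \<and> cadjoint V \<circ> V = id"

definition compact_operator :: "('h::complex_hilbert_space \<Rightarrow> 'h) \<Rightarrow> bool"
  where "compact_operator f \<longleftrightarrow> bounded_clinear f \<and> compact (closure (f ` ball 0 1))"

text \<open>\<open>singular_value B m\<close> is the entry with index \<open>m\<close> (starting at 0) of the decreasing list, with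
  multiplicities, of the eigenvalues \<open>s\<close> of \<open>(B\<^sup>*B)\<^bsup>1/2\<^esup>\<close>: it is the least \<open>t \<ge> 0\<close> such that at most
  \<open>m\<close> of them exceed \<open>t\<close>, that is, such that the eigenspaces for \<open>s > t\<close> together span a space of
  dimension at most \<open>m\<close>.\<close>

definition singular_value :: "('h::complex_hilbert_space \<Rightarrow> 'h) \<Rightarrow> nat \<Rightarrow> real"
  where "singular_value B m = Inf {t. 0 \<le> t \<and> (\<exists>b. finite b \<and> card b \<le> m \<and>
     (\<Union>s\<in>{t<..}. {x. cadjoint B (B x) = complex_of_real (s\<^sup>2) *\<^sub>C x}) \<subseteq> cspan b)}"

definition dixmier_ideal :: "('h::complex_hilbert_space \<Rightarrow> 'h) set"
  where "dixmier_ideal = {B. compact_operator B \<and>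
     bdd_above ((\<lambda>n. (\<Sum>m<n. singular_value B m) / ln (real n)) ` {2..})}"


section \<open>Unbounded operators\<close>

text \<open>An unbounded operator is represented by its graph, so that extension is inclusion, the domain
  is \<^const>\<open>Domain\<close>, and composition and powers are those of relations (\<open>S O T\<close> applies \<open>S\<close>
  first).\<close>

type_synonym 'h unbounded_op = "('h \<times> 'h) set"

definition op_adjoint :: "'h::complex_hilbert_space unbounded_op \<Rightarrow> 'h unbounded_op"
  where "op_adjoint S = {(x, y). \<forall>(u, v)\<in>S. cinner v x = cinner u y}"

definition self_adjoint_op :: "'h::complex_hilbert_space unbounded_op \<Rightarrow> bool"
  where "self_adjoint_op S \<longleftrightarrow> csubspace S \<and> single_valued S \<and> closure (Domain S) = UNIV \<and>
     op_adjoint S = S"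

definition positive_op :: "'h::complex_hilbert_space unbounded_op \<Rightarrow> bool"
  where "positive_op S \<longleftrightarrow> self_adjoint_op S \<and> (\<forall>(u, v)\<in>S. 0 \<le> Re (cinner v u))"

definition op_graph :: "('h \<Rightarrow> 'h) \<Rightarrow> 'h unbounded_op"
  where "op_graph f = {(x, f x) | x. True}"

text \<open>The graph of \<open>(S - z)\<inverse>\<close>; \<open>z\<close> is in the resolvent set iff this is the graph of an everywhere
  defined bounded operator.\<close>

definition resolvent_graph :: "'h::complex_hilbert_space unbounded_op \<Rightarrow> complex \<Rightarrow> 'h unbounded_op"
  where "resolvent_graph S z = {(v - z *\<^sub>C u, u) | u v. (u, v) \<in> S}"

definition has_compact_resolvent :: "'h::complex_hilbert_space unbounded_op \<Rightarrow> bool"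
  where "has_compact_resolvent S \<longleftrightarrow>
     (\<exists>z R. bounded_clinear R \<and> op_graph R = resolvent_graph S z) \<and>
     (\<forall>z R. bounded_clinear R \<and> op_graph R = resolvent_graph S z \<longrightarrow> compact_operator R)"

text \<open>\<open>|S| = (S\<^sup>*S)\<^bsup>1/2\<^esup>\<close>\<close>

definition op_abs :: "'h::complex_hilbert_space unbounded_op \<Rightarrow> 'h unbounded_op"
  where "op_abs S = (THE P. positive_op P \<and> P O P = S O op_adjoint S)"

definition op_kernel :: "'h::complex_hilbert_space unbounded_op \<Rightarrow> 'h set"
  where "op_kernel S = {u. (u, 0) \<in> S}"

text \<open>The graph of \<open>|S|\<^bsup>-p\<^esup>\<close> on \<open>(ker S)\<^sup>\<bottom>\<close>, extended by zero on \<open>ker S\<close> (this only appends zeros to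
  the list of singular values).\<close>

definition op_abs_inverse_power :: "'h::complex_hilbert_space unbounded_op \<Rightarrow> nat \<Rightarrow> 'h unbounded_op"
  where "op_abs_inverse_power S p = {(v + w, u) | u v w. (u, v) \<in> op_abs S ^^ p \<and>
     (\<forall>k\<in>op_kernel S. cinner u k = 0) \<and> w \<in> op_kernel S}"

definition p_plus_summable :: "nat \<Rightarrow> 'h::complex_hilbert_space unbounded_op \<Rightarrow> bool"
  where "p_plus_summable p S \<longleftrightarrow> (\<exists>B\<in>dixmier_ideal. op_graph B = op_abs_inverse_power S p)"


section \<open>Unital C*-algebras and their representations\<close>

record 'a cstar_struct = "'a ring" +
  cscale :: "complex \<Rightarrow> 'a \<Rightarrow> 'a"
  involution :: "'a \<Rightarrow> 'a"
  cnorm :: "'a \<Rightarrow> real"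

definition cstar_dist :: "('a, 'm) cstar_struct_scheme \<Rightarrow> 'a \<Rightarrow> 'a \<Rightarrow> real"
  where "cstar_dist A x y = (if x \<in> carrier A \<and> y \<in> carrier A then cnorm A (x \<ominus>\<^bsub>A\<^esub> y) else 0)"

definition cstar_topology :: "('a, 'm) cstar_struct_scheme \<Rightarrow> 'a topology"
  where "cstar_topology A = Metric_space.mtopology (carrier A) (cstar_dist A)"

locale unital_cstar_algebra = Ring.ring A for A :: "('a, 'm) cstar_struct_scheme" (structure) +
  assumes cscale_closed: "x \<in> carrier A \<Longrightarrow> cscale A c x \<in> carrier A"
    and cscale_add_right: "\<lbrakk>x \<in> carrier A; y \<in> carrier A\<rbrakk> \<Longrightarrow> cscale A c (x \<oplus> y) = cscale A c x \<oplus> cscale A c y"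
    and cscale_add_left: "x \<in> carrier A \<Longrightarrow> cscale A (c + d) x = cscale A c x \<oplus> cscale A d x"
    and cscale_cscale: "x \<in> carrier A \<Longrightarrow> cscale A c (cscale A d x) = cscale A (c * d) x"
    and cscale_one: "x \<in> carrier A \<Longrightarrow> cscale A 1 x = x"
    and cscale_mult_left: "\<lbrakk>x \<in> carrier A; y \<in> carrier A\<rbrakk> \<Longrightarrow> cscale A c x \<otimes> y = cscale A c (x \<otimes> y)"
    and cscale_mult_right: "\<lbrakk>x \<in> carrier A; y \<in> carrier A\<rbrakk> \<Longrightarrow> x \<otimes> cscale A c y = cscale A c (x \<otimes> y)"
    and involution_closed: "x \<in> carrier A \<Longrightarrow> involution A x \<in> carrier A"
    and involution_involution: "x \<in> carrier A \<Longrightarrow> involution A (involution A x) = x"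
    and involution_add: "\<lbrakk>x \<in> carrier A; y \<in> carrier A\<rbrakk>
          \<Longrightarrow> involution A (x \<oplus> y) = involution A x \<oplus> involution A y"
    and involution_mult: "\<lbrakk>x \<in> carrier A; y \<in> carrier A\<rbrakk>
          \<Longrightarrow> involution A (x \<otimes> y) = involution A y \<otimes> involution A x"
    and involution_cscale: "x \<in> carrier A \<Longrightarrow> involution A (cscale A c x) = cscale A (cnj c) (involution A x)"
    and cnorm_nonneg: "x \<in> carrier A \<Longrightarrow> 0 \<le> cnorm A x"
    and cnorm_eq_0: "x \<in> carrier A \<Longrightarrow> cnorm A x = 0 \<longleftrightarrow> x = \<zero>"
    and cnorm_add: "\<lbrakk>x \<in> carrier A; y \<in> carrier A\<rbrakk> \<Longrightarrow> cnorm A (x \<oplus> y) \<le> cnorm A x + cnorm A y"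
    and cnorm_cscale: "x \<in> carrier A \<Longrightarrow> cnorm A (cscale A c x) = cmod c * cnorm A x"
    and cnorm_mult: "\<lbrakk>x \<in> carrier A; y \<in> carrier A\<rbrakk> \<Longrightarrow> cnorm A (x \<otimes> y) \<le> cnorm A x * cnorm A y"
    and cstar_identity: "x \<in> carrier A \<Longrightarrow> cnorm A (involution A x \<otimes> x) = (cnorm A x)\<^sup>2"
    and complete: "Metric_space.mcomplete (carrier A) (cstar_dist A)"

definition unital_star_hom ::
  "('a, 'm) cstar_struct_scheme \<Rightarrow> ('b, 'n) cstar_struct_scheme \<Rightarrow> ('a \<Rightarrow> 'b) \<Rightarrow> bool"
  where "unital_star_hom A B \<phi> \<longleftrightarrow> \<phi> \<in> ring_hom A B \<and>
     (\<forall>x\<in>carrier A. (\<forall>c. \<phi> (cscale A c x) = cscale B c (\<phi> x)) \<and>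
        \<phi> (involution A x) = involution B (\<phi> x))"

definition unital_star_subalgebra :: "('a, 'm) cstar_struct_scheme \<Rightarrow> 'a set \<Rightarrow> bool"
  where "unital_star_subalgebra A S \<longleftrightarrow> S \<subseteq> carrier A \<and> \<one>\<^bsub>A\<^esub> \<in> S \<and>
     (\<forall>x\<in>S. \<forall>y\<in>S. x \<oplus>\<^bsub>A\<^esub> y \<in> S \<and> x \<otimes>\<^bsub>A\<^esub> y \<in> S) \<and>
     (\<forall>x\<in>S. (\<forall>c. cscale A c x \<in> S) \<and> involution A x \<in> S)"

definition generated_star_subalgebra :: "('a, 'm) cstar_struct_scheme \<Rightarrow> 'a set \<Rightarrow> 'a set"
  where "generated_star_subalgebra A X = \<Inter> {S. unital_star_subalgebra A S \<and> X \<subseteq> S}"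

text \<open>A unital *-representation, by bounded operators, of a unital *-subalgebra \<open>S\<close> of \<open>A\<close>.\<close>

definition star_representation_on ::
  "('a, 'm) cstar_struct_scheme \<Rightarrow> 'a set \<Rightarrow> ('a \<Rightarrow> 'h::complex_hilbert_space \<Rightarrow> 'h) \<Rightarrow> bool"
  where "star_representation_on A S \<pi> \<longleftrightarrow>
     (\<forall>x\<in>S. bounded_clinear (\<pi> x)) \<and> \<pi> \<one>\<^bsub>A\<^esub> = id \<and>
     (\<forall>x\<in>S. \<forall>y\<in>S. (\<forall>\<xi>. \<pi> (x \<oplus>\<^bsub>A\<^esub> y) \<xi> = \<pi> x \<xi> + \<pi> y \<xi>) \<and> \<pi> (x \<otimes>\<^bsub>A\<^esub> y) = \<pi> x \<circ> \<pi> y) \<and>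
     (\<forall>x\<in>S. (\<forall>c \<xi>. \<pi> (cscale A c x) \<xi> = c *\<^sub>C \<pi> x \<xi>) \<and> \<pi> (involution A x) = cadjoint (\<pi> x))"

abbreviation star_representation ::
  "('a, 'm) cstar_struct_scheme \<Rightarrow> ('a \<Rightarrow> 'h::complex_hilbert_space \<Rightarrow> 'h) \<Rightarrow> bool"
  where "star_representation A \<pi> \<equiv> star_representation_on A (carrier A) \<pi>"


section \<open>Compact groups and C*-dynamical systems\<close>

definition compact_group :: "('g, 'm) monoid_scheme \<Rightarrow> 'g topology \<Rightarrow> bool"
  where "compact_group G X \<longleftrightarrow> Group.group G \<and> topspace X = carrier G \<and>
     compact_space X \<and> Hausdorff_space X \<and>
     continuous_map (prod_topology X X) X (\<lambda>(g, h). g \<otimes>\<^bsub>G\<^esub> h) \<and>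
     continuous_map X X (\<lambda>g. inv\<^bsub>G\<^esub> g)"

definition unitary_representation ::
  "('g, 'm) monoid_scheme \<Rightarrow> 'g topology \<Rightarrow> ('g \<Rightarrow> 'h::complex_hilbert_space \<Rightarrow> 'h) \<Rightarrow> bool"
  where "unitary_representation G X U \<longleftrightarrow> (\<forall>g\<in>carrier G. unitary (U g)) \<and>
     (\<forall>g\<in>carrier G. \<forall>h\<in>carrier G. U (g \<otimes>\<^bsub>G\<^esub> h) = U g \<circ> U h) \<and>
     (\<forall>\<xi>. continuous_map X euclidean (\<lambda>g. U g \<xi>))"

definition cstar_dynamical_system ::
  "('a, 'm) cstar_struct_scheme \<Rightarrow> ('g, 'n) monoid_scheme \<Rightarrow> 'g topology \<Rightarrow> ('g \<Rightarrow> 'a \<Rightarrow> 'a) \<Rightarrow> bool"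
  where "cstar_dynamical_system A G X \<alpha> \<longleftrightarrow> unital_cstar_algebra A \<and> compact_group G X \<and>
     (\<forall>g\<in>carrier G. unital_star_hom A A (\<alpha> g) \<and> bij_betw (\<alpha> g) (carrier A) (carrier A)) \<and>
     (\<forall>g\<in>carrier G. \<forall>h\<in>carrier G. \<forall>x\<in>carrier A. \<alpha> (g \<otimes>\<^bsub>G\<^esub> h) x = \<alpha> g (\<alpha> h x)) \<and>
     (\<forall>x\<in>carrier A. continuous_map X (cstar_topology A) (\<lambda>g. \<alpha> g x))"


section \<open>Spectral triples\<close>

text \<open>Below, \<open>C\<close> is the bounded extension of the commutator \<open>[D, \<pi> x]\<close> from \<open>Domain D\<close>; the condition
  includes that \<open>\<pi> x\<close> maps \<open>Domain D\<close> into itself.\<close>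

definition even_spectral_triple ::
  "('a, 'm) cstar_struct_scheme \<Rightarrow> 'a set \<Rightarrow> ('a \<Rightarrow> 'h::complex_hilbert_space \<Rightarrow> 'h)
     \<Rightarrow> 'h unbounded_op \<Rightarrow> ('h \<Rightarrow> 'h) \<Rightarrow> bool"
  where "even_spectral_triple A S \<pi> D \<gamma> \<longleftrightarrow>
     unital_cstar_algebra A \<and>
     unital_star_subalgebra A S \<and> cstar_topology A closure_of S = carrier A \<and>
     separable_space (euclidean :: 'h topology) \<and>
     star_representation_on A S \<pi> \<and>
     self_adjoint_op D \<and> has_compact_resolvent D \<and>
     (\<forall>x\<in>S. \<exists>C. bounded_clinear C \<and> (\<forall>(u, v)\<in>D. (\<pi> x u, \<pi> x v + C u) \<in> D)) \<and>
     bounded_clinear \<gamma> \<and> cadjoint \<gamma> = \<gamma> \<and> \<gamma> \<circ> \<gamma> = id \<and>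
     (\<forall>x\<in>S. \<gamma> \<circ> \<pi> x = \<pi> x \<circ> \<gamma>) \<and>
     (\<forall>(u, v)\<in>D. (\<gamma> u, - \<gamma> v) \<in> D)"

definition equivariant_even_spectral_triple ::
  "('a, 'm) cstar_struct_scheme \<Rightarrow> ('g, 'n) monoid_scheme \<Rightarrow> 'g topology \<Rightarrow> ('g \<Rightarrow> 'a \<Rightarrow> 'a) \<Rightarrow> 'a set
     \<Rightarrow> ('a \<Rightarrow> 'h::complex_hilbert_space \<Rightarrow> 'h) \<Rightarrow> ('g \<Rightarrow> 'h \<Rightarrow> 'h) \<Rightarrow> 'h unbounded_op \<Rightarrow> ('h \<Rightarrow> 'h) \<Rightarrow> bool"
  where "equivariant_even_spectral_triple A G X \<alpha> S \<pi> U D \<gamma> \<longleftrightarrow>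
     cstar_dynamical_system A G X \<alpha> \<and>
     star_representation A \<pi> \<and> unitary_representation G X U \<and>
     (\<forall>x\<in>carrier A. \<forall>g\<in>carrier G. \<pi> (\<alpha> g x) = U g \<circ> \<pi> x \<circ> cadjoint (U g)) \<and>
     inj_on \<pi> (carrier A) \<and>
     even_spectral_triple A S \<pi> D \<gamma> \<and>
     (\<forall>g\<in>carrier G. {(U g u, U g v) | u v. (u, v) \<in> D} = D \<and> U g \<circ> \<gamma> = \<gamma> \<circ> U g)"


section \<open>Universal C*-algebras\<close>

text \<open>Words in the letters \<open>(g, False)\<close>, for a generator \<open>g\<close>, and \<open>(g, True)\<close>, for its adjoint.
  The free unital *-algebra is the monoid algebra over \<open>\<complex>\<close> of these words.\<close>

datatype 'g star_word = Star_Word (letters: "('g \<times> bool) list")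

instantiation star_word :: (type) monoid_add
begin

definition zero_star_word :: "'a star_word" where "0 = Star_Word []"

definition plus_star_word :: "'a star_word \<Rightarrow> 'a star_word \<Rightarrow> 'a star_word"
  where "v + w = Star_Word (letters v @ letters w)"

instance
  by standard (simp_all add: zero_star_word_def plus_star_word_def)

end

type_synonym 'g free_star_algebra = "'g star_word \<Rightarrow>\<^sub>0 complex"

definition free_gen :: "'g \<Rightarrow> 'g free_star_algebra"
  where "free_gen g = Poly_Mapping.single (Star_Word [(g, False)]) 1"

definition free_scale :: "complex \<Rightarrow> 'g free_star_algebra \<Rightarrow> 'g free_star_algebra"
  where "free_scale c x = Poly_Mapping.single 0 c * x"

definition word_star :: "'g star_word \<Rightarrow> 'g star_word"
  where "word_star w = Star_Word (rev (map (\<lambda>(g, s). (g, \<not> s)) (letters w)))"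

definition free_star :: "'g free_star_algebra \<Rightarrow> 'g free_star_algebra"
  where "free_star x = Poly_Mapping.map cnj (Poly_Mapping.map_key word_star x)"

definition cstar_seminorm :: "('g free_star_algebra \<Rightarrow> real) \<Rightarrow> bool"
  where "cstar_seminorm p \<longleftrightarrow> (\<forall>x. 0 \<le> p x) \<and> (\<forall>x y. p (x + y) \<le> p x + p y) \<and>
     (\<forall>c x. p (free_scale c x) = cmod c * p x) \<and> (\<forall>x y. p (x * y) \<le> p x * p y) \<and>
     (\<forall>x. p (free_star x * x) = (p x)\<^sup>2)"

text \<open>The universal unital C*-algebra on generators \<open>'g\<close> subject to the relations \<open>r = 0\<close>, \<open>r \<in> R\<close>, is
  the Hausdorff completion of the free unital *-algebra for the largest C*-seminorm annihilating \<open>R\<close>.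
  (The C*-seminorms annihilating \<open>R\<close> are the functions \<open>x \<mapsto> \<parallel>\<rho> x\<parallel>\<close> for the unital *-homomorphisms
  \<open>\<rho>\<close> into unital C*-algebras in which the relations hold.)  This is meaningful only if these
  seminorms are pointwise bounded.\<close>

definition universal_seminorm :: "'g free_star_algebra set \<Rightarrow> 'g free_star_algebra \<Rightarrow> real"
  where "universal_seminorm R x = Sup {p x | p. cstar_seminorm p \<and> (\<forall>r\<in>R. p r = 0)}"

definition universal_Cauchy :: "'g free_star_algebra set \<Rightarrow> (nat \<Rightarrow> 'g free_star_algebra) \<Rightarrow> bool"
  where "universal_Cauchy R x \<longleftrightarrow>
     (\<forall>e>0. \<exists>M. \<forall>m\<ge>M. \<forall>n\<ge>M. universal_seminorm R (x m - x n) < e)"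

definition completion_class ::
  "'g free_star_algebra set \<Rightarrow> (nat \<Rightarrow> 'g free_star_algebra) \<Rightarrow> (nat \<Rightarrow> 'g free_star_algebra) set"
  where "completion_class R x =
     {y. universal_Cauchy R y \<and> (\<lambda>n. universal_seminorm R (x n - y n)) \<longlonglongrightarrow> 0}"

definition completion_rep :: "(nat \<Rightarrow> 'g free_star_algebra) set \<Rightarrow> nat \<Rightarrow> 'g free_star_algebra"
  where "completion_rep X = (SOME x. x \<in> X)"

definition universal_cstar_algebra ::
  "'g free_star_algebra set \<Rightarrow> (nat \<Rightarrow> 'g free_star_algebra) set cstar_struct"
  where "universal_cstar_algebra R =
    \<lparr>carrier = completion_class R ` {x. universal_Cauchy R x},
     monoid.mult = (\<lambda>X Y. completion_class R (\<lambda>n. completion_rep X n * completion_rep Y n)),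
     one = completion_class R (\<lambda>_. 1),
     zero = completion_class R (\<lambda>_. 0),
     add = (\<lambda>X Y. completion_class R (\<lambda>n. completion_rep X n + completion_rep Y n)),
     cscale = (\<lambda>c X. completion_class R (\<lambda>n. free_scale c (completion_rep X n))),
     involution = (\<lambda>X. completion_class R (\<lambda>n. free_star (completion_rep X n))),
     cnorm = (\<lambda>X. lim (\<lambda>n. universal_seminorm R (completion_rep X n)))\<rparr>"

definition universal_gen :: "'g free_star_algebra set \<Rightarrow> 'g \<Rightarrow> (nat \<Rightarrow> 'g free_star_algebra) set"
  where "universal_gen R g = completion_class R (\<lambda>_. free_gen g)"


section \<open>The quantum group $U_q(2)$\<close>

datatype uq2_generator = GenA | GenB | GenD

definition uq2_relations :: "complex \<Rightarrow> uq2_generator free_star_algebra set"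
  where "uq2_relations q =
    (let a = free_gen GenA; b = free_gen GenB; D = free_gen GenD;
         a' = free_star a; b' = free_star b; D' = free_star D
     in {b * a - free_scale q (a * b),
         a' * b - free_scale q (b * a'),
         b * b' - b' * b,
         a * a' + b * b' - 1,
         a * D - D * a,
         b * D - free_scale (q\<^sup>2 / complex_of_real ((cmod q)\<^sup>2)) (D * b),
         D * D' - 1,
         D' * D - 1,
         a' * a + free_scale (complex_of_real ((cmod q)\<^sup>2)) (b' * b) - 1})"

type_synonym uq2_carrier = "(nat \<Rightarrow> uq2_generator free_star_algebra) set"

definition C_Uq2 :: "complex \<Rightarrow> uq2_carrier cstar_struct"
  where "C_Uq2 q = universal_cstar_algebra (uq2_relations q)"

definition uq2_a :: "complex \<Rightarrow> uq2_carrier" where "uq2_a q = universal_gen (uq2_relations q) GenA"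
definition uq2_b :: "complex \<Rightarrow> uq2_carrier" where "uq2_b q = universal_gen (uq2_relations q) GenB"
definition uq2_D :: "complex \<Rightarrow> uq2_carrier" where "uq2_D q = universal_gen (uq2_relations q) GenD"

definition A_f :: "complex \<Rightarrow> uq2_carrier set"
  where "A_f q = generated_star_subalgebra (C_Uq2 q) {uq2_a q, uq2_b q, uq2_D q}"

text \<open>\<open>\<ell>\<^sup>2(\<nat>) \<otimes> \<ell>\<^sup>2(\<int>) \<otimes> \<ell>\<^sup>2(\<int>)\<close> is identified with \<open>\<ell>\<^sup>2(\<nat> \<times> \<int> \<times> \<int>)\<close>, the vector \<open>e\<^sub>i \<otimes> e\<^sub>j \<otimes> e\<^sub>k\<close>
  being \<open>basis_vec i j k\<close>.\<close>

type_synonym uq2_space = "(nat \<times> int \<times> int) ell2"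

abbreviation basis_vec :: "nat \<Rightarrow> int \<Rightarrow> int \<Rightarrow> uq2_space"
  where "basis_vec i j k \<equiv> ket (i, j, k)"

definition uq2_rep :: "complex \<Rightarrow> uq2_carrier \<Rightarrow> uq2_space \<Rightarrow> uq2_space"
  where "uq2_rep q = (THE \<pi>. \<pi> \<in> extensional (carrier (C_Uq2 q)) \<and> star_representation (C_Uq2 q) \<pi> \<and>
     (\<forall>i j k.
        \<pi> (uq2_a q) (basis_vec i j k) = complex_of_real (sqrt (1 - cmod q ^ (2 * i + 2))) *\<^sub>C basis_vec (i + 1) j k \<and>
        \<pi> (uq2_b q) (basis_vec i j k) = q ^ i *\<^sub>C basis_vec i (j + 1) k \<and>
        \<pi> (uq2_D q) (basis_vec i j k) =
          exp (- 2 * complex_of_real pi * \<i> * complex_of_real (Arg q / pi) * of_int j) *\<^sub>C basis_vec i j (k + 1)))"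

definition circle_group :: "complex monoid"
  where "circle_group = \<lparr>carrier = sphere 0 1, monoid.mult = (*), one = 1\<rparr>"

definition torus3 :: "(complex \<times> complex \<times> complex) monoid"
  where "torus3 = circle_group \<times>\<times> circle_group \<times>\<times> circle_group"

definition torus_action :: "complex \<Rightarrow> complex \<times> complex \<times> complex \<Rightarrow> uq2_carrier \<Rightarrow> uq2_carrier"
  where "torus_action q = (\<lambda>(z1, z2, z3). THE \<phi>. \<phi> \<in> extensional (carrier (C_Uq2 q)) \<and>
     unital_star_hom (C_Uq2 q) (C_Uq2 q) \<phi> \<and>
     \<phi> (uq2_a q) = cscale (C_Uq2 q) z1 (uq2_a q) \<and>
     \<phi> (uq2_b q) = cscale (C_Uq2 q) z2 (uq2_b q) \<and>
     \<phi> (uq2_D q) = cscale (C_Uq2 q) z3 (uq2_D q))"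

definition torus_unitary :: "complex \<times> complex \<times> complex \<Rightarrow> uq2_space \<Rightarrow> uq2_space"
  where "torus_unitary = (\<lambda>(z1, z2, z3). THE V. bounded_clinear V \<and>
     (\<forall>i j k. V (basis_vec i j k) = (z1 ^ i * z2 powi j * z3 powi k) *\<^sub>C basis_vec i j k))"

definition d_coeff :: "nat \<Rightarrow> int \<Rightarrow> int \<Rightarrow> complex"
  where "d_coeff i j k = (if j \<ge> 0 then of_nat i + of_int j + \<i> * of_int k
                    else - of_nat i + of_int j + \<i> * of_int k)"

text \<open>The linear operator with domain the span of the basis and \<open>T e\<^sub>i\<^sub>j\<^sub>k = d(i,j,k) e\<^sub>i\<^sub>j\<^sub>k\<close>: its graph is
  a subspace of the Hilbert sum of two copies of the space.\<close>

definition T_op :: "uq2_space unbounded_op"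
  where "T_op = cspan {(basis_vec i j k, d_coeff i j k *\<^sub>C basis_vec i j k) | i j k. True}"

text \<open>The matrix with rows \<open>(0, T\<^sup>*)\<close> and \<open>(T, 0)\<close> on the span of the standard basis vectors, and its
  unique self-adjoint extension.\<close>

definition Dirac_core :: "(uq2_space \<times> uq2_space) unbounded_op"
  where "Dirac_core = {((\<xi>, \<eta>), (\<zeta>, \<omega>)) | \<xi> \<eta> \<zeta> \<omega>.
     \<xi> \<in> cspan (range ket) \<and> \<eta> \<in> cspan (range ket) \<and> (\<eta>, \<zeta>) \<in> op_adjoint T_op \<and> (\<xi>, \<omega>) \<in> T_op}"

definition Dirac :: "(uq2_space \<times> uq2_space) unbounded_op"
  where "Dirac = (THE S. self_adjoint_op S \<and> Dirac_core \<subseteq> S)"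

definition pi_eq :: "complex \<Rightarrow> uq2_carrier \<Rightarrow> uq2_space \<times> uq2_space \<Rightarrow> uq2_space \<times> uq2_space"
  where "pi_eq q x = (\<lambda>(\<xi>, \<eta>). (uq2_rep q x \<xi>, uq2_rep q x \<eta>))"

definition torus_unitary2 ::
  "complex \<times> complex \<times> complex \<Rightarrow> uq2_space \<times> uq2_space \<Rightarrow> uq2_space \<times> uq2_space"
  where "torus_unitary2 z = (\<lambda>(\<xi>, \<eta>). (torus_unitary z \<xi>, torus_unitary z \<eta>))"

definition grading :: "uq2_space \<times> uq2_space \<Rightarrow> uq2_space \<times> uq2_space"
  where "grading = (\<lambda>(\<xi>, \<eta>). (\<xi>, - \<eta>))"

end

theory Submission
  imports Defs "HOL-Real_Asymp.Real_Asymp"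
begin

text \<open>Every C*-seminorm \<open>p\<close> that annihilates the relations is bounded by the operator norm of the
  representation on \<open>\<ell>\<^sup>2(\<nat> \<times> \<int> \<times> \<int>)\<close>.  Hence that operator norm is the universal seminorm, and
  the extension of the representation to the completion is isometric.  For the bound, split an
  element \<open>z\<close> into its components \<open>z\<^sub>\<alpha>\<close> of degree \<open>\<alpha> \<in> \<int>\<^sup>3\<close>.  The element \<open>z\<^sub>\<alpha>\<^sup>* z\<^sub>\<alpha>\<close> has degree
  zero and is therefore a polynomial \<open>f(b b\<^sup>*)\<close> modulo the relations, and
  \<open>p(f(b b\<^sup>*)) \<le> sup |f(|q|\<^bsup>2k\<^esup>)|\<close>, which is at most the squared operator norm of \<open>z\<close>.  So \<open>p(z)\<close>
  is at most the number of degrees in \<open>z\<close> times the operator norm.  For powers of \<open>z\<^sup>* z\<close> this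
  number grows only polynomially, and taking roots removes it.

  The Dirac operator and its absolute value have at most one non-zero entry in each row and
  column of their matrices, and a self-adjoint operator that agrees with such a matrix on the
  basis vectors is determined by it.  The number of eigenvalues of modulus less than \<open>r\<close> is of
  order \<open>r\<^sup>3\<close>, so the singular values of the inverse cube are of order \<open>1/n\<close>.\<close>

section \<open>Hilbert spaces and bounded operators\<close>

\<comment> \<open>An arbitrary C*-seminorm on the free algebra offers neither spectral theory nor
  positivity, only the C*-identity. In their place, letters of different kinds commute up to
  scalars, with each other and all with x = b b', so that every word becomes a^n b^m D^l f(x); and x
  satisfies a a' = 1 - x and x a = t a x with t = |q|^2. These two relations bound x by 1 and let
  the points 1, t, t^2, ... be split off one at a time. They are the eigenvalues of x in the
  representation; what remains is a small disc around their limit 0, where sums of coefficients are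
  good enough. Each splitting costs a constant factor, which powers of a self-adjoint element
  remove. Several objects of the statement are definite descriptions and need existence and
  uniqueness; for representations and automorphisms uniqueness rests on automatic contractivity. The
  delicate commutator is that with b: d(i,j,k) jumps by 2i + 1 where j changes sign, and the weight
  q^i of b absorbs this.\<close>
subclass (in complex_hilbert_space) banach ..

lemma cinner_zero_left [simp]: "cinner 0 y = 0"
  using cinner_add_left[of 0 0 y] by simp

lemma cinner_minus_left [simp]: "cinner (- x) y = - cinner x y"
  using cinner_add_left[of x "- x" y] by (simp add: eq_neg_iff_add_eq_0 add.commute)

lemma cinner_add_right: "cinner x (y + z) = cinner x y + cinner x z"
  by (metis cinner_commute cinner_add_left complex_cnj_add)

lemma cinner_scaleC_right: "cinner x (c *\<^sub>C y) = cnj c * cinner x y"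
  by (metis cinner_commute cinner_scaleC_left complex_cnj_mult)

lemma cinner_zero_right [simp]: "cinner x 0 = 0"
  using cinner_add_right[of x 0 0] by simp

lemma cinner_minus_right [simp]: "cinner x (- y) = - cinner x y"
  using cinner_add_right[of x y "- y"] by (simp add: eq_neg_iff_add_eq_0 add.commute)

lemma cinner_diff_right: "cinner x (y - z) = cinner x y - cinner x z"
  using cinner_add_right[of x y "- z"] by simp

lemma cinner_self: "cinner x x = complex_of_real ((norm x)\<^sup>2)"
proof (rule complex_eqI)
  show "Re (cinner x x) = Re (complex_of_real ((norm x)\<^sup>2))"
    by (simp add: power2_norm_eq_inner inner_eq_Re_cinner)
  show "Im (cinner x x) = Im (complex_of_real ((norm x)\<^sup>2))"
    using arg_cong[OF cinner_commute[of x x], of Im] by simp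
qed

lemma norm_scaleC [simp]: "norm (c *\<^sub>C x) = cmod c * norm (x :: 'h::complex_hilbert_space)"
proof (rule power2_eq_imp_eq)
  have "complex_of_real ((norm (c *\<^sub>C x))\<^sup>2) = complex_of_real ((cmod c * norm x)\<^sup>2)"
    unfolding cinner_self[symmetric] power_mult_distrib of_real_mult
    by (simp add: cinner_scaleC_left cinner_scaleC_right complex_norm_square mult_ac del:
        of_real_power)
  thus "(norm (c *\<^sub>C x))\<^sup>2 = (cmod c * norm x)\<^sup>2" using of_real_eq_iff by blast
qed simp_all

lemma Cauchy_Schwarz_cinner: "cmod (cinner x y) \<le> norm x * norm (y :: 'h::complex_hilbert_space)"
proof (cases "cinner x y = 0")
  case False
  \<comment> \<open>The phase \<open>c\<close> turns the inner product into its modulus, so that the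
    real Cauchy-Schwarz inequality applies to \<open>c *\<^sub>C x\<close>.\<close>
  define c where "c = cnj (cinner x y) / complex_of_real (cmod (cinner x y))"
  have c: "cmod c = 1" using False by (simp add: c_def norm_divide)
  have "cnj (cinner x y) * cinner x y = complex_of_real ((cmod (cinner x y))\<^sup>2)"
    by (metis complex_norm_square mult.commute)
  hence "c * cinner x y = complex_of_real (cmod (cinner x y))"
    using False by (simp add: c_def power2_eq_square)
  hence "inner (c *\<^sub>C x) y = cmod (cinner x y)"
    by (simp add: inner_eq_Re_cinner cinner_scaleC_left)
  moreover have "inner (c *\<^sub>C x) y \<le> norm (c *\<^sub>C x) * norm y" by (rule norm_cauchy_schwarz)
  ultimately show ?thesis using c by simp
qed simp

lemma bounded_bilinear_cinner:
  "bounded_bilinear (cinner :: 'h::complex_hilbert_space \<Rightarrow> 'h \<Rightarrow> complex)"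
proof
  fix a a' b b' :: 'h and r :: real
  show "cinner (a + a') b = cinner a b + cinner a' b" "cinner a (b + b') = cinner a b + cinner a b'"
    by (simp_all add: cinner_add_left cinner_add_right)
  show "cinner (r *\<^sub>R a) b = r *\<^sub>R cinner a b" "cinner a (r *\<^sub>R b) = r *\<^sub>R cinner a b"
    by (simp_all flip: scaleC_of_real add: cinner_scaleC_left cinner_scaleC_right
        scaleR_conv_of_real)
  show "\<exists>K. \<forall>a b :: 'h. norm (cinner a b) \<le> norm a * norm b * K"
    by (rule exI[of _ 1]) (simp add: Cauchy_Schwarz_cinner)
qed

lemma bounded_bilinear_scaleC:
  "bounded_bilinear (scaleC :: complex \<Rightarrow> 'h \<Rightarrow> 'h::complex_hilbert_space)"
proof
  fix a a' :: complex and b b' :: 'h and r :: real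
  show "(a + a') *\<^sub>C b = a *\<^sub>C b + a' *\<^sub>C b" "a *\<^sub>C (b + b') = a *\<^sub>C b + a *\<^sub>C b'"
    by (simp_all add: scaleC_add_left scaleC_add_right)
  show "(r *\<^sub>R a) *\<^sub>C b = r *\<^sub>R a *\<^sub>C b" "a *\<^sub>C r *\<^sub>R b = r *\<^sub>R a *\<^sub>C b"
    by (simp_all flip: scaleC_of_real add: scaleC_scaleC scaleR_conv_of_real mult_ac)
  show "\<exists>K. \<forall>a (b :: 'h). norm (a *\<^sub>C b) \<le> norm a * norm b * K"
    by (rule exI[of _ 1]) simp
qed

lemmas tendsto_cinner = bounded_bilinear.tendsto[OF bounded_bilinear_cinner]
lemmas tendsto_scaleC = bounded_bilinear.tendsto[OF bounded_bilinear_scaleC]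
lemmas scaleC_diff_right = bounded_bilinear.diff_right[OF bounded_bilinear_scaleC]
lemmas scaleC_diff_left = bounded_bilinear.diff_left[OF bounded_bilinear_scaleC]

lemma cinner_eqI:
  assumes "\<And>z. cinner z x = cinner z (y :: 'h::complex_hilbert_space)" shows "x = y"
proof -
  have "cinner (x - y) (x - y) = 0" using assms[of "x - y"] by (simp add: cinner_diff_right)
  thus ?thesis by (simp add: cinner_self)
qed

lemma bounded_clinearI:
  assumes "\<And>x y. f (x + y) = f x + f y" and "\<And>c x. f (c *\<^sub>C x) = c *\<^sub>C f x"
    and "\<And>x. norm (f x) \<le> K * norm x"
  shows "bounded_clinear f"
  unfolding bounded_clinear_def
proof (intro conjI allI bounded_linear_intro[of _ K])
  show "f (r *\<^sub>R x) = r *\<^sub>R f x" for r x using assms(2)[of "complex_of_real r" x]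
      by (simp add: scaleC_of_real)
qed (use assms in \<open>auto simp: mult.commute\<close>)

lemma bounded_clinear_bounded_linear: "bounded_clinear f \<Longrightarrow> bounded_linear f"
  and bounded_clinear_scaleC: "bounded_clinear f \<Longrightarrow> f (c *\<^sub>C x) = c *\<^sub>C f x"
  and bounded_clinear_add: "bounded_clinear f \<Longrightarrow> f (x + y) = f x + f y"
  and bounded_clinear_diff: "bounded_clinear f \<Longrightarrow> f (x - y) = f x - f y"
  and bounded_clinear_zero: "bounded_clinear f \<Longrightarrow> f 0 = 0"
  by (auto simp: bounded_clinear_def linear_simps)

lemma bounded_clinear_norm_le: "bounded_clinear f \<Longrightarrow> norm (f x) \<le> onorm f * norm x"
  by (rule onorm[OF bounded_clinear_bounded_linear])

lemma bounded_clinear_id: "bounded_clinear id" "bounded_clinear (\<lambda>x. x)"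
  by (auto simp: bounded_clinear_def id_def bounded_linear_ident)

lemma bounded_clinear_const_zero: "bounded_clinear (\<lambda>_. 0)"
  by (auto simp: bounded_clinear_def)

lemma bounded_clinear_compose:
  "bounded_clinear f \<Longrightarrow> bounded_clinear g \<Longrightarrow> bounded_clinear (\<lambda>x. f (g x))"
  by (auto simp: bounded_clinear_def bounded_linear_compose)

lemma bounded_clinear_comp: "bounded_clinear f \<Longrightarrow> bounded_clinear g \<Longrightarrow> bounded_clinear (f \<circ> g)"
  using bounded_clinear_compose[of f g] by (simp add: o_def)

lemma bounded_clinear_plus:
  "bounded_clinear f \<Longrightarrow> bounded_clinear g \<Longrightarrow> bounded_clinear (\<lambda>x. f x + g x)"
  by (auto simp: bounded_clinear_def bounded_linear_add scaleC_add_right)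

lemma bounded_clinear_minus: "bounded_clinear f \<Longrightarrow> bounded_clinear (\<lambda>x. - f x)"
  by (auto simp: bounded_clinear_def bounded_linear_minus)

lemma bounded_clinear_scale: "bounded_clinear f \<Longrightarrow> bounded_clinear (\<lambda>x. c *\<^sub>C f x)"
  unfolding bounded_clinear_def
  by (auto intro!: bounded_linear_compose[OF bounded_bilinear.bounded_linear_right[OF
      bounded_bilinear_scaleC]]
      simp: scaleC_scaleC mult.commute)

lemma bounded_clinear_sum:
  "(\<And>i. i \<in> I \<Longrightarrow> bounded_clinear (f i)) \<Longrightarrow> bounded_clinear (\<lambda>x. \<Sum>i\<in>I. f i x)"
  by (induction I rule: infinite_finite_induct)
    (auto intro: bounded_clinear_plus bounded_clinear_const_zero)

text \<open>\<open>cadjoint\<close> is a definite description and says nothing before an adjoint is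
  known to exist. A pair carries existence along, and \<open>cadjoint_eqI\<close> then evaluates
  \<open>cadjoint\<close>.\<close>

definition adjoint_pair :: "('h::complex_hilbert_space \<Rightarrow> 'h) \<Rightarrow> ('h \<Rightarrow> 'h) \<Rightarrow> bool"
  where "adjoint_pair f g \<longleftrightarrow> (\<forall>x y. cinner (f x) y = cinner x (g y))"

lemma adjoint_pairD: "adjoint_pair f g \<Longrightarrow> cinner (f x) y = cinner x (g y)"
  by (simp add: adjoint_pair_def)

lemma adjoint_pair_unique:
  assumes "adjoint_pair f g" "adjoint_pair f g'" shows "g = g'"
proof
  show "g y = g' y" for y
    by (rule cinner_eqI) (metis assms adjoint_pairD)
qed

lemma cadjoint_eqI: "adjoint_pair f g \<Longrightarrow> cadjoint f = g"
  unfolding cadjoint_def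
  by (intro the_equality) (auto simp: adjoint_pair_def intro: adjoint_pair_unique[of f])

lemma adjoint_pair_sym: "adjoint_pair f g \<Longrightarrow> adjoint_pair g f"
  unfolding adjoint_pair_def by (metis cinner_commute)

lemma adjoint_pair_comp:
  "adjoint_pair f g \<Longrightarrow> adjoint_pair f' g' \<Longrightarrow> adjoint_pair (f \<circ> f') (g' \<circ> g)"
  by (simp add: adjoint_pair_def)

lemma adjoint_pair_plus:
  "adjoint_pair f g \<Longrightarrow> adjoint_pair f' g' \<Longrightarrow> adjoint_pair (\<lambda>x. f x + f' x) (\<lambda>x. g x + g' x)"
  by (simp add: adjoint_pair_def cinner_add_left cinner_add_right)

lemma adjoint_pair_scale:
  "adjoint_pair f g \<Longrightarrow> adjoint_pair (\<lambda>x. c *\<^sub>C f x) (\<lambda>x. cnj c *\<^sub>C g x)"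
  by (simp add: adjoint_pair_def cinner_scaleC_left cinner_scaleC_right)

text \<open>Both conclusions come from the pairing: |g y|^2 equals
  \<open>cinner (f (g y)) y\<close>, which Cauchy-Schwarz bounds, and linearity of \<open>g\<close>
  follows by testing against all vectors.\<close>

lemma adjoint_pair_bounded_clinear:
  assumes fg: "adjoint_pair f g" and f: "bounded_clinear f"
  shows "bounded_clinear g" "onorm g \<le> onorm f"
proof -
  have n: "norm (g y) \<le> onorm f * norm y" for y
  proof (cases "g y = 0")
    case False
    have "(norm (g y))\<^sup>2 = cmod (cinner (f (g y)) y)"
      by (simp add: adjoint_pairD[OF fg] cinner_self norm_power)
    also have "\<dots> \<le> norm (f (g y)) * norm y" by (rule Cauchy_Schwarz_cinner)
    also have "\<dots> \<le> (onorm f * norm (g y)) * norm y"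
      by (intro mult_right_mono bounded_clinear_norm_le f) simp
    finally show ?thesis using False by (simp add: power2_eq_square mult_ac)
  qed (simp add: onorm_pos_le bounded_clinear_bounded_linear f)
  show "bounded_clinear g"
  proof (rule bounded_clinearI[OF _ _ n])
    show "g (x + y) = g x + g y" for x y
      by (rule cinner_eqI) (simp add: cinner_add_right flip: adjoint_pairD[OF fg])
    show "g (c *\<^sub>C x) = c *\<^sub>C g x" for c x
      by (rule cinner_eqI) (simp add: cinner_scaleC_right flip: adjoint_pairD[OF fg])
  qed
  show "onorm g \<le> onorm f"
    using n by (intro onorm_bound) (simp_all add: onorm_pos_le bounded_clinear_bounded_linear f)
qed

text \<open>The C*-identity for operators. The lower bound for the composition comes from |f x|^2 =
  <x, g (f x)>; this is what makes \<open>op_norm\<close> a C*-seminorm.\<close>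

lemma onorm_adjoint_comp:
  assumes fg: "adjoint_pair f g" and f: "bounded_clinear f"
  shows "onorm (g \<circ> f) = (onorm f)\<^sup>2"
proof (rule antisym)
  note g = adjoint_pair_bounded_clinear[OF fg f]
  have gf: "bounded_clinear (g \<circ> f)" by (rule bounded_clinear_comp[OF g(1) f])
  have pos: "0 \<le> onorm f" "0 \<le> onorm (g \<circ> f)"
    by (simp_all add: onorm_pos_le bounded_clinear_bounded_linear f gf)
  have "onorm (g \<circ> f) \<le> onorm g * onorm f"
    by (rule onorm_compose) (simp_all add: bounded_clinear_bounded_linear f g)
  also have "\<dots> \<le> (onorm f)\<^sup>2" using g(2) pos by (simp add: power2_eq_square mult_right_mono)
  finally show "onorm (g \<circ> f) \<le> (onorm f)\<^sup>2" .
  have "onorm f \<le> sqrt (onorm (g \<circ> f))"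
  proof (rule onorm_bound)
    fix x
    have "(norm (f x))\<^sup>2 = cmod (cinner x ((g \<circ> f) x))"
      by (simp add: cinner_self norm_power flip: adjoint_pairD[OF fg])
    also have "\<dots> \<le> norm x * norm ((g \<circ> f) x)" by (rule Cauchy_Schwarz_cinner)
    also have "\<dots> \<le> norm x * (onorm (g \<circ> f) * norm x)"
      by (intro mult_left_mono bounded_clinear_norm_le gf) simp
    finally have "(norm (f x))\<^sup>2 \<le> (sqrt (onorm (g \<circ> f)) * norm x)\<^sup>2"
      using pos by (simp add: power_mult_distrib power2_eq_square mult_ac)
    thus "norm (f x) \<le> sqrt (onorm (g \<circ> f)) * norm x"
      by (rule power2_le_imp_le) (simp add: pos)
  qed (simp add: pos)
  thus "(onorm f)\<^sup>2 \<le> onorm (g \<circ> f)"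
    using pos power_mono[of "onorm f" "sqrt (onorm (g \<circ> f))" 2] by simp
qed

lemma map_prod_bounded_clinear:
  assumes "bounded_clinear f" "bounded_clinear g" shows "bounded_clinear (map_prod f g)"
proof -
  have "bounded_linear (\<lambda>z. (f (fst z), g (snd z)))"
    by (intro bounded_linear_Pair bounded_linear_compose[OF _ bounded_linear_fst]
        bounded_linear_compose[OF _ bounded_linear_snd] bounded_clinear_bounded_linear assms)
  moreover have "(\<lambda>z. (f (fst z), g (snd z))) = map_prod f g" by auto
  ultimately show ?thesis
    using assms by (simp add: bounded_clinear_def scaleC_prod_def)
qed

lemma map_prod_adjoint_pair:
  "adjoint_pair f f' \<Longrightarrow> adjoint_pair g g' \<Longrightarrow> adjoint_pair (map_prod f g) (map_prod f' g')"
  by (simp add: adjoint_pair_def cinner_prod_def)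

section \<open>Square-summable families\<close>

lemmas Rep_ell2_simps [simp] = plus_ell2.rep_eq minus_ell2.rep_eq uminus_ell2.rep_eq
    zero_ell2.rep_eq
  scaleC_ell2.rep_eq scaleR_ell2.rep_eq

lemma Rep_ell2_sum [simp]: "Rep_ell2 (\<Sum>i\<in>I. f i) x = (\<Sum>i\<in>I. Rep_ell2 (f i) x)"
  by (induction I rule: infinite_finite_induct) simp_all

lemma ell2_eqI: "(\<And>x. Rep_ell2 v x = Rep_ell2 w x) \<Longrightarrow> v = w"
  by (metis Rep_ell2_inject ext)

lemma Rep_ell2_summable: "(\<lambda>x. (cmod (Rep_ell2 v x))\<^sup>2) summable_on UNIV"
  using Rep_ell2[of v] by simp

lemma Rep_ell2_ket: "Rep_ell2 (ket x) y = (if y = x then 1 else 0)"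
  by (simp add: ket.rep_eq)

lemma cinner_ell2_eq: "cinner v w = (\<Sum>\<^sub>\<infinity>x. Rep_ell2 v x * cnj (Rep_ell2 w x))"
  by (simp add: cinner_ell2.rep_eq)

lemma cinner_ket_right [simp]: "cinner v (ket x) = Rep_ell2 v x"
proof -
  have "cinner v (ket x) = (\<Sum>\<^sub>\<infinity>y\<in>{x}. Rep_ell2 v y)"
    unfolding cinner_ell2_eq by (rule infsum_cong_neutral) (auto simp: Rep_ell2_ket)
  thus ?thesis by simp
qed

lemma cinner_ket_left [simp]: "cinner (ket x) v = cnj (Rep_ell2 v x)"
  by (metis cinner_commute cinner_ket_right)

lemma norm_ket [simp]: "norm (ket x) = 1"
proof -
  have "complex_of_real ((norm (ket x))\<^sup>2) = 1"
    unfolding cinner_self[symmetric] by (simp add: Rep_ell2_ket)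
  thus ?thesis by (metis norm_ge_zero of_real_eq_1_iff power2_eq_1_iff neg_one_eq_numeral_iff(1)
        le_minus_one_simps(3))
qed

text \<open>Truncation to an arbitrary set, so that no finiteness enters the lifting. For finite
  sets it lies in the span of the basis and approximates every vector.\<close>

lift_definition ell2_restrict :: "'a set \<Rightarrow> 'a ell2 \<Rightarrow> 'a ell2"
  is "\<lambda>F f x. if x \<in> F then f x else 0"
  by (erule summable_on_comparison_test) auto

lemma ell2_restrict_sum:
  "finite F \<Longrightarrow> ell2_restrict F v = (\<Sum>x\<in>F. Rep_ell2 v x *\<^sub>C ket x)"
  by (rule ell2_eqI) (simp add: ell2_restrict.rep_eq Rep_ell2_ket if_distrib[of "(*) _"]
      sum.delta' cong: if_cong)

lemma norm_ell2_restrict_diff: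
  "(norm (v - ell2_restrict F v))\<^sup>2 = (\<Sum>\<^sub>\<infinity>x\<in>-F. (cmod (Rep_ell2 v x))\<^sup>2)"
  unfolding norm_ell2_sq by (rule infsum_cong_neutral) (auto simp: ell2_restrict.rep_eq)

lemma ell2_restrict_approx:
  assumes "e > 0" obtains F where "finite F" "norm (v - ell2_restrict F v) < e"
proof -
  let ?f = "\<lambda>x. (cmod (Rep_ell2 v x))\<^sup>2"
  have "(sum ?f \<longlongrightarrow> infsum ?f UNIV) (finite_subsets_at_top UNIV)"
    using Rep_ell2_summable[of v] by (simp add: summable_iff_has_sum_infsum has_sum_def)
  hence "\<forall>\<^sub>F F in finite_subsets_at_top UNIV. dist (sum ?f F) (infsum ?f UNIV) < e\<^sup>2"
    using assms by (intro tendstoD) auto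
  then obtain F where F: "finite F" "dist (sum ?f F) (infsum ?f UNIV) < e\<^sup>2"
    unfolding eventually_finite_subsets_at_top by blast
  have "infsum ?f UNIV = infsum ?f (F \<union> -F)" by simp
  also have "\<dots> = infsum ?f F + infsum ?f (-F)"
    by (rule infsum_Un_disjoint) (auto intro: summable_on_subset_banach[OF Rep_ell2_summable])
  finally have "infsum ?f (-F) < e\<^sup>2" using F by (simp add: dist_real_def)
  hence "(norm (v - ell2_restrict F v))\<^sup>2 < e\<^sup>2" by (simp add: norm_ell2_restrict_diff)
  hence "norm (v - ell2_restrict F v) < e" by (rule power2_less_imp_less) (use assms in simp)
  with F(1) show thesis by (rule that)
qed

lemma ell2_restrict_in_span: "finite F \<Longrightarrow> ell2_restrict F v \<in> cspan (range ket)"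
  unfolding ell2_restrict_sum
  by (intro complex_vector.span_sum complex_vector.span_scale complex_vector.span_base rangeI)

text \<open>A linear and closed condition that holds on basis vectors holds everywhere; operators
  and functionals given on \<open>ket\<close> are identified in this way.\<close>

lemma closed_csubspace_UNIV:
  fixes S :: "'a ell2 set"
  assumes "csubspace S" "closed S" "range ket \<subseteq> S"
  shows "S = UNIV"
proof -
  have "v \<in> S" for v
  proof -
    have "v \<in> closure S"
      unfolding closure_approachable
    proof (intro allI impI)
      fix e :: real assume "e > 0"
      then obtain F where "finite F" "norm (v - ell2_restrict F v) < e"
        by (rule ell2_restrict_approx)
      moreover have "cspan (range ket) \<subseteq> S" by (rule complex_vector.span_minimal[OF assms(3,1)])
      ultimately show "\<exists>y\<in>S. dist y v < e"
        using ell2_restrict_in_span by (intro bexI[of _ "ell2_restrict F v"]) (auto simp: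
            dist_norm norm_minus_commute)
    qed
    thus ?thesis using assms(2) by simp
  qed
  thus ?thesis by auto
qed

lemma closure_csubspace_ket: "cspan (range ket) \<subseteq> S \<Longrightarrow> closure S = (UNIV :: 'a ell2 set)"
proof -
  assume S: "cspan (range ket) \<subseteq> S"
  have "v \<in> closure S" for v
    unfolding closure_approachable
  proof (intro allI impI)
    fix e :: real assume "e > 0"
    then obtain F where "finite F" "norm (v - ell2_restrict F v) < e"
      by (rule ell2_restrict_approx)
    thus "\<exists>y\<in>S. dist y v < e"
      using S ell2_restrict_in_span[of F v]
      by (intro bexI[of _ "ell2_restrict F v"]) (auto simp: dist_norm norm_minus_commute)
  qed
  thus ?thesis by auto
qed

lemma bounded_clinear_eq_on_ket:
  fixes f g :: "'a ell2 \<Rightarrow> 'h::complex_hilbert_space"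
  assumes f: "bounded_clinear f" and g: "bounded_clinear g" and eq: "\<And>x. f (ket x) = g (ket x)"
  shows "f = g"
proof -
  have "closed {v. f v = g v}"
    by (intro closed_Collect_eq linear_continuous_on bounded_clinear_bounded_linear f g)
  moreover have "csubspace {v. f v = g v}"
    unfolding complex_vector.subspace_def
    by (simp add: bounded_clinear_add[OF f] bounded_clinear_add[OF g] bounded_clinear_zero f g
        bounded_clinear_scaleC)
  ultimately have "{v. f v = g v} = UNIV"
    by (intro closed_csubspace_UNIV) (auto simp: eq)
  thus ?thesis by auto
qed

text \<open>The theorem of Riesz: the candidate has coordinates \<open>cnj (\<phi> (ket x))\<close>, and testing \<open>\<phi>\<close> on its
  finite truncations bounds its norm.\<close>

lemma ell2_functional:
  fixes \<phi> :: "'a ell2 \<Rightarrow> complex"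
  assumes lin: "bounded_linear \<phi>" and sc: "\<And>c v. \<phi> (c *\<^sub>C v) = c * \<phi> v"
  obtains r where "\<And>v. \<phi> v = cinner v r"
proof -
  interpret bounded_linear \<phi> by (rule lin)
  obtain K where K: "K \<ge> 0" "\<And>v. cmod (\<phi> v) \<le> norm v * K" using nonneg_bounded by blast
  define r where "r x = cnj (\<phi> (ket x))" for x
  have bd: "(\<Sum>x\<in>F. (cmod (r x))\<^sup>2) \<le> K\<^sup>2" if F: "finite F" for F
  proof -
    define s where "s = (\<Sum>x\<in>F. (cmod (r x))\<^sup>2)"
    define v where "v = (\<Sum>x\<in>F. r x *\<^sub>C ket x)"
    have Rv: "Rep_ell2 v x = (if x \<in> F then r x else 0)" for x
      using F by (simp add: v_def Rep_ell2_ket if_distrib[of "(*) _"] sum.delta' cong: if_cong)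
    have "(norm v)\<^sup>2 = (\<Sum>\<^sub>\<infinity>x\<in>F. (cmod (r x))\<^sup>2)"
      unfolding norm_ell2_sq by (rule infsum_cong_neutral) (auto simp: Rv)
    hence nv: "(norm v)\<^sup>2 = s" using F by (simp add: s_def)
    have "\<phi> v = complex_of_real s"
      by (simp add: v_def s_def sum sc r_def complex_norm_square mult.commute del: of_real_power)
    moreover have "s \<ge> 0" by (simp add: s_def sum_nonneg)
    ultimately have "s \<le> norm v * K" using K(2)[of v] by simp
    hence "norm v * norm v \<le> norm v * K" using nv by (simp add: power2_eq_square)
    hence "norm v \<le> K" using K(1) by (cases "norm v = 0") auto
    thus ?thesis using nv power_mono[of "norm v" K 2] by (simp add: s_def)
  qed
  have "(\<lambda>x. (cmod (r x))\<^sup>2) summable_on UNIV"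
    by (rule nonneg_bdd_above_summable_on) (auto simp: bdd_above_def intro!: exI[of _ "K\<^sup>2"] bd)
  hence Rr: "Rep_ell2 (Abs_ell2 r) = r" by (simp add: Abs_ell2_inverse)
  have "closed {v. \<phi> v = cinner v (Abs_ell2 r)}"
    by (intro closed_Collect_eq linear_continuous_on lin
        bounded_bilinear.bounded_linear_left[OF bounded_bilinear_cinner])
  moreover have "csubspace {v. \<phi> v = cinner v (Abs_ell2 r)}"
    unfolding complex_vector.subspace_def
    by (simp add: zero add sc cinner_add_left cinner_scaleC_left)
  ultimately have "{v. \<phi> v = cinner v (Abs_ell2 r)} = UNIV"
    by (intro closed_csubspace_UNIV) (auto simp: Rr, simp add: r_def)
  thus thesis using that by blast
qed

text \<open>The Riesz representation of the functional \<open>cinner (f x) y\<close> of x, for each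
  fixed \<open>y\<close>, supplies the adjoint, so that \<open>cadjoint\<close> is meaningful for
  all bounded operators on \<open>ell2\<close>.\<close>

lemma ell2_adjoint_pair:
  fixes f :: "'a ell2 \<Rightarrow> 'a ell2"
  assumes f: "bounded_clinear f"
  shows "adjoint_pair f (cadjoint f)"
proof -
  have "\<exists>r. \<forall>x. cinner (f x) y = cinner x r" for y
  proof -
    have "bounded_linear (\<lambda>x. cinner (f x) y)"
      by (rule bounded_linear_compose[OF bounded_bilinear.bounded_linear_left[OF
          bounded_bilinear_cinner]
            bounded_clinear_bounded_linear[OF f]])
    thus ?thesis
      using ell2_functional[of "\<lambda>x. cinner (f x) y"]
      by (metis bounded_clinear_scaleC cinner_scaleC_left f)
  qed
  then obtain g where "adjoint_pair f g" unfolding adjoint_pair_def by metis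
  thus ?thesis using cadjoint_eqI by blast
qed

text \<open>\<open>wshift g c\<close> is meaningful only for bounded \<open>c\<close> and for \<open>g\<close> injective where \<open>c\<close> does not
  vanish; otherwise \<open>Abs_ell2\<close> may be applied outside its domain.\<close>

definition wshift :: "('a \<Rightarrow> 'a) \<Rightarrow> ('a \<Rightarrow> complex) \<Rightarrow> 'a ell2 \<Rightarrow> 'a ell2"
  where "wshift g c v = Abs_ell2 (\<lambda>y. c y * Rep_ell2 v (g y))"

context
  fixes g :: "'a \<Rightarrow> 'a" and c :: "'a \<Rightarrow> complex" and K :: real
  assumes inj: "inj_on g {y. c y \<noteq> 0}" and bound: "\<And>y. cmod (c y) \<le> K"
begin

lemma wshift_sum_le:
  assumes "finite F"
  shows "(\<Sum>y\<in>F. (cmod (c y * Rep_ell2 v (g y)))\<^sup>2) \<le> (K * norm v)\<^sup>2"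
proof -
  let ?F = "F \<inter> {y. c y \<noteq> 0}"
  have "(\<Sum>y\<in>F. (cmod (c y * Rep_ell2 v (g y)))\<^sup>2) = (\<Sum>y\<in>?F. (cmod (c y * Rep_ell2 v (g y)))\<^sup>2)"
    by (rule sum.mono_neutral_right) (use assms in auto)
  also have "\<dots> \<le> (\<Sum>y\<in>?F. K\<^sup>2 * (cmod (Rep_ell2 v (g y)))\<^sup>2)"
    by (intro sum_mono) (auto simp: norm_mult power_mult_distrib intro!: mult_right_mono
        power_mono bound)
  also have "\<dots> = K\<^sup>2 * (\<Sum>x\<in>g ` ?F. (cmod (Rep_ell2 v x))\<^sup>2)"
    by (subst sum.reindex) (auto simp: sum_distrib_left intro: inj_on_subset[OF inj])
  also have "\<dots> \<le> K\<^sup>2 * (norm v)\<^sup>2"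
    using assms by (intro mult_left_mono sum_le_norm_ell2) auto
  finally show ?thesis by (simp add: power_mult_distrib)
qed

lemma Rep_wshift: "Rep_ell2 (wshift g c v) y = c y * Rep_ell2 v (g y)"
proof -
  have "(\<lambda>y. (cmod (c y * Rep_ell2 v (g y)))\<^sup>2) summable_on UNIV"
    by (rule nonneg_bdd_above_summable_on)
      (auto simp: bdd_above_def intro!: exI[of _ "(K * norm v)\<^sup>2"] wshift_sum_le)
  thus ?thesis by (simp add: wshift_def Abs_ell2_inverse)
qed

lemma wshift_norm_le: "norm (wshift g c v) \<le> K * norm v"
proof (rule power2_le_imp_le)
  show "(norm (wshift g c v))\<^sup>2 \<le> (K * norm v)\<^sup>2"
    unfolding norm_ell2_sq
    by (rule infsum_le_finite_sums[OF Rep_ell2_summable]) (simp add: Rep_wshift wshift_sum_le)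
  show "0 \<le> K * norm v" using order_trans[OF norm_ge_zero bound] by simp
qed

lemma wshift_bounded_clinear: "bounded_clinear (wshift g c)"
  by (rule bounded_clinearI[OF _ _ wshift_norm_le])
    (auto intro!: ell2_eqI simp: Rep_wshift algebra_simps)

end

lemma adjoint_pair_wshift:
  assumes c: "\<And>y. cmod (c y) \<le> K" and c': "\<And>x. cmod (c' x) \<le> K"
    and g: "\<And>y. c y \<noteq> 0 \<Longrightarrow> g' (g y) = y \<and> c' (g y) = cnj (c y)"
    and g': "\<And>x. c' x \<noteq> 0 \<Longrightarrow> g (g' x) = x \<and> c (g' x) = cnj (c' x)"
  shows "adjoint_pair (wshift g c) (wshift g' c')"
  unfolding adjoint_pair_def
proof (intro allI)
  fix v w
  let ?S = "{y. c y \<noteq> 0}" and ?S' = "{x. c' x \<noteq> 0}"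
  have inj: "inj_on g ?S" "inj_on g' ?S'"
    using g g' by (auto intro: inj_on_inverseI)
  have bij: "bij_betw g ?S ?S'"
    by (rule bij_betw_byWitness[where f' = g']) (use g g' in force)+
  have "cinner (wshift g c v) w = (\<Sum>\<^sub>\<infinity>y. c y * Rep_ell2 v (g y) * cnj (Rep_ell2 w y))"
    by (simp add: cinner_ell2_eq Rep_wshift[OF inj(1) c])
  also have "\<dots> = (\<Sum>\<^sub>\<infinity>y\<in>?S. Rep_ell2 v (g y) * cnj (c' (g y) * Rep_ell2 w (g' (g y))))"
    by (rule infsum_cong_neutral) (auto simp: g)
  also have "\<dots> = (\<Sum>\<^sub>\<infinity>x\<in>?S'. Rep_ell2 v x * cnj (c' x * Rep_ell2 w (g' x)))"
    by (rule infsum_reindex_bij_betw[OF bij])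
  also have "\<dots> = (\<Sum>\<^sub>\<infinity>x. Rep_ell2 v x * cnj (c' x * Rep_ell2 w (g' x)))"
    by (rule infsum_cong_neutral) auto
  also have "\<dots> = cinner v (wshift g' c' w)"
    by (simp add: cinner_ell2_eq Rep_wshift[OF inj(2) c'])
  finally show "cinner (wshift g c v) w = cinner v (wshift g' c' w)" .
qed

abbreviation diag_op :: "('a \<Rightarrow> complex) \<Rightarrow> 'a ell2 \<Rightarrow> 'a ell2"
  where "diag_op c \<equiv> wshift (\<lambda>x. x) c"

lemma Rep_diag_op: "(\<And>x. cmod (c x) \<le> K) \<Longrightarrow> Rep_ell2 (diag_op c v) x = c x * Rep_ell2 v x"
  by (rule Rep_wshift[of _ _ K]) auto

lemma diag_op_bounded_clinear: "(\<And>x. cmod (c x) \<le> K) \<Longrightarrow> bounded_clinear (diag_op c)"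
  by (rule wshift_bounded_clinear[of _ _ K]) auto

lemma adjoint_pair_diag_op:
  "(\<And>x. cmod (c x) \<le> K) \<Longrightarrow> adjoint_pair (diag_op c) (diag_op (\<lambda>x. cnj (c x)))"
  by (rule adjoint_pair_wshift[of _ K]) auto

section \<open>Free *-algebras and C*-seminorms\<close>

lemma free_star_algebra_expand:
  "(z :: 'g free_star_algebra) = (\<Sum>w\<in>Poly_Mapping.keys z. Poly_Mapping.single w
      (Poly_Mapping.lookup z w))"
  by (rule poly_mapping_eqI)
    (simp add: lookup_sum lookup_single when_def sum.delta in_keys_iff)

text \<open>The coefficient in \<open>single\<close> is arbitrary and may be 0, so the zero element
  needs no case of its own.\<close>

lemma free_star_algebra_induct [case_names single add]:
  fixes z :: "'g free_star_algebra"
  assumes single: "\<And>w c. P (Poly_Mapping.single w c)" and add: "\<And>x y. P x \<Longrightarrow> P y \<Longrightarrow> P (x + y)"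
  shows "P z"
proof -
  have "P 0" using single[of 0 0] by simp
  hence "P (\<Sum>w\<in>W. Poly_Mapping.single w (Poly_Mapping.lookup z w))" for W
    by (induction W rule: infinite_finite_induct) (auto intro: single add)
  thus ?thesis by (subst free_star_algebra_expand)
qed

lemma single_zero_commute:
  "z * Poly_Mapping.single 0 c = Poly_Mapping.single 0 c * (z :: 'g free_star_algebra)"
  by (induction z rule: free_star_algebra_induct) (simp_all add: mult_single mult.commute
      distrib_left distrib_right)

lemma free_scale_add_right: "free_scale c (x + y) = free_scale c x + free_scale c y"
  and free_scale_diff_right: "free_scale c (x - y) = free_scale c x - free_scale c y"
  and free_scale_add_left: "free_scale (c + d) x = free_scale c x + free_scale d x"
  and free_scale_scale [simp]: "free_scale c (free_scale d x) = free_scale (c * d) x"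
  and free_scale_one [simp]: "free_scale 1 x = x"
  and free_scale_zero_left [simp]: "free_scale 0 x = 0"
  and free_scale_zero_right [simp]: "free_scale c 0 = 0"
  and free_scale_minus_one: "free_scale (- 1) x = - x"
  and free_scale_mult_left [simp]: "free_scale c x * y = free_scale c (x * y)"
proof -
  have "Poly_Mapping.single 0 c * (Poly_Mapping.single 0 d * x) = Poly_Mapping.single 0 (c * d) * x"
    by (simp add: mult_single flip: mult.assoc)
  thus "free_scale c (free_scale d x) = free_scale (c * d) x" by (simp add: free_scale_def)
qed (simp_all add: free_scale_def distrib_left distrib_right right_diff_distrib single_add
      mult.assoc single_uminus)

lemma free_scale_mult_right [simp]: "x * free_scale c y = free_scale c (x * y)"
  unfolding free_scale_def by (metis mult.assoc single_zero_commute)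

lemma free_scale_single: "free_scale c (Poly_Mapping.single w d) = Poly_Mapping.single w (c * d)"
  by (simp add: free_scale_def mult_single)

lemma lookup_free_scale: "Poly_Mapping.lookup (free_scale c x) w = c * Poly_Mapping.lookup x w"
  by (induction x rule: free_star_algebra_induct)
    (simp_all add: free_scale_single free_scale_add_right lookup_single lookup_add when_def
        distrib_left)

lemma word_star_involution [simp]: "word_star (word_star w) = w"
  by (cases w) (simp add: word_star_def rev_map case_prod_unfold comp_def)

lemma word_star_plus: "word_star (v + w) = word_star w + word_star v"
  by (simp add: word_star_def plus_star_word_def)

lemma word_star_zero [simp]: "word_star 0 = 0"
  by (simp add: word_star_def zero_star_word_def)

lemma lookup_free_star: "Poly_Mapping.lookup (free_star x) w = cnj (Poly_Mapping.lookup x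
    (word_star w))"
proof -
  have "inj word_star" by (metis injI word_star_involution)
  thus ?thesis
    by (simp add: free_star_def map.rep_eq map_key.rep_eq[OF \<open>inj word_star\<close>] when_def)
qed

lemma free_star_add: "free_star (x + y) = free_star x + free_star y"
  and free_star_diff: "free_star (x - y) = free_star x - free_star y"
  and free_star_scale: "free_star (free_scale c x) = free_scale (cnj c) (free_star x)"
  and free_star_involution [simp]: "free_star (free_star x) = x"
  by (rule poly_mapping_eqI; simp add: lookup_free_star lookup_add lookup_minus lookup_free_scale)+

lemma free_star_single: "free_star (Poly_Mapping.single w c) = Poly_Mapping.single (word_star w)
    (cnj c)"
proof (rule poly_mapping_eqI)
  fix v
  have "w = word_star v \<longleftrightarrow> word_star w = v" by (metis word_star_involution)
  thus "Poly_Mapping.lookup (free_star (Poly_Mapping.single w c)) v = Poly_Mapping.lookup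
      (Poly_Mapping.single (word_star w) (cnj c)) v"
    unfolding lookup_free_star lookup_single when_def by simp
qed

lemma free_star_one [simp]: "free_star 1 = 1"
  using free_star_single[of 0 1] by simp

lemma free_star_mult: "free_star (x * y) = free_star y * free_star x"
proof (induction x rule: free_star_algebra_induct)
  case (single v c)
  show ?case
    by (induction y rule: free_star_algebra_induct)
      (simp_all add: mult_single free_star_single word_star_plus mult.commute distrib_left
        distrib_right free_star_add)
qed (simp add: distrib_left distrib_right free_star_add)

lemma keys_free_star: "Poly_Mapping.keys (free_star x) = word_star ` Poly_Mapping.keys x"
proof -
  have "w \<in> Poly_Mapping.keys (free_star x) \<longleftrightarrow> word_star w \<in> Poly_Mapping.keys x" for w
    by (simp add: in_keys_iff lookup_free_star)
  hence "Poly_Mapping.keys (free_star x) = {w. word_star w \<in> Poly_Mapping.keys x}" by auto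
  also have "\<dots> = word_star ` Poly_Mapping.keys x"
    by (auto intro: image_eqI[where x = "word_star _"])
  finally show ?thesis .
qed

definition free_letter :: "'g \<times> bool \<Rightarrow> 'g free_star_algebra"
  where "free_letter l = Poly_Mapping.single (Star_Word [l]) 1"

lemma free_gen_eq_letter: "free_gen g = free_letter (g, False)"
  by (simp add: free_gen_def free_letter_def)

lemma free_star_letter: "free_star (free_letter (g, s)) = free_letter (g, \<not> s)"
  by (simp add: free_letter_def free_star_single word_star_def)

lemma single_Star_Word_Nil: "Poly_Mapping.single (Star_Word []) 1 = (1 :: 'g free_star_algebra)"
  by (simp flip: zero_star_word_def)

lemma single_Star_Word_Cons:
  "Poly_Mapping.single (Star_Word (l # ls)) 1 = free_letter l * (Poly_Mapping.single (Star_Word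
      ls) 1 :: 'g free_star_algebra)"
  by (simp add: free_letter_def mult_single plus_star_word_def)

lemma single_eq_free_scale: "Poly_Mapping.single w c = free_scale c (Poly_Mapping.single w 1)"
  by (simp add: free_scale_single)

text \<open>A root test: if \<open>x > y\<close>, then \<open>(x / y)^(2^k)\<close> grows faster than the cube of \<open>2^k\<close>.\<close>

lemma le_from_powers:
  fixes x y K :: real
  assumes x: "0 \<le> x" and y: "0 \<le> y"
    and le: "\<And>k. x ^ (2 ^ k) \<le> K * real (2 ^ k) ^ 3 * y ^ (2 ^ k)"
  shows "x \<le> y"
proof (rule ccontr)
  assume "\<not> x \<le> y"
  hence xy: "y < x" by simp
  have "y \<noteq> 0" using le[of 0] xy x by auto
  hence y: "y > 0" using y by simp
  define r where "r = x / y"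
  have r: "r > 1" using xy y by (simp add: r_def)
  have "(\<lambda>n. K * real n ^ 3 / r ^ n) \<longlonglongrightarrow> 0" using r by real_asymp
  hence "\<forall>\<^sub>F n in sequentially. K * real n ^ 3 / r ^ n < 1" by (rule order_tendstoD) simp
  then obtain N where N: "\<And>n. n \<ge> N \<Longrightarrow> K * real n ^ 3 / r ^ n < 1"
    by (auto simp: eventually_sequentially)
  have "N \<le> 2 ^ N" by (simp add: less_imp_le)
  from N[OF this] have "K * real (2 ^ N) ^ 3 < r ^ (2 ^ N)" using r by (simp add: divide_less_eq)
  moreover have "r ^ (2 ^ N) \<le> K * real (2 ^ N) ^ 3"
    using le[of N] y by (simp add: r_def power_divide divide_le_eq)
  ultimately show False by simp
qed

section \<open>Arbitrary C*-seminorms on the free algebra and congruence modulo relations\<close>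

locale cstar_seminorm_loc =
  fixes p :: "'g free_star_algebra \<Rightarrow> real"
  assumes cstar_seminorm: "cstar_seminorm p"
begin

lemma nonneg [simp]: "0 \<le> p x"
  and add_le: "p (x + y) \<le> p x + p y"
  and scale: "p (free_scale c x) = cmod c * p x"
  and mult_le: "p (x * y) \<le> p x * p y"
  and star_mult: "p (free_star x * x) = (p x)\<^sup>2"
  using cstar_seminorm unfolding cstar_seminorm_def by blast+

lemma zero [simp]: "p 0 = 0"
  using scale[of 0 0] by simp

lemma minus [simp]: "p (- x) = p x"
  using scale[of "-1" x] by (simp add: free_scale_minus_one)

lemma diff_le: "p (x - y) \<le> p x + p y"
  using add_le[of x "- y"] by simp

lemma diff_commute: "p (x - y) = p (y - x)"
  using minus[of "x - y"] by simp

lemma le_add_diff: "p x \<le> p y + p (x - y)"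
  using add_le[of y "x - y"] by simp

lemma abs_diff_le: "\<bar>p x - p y\<bar> \<le> p (x - y)"
  using le_add_diff[of x y] le_add_diff[of y x] by (simp add: diff_commute[of y x])

lemma diff_trans: "p (x - z) \<le> p (x - y) + p (y - z)"
  using add_le[of "x - y" "y - z"] by simp

lemma sum_le: "p (\<Sum>i\<in>I. f i) \<le> (\<Sum>i\<in>I. p (f i))"
  by (induction I rule: infinite_finite_induct) (auto intro: order_trans[OF add_le])

text \<open>With y the adjoint of x, the C*-identity gives p(x)^2 <= p(y) p(x), hence p(x) <= p(y)
  after cancelling; the same for y yields equality.\<close>

lemma star [simp]: "p (free_star x) = p x"
proof -
  have le: "p x \<le> p (free_star x)" for x
  proof (cases "p x = 0")
    case False
    have "p x * p x \<le> p (free_star x) * p x"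
      using mult_le[of "free_star x" x] by (simp add: star_mult power2_eq_square)
    thus ?thesis using False nonneg[of x] by (simp add: mult_le_cancel_right)
  qed simp
  from le[of x] le[of "free_star x"] show ?thesis by simp
qed

lemma mult_star: "p (x * free_star x) = (p x)\<^sup>2"
  using star_mult[of "free_star x"] by simp

text \<open>By the C*-identity \<open>p 1\<close> is a root of s = s^2. The value 0 does occur, for
  the zero seminorm, so only an inequality can be claimed.\<close>

lemma one_le: "p 1 \<le> 1"
proof -
  have "p 1 = (p 1)\<^sup>2" using star_mult[of 1] by simp
  hence "p 1 = 0 \<or> p 1 = 1" by (simp add: power2_eq_square)
  thus ?thesis by auto
qed

lemma cong: "p (x - y) = 0 \<Longrightarrow> p x = p y"
  using abs_diff_le[of x y] by simp

lemma mult_cong: assumes "p (x - x') = 0" "p (y - y') = 0" shows "p (x * y - x' * y') = 0"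
proof -
  have "p (x * y - x' * y') = p ((x - x') * y + x' * (y - y'))" by (simp add: algebra_simps)
  also have "\<dots> \<le> p (x - x') * p y + p x' * p (y - y')"
    by (intro order_trans[OF add_le] add_mono mult_le)
  finally show ?thesis using assms nonneg[of "x * y - x' * y'"] by simp
qed

lemma power_le: "p (x ^ n) \<le> p x ^ n"
proof (induction n)
  case (Suc n)
  have "p (x ^ Suc n) \<le> p x * p (x ^ n)" by (simp add: mult_le)
  also have "\<dots> \<le> p x * p x ^ n" by (intro mult_left_mono Suc) simp
  finally show ?case by simp
qed (simp add: one_le)

text \<open>The C*-identity only squares, so exact powers come with exponents 2^k. Self-adjointness
  is asked for up to seminorm zero, because the polynomials in \<open>b * b'\<close> met later are
  self-adjoint only modulo the relations.\<close>

lemma power_two_power: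
  assumes "p (free_star x - x) = 0" shows "p (x ^ (2 ^ k)) = p x ^ (2 ^ k)"
proof -
  have sq: "p (y * y) = (p y)\<^sup>2" if "p (free_star y - y) = 0" for y
  proof -
    have "p (free_star y * y - y * y) = 0" by (rule mult_cong) (use that in simp_all)
    thus ?thesis using cong star_mult[of y] by metis
  qed
  have "p (free_star (x ^ (2 ^ k)) - x ^ (2 ^ k)) = 0 \<and> p (x ^ (2 ^ k)) = p x ^ (2 ^ k)"
  proof (induction k)
    case (Suc k)
    let ?y = "x ^ (2 ^ k)"
    have e: "x ^ (2 ^ Suc k) = ?y * ?y" by (simp add: mult_2 power_add)
    have "p (?y * ?y) = (p x ^ (2 ^ k))\<^sup>2" using Suc sq[of ?y] by simp
    moreover have "p (free_star (?y * ?y) - ?y * ?y) = 0"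
      unfolding free_star_mult by (rule mult_cong) (use Suc in simp_all)
    ultimately show ?case unfolding e by (simp add: power_mult mult_2 power_add power2_eq_square)
  qed (use assms in simp)
  thus ?thesis ..
qed

end

text \<open>Congruence modulo the common kernel of all admissible seminorms takes the place of the
  ideal generated by \<open>R\<close>. A computation then holds at once for an arbitrary seminorm
  and for the operator norm, and the adjoints of the relations come for free.\<close>

definition rel_cong :: "'g free_star_algebra set \<Rightarrow> 'g free_star_algebra \<Rightarrow> 'g free_star_algebra \<Rightarrow>
    bool"
  where "rel_cong R x y \<longleftrightarrow> (\<forall>p. cstar_seminorm p \<and> (\<forall>r\<in>R. p r = 0) \<longrightarrow> p (x - y) = 0)"

lemma rel_congI:
  "(\<And>p. cstar_seminorm_loc p \<Longrightarrow> (\<And>r. r \<in> R \<Longrightarrow> p r = 0) \<Longrightarrow> p (x - y) = 0) \<Longrightarrow> rel_cong R x y"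
  by (simp add: rel_cong_def cstar_seminorm_loc_def)

lemma rel_congD:
  "rel_cong R x y \<Longrightarrow> cstar_seminorm_loc p \<Longrightarrow> (\<And>r. r \<in> R \<Longrightarrow> p r = 0) \<Longrightarrow> p (x - y) = 0"
  by (auto simp: rel_cong_def cstar_seminorm_loc_def)

lemma rel_cong_relation: "x - y \<in> R \<Longrightarrow> rel_cong R x y"
  by (rule rel_congI) simp

lemma rel_cong_refl [simp]: "rel_cong R x x"
  by (rule rel_congI) (simp add: cstar_seminorm_loc.zero)

lemma rel_cong_sym: "rel_cong R x y \<Longrightarrow> rel_cong R y x"
  by (rule rel_congI) (metis cstar_seminorm_loc.diff_commute rel_congD)

lemma rel_cong_trans [trans]:
  assumes "rel_cong R x y" "rel_cong R y z" shows "rel_cong R x z"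
proof (rule rel_congI)
  fix p assume p: "cstar_seminorm_loc p" "\<And>r. r \<in> R \<Longrightarrow> p r = 0"
  have "p (x - z) \<le> p (x - y) + p (y - z)" by (rule cstar_seminorm_loc.diff_trans[OF p(1)])
  thus "p (x - z) = 0"
    using rel_congD[OF assms(1) p] rel_congD[OF assms(2) p] cstar_seminorm_loc.nonneg[OF p(1), of
        "x - z"]
    by simp
qed

lemma rel_cong_mult:
  "rel_cong R x x' \<Longrightarrow> rel_cong R y y' \<Longrightarrow> rel_cong R (x * y) (x' * y')"
  by (rule rel_congI) (auto intro: cstar_seminorm_loc.mult_cong dest: rel_congD)

lemma rel_cong_add:
  assumes "rel_cong R x x'" "rel_cong R y y'" shows "rel_cong R (x + y) (x' + y')"
proof (rule rel_congI)
  fix p assume p: "cstar_seminorm_loc p" "\<And>r. r \<in> R \<Longrightarrow> p r = 0"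
  have "p (x + y - (x' + y')) \<le> p (x - x') + p (y - y')"
    using cstar_seminorm_loc.add_le[OF p(1), of "x - x'" "y - y'"] by (simp add: algebra_simps)
  thus "p (x + y - (x' + y')) = 0"
    using rel_congD[OF assms(1) p] rel_congD[OF assms(2) p]
      cstar_seminorm_loc.nonneg[OF p(1), of "x + y - (x' + y')"] by simp
qed

lemma rel_cong_scale: "rel_cong R x y \<Longrightarrow> rel_cong R (free_scale c x) (free_scale c y)"
  by (rule rel_congI) (simp flip: free_scale_diff_right add: cstar_seminorm_loc.scale rel_congD)

lemma rel_cong_minus: "rel_cong R x y \<Longrightarrow> rel_cong R (- x) (- y)"
  using rel_cong_scale[of R x y "-1"] by (simp add: free_scale_minus_one)

lemma rel_cong_diff: "rel_cong R x x' \<Longrightarrow> rel_cong R y y' \<Longrightarrow> rel_cong R (x - y) (x' - y')"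
  using rel_cong_add[of R x x' "- y" "- y'"] rel_cong_minus[of R y y'] by simp

lemma rel_cong_star: "rel_cong R x y \<Longrightarrow> rel_cong R (free_star x) (free_star y)"
  by (rule rel_congI) (simp flip: free_star_diff add: cstar_seminorm_loc.star rel_congD)

lemma rel_cong_mult_left: "rel_cong R x y \<Longrightarrow> rel_cong R (z * x) (z * y)"
  and rel_cong_mult_right: "rel_cong R x y \<Longrightarrow> rel_cong R (x * z) (y * z)"
  by (simp_all add: rel_cong_mult)

lemma rel_cong_sum:
  "(\<And>i. i \<in> I \<Longrightarrow> rel_cong R (f i) (g i)) \<Longrightarrow> rel_cong R (\<Sum>i\<in>I. f i) (\<Sum>i\<in>I. g i)"
  by (induction I rule: infinite_finite_induct) (auto intro: rel_cong_add)

section \<open>Polynomials in an element of the free algebra\<close>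

text \<open>\<open>poly\<close> evaluates at an argument of the coefficient type; here complex
  coefficients meet an element of a noncommutative algebra on which they act through
  \<open>free_scale\<close>.\<close>

definition free_poly :: "'g free_star_algebra \<Rightarrow> complex poly \<Rightarrow> 'g free_star_algebra"
  where "free_poly x f = (\<Sum>i\<le>degree f. free_scale (coeff f i) (x ^ i))"

lemma free_poly_eq_sum:
  "degree f \<le> n \<Longrightarrow> free_poly x f = (\<Sum>i\<le>n. free_scale (coeff f i) (x ^ i))"
  unfolding free_poly_def by (rule sum.mono_neutral_left) (auto simp: coeff_eq_0)

lemma free_poly_zero [simp]: "free_poly x 0 = 0"
  by (simp add: free_poly_def)

lemma free_poly_pCons: "free_poly x (pCons c f) = free_scale c 1 + x * free_poly x f"
proof -
  have "free_poly x (pCons c f) = (\<Sum>i\<le>Suc (degree f). free_scale (coeff (pCons c f) i) (x ^ i))"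
    by (rule free_poly_eq_sum) (simp add: degree_pCons_le)
  also have "\<dots> = free_scale c 1 + (\<Sum>i\<le>degree f. x * free_scale (coeff f i) (x ^ i))"
    by (simp add: sum.atMost_Suc_shift del: sum.atMost_Suc)
  finally show ?thesis by (simp add: free_poly_def sum_distrib_left)
qed

lemma free_poly_const [simp]: "free_poly x [:c:] = free_scale c 1"
  by (simp add: free_poly_pCons)

lemma free_poly_one [simp]: "free_poly x 1 = 1"
  using free_poly_const[of x 1] by (simp add: one_pCons)

lemma free_poly_add: "free_poly x (f + g) = free_poly x f + free_poly x g"
proof -
  let ?n = "max (degree f) (degree g)"
  have "degree (f + g) \<le> ?n" by (rule degree_add_le_max)
  thus ?thesis
    using free_poly_eq_sum[of f ?n x] free_poly_eq_sum[of g ?n x] free_poly_eq_sum[of "f + g" ?n x]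
    by (simp add: free_scale_add_left sum.distrib)
qed

lemma free_poly_smult: "free_poly x (smult c f) = free_scale c (free_poly x f)"
  by (induction f) (simp_all add: free_poly_pCons free_scale_add_right)

lemma free_poly_mult: "free_poly x (f * g) = free_poly x f * free_poly x g"
  by (induction f) (simp_all add: free_poly_pCons free_poly_add free_poly_smult distrib_right
      mult.assoc)

lemma free_poly_power: "free_poly x (f ^ n) = free_poly x f ^ n"
  by (induction n) (simp_all add: free_poly_mult)



text \<open>The scalar stays existential: the normal form only requires that letters can change
  places, so powers of q and phases need not be tracked.\<close>

definition qcomm :: "'g free_star_algebra set \<Rightarrow> 'g free_star_algebra \<Rightarrow> 'g free_star_algebra \<Rightarrow> bool"
  where "qcomm R x y \<longleftrightarrow> (\<exists>c. c \<noteq> 0 \<and> rel_cong R (x * y) (free_scale c (y * x)))"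

lemma qcommI: "rel_cong R (x * y) (free_scale c (y * x)) \<Longrightarrow> c \<noteq> 0 \<Longrightarrow> qcomm R x y"
  by (auto simp: qcomm_def)

lemma qcomm_sym: assumes "qcomm R x y" shows "qcomm R y x"
proof -
  from assms obtain c where c: "c \<noteq> 0" "rel_cong R (x * y) (free_scale c (y * x))"
    by (auto simp: qcomm_def)
  from rel_cong_sym[OF rel_cong_scale[OF c(2), of "inverse c"]] c(1)
  have "rel_cong R (y * x) (free_scale (inverse c) (x * y))" by simp
  thus ?thesis by (rule qcommI) (simp add: c)
qed

lemma qcomm_star: assumes "qcomm R x y" shows "qcomm R (free_star x) (free_star y)"
proof -
  from assms obtain c where c: "c \<noteq> 0" "rel_cong R (x * y) (free_scale c (y * x))"
    by (auto simp: qcomm_def)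
  from rel_cong_star[OF c(2)]
  have "qcomm R (free_star y) (free_star x)"
    by (intro qcommI[of _ _ _ "cnj c"]) (simp_all add: free_star_mult free_star_scale c)
  thus ?thesis by (rule qcomm_sym)
qed

lemma qcomm_one: "qcomm R x 1"
  by (rule qcommI[of _ _ _ 1]) simp_all

lemma qcomm_mult: assumes "qcomm R x y" "qcomm R x z" shows "qcomm R x (y * z)"
proof -
  from assms obtain c d where c: "c \<noteq> 0" "rel_cong R (x * y) (free_scale c (y * x))"
    and d: "d \<noteq> 0" "rel_cong R (x * z) (free_scale d (z * x))"
    by (auto simp: qcomm_def)
  have "rel_cong R (x * y * z) (free_scale c (y * x) * z)"
    by (rule rel_cong_mult_right[OF c(2)])
  also have "free_scale c (y * x) * z = free_scale c (y * (x * z))" by (simp add: mult.assoc)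
  also have "rel_cong R \<dots> (free_scale c (y * free_scale d (z * x)))"
    by (intro rel_cong_scale rel_cong_mult_left d)
  also have "free_scale c (y * free_scale d (z * x)) = free_scale (c * d) (y * z * x)"
      by (simp only: mult.assoc free_scale_mult_right free_scale_scale)
  finally have "rel_cong R (x * (y * z)) (free_scale (c * d) (y * z * x))"
      by (simp only: mult.assoc)
  thus ?thesis by (rule qcommI) (simp add: c d)
qed

lemma qcomm_power: "qcomm R x y \<Longrightarrow> qcomm R x (y ^ n)"
  by (induction n) (simp_all add: qcomm_one qcomm_mult)

text \<open>Multiplying u y = c y u by v from both sides gives y v = c v y. This supplies the
  commutation of the adjoint of D with the other generators, which is not among the
  relations.\<close>

lemma qcomm_unitary:
  assumes "qcomm R u y" "rel_cong R (u * v) 1" "rel_cong R (v * u) 1"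
  shows "qcomm R v y"
proof -
  from assms(1) obtain c where c: "c \<noteq> 0" "rel_cong R (u * y) (free_scale c (y * u))"
    by (auto simp: qcomm_def)
  have "rel_cong R (1 * (y * v)) ((v * u) * (y * v))"
    by (rule rel_cong_mult_right[OF rel_cong_sym[OF assms(3)]])
  also have "(v * u) * (y * v) = v * (u * y) * v" by (simp add: mult.assoc)
  also have "rel_cong R \<dots> (v * free_scale c (y * u) * v)"
    by (intro rel_cong_mult_right rel_cong_mult_left c)
  also have "\<dots> = free_scale c (v * y * (u * v))" by (simp add: mult.assoc)
  also have "rel_cong R \<dots> (free_scale c (v * y * 1))"
    by (intro rel_cong_scale rel_cong_mult_left assms)
  finally have "qcomm R y v" by (intro qcommI[of _ _ _ c]) (simp_all add: c)
  thus ?thesis by (rule qcomm_sym)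
qed

text \<open>Each factor x contributes one scalar c when it passes y, so f(x) becomes f(c x);
  \<open>[:0, c:]\<close> is the polynomial c X.\<close>

lemma free_poly_rel_commute:
  assumes "rel_cong R (x * y) (free_scale c (y * x))"
  shows "rel_cong R (free_poly x f * y) (y * free_poly x (pcompose f [:0, c:]))"
proof (induction f)
  case (pCons d f)
  let ?f = "pcompose f [:0, c:]"
  have "free_poly x (pCons d f) * y = free_scale d y + x * (free_poly x f * y)"
    by (simp add: free_poly_pCons distrib_right mult.assoc)
  also have "rel_cong R \<dots> (free_scale d y + x * (y * free_poly x ?f))"
    by (intro rel_cong_add rel_cong_mult_left pCons rel_cong_refl)
  also have "x * (y * free_poly x ?f) = (x * y) * free_poly x ?f" by (simp add: mult.assoc)
  also have "rel_cong R (free_scale d y + \<dots>) (free_scale d y + free_scale c (y * x) * free_poly x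
      ?f)"
    by (intro rel_cong_add rel_cong_mult_right assms rel_cong_refl)
  also have "\<dots> = y * free_poly x (pcompose (pCons d f) [:0, c:])"
    by (simp add: pcompose_pCons free_poly_add free_poly_pCons free_poly_smult distrib_left
        mult.assoc)
  finally show ?case .
qed simp

lemma qcomm_free_poly:
  assumes "qcomm R x y"
  obtains g where "rel_cong R (free_poly x f * y) (y * free_poly x g)"
  using assms free_poly_rel_commute unfolding qcomm_def by blast

section \<open>The relations of \<open>U_q(2)\<close>\<close>

text \<open>Integer powers with x' standing in for an inverse of x. For a and its adjoint it is no
  inverse, so exponents add only up to a polynomial in \<open>b * b'\<close>.\<close>

definition zpow :: "'a::monoid_mult \<Rightarrow> 'a \<Rightarrow> int \<Rightarrow> 'a"
  where "zpow x x' n = (if 0 \<le> n then x ^ nat n else x' ^ nat (- n))"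

lemma zpow_minus: "zpow x' x (- n) = zpow x x' n"
  by (simp add: zpow_def)

lemma qcomm_zpow: "qcomm R y x \<Longrightarrow> qcomm R y x' \<Longrightarrow> qcomm R y (zpow x x' n)"
  by (simp add: zpow_def qcomm_power)

text \<open>For n >= 0 the power simply grows. For n < 0 the new x meets an x', their product is a
  polynomial in y by hypothesis, and this polynomial passes the remaining power of x' to the
  right.\<close>

lemma zpow_step:
  assumes "qcomm R y x'" and xx': "rel_cong R (x * x') (free_poly y g)"
  obtains f where "rel_cong R (x * zpow x x' n) (zpow x x' (n + 1) * free_poly y f)"
proof (cases "n \<ge> 0")
  case True
  hence "nat (n + 1) = Suc (nat n)" by simp
  with True have "x * zpow x x' n = zpow x x' (n + 1) * free_poly y 1"
    by (simp add: zpow_def)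
  thus thesis using that by (metis rel_cong_refl)
next
  case False
  define k where "k = nat (- n - 1)"
  have k: "nat (- n) = Suc k" using False by (simp add: k_def)
  have z: "zpow x x' (n + 1) = x' ^ k"
    using False by (cases "n = - 1") (auto simp: zpow_def k_def)
  obtain f where f: "rel_cong R (free_poly y g * x' ^ k) (x' ^ k * free_poly y f)"
    using qcomm_free_poly[OF qcomm_power[OF assms(1)]] by blast
  have "x * zpow x x' n = x * x' * x' ^ k" using False k by (simp add: zpow_def mult.assoc)
  also have "rel_cong R \<dots> (free_poly y g * x' ^ k)" by (intro rel_cong_mult_right xx')
  also note f
  finally show thesis using that z by simp
qed

text \<open>The grading by Z^3 for which all relations are homogeneous. It gives the weights of the
  torus action, and in the representation a word of degree \<alpha> moves basis indices by
  \<alpha>.\<close>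

fun letter_deg :: "uq2_generator \<times> bool \<Rightarrow> int \<times> int \<times> int" where
  "letter_deg (GenA, s) = (if s then - 1 else 1, 0, 0)"
| "letter_deg (GenB, s) = (0, if s then - 1 else 1, 0)"
| "letter_deg (GenD, s) = (0, 0, if s then - 1 else 1)"

definition word_deg :: "uq2_generator star_word \<Rightarrow> int \<times> int \<times> int"
  where "word_deg w = sum_list (map letter_deg (letters w))"

lemma letter_deg_star: "letter_deg (g, \<not> s) = - letter_deg (g, s)"
  by (cases g) (auto simp: zero_prod_def)

lemma word_deg_Nil [simp]: "word_deg (Star_Word []) = 0"
  and word_deg_Cons [simp]: "word_deg (Star_Word (l # ls)) = letter_deg l + word_deg (Star_Word ls)"
  by (simp_all add: word_deg_def)

lemma word_deg_plus: "word_deg (v + w) = word_deg v + word_deg w"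
  by (simp add: word_deg_def plus_star_word_def)

lemma word_deg_star: "word_deg (word_star w) = - word_deg w"
proof -
  have "sum_list (map letter_deg (rev (map (\<lambda>(g, s). (g, \<not> s)) ls))) = - sum_list (map letter_deg
      ls)" for ls
    by (induction ls) (auto simp: letter_deg_star)
  thus ?thesis by (simp add: word_deg_def word_star_def)
qed

section \<open>Normal forms modulo the relations of U_q(2)\<close>

locale uq2 =
  fixes q :: complex
  assumes q_pos: "0 < cmod q" and q_less: "cmod q < 1"
begin

abbreviation R where "R \<equiv> uq2_relations q"
abbreviation cong (infix "\<doteq>" 50) where "x \<doteq> y \<equiv> rel_cong R x y"
abbreviation a where "a \<equiv> free_letter (GenA, False)"
abbreviation a' where "a' \<equiv> free_letter (GenA, True)"
abbreviation b where "b \<equiv> free_letter (GenB, False)"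
abbreviation b' where "b' \<equiv> free_letter (GenB, True)"
abbreviation d where "d \<equiv> free_letter (GenD, False)"
abbreviation d' where "d' \<equiv> free_letter (GenD, True)"
abbreviation bb where "bb \<equiv> b * b'"

definition t :: real where "t = (cmod q)\<^sup>2"

lemma t_pos: "0 < t" and t_less: "t < 1"
  using q_pos q_less by (auto simp: t_def power_less_one_iff)

lemma q_nonzero: "q \<noteq> 0" using q_pos by auto

lemma q_cnj: "q * cnj q = complex_of_real t" "cnj q * q = complex_of_real t"
  by (simp_all add: t_def complex_norm_square mult.commute del: of_real_power)

lemma rel:
  shows rel_ba: "b * a \<doteq> free_scale q (a * b)"
    and rel_a'b: "a' * b \<doteq> free_scale q (b * a')"
    and rel_bb': "b * b' \<doteq> b' * b"
    and rel_aa': "a * a' \<doteq> 1 - bb"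
    and rel_ad: "a * d \<doteq> d * a"
    and rel_bd: "b * d \<doteq> free_scale (q\<^sup>2 / complex_of_real t) (d * b)"
    and rel_dd': "d * d' \<doteq> 1"
    and rel_d'd: "d' * d \<doteq> 1"
    and rel_a'a: "a' * a \<doteq> 1 - free_scale (complex_of_real t) bb"
proof -
  note r = uq2_relations_def Let_def free_gen_eq_letter free_star_letter t_def
  show "b * a \<doteq> free_scale q (a * b)" "a' * b \<doteq> free_scale q (b * a')" "a * d \<doteq> d * a"
    "b * d \<doteq> free_scale (q\<^sup>2 / complex_of_real t) (d * b)" "d * d' \<doteq> 1" "d' * d \<doteq> 1"
    "a * a' \<doteq> 1 - bb"
    by (rule rel_cong_relation; simp add: r algebra_simps)+
  show bb: "b * b' \<doteq> b' * b" by (rule rel_cong_relation) (simp add: r)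
  have "a' * a \<doteq> 1 - free_scale (complex_of_real t) (b' * b)"
    by (rule rel_cong_relation) (simp add: r algebra_simps)
  also have "1 - free_scale (complex_of_real t) (b' * b) \<doteq> 1 - free_scale (complex_of_real t) bb"
    by (intro rel_cong_diff rel_cong_scale rel_cong_sym[OF bb] rel_cong_refl)
  finally show "a' * a \<doteq> 1 - free_scale (complex_of_real t) bb" .
qed

lemma qcomm_ab: "qcomm R b a" "qcomm R b a'" "qcomm R b' a" "qcomm R b' a'"
proof -
  show 1: "qcomm R b a" by (rule qcommI[OF rel_ba q_nonzero])
  show 2: "qcomm R b a'" by (rule qcomm_sym, rule qcommI[OF rel_a'b q_nonzero])
  show "qcomm R b' a'" "qcomm R b' a" using qcomm_star[OF 1] qcomm_star[OF 2]
      by (simp_all add: free_star_letter)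
qed

lemma qcomm_d:
  assumes "qcomm R d (free_letter (g, s))" shows "qcomm R d' (free_letter (g, s))" "qcomm R d
      (free_letter (g, \<not> s))"
    "qcomm R d' (free_letter (g, \<not> s))"
proof -
  show 1: "qcomm R d' (free_letter (g, s))" by (rule qcomm_unitary[OF assms rel_dd' rel_d'd])
  show "qcomm R d (free_letter (g, \<not> s))" "qcomm R d' (free_letter (g, \<not> s))"
    using qcomm_star[OF 1] qcomm_star[OF assms] by (simp_all add: free_star_letter)
qed

lemma qcomm_da: "qcomm R d a" "qcomm R d' a" "qcomm R d a'" "qcomm R d' a'"
proof -
  show 1: "qcomm R d a"
    by (rule qcomm_sym, rule qcommI[of _ _ _ 1]) (use rel_ad in simp_all)
  show "qcomm R d' a" "qcomm R d a'" "qcomm R d' a'" using qcomm_d[OF 1] by simp_all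
qed

lemma qcomm_db: "qcomm R d b" "qcomm R d' b" "qcomm R d b'" "qcomm R d' b'"
proof -
  show 1: "qcomm R d b"
    by (rule qcomm_sym, rule qcommI[OF rel_bd]) (use q_nonzero t_pos in simp)
  show "qcomm R d' b" "qcomm R d b'" "qcomm R d' b'" using qcomm_d[OF 1] by simp_all
qed

text \<open>Each letter commutes up to a scalar with b and with its adjoint separately. This is why
  polynomials in \<open>b * b'\<close> can be collected at the right end of a word.\<close>

lemma qcomm_X: "qcomm R bb (free_letter l)"
proof -
  have bb': "qcomm R b b'" by (rule qcommI[of _ _ _ 1]) (use rel_bb' in simp_all)
  have self: "qcomm R x x" for x :: "uq2_generator free_star_algebra"
    by (rule qcommI[of _ _ _ 1]) simp_all
  obtain g s where l: "l = (g, s)" by (cases l)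
  have "qcomm R (free_letter l) b" "qcomm R (free_letter l) b'"
    unfolding l
    by (cases g; cases s; simp add: qcomm_sym[OF qcomm_ab(1)] qcomm_sym[OF qcomm_ab(2)]
        qcomm_sym[OF qcomm_ab(3)]
        qcomm_sym[OF qcomm_ab(4)] qcomm_db self bb' qcomm_sym[OF bb'])+
  hence "qcomm R (free_letter l) bb" by (rule qcomm_mult)
  thus ?thesis by (rule qcomm_sym)
qed

text \<open>The factors q and \<open>cnj q\<close> picked up from b and its adjoint combine to
  |q|^2: the phase of q cancels and the real number \<open>t\<close> is left. This relation drives
  the estimates for polynomials in \<open>b * b'\<close>.\<close>

lemma rel_Xa: "bb * a \<doteq> free_scale (complex_of_real t) (a * bb)"
proof -
  have b'a: "b' * a \<doteq> free_scale (cnj q) (a * b')"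
    using rel_cong_star[OF rel_a'b] by (simp add: free_star_mult free_star_scale free_star_letter)
  have "bb * a = b * (b' * a)" by (simp add: mult.assoc)
  also have "\<dots> \<doteq> b * free_scale (cnj q) (a * b')" by (intro rel_cong_mult_left b'a)
  also have "\<dots> = free_scale (cnj q) ((b * a) * b')" by (simp add: mult.assoc)
  also have "\<dots> \<doteq> free_scale (cnj q) (free_scale q (a * b) * b')"
    by (intro rel_cong_scale rel_cong_mult_right rel_ba)
  also have "\<dots> = free_scale (complex_of_real t) (a * bb)" by (simp add: mult.assoc q_cnj)
  finally show ?thesis .
qed

fun monomial :: "int \<times> int \<times> int \<Rightarrow> uq2_generator free_star_algebra" where
  "monomial (n, m, l) = zpow a a' n * zpow b b' m * zpow d d' l"

text \<open>The degree fixes the monomial, so that all freedom within one degree sits in a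
  polynomial factor on the right.\<close>

definition nform :: "int \<times> int \<times> int \<Rightarrow> uq2_generator free_star_algebra \<Rightarrow> bool"
  where "nform \<alpha> z \<longleftrightarrow> (\<exists>f. z \<doteq> monomial \<alpha> * free_poly bb f)"

lemma nform_poly_right: assumes "z \<doteq> monomial \<alpha> * free_poly bb g * free_poly bb f" shows "nform \<alpha> z"
  unfolding nform_def by (rule exI[of _ "g * f"]) (use assms in \<open>simp add: free_poly_mult
      mult.assoc\<close>)

lemma nform_scale:
  assumes "z \<doteq> free_scale c y" "nform \<alpha> y" shows "nform \<alpha> z"
proof -
  from assms(2) obtain f where "y \<doteq> monomial \<alpha> * free_poly bb f" by (auto simp: nform_def)
  from rel_cong_trans[OF assms(1) rel_cong_scale[OF this]]
  have "z \<doteq> monomial \<alpha> * free_poly bb (smult c f)" by (simp add: free_poly_smult)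
  thus ?thesis by (auto simp: nform_def)
qed

lemma qcomm_X_zpow: "qcomm R bb (zpow a a' n)" "qcomm R bb (zpow b b' n)" "qcomm R bb (zpow d d' n)"
  by (intro qcomm_zpow qcomm_X)+

text \<open>A letter times its adjoint must be a polynomial in x = b b' in both orders: 1 - x and 1
  - t x for a, x for b, and 1 for D. A starred letter is handled by exchanging the two arguments of
  \<open>zpow\<close> and the sign of n.\<close>

lemma letter_zpow:
  obtains f g h where
    "free_letter (GenA, s) * zpow a a' n \<doteq> zpow a a' (n + (if s then - 1 else 1)) * free_poly bb f"
    "free_letter (GenB, s) * zpow b b' n \<doteq> zpow b b' (n + (if s then - 1 else 1)) * free_poly bb g"
    "free_letter (GenD, s) * zpow d d' n \<doteq> zpow d d' (n + (if s then - 1 else 1)) * free_poly bb h"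
proof -
  have key: "\<exists>f. free_letter (g, s) * zpow (free_letter (g, False)) (free_letter (g, True)) n
      \<doteq> zpow (free_letter (g, False)) (free_letter (g, True)) (n + (if s then - 1 else 1)) *
          free_poly bb f"
    if f1: "free_letter (g, False) * free_letter (g, True) \<doteq> free_poly bb f1"
      and f2: "free_letter (g, True) * free_letter (g, False) \<doteq> free_poly bb f2" for g f1 f2
  proof (cases s)
    case True
    let ?x = "free_letter (g, False)" and ?x' = "free_letter (g, True)"
    obtain f where "?x' * zpow ?x' ?x (- n) \<doteq> zpow ?x' ?x (- n + 1) * free_poly bb f"
      using zpow_step[OF qcomm_X f2] by blast
    moreover have "- n + 1 = - (n - 1)" by simp
    ultimately have "?x' * zpow ?x ?x' n \<doteq> zpow ?x ?x' (n - 1) * free_poly bb f"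
      by (simp only: zpow_minus)
    thus ?thesis using True by auto
  next
    case False
    obtain f where "free_letter (g, False) * zpow (free_letter (g, False)) (free_letter (g, True))
        n \<doteq> zpow (free_letter (g, False)) (free_letter (g, True)) (n + 1) * free_poly bb f"
      using zpow_step[OF qcomm_X f1] by blast
    thus ?thesis using False by auto
  qed
  have bb: "free_poly bb [:0, 1:] = bb" "free_poly bb [:1, -1:] = 1 - bb"
    "free_poly bb [:1, - complex_of_real t:] = 1 - free_scale (complex_of_real t) bb"
    using free_scale_minus_one[of "b * (b' * 1)"]
    by (simp_all add: free_poly_pCons free_scale_minus_one)
      (metis add_uminus_conv_diff free_scale_minus_one free_scale_scale mult_minus1)
  have b'b: "b' * b \<doteq> bb" by (rule rel_cong_sym[OF rel_bb'])
  show thesis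
    using key[of GenA "[:1, -1:]" "[:1, - complex_of_real t:]"] key[of GenB "[:0, 1:]" "[:0, 1:]"]
      key[of GenD 1 1] that
    by (auto simp: bb rel_aa' rel_a'a rel_dd' rel_d'd b'b)
qed

lemma qcomm_pass:
  assumes "qcomm R x y" obtains c where "x * y \<doteq> free_scale c (y * x)"
  using assms by (auto simp: qcomm_def)

text \<open>The letter passes the blocks in front of its own at the cost of a scalar and merges with
  its own block at the cost of a polynomial in \<open>b * b'\<close>, which then passes the blocks
  behind and joins f.\<close>

lemma nform_letter:
  assumes "nform \<alpha> z" shows "nform (letter_deg l + \<alpha>) (free_letter l * z)"
proof -
  obtain n m k where \<alpha>: "\<alpha> = (n, m, k)" by (cases \<alpha>) auto
  obtain g s where l: "l = (g, s)" by (cases l)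
  let ?A = "zpow a a'" and ?B = "zpow b b'" and ?D = "zpow d d'"
  define e :: int where "e = (if s then - 1 else 1)"
  let ?L = "free_letter (g, s)"
  from assms obtain f where z: "z \<doteq> ?A n * ?B m * ?D k * free_poly bb f" by (auto simp: nform_def \<alpha>)
  have Lz: "?L * z \<doteq> ?L * (?A n * ?B m * ?D k * free_poly bb f)" by (rule rel_cong_mult_left[OF z])

  show ?thesis
  proof (cases g)
    case GenA
    obtain h where h: "?L * ?A n \<doteq> ?A (n + e) * free_poly bb h"
      using letter_zpow[of s n] GenA unfolding e_def by metis
    obtain h' where h': "free_poly bb h * (?B m * ?D k) \<doteq> (?B m * ?D k) * free_poly bb h'"
      using qcomm_free_poly[OF qcomm_mult[OF qcomm_X_zpow(2,3)]] by blast
    note Lz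
    also have "?L * (?A n * ?B m * ?D k * free_poly bb f) = (?L * ?A n) * ((?B m * ?D k) *
        free_poly bb f)"
      by (simp add: mult.assoc)
    also have "\<dots> \<doteq> (?A (n + e) * free_poly bb h) * ((?B m * ?D k) * free_poly bb f)"
      by (intro rel_cong_mult_right h)
    also have "\<dots> = ?A (n + e) * (free_poly bb h * (?B m * ?D k)) * free_poly bb f"
        by (simp add: mult.assoc)
    also have "\<dots> \<doteq> ?A (n + e) * ((?B m * ?D k) * free_poly bb h') * free_poly bb f"
      by (intro rel_cong_mult_right rel_cong_mult_left h')
    also have "\<dots> = monomial (letter_deg l + \<alpha>) * free_poly bb h' * free_poly bb f"
      by (simp add: mult.assoc l GenA \<alpha> e_def add.commute)
    finally show ?thesis unfolding l by (rule nform_poly_right[unfolded l])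
  next
    case GenB
    obtain h where h: "?L * ?B m \<doteq> ?B (m + e) * free_poly bb h"
      using letter_zpow[of s m] GenB unfolding e_def by metis
    obtain h' where h': "free_poly bb h * ?D k \<doteq> ?D k * free_poly bb h'"
      using qcomm_free_poly[OF qcomm_X_zpow(3)] by blast
    have "qcomm R ?L (?A n)" unfolding GenB by (cases s) (simp_all add: qcomm_zpow qcomm_ab)
    then obtain c where c: "?L * ?A n \<doteq> free_scale c (?A n * ?L)" by (rule qcomm_pass)
    note Lz
    also have "?L * (?A n * ?B m * ?D k * free_poly bb f) = (?L * ?A n) * ((?B m * ?D k) *
        free_poly bb f)"
      by (simp add: mult.assoc)
    also have "\<dots> \<doteq> free_scale c (?A n * ?L) * ((?B m * ?D k) * free_poly bb f)"
      by (intro rel_cong_mult_right c)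
    also have "\<dots> = free_scale c (?A n * (?L * ?B m) * (?D k * free_poly bb f))"
        by (simp add: mult.assoc)
    finally show ?thesis unfolding l
    proof (rule nform_scale)
      have "?A n * (?L * ?B m) * (?D k * free_poly bb f)
          \<doteq> ?A n * (?B (m + e) * free_poly bb h) * (?D k * free_poly bb f)"
        by (intro rel_cong_mult_right rel_cong_mult_left h)
      also have "\<dots> = ?A n * ?B (m + e) * (free_poly bb h * ?D k) * free_poly bb f"
          by (simp add: mult.assoc)
      also have "\<dots> \<doteq> ?A n * ?B (m + e) * (?D k * free_poly bb h') * free_poly bb f"
        by (intro rel_cong_mult_right rel_cong_mult_left h')
      also have "\<dots> = monomial (letter_deg (g, s) + \<alpha>) * free_poly bb h' * free_poly bb f"
        by (simp add: mult.assoc GenB \<alpha> e_def add.commute)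
      finally show "nform (letter_deg (g, s) + \<alpha>) (?A n * (?L * ?B m) * (?D k * free_poly bb f))"
        by (rule nform_poly_right)
    qed
  next
    case GenD
    obtain h where h: "?L * ?D k \<doteq> ?D (k + e) * free_poly bb h"
      using letter_zpow[of s k] GenD unfolding e_def by metis
    have "qcomm R ?L (?A n * ?B m)"
      unfolding GenD by (rule qcomm_mult; cases s; simp add: qcomm_zpow qcomm_da qcomm_db)
    then obtain c where c: "?L * (?A n * ?B m) \<doteq> free_scale c (?A n * ?B m * ?L)"
      by (rule qcomm_pass)
    note Lz
    also have "?L * (?A n * ?B m * ?D k * free_poly bb f) = (?L * (?A n * ?B m)) * (?D k *
        free_poly bb f)"
      by (simp add: mult.assoc)
    also have "\<dots> \<doteq> free_scale c (?A n * ?B m * ?L) * (?D k * free_poly bb f)"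
      by (intro rel_cong_mult_right c)
    also have "\<dots> = free_scale c (?A n * ?B m * (?L * ?D k) * free_poly bb f)"
        by (simp add: mult.assoc)
    finally show ?thesis unfolding l
    proof (rule nform_scale)
      have "?A n * ?B m * (?L * ?D k) * free_poly bb f
          \<doteq> ?A n * ?B m * (?D (k + e) * free_poly bb h) * free_poly bb f"
        by (intro rel_cong_mult_right rel_cong_mult_left h)
      also have "\<dots> = monomial (letter_deg (g, s) + \<alpha>) * free_poly bb h * free_poly bb f"
        by (simp add: mult.assoc GenD \<alpha> e_def add.commute)
      finally show "nform (letter_deg (g, s) + \<alpha>) (?A n * ?B m * (?L * ?D k) * free_poly bb f)"
        by (rule nform_poly_right)
    qed
  qed
qed

lemma nform_word: "nform (word_deg w) (Poly_Mapping.single w 1)"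
proof -
  have "nform (word_deg (Star_Word ls)) (Poly_Mapping.single (Star_Word ls) 1)" for ls
  proof (induction ls)
    case Nil
    have "(1 :: uq2_generator free_star_algebra) \<doteq> monomial 0 * free_poly bb 1"
      by (simp add: zpow_def zero_prod_def)
    hence "nform 0 1" unfolding nform_def by blast
    thus ?case by (simp add: single_Star_Word_Nil)
  next
    case (Cons l ls)
    show ?case using nform_letter[OF Cons, of l] by (simp only: single_Star_Word_Cons word_deg_Cons)
  qed
  thus ?thesis by (metis star_word.collapse)
qed

text \<open>The monomial of degree 0 is 1, so the normal form of each word is its polynomial factor
  alone.\<close>

lemma degree_zero_poly:
  assumes "\<And>w. w \<in> Poly_Mapping.keys z \<Longrightarrow> word_deg w = 0"
  obtains f where "z \<doteq> free_poly bb f"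
proof -
  have "\<exists>f. Poly_Mapping.single w 1 \<doteq> free_poly bb f" if "w \<in> Poly_Mapping.keys z" for w
    using nform_word[of w] assms[OF that] by (simp add: nform_def zpow_def zero_prod_def)
  then obtain f where f: "\<And>w. w \<in> Poly_Mapping.keys z
    \<Longrightarrow> Poly_Mapping.single w 1 \<doteq> free_poly bb (f w)"
    by metis
  let ?F = "\<lambda>w. smult (Poly_Mapping.lookup z w) (f w)"
  have "(\<Sum>w\<in>Poly_Mapping.keys z. Poly_Mapping.single w (Poly_Mapping.lookup z w))
      \<doteq> (\<Sum>w\<in>Poly_Mapping.keys z. free_poly bb (?F w))"
    by (intro rel_cong_sum, subst single_eq_free_scale) (simp add: free_poly_smult rel_cong_scale f)
  moreover have "(\<Sum>w\<in>W. free_poly bb (?F w)) = free_poly bb (\<Sum>w\<in>W. ?F w)" for W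
    by (induction W rule: infinite_finite_induct) (simp_all add: free_poly_add)
  ultimately show thesis using that by (metis free_star_algebra_expand)
qed

end

section \<open>C*-seminorms of polynomials in \<open>b b\<^sup>*\<close>\<close>

text \<open>The coefficient norm of f on the disc of radius r. It is submultiplicative, for r = 1 it
  dominates p(f(x)) whenever p(x) <= 1, and for r = t^n it controls f at all points t^k with k >= n
  together.\<close>

definition poly_l1 :: "real \<Rightarrow> complex poly \<Rightarrow> real"
  where "poly_l1 r f = (\<Sum>i\<le>degree f. cmod (coeff f i) * r ^ i)"

lemma poly_l1_eq_sum: "degree f \<le> n \<Longrightarrow> poly_l1 r f = (\<Sum>i\<le>n. cmod (coeff f i) * r ^ i)"
  unfolding poly_l1_def by (rule sum.mono_neutral_left) (auto simp: coeff_eq_0)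

lemma poly_l1_nonneg: "0 \<le> r \<Longrightarrow> 0 \<le> poly_l1 r f"
  unfolding poly_l1_def by (intro sum_nonneg) simp

lemma poly_l1_pCons: "poly_l1 r (pCons c f) = cmod c + r * poly_l1 r f"
proof -
  have "poly_l1 r (pCons c f) = (\<Sum>i\<le>Suc (degree f). cmod (coeff (pCons c f) i) * r ^ i)"
    by (rule poly_l1_eq_sum) (simp add: degree_pCons_le)
  also have "\<dots> = cmod c + (\<Sum>i\<le>degree f. r * (cmod (coeff f i) * r ^ i))"
    by (simp add: sum.atMost_Suc_shift mult_ac del: sum.atMost_Suc)
  finally show ?thesis by (simp add: poly_l1_def sum_distrib_left)
qed

lemma poly_l1_zero [simp]: "poly_l1 r 0 = 0"
  by (simp add: poly_l1_def)

lemma poly_l1_const [simp]: "poly_l1 r [:c:] = cmod c"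
  by (simp add: poly_l1_pCons)

lemma poly_l1_add_le:
  assumes "0 \<le> r" shows "poly_l1 r (f + g) \<le> poly_l1 r f + poly_l1 r g"
proof -
  let ?n = "max (degree f) (degree g)"
  have "poly_l1 r (f + g) = (\<Sum>i\<le>?n. cmod (coeff f i + coeff g i) * r ^ i)"
    by (simp add: poly_l1_eq_sum[OF degree_add_le_max])
  also have "\<dots> \<le> (\<Sum>i\<le>?n. cmod (coeff f i) * r ^ i + cmod (coeff g i) * r ^ i)"
    by (intro sum_mono) (use assms in \<open>auto simp flip: distrib_right intro!: mult_right_mono
        norm_triangle_ineq\<close>)
  finally show ?thesis
    by (simp add: sum.distrib poly_l1_eq_sum[of f ?n] poly_l1_eq_sum[of g ?n])
qed

lemma poly_l1_smult: "poly_l1 r (smult c f) = cmod c * poly_l1 r f"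
  by (induction f) (simp_all add: poly_l1_pCons norm_mult algebra_simps)

lemma poly_l1_diff_le: "0 \<le> r \<Longrightarrow> poly_l1 r (f - g) \<le> poly_l1 r f + poly_l1 r g"
  using poly_l1_add_le[of r f "smult (-1) g"] poly_l1_smult[of r "-1" g] by simp

lemma poly_l1_mult_le:
  assumes r: "0 \<le> r" shows "poly_l1 r (f * g) \<le> poly_l1 r f * poly_l1 r g"
proof (induction f)
  case (pCons c f)
  have "poly_l1 r (pCons c f * g) \<le> poly_l1 r (smult c g) + poly_l1 r (pCons 0 (f * g))"
    unfolding mult_pCons_left by (rule poly_l1_add_le[OF r])
  also have "\<dots> \<le> cmod c * poly_l1 r g + r * (poly_l1 r f * poly_l1 r g)"
    using mult_left_mono[OF pCons.IH r] by (simp add: poly_l1_smult poly_l1_pCons)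
  finally show ?case by (simp add: poly_l1_pCons algebra_simps)
qed simp

lemma poly_l1_power_le: assumes r: "0 \<le> r" shows "poly_l1 r (f ^ n) \<le> poly_l1 r f ^ n"
proof (induction n)
  case (Suc n)
  have "poly_l1 r (f ^ Suc n) \<le> poly_l1 r f * poly_l1 r (f ^ n)"
    using poly_l1_mult_le[OF r] by simp
  also have "\<dots> \<le> poly_l1 r f * poly_l1 r f ^ n"
    by (intro mult_left_mono Suc poly_l1_nonneg r)
  finally show ?case by simp
qed (simp add: one_pCons)

lemma poly_l1_pcompose_linear: "poly_l1 r (pcompose f [:0, c:]) = poly_l1 (r * cmod c) f"
  by (induction f) (simp_all add: pcompose_pCons poly_l1_pCons poly_l1_smult)

lemma poly_l1_tendsto:
  assumes "\<bar>t\<bar> < 1" shows "(\<lambda>n. poly_l1 (t ^ n) f) \<longlonglongrightarrow> cmod (coeff f 0)"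
proof -
  have "((\<lambda>r. \<Sum>i\<le>degree f. cmod (coeff f i) * r ^ i) \<longlongrightarrow> (\<Sum>i\<le>degree f. cmod (coeff f i) * 0 ^ i))
      (nhds 0)"
    by (intro tendsto_intros filterlim_ident)
  moreover have "(\<Sum>i\<le>degree f. cmod (coeff f i) * 0 ^ i) = cmod (coeff f 0)"
    by (simp add: power_0_left if_distrib[of "(*) _"] sum.delta cong: if_cong)
  moreover have "(\<lambda>n. t ^ n) \<longlonglongrightarrow> 0" by (rule LIMSEQ_power_zero) (use assms in simp)
  ultimately show ?thesis unfolding poly_l1_def by (auto intro: filterlim_compose)
qed

lemma (in cstar_seminorm_loc) free_poly_le:
  assumes "p x \<le> 1" shows "p (free_poly x f) \<le> poly_l1 1 f"
proof (induction f)
  case (pCons c f)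
  have "p (free_poly x (pCons c f)) \<le> p (free_scale c 1) + p (x * free_poly x f)"
    by (simp add: free_poly_pCons add_le)
  also have "\<dots> \<le> cmod c * 1 + p x * p (free_poly x f)"
    by (intro add_mono mult_le) (simp add: scale one_le mult_left_le)
  also have "\<dots> \<le> cmod c + 1 * poly_l1 1 f"
    using mult_mono[OF assms pCons.IH] by simp
  finally show ?case by (simp add: poly_l1_pCons)
qed simp

context uq2
begin

lemma free_star_X: "free_star bb = bb"
  by (simp add: free_star_mult free_star_letter)

lemma rel_X_power_a: "bb ^ n * a \<doteq> free_scale (complex_of_real (t ^ n)) (a * bb ^ n)"
proof (induction n)
  case (Suc n)
  have "bb ^ Suc n * a = bb * (bb ^ n * a)" by (simp only: power_Suc mult.assoc)
  also have "\<dots> \<doteq> bb * free_scale (complex_of_real (t ^ n)) (a * bb ^ n)"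
    by (rule rel_cong_mult_left[OF Suc])
  also have "\<dots> = free_scale (complex_of_real (t ^ n)) ((bb * a) * bb ^ n)"
    by (simp only: mult.assoc free_scale_mult_right)
  also have "\<dots> \<doteq> free_scale (complex_of_real (t ^ n)) (free_scale (complex_of_real t) (a * bb) *
      bb ^ n)"
    by (intro rel_cong_scale rel_cong_mult_right rel_Xa)
  also have "\<dots> = free_scale (complex_of_real (t ^ Suc n)) (a * bb ^ Suc n)"
    by (simp add: mult.assoc power_commutes mult.commute)
  finally show ?case .
qed simp

end

locale uq2_seminorm = uq2 q + cstar_seminorm_loc p
  for q :: complex and p :: "uq2_generator free_star_algebra \<Rightarrow> real" +
  assumes relations: "r \<in> R \<Longrightarrow> p r = 0"
begin

lemma p_cong: "x \<doteq> y \<Longrightarrow> p x = p y"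
  by (rule cong) (rule rel_congD[OF _ cstar_seminorm_loc_axioms relations])

lemma p_a_sq: "(p a)\<^sup>2 \<le> 1 + p bb"
proof -
  have "(p a)\<^sup>2 = p (a * a')" using mult_star[of a] by (simp add: free_star_letter)
  also have "\<dots> = p (1 - bb)" by (rule p_cong[OF rel_aa'])
  also have "\<dots> \<le> 1 + p bb" using diff_le[of 1 bb] one_le by simp
  finally show ?thesis .
qed

lemma p_a': "p a' = p a"
  using star[of a] by (simp add: free_star_letter)

text \<open>Since \<open>x\<^sup>n (1 - x) = x\<^sup>n a a\<^sup>* = t\<^sup>n a x\<^sup>n a\<^sup>*\<close> for \<open>x = b b\<^sup>*\<close>, the elements \<open>x\<^bsup>n+1\<^esup>\<close> and
  \<open>x\<^sup>n\<close> have nearly the same seminorm for large \<open>n\<close>.\<close>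

lemma p_X_le_one: "p bb \<le> 1"
proof (rule ccontr)
  assume "\<not> p bb \<le> 1"
  hence r: "p bb > 1" by simp
  \<comment> \<open>Below this threshold \<open>t ^ n * (1 + p bb)\<close> is smaller than
    \<open>p bb - 1\<close>, which contradicts the estimate obtained at the end.\<close>
  have "(p bb - 1) / (1 + p bb) > 0" using r by simp
  then obtain n where n: "t ^ n < (p bb - 1) / (1 + p bb)"
    using t_less real_arch_pow_inv by blast
  \<comment> \<open>\<open>Suc N\<close> has to be a power of two, because for these exponents the
    seminorm of the power of \<open>bb\<close> is known exactly; \<open>n \<le> N\<close> keeps t^N
    below the threshold.\<close>
  define N where "N = (2 :: nat) ^ n - 1"
  have "n < 2 ^ n" by (rule less_exp)
  hence N: "Suc N = 2 ^ n" "n \<le> N" unfolding N_def by linarith+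
  have "bb ^ N * (1 - bb) \<doteq> bb ^ N * (a * a')"
    by (rule rel_cong_mult_left[OF rel_cong_sym[OF rel_aa']])
  also have "bb ^ N * (a * a') = (bb ^ N * a) * a'" by (simp only: mult.assoc)
  also have "\<dots> \<doteq> free_scale (complex_of_real (t ^ N)) (a * bb ^ N) * a'"
    by (rule rel_cong_mult_right[OF rel_X_power_a])
  also have "\<dots> = free_scale (complex_of_real (t ^ N)) (a * bb ^ N * a')" by simp
  finally have "p (bb ^ N * (1 - bb)) = t ^ N * p (a * bb ^ N * a')"
    using t_pos by (simp add: p_cong scale norm_power del: of_real_power)
  also have "\<dots> \<le> t ^ N * (p a * p (bb ^ N) * p a')"
    using t_pos by (intro mult_left_mono order_trans[OF mult_le] mult_right_mono mult_le) auto
  also have "\<dots> = t ^ N * (p a)\<^sup>2 * p (bb ^ N)" by (simp add: p_a' power2_eq_square mult_ac)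
  also have "\<dots> \<le> t ^ N * (1 + p bb) * p bb ^ N"
    using t_pos by (intro mult_mono p_a_sq power_le) auto
  finally have 1: "p (bb ^ N * (1 - bb)) \<le> t ^ N * (1 + p bb) * p bb ^ N" .
  have "p bb * p bb ^ N = p (bb ^ Suc N)"
    using power_two_power[of bb n] unfolding N(1) by (simp add: free_star_X flip: N(1))
  also have "\<dots> \<le> p (bb ^ N) + p (bb ^ N * (1 - bb))"
    using diff_le[of "bb ^ N" "bb ^ N * (1 - bb)"] by (simp add: right_diff_distrib power_commutes)
  also have "\<dots> \<le> (1 + t ^ N * (1 + p bb)) * p bb ^ N"
    using 1 power_le[of bb N] by (simp add: algebra_simps)
  finally have "p bb \<le> 1 + t ^ N * (1 + p bb)" using r by (simp add: mult_le_cancel_right)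
  moreover have "t ^ N \<le> t ^ n" using N(2) t_pos t_less by (intro power_decreasing) auto
  hence "t ^ N * (1 + p bb) \<le> t ^ n * (1 + p bb)" using r by (intro mult_right_mono) auto
  moreover have "t ^ n * (1 + p bb) < p bb - 1" using n r by (simp add: less_divide_eq)
  ultimately show False by simp
qed

text \<open>The constant term at \<open>1\<close> is split off: \<open>f(x) = f(1) + (1 - x) g(x)\<close>, and
  \<open>(1 - x) g(x) = a g(t x) a\<^sup>*\<close> shifts the remaining points \<open>t\<^sup>k\<close>.\<close>

lemma p_free_poly_interpolate:
  "\<exists>C\<ge>0. \<forall>f B. (\<forall>k<n. cmod (poly f (complex_of_real (t ^ k))) \<le> B) \<longrightarrow> poly_l1 (t ^ n) f \<le> B \<longrightarrow>
     p (free_poly bb f) \<le> C * B"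
proof (induction n)
  case 0
  show ?case
    by (rule exI[of _ 1]) (auto intro: order_trans[OF free_poly_le[OF p_X_le_one]])
next
  case (Suc n)
  then obtain C where C: "C \<ge> 0"
    "\<And>f B. (\<And>k. k < n \<Longrightarrow> cmod (poly f (complex_of_real (t ^ k))) \<le> B) \<Longrightarrow> poly_l1 (t ^ n) f \<le> B \<Longrightarrow>
     p (free_poly bb f) \<le> C * B" by blast
  \<comment> \<open>The summand 1 pays for the value at 1; the first 2 bounds (p a)^2; and 2 B / (1
    - t) bounds the quotient g at the points t^k with k >= 1, where 1 - t^k is at least 1 -
    t.\<close>
  have "p (free_poly bb f) \<le> (1 + 2 * C * (2 / (1 - t))) * B"
    if f: "\<And>k. k < Suc n \<Longrightarrow> cmod (poly f (complex_of_real (t ^ k))) \<le> B"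
      and l1: "poly_l1 (t ^ Suc n) f \<le> B" for f B
  proof -
    define c where "c = poly f 1"
    have cB: "cmod c \<le> B" using f[of 0] by (simp add: c_def)
    hence B: "B \<ge> 0" using norm_ge_zero order_trans by blast
    have "poly (f - [:c:]) 1 = 0" by (simp add: c_def)
    then obtain h where h: "f - [:c:] = [:- 1, 1:] * h" using poly_eq_0_iff_dvd by blast
    define g where "g = - h"
    have g: "[:1, - 1:] * g = f - [:c:]"
      unfolding h g_def by simp
    define g' where "g' = pcompose g [:0, complex_of_real t:]"
    have fg: "f = [:c:] + g * [:1, - 1:]" using g by (simp add: mult.commute[of g])
    have "free_poly bb g * (1 - bb) \<doteq> free_poly bb g * (a * a')"
      by (rule rel_cong_mult_left[OF rel_cong_sym[OF rel_aa']])
    also have "\<dots> = free_poly bb g * a * a'" by (simp only: mult.assoc)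
    also have "\<dots> \<doteq> a * free_poly bb g' * a'"
      unfolding g'_def by (rule rel_cong_mult_right[OF free_poly_rel_commute[OF rel_Xa]])
    finally have pg: "p (free_poly bb g * (1 - bb)) = p (a * free_poly bb g' * a')" by (rule p_cong)
    have "free_poly bb [:1, - 1:] = 1 - bb" by (simp add: free_poly_pCons free_scale_minus_one)
    hence "p (free_poly bb f) \<le> p (free_scale c 1) + p (free_poly bb g * (1 - bb))"
      unfolding fg free_poly_add free_poly_mult by (simp add: add_le)
    also have "p (free_scale c 1) \<le> B"
      using cB one_le mult_mono[of "cmod c" B "p 1" 1] B by (simp add: scale)
    also have "p (free_poly bb g * (1 - bb)) \<le> p a * p (free_poly bb g') * p a'"
      unfolding pg by (intro order_trans[OF mult_le] mult_right_mono mult_le nonneg)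
    also have "\<dots> = (p a)\<^sup>2 * p (free_poly bb g')" by (simp add: p_a' power2_eq_square)
    also have "\<dots> \<le> 2 * p (free_poly bb g')"
      using p_a_sq p_X_le_one by (intro mult_right_mono) auto
    also have "p (free_poly bb g') \<le> C * (2 * B / (1 - t))"
    proof (rule C(2))
      fix k assume k: "k < n"
      let ?s = "t ^ Suc k"
      have s: "?s \<le> t" using power_le_one[of t k] t_pos t_less by (simp add: mult_left_le)
      have "(1 - complex_of_real ?s) * poly g (complex_of_real ?s) = poly ([:1, - 1:] * g)
          (complex_of_real ?s)"
        by (simp add: algebra_simps)
      also have "\<dots> = poly f (complex_of_real ?s) - c" unfolding g by simp
      finally have "cmod (1 - complex_of_real ?s) * cmod (poly g (complex_of_real ?s)) \<le> B + B"
        using f[of "Suc k"] cB k norm_triangle_ineq4[of "poly f (complex_of_real ?s)" c]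
        by (simp flip: norm_mult)
      moreover have "cmod (1 - complex_of_real ?s) = 1 - ?s"
        using s t_less by (metis abs_of_nonneg diff_ge_0_iff_ge less_eq_real_def norm_of_real
            of_real_1 of_real_diff order_trans)
      moreover have "(1 - t) * cmod (poly g (complex_of_real ?s)) \<le> (1 - ?s) * cmod (poly g
          (complex_of_real ?s))"
        using s by (intro mult_right_mono) auto
      ultimately have "(1 - t) * cmod (poly g (complex_of_real ?s)) \<le> 2 * B" by simp
      hence "cmod (poly g (complex_of_real ?s)) \<le> 2 * B / (1 - t)"
        using t_less by (simp add: pos_le_divide_eq mult.commute)
      moreover have "poly g' (complex_of_real (t ^ k)) = poly g (complex_of_real ?s)"
        by (simp add: g'_def poly_pcompose mult.commute)
      ultimately show "cmod (poly g' (complex_of_real (t ^ k))) \<le> 2 * B / (1 - t)" by simp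
    next
      let ?s = "t ^ Suc n"
      have s: "0 \<le> ?s" "?s \<le> t" using power_le_one[of t n] t_pos t_less
          by (simp_all add: mult_left_le)
      \<comment> \<open>Solving g = (1 - X) g + X g for the coefficient norm replaces division by 1
        - X: the last term contributes only t^(n+1) times the norm of g.\<close>
      have "g = [:1, - 1:] * g + pCons 0 g" by simp
      hence "poly_l1 ?s g \<le> poly_l1 ?s ([:1, - 1:] * g) + poly_l1 ?s (pCons 0 g)"
        using poly_l1_add_le[OF s(1)] by metis
      moreover have "poly_l1 ?s ([:1, - 1:] * g) \<le> B + B"
        unfolding g using poly_l1_diff_le[OF s(1), of f "[:c:]"] l1 cB by simp
      ultimately have "(1 - ?s) * poly_l1 ?s g \<le> 2 * B" by (simp add: poly_l1_pCons algebra_simps)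
      moreover have "(1 - t) * poly_l1 ?s g \<le> (1 - ?s) * poly_l1 ?s g"
        using s by (intro mult_right_mono poly_l1_nonneg) auto
      ultimately have "(1 - t) * poly_l1 ?s g \<le> 2 * B" by linarith
      hence "poly_l1 ?s g \<le> 2 * B / (1 - t)"
        using t_less by (simp add: pos_le_divide_eq mult.commute)
      moreover have "poly_l1 (t ^ n) g' = poly_l1 ?s g"
        using t_pos by (simp add: g'_def poly_l1_pcompose_linear mult.commute)
      ultimately show "poly_l1 (t ^ n) g' \<le> 2 * B / (1 - t)" by simp
    qed
    finally show ?thesis by (simp add: algebra_simps)
  qed
  moreover have "0 \<le> 1 + 2 * C * (2 / (1 - t))" using C(1) t_less by simp
  ultimately show ?case by blast
qed

text \<open>The constant of \<open>p_free_poly_interpolate\<close> depends on n but not on f, so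
  applying it to the powers f^(2^k) and taking roots removes it. The index n makes the coefficient
  norm on the disc of radius t^n smaller than M + e; this is possible since that norm tends to
  |f(0)|, and |f(0)| is at most M because t^k tends to 0.\<close>

lemma p_free_poly_le:
  assumes sa: "free_star (free_poly bb f) \<doteq> free_poly bb f"
    and M: "\<And>k. cmod (poly f (complex_of_real (t ^ k))) \<le> M"
  shows "p (free_poly bb f) \<le> M"
proof (rule field_le_epsilon)
  fix e :: real assume e: "e > 0"
  have M0: "M \<ge> 0" using M[of 0] norm_ge_zero order_trans by blast
  have "(\<lambda>k. complex_of_real (t ^ k)) \<longlonglongrightarrow> complex_of_real 0"
    using t_pos t_less by (intro tendsto_of_real LIMSEQ_realpow_zero) auto
  hence "(\<lambda>k. cmod (poly f (complex_of_real (t ^ k)))) \<longlonglongrightarrow> cmod (poly f (complex_of_real 0))"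
    by (intro tendsto_norm isCont_tendsto_compose[OF poly_isCont])
  hence "cmod (poly f (complex_of_real 0)) \<le> M"
    by (rule tendsto_upperbound) (simp_all add: M del: of_real_power)
  hence "cmod (coeff f 0) < M + e" using e by (simp add: poly_0_coeff_0)
  moreover have "(\<lambda>n. poly_l1 (t ^ n) f) \<longlonglongrightarrow> cmod (coeff f 0)"
    by (rule poly_l1_tendsto) (use t_pos t_less in simp)
  ultimately have "\<forall>\<^sub>F n in sequentially. poly_l1 (t ^ n) f < M + e" by (simp add: order_tendstoD)
  then obtain n where n: "poly_l1 (t ^ n) f < M + e" by (auto simp: eventually_sequentially)
  obtain C where C: "C \<ge> 0"
    "\<And>f B. (\<And>k. k < n \<Longrightarrow> cmod (poly f (complex_of_real (t ^ k))) \<le> B) \<Longrightarrow> poly_l1 (t ^ n) f \<le> B \<Longrightarrow>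
     p (free_poly bb f) \<le> C * B" using p_free_poly_interpolate[of n] by blast
  show "p (free_poly bb f) \<le> M + e"
  proof (rule le_from_powers[where K = C])
    fix k
    let ?m = "(2 :: nat) ^ k"
    have "p (free_poly bb f) ^ ?m = p (free_poly bb f ^ ?m)"
      by (rule power_two_power[symmetric], rule rel_congD[OF sa cstar_seminorm_loc_axioms
          relations])
    also have "\<dots> = p (free_poly bb (f ^ ?m))" by (simp add: free_poly_power)
    also have "\<dots> \<le> C * (M + e) ^ ?m"
    proof (rule C(2))
      show "cmod (poly (f ^ ?m) (complex_of_real (t ^ i))) \<le> (M + e) ^ ?m" for i
        unfolding poly_power norm_power using M[of i] e by (intro power_mono) auto
      have "poly_l1 (t ^ n) (f ^ ?m) \<le> poly_l1 (t ^ n) f ^ ?m"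
        using t_pos by (intro poly_l1_power_le) auto
      also have "\<dots> \<le> (M + e) ^ ?m"
        using n t_pos by (intro power_mono poly_l1_nonneg) auto
      finally show "poly_l1 (t ^ n) (f ^ ?m) \<le> (M + e) ^ ?m" .
    qed
    also have "\<dots> \<le> C * real ?m ^ 3 * (M + e) ^ ?m"
      using C(1) M0 e by (intro mult_right_mono) (auto intro!: mult_right_mono[of 1, simplified]
          simp: mult_le_cancel_left1)
    finally show "p (free_poly bb f) ^ ?m \<le> C * real ?m ^ 3 * (M + e) ^ ?m" .
  qed (use M0 e in auto)
qed

end

section \<open>The representation on \<open>\<ell>\<^sup>2(\<nat> \<times> \<int> \<times> \<int>)\<close> and the universal seminorm\<close>

lemma onorm_scaleC:
  assumes f: "bounded_clinear f" shows "onorm (\<lambda>x. c *\<^sub>C f x) = cmod c * onorm f"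
proof (rule antisym)
  have le: "onorm (\<lambda>x. c *\<^sub>C f x) \<le> cmod c * onorm f" if f: "bounded_clinear f" for c
      and f :: "'a \<Rightarrow> 'b"
  proof (rule onorm_bound)
    show "norm (c *\<^sub>C f x) \<le> cmod c * onorm f * norm x" for x
      using mult_left_mono[OF bounded_clinear_norm_le[OF f, of x], of "cmod c"]
        by (simp add: mult.assoc)
  qed (simp add: onorm_pos_le bounded_clinear_bounded_linear f)
  show "onorm (\<lambda>x. c *\<^sub>C f x) \<le> cmod c * onorm f" by (rule le[OF f])
  show "cmod c * onorm f \<le> onorm (\<lambda>x. c *\<^sub>C f x)"
  proof (cases "c = 0")
    case True
    thus ?thesis by (simp add: onorm_zero)
  next
    case False
    have "onorm (\<lambda>x. inverse c *\<^sub>C c *\<^sub>C f x) \<le> cmod (inverse c) * onorm (\<lambda>x. c *\<^sub>C f x)"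
      by (rule le[OF bounded_clinear_scale[OF f]])
    hence "cmod c * onorm f \<le> cmod c * (cmod (inverse c) * onorm (\<lambda>x. c *\<^sub>C f x))"
      using False by (intro mult_left_mono) (simp_all add: scaleC_scaleC scaleC_one)
    also have "\<dots> = onorm (\<lambda>x. c *\<^sub>C f x)" using False by (simp add: norm_inverse)
    finally show ?thesis .
  qed
qed

section \<open>The letters as weighted shifts of the basis\<close>

definition dphase :: "complex \<Rightarrow> int \<Rightarrow> complex"
  where "dphase q j = exp (- 2 * complex_of_real pi * \<i> * complex_of_real (Arg q / pi) * of_int j)"

text \<open>Operators are described by the coordinates of the image, so indices are pulled back: a
  raises i, hence the shift lowers it. At i = 0 the subtraction \<open>i - 1\<close> stays at 0,
  which is harmless because the weight of a vanishes there.\<close>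

fun letter_shift :: "uq2_generator \<times> bool \<Rightarrow> nat \<times> int \<times> int \<Rightarrow> nat \<times> int \<times> int" where
  "letter_shift (GenA, s) (i, j, k) = (if s then i + 1 else i - 1, j, k)"
| "letter_shift (GenB, s) (i, j, k) = (i, if s then j + 1 else j - 1, k)"
| "letter_shift (GenD, s) (i, j, k) = (i, j, if s then k + 1 else k - 1)"

text \<open>Weights are indexed by the target, which is why a carries |q|^(2i) here but |q|^(2i+2)
  in its action on basis vectors.\<close>

fun letter_weight :: "complex \<Rightarrow> uq2_generator \<times> bool \<Rightarrow> nat \<times> int \<times> int \<Rightarrow> complex" where
  "letter_weight q (GenA, s) (i, j, k) = complex_of_real (sqrt (1 - (cmod q)\<^sup>2 ^ (if s then i + 1
      else i)))"
| "letter_weight q (GenB, s) (i, j, k) = (if s then cnj q else q) ^ i"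
| "letter_weight q (GenD, s) (i, j, k) = (if s then cnj (dphase q j) else dphase q j)"

definition letter_op :: "complex \<Rightarrow> uq2_generator \<times> bool \<Rightarrow> uq2_space \<Rightarrow> uq2_space"
  where "letter_op q l = wshift (letter_shift l) (letter_weight q l)"

definition word_op :: "complex \<Rightarrow> uq2_generator star_word \<Rightarrow> uq2_space \<Rightarrow> uq2_space"
  where "word_op q w = foldr (\<lambda>l f. letter_op q l \<circ> f) (letters w) id"

definition free_rep :: "complex \<Rightarrow> uq2_generator free_star_algebra \<Rightarrow> uq2_space \<Rightarrow> uq2_space"
  where "free_rep q z = (\<lambda>v. \<Sum>w\<in>Poly_Mapping.keys z. Poly_Mapping.lookup z w *\<^sub>C word_op q w v)"

fun index_deg :: "nat \<times> int \<times> int \<Rightarrow> int \<times> int \<times> int" where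
  "index_deg (i, j, k) = (int i, j, k)"

lemma cmod_dphase [simp]: "cmod (dphase q j) = 1"
proof -
  have "- 2 * complex_of_real pi * \<i> * complex_of_real (Arg q / pi) * of_int j
      = \<i> * complex_of_real (- 2 * Arg q * real_of_int j)"
    by (simp add: field_simps)
  thus ?thesis unfolding dphase_def by (simp only: norm_exp_i_times)
qed

lemma dphase_cnj [simp]: "dphase q j * cnj (dphase q j) = 1" "cnj (dphase q j) * dphase q j = 1"
  by (simp_all add: complex_norm_square[symmetric] mult.commute[of "cnj _"])

text \<open>The quotient q^2 / |q|^2 is exp (2 i Arg q), the scalar in the relation between b and D;
  lowering j by one produces exactly this factor.\<close>

lemma dphase_diff_one:
  assumes "q \<noteq> 0" shows "dphase q (j - 1) = q\<^sup>2 / complex_of_real ((cmod q)\<^sup>2) * dphase q j"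
proof -
  have "q\<^sup>2 = (complex_of_real (cmod q) * exp (\<i> * complex_of_real (Arg q)))\<^sup>2"
    using Arg_eq[OF assms] by simp
  hence "q\<^sup>2 / complex_of_real ((cmod q)\<^sup>2) = exp (\<i> * complex_of_real (Arg q)) ^ 2"
    using assms by (simp add: power_mult_distrib)
  also have "\<dots> = exp (2 * \<i> * complex_of_real (Arg q))"
    by (simp flip: exp_of_nat_mult add: mult.assoc)
  finally have e: "q\<^sup>2 / complex_of_real ((cmod q)\<^sup>2) = exp (2 * \<i> * complex_of_real (Arg q))" .
  show ?thesis unfolding e dphase_def exp_add[symmetric] by (simp add: field_simps)
qed

context uq2
begin

lemma t_power_le: "t ^ n \<le> 1"
  using t_pos t_less by (intro power_le_one) auto

lemma letter_weight_le: "cmod (letter_weight q l y) \<le> 1"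
proof -
  obtain g s i j k where [simp]: "l = (g, s)" "y = (i, j, k)" by (metis prod_cases3 surj_pair)
  have "0 \<le> t ^ n" for n using t_pos by simp
  thus ?thesis
    using t_power_le q_less
    by (cases g; simp add: norm_power power_le_one flip: t_def)
qed

text \<open>A non-zero weight of a excludes i = 0, the one place where truncated subtraction is not
  invertible.\<close>

lemma letter_shift_inverse:
  assumes "letter_weight q (g, s) y \<noteq> 0"
  shows "letter_shift (g, \<not> s) (letter_shift (g, s) y) = y"
    and "letter_weight q (g, \<not> s) (letter_shift (g, s) y) = cnj (letter_weight q (g, s) y)"
proof -
  obtain i j k where [simp]: "y = (i, j, k)" by (metis prod_cases3)
  show "letter_shift (g, \<not> s) (letter_shift (g, s) y) = y"
    using assms by (cases g; cases i; cases s) auto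
  show "letter_weight q (g, \<not> s) (letter_shift (g, s) y) = cnj (letter_weight q (g, s) y)"
    using assms by (cases g; cases i; cases s) auto
qed

lemma letter_shift_inj: "inj_on (letter_shift l) {y. letter_weight q l y \<noteq> 0}"
  by (cases l) (auto intro!: inj_on_inverseI letter_shift_inverse)

lemma Rep_letter_op: "Rep_ell2 (letter_op q l v) y = letter_weight q l y * Rep_ell2 v
    (letter_shift l y)"
  unfolding letter_op_def by (rule Rep_wshift[OF letter_shift_inj letter_weight_le])

lemma letter_op_bounded_clinear: "bounded_clinear (letter_op q l)"
  unfolding letter_op_def by (rule wshift_bounded_clinear[OF letter_shift_inj letter_weight_le])

lemma letter_op_adjoint_pair: "adjoint_pair (letter_op q (g, s)) (letter_op q (g, \<not> s))"
  unfolding letter_op_def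
  using letter_shift_inverse[of g s] letter_shift_inverse[of g "\<not> s"]
  by (intro adjoint_pair_wshift[of _ 1]) (auto simp: letter_weight_le)

lemma word_op_Nil: "word_op q (Star_Word []) = id"
  and word_op_Cons: "word_op q (Star_Word (l # ls)) = letter_op q l \<circ> word_op q (Star_Word ls)"
  by (simp_all add: word_op_def)

lemma word_op_plus: "word_op q (v + w) = word_op q v \<circ> word_op q w"
proof -
  have "word_op q (Star_Word (ls @ ms)) = word_op q (Star_Word ls) \<circ> word_op q (Star_Word ms)"
      for ls ms
    by (induction ls) (simp_all add: word_op_Nil word_op_Cons comp_assoc)
  thus ?thesis by (cases v; cases w) (simp add: plus_star_word_def)
qed

lemma word_op_bounded_clinear: "bounded_clinear (word_op q w)"
proof -
  have "bounded_clinear (word_op q (Star_Word ls))" for ls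
    by (induction ls)
      (simp_all only: word_op_Nil word_op_Cons bounded_clinear_id bounded_clinear_comp
          letter_op_bounded_clinear)
  thus ?thesis by (cases w) simp
qed

lemma word_op_adjoint_pair: "adjoint_pair (word_op q w) (word_op q (word_star w))"
proof -
  have "adjoint_pair (word_op q (Star_Word ls)) (word_op q (word_star (Star_Word ls)))" for ls
  proof (induction ls)
    case Nil
    show ?case by (simp add: word_star_def word_op_Nil adjoint_pair_def)
  next
    case (Cons l ls)
    obtain g s where l: "l = (g, s)" by (cases l)
    have "word_star (Star_Word (l # ls)) = word_star (Star_Word ls) + Star_Word [(g, \<not> s)]"
      by (simp add: word_star_def plus_star_word_def l)
    hence "word_op q (word_star (Star_Word (l # ls))) = word_op q (word_star (Star_Word ls)) \<circ>
        letter_op q (g, \<not> s)"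
      by (simp add: word_op_plus word_op_Cons word_op_Nil)
    thus ?case
      using adjoint_pair_comp[OF letter_op_adjoint_pair[of g s] Cons] by (simp only: word_op_Cons l)
  qed
  thus ?thesis by (cases w) simp
qed

lemma free_rep_eq_sum:
  "finite W \<Longrightarrow> Poly_Mapping.keys z \<subseteq> W \<Longrightarrow>
    free_rep q z v = (\<Sum>w\<in>W. Poly_Mapping.lookup z w *\<^sub>C word_op q w v)"
  unfolding free_rep_def by (rule sum.mono_neutral_left) (auto simp: in_keys_iff)

lemma free_rep_single: "free_rep q (Poly_Mapping.single w c) v = c *\<^sub>C word_op q w v"
  using free_rep_eq_sum[of "{w}" "Poly_Mapping.single w c"] by simp

lemma free_rep_add: "free_rep q (x + y) v = free_rep q x v + free_rep q y v"
proof -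
  let ?W = "Poly_Mapping.keys x \<union> Poly_Mapping.keys y"
  have "Poly_Mapping.keys (x + y) \<subseteq> ?W" by (rule Poly_Mapping.keys_add)
  thus ?thesis
    by (simp add: free_rep_eq_sum[of ?W] lookup_add scaleC_add_left sum.distrib)
qed

lemma free_rep_zero [simp]: "free_rep q 0 v = 0"
  by (simp add: free_rep_def)

lemma free_rep_scale: "free_rep q (free_scale c x) v = c *\<^sub>C free_rep q x v"
  by (induction x rule: free_star_algebra_induct)
    (simp_all add: free_scale_single free_rep_single free_scale_add_right free_rep_add
      scaleC_add_right scaleC_scaleC)

lemma free_rep_minus: "free_rep q (- x) v = - free_rep q x v"
  using free_rep_add[of x "- x" v] by (simp add: eq_neg_iff_add_eq_0 add.commute)

lemma free_rep_diff: "free_rep q (x - y) v = free_rep q x v - free_rep q y v"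
  using free_rep_add[of x "- y" v] by (simp add: free_rep_minus)

lemma free_rep_one: "free_rep q 1 = id"
proof
  show "free_rep q 1 v = id v" for v
    using free_rep_single[of "Star_Word []" 1 v]
    by (simp add: single_Star_Word_Nil word_op_Nil scaleC_one)
qed

lemma free_rep_letter: "free_rep q (free_letter l) = letter_op q l"
  by (rule ext) (simp add: free_letter_def free_rep_single word_op_Cons word_op_Nil scaleC_one)

lemma free_rep_bounded_clinear: "bounded_clinear (free_rep q z)"
  unfolding free_rep_def by (intro bounded_clinear_sum bounded_clinear_scale
      word_op_bounded_clinear)

lemma free_rep_mult: "free_rep q (x * y) v = free_rep q x (free_rep q y v)"
proof (induction x rule: free_star_algebra_induct)
  case (single w c)
  note w = word_op_bounded_clinear[of w]
  show ?case
    by (induction y rule: free_star_algebra_induct)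
      (simp_all add: mult_single free_rep_single word_op_plus distrib_left free_rep_add
        bounded_clinear_add[OF w] bounded_clinear_scaleC[OF w] scaleC_add_right scaleC_scaleC)
qed (simp add: distrib_right free_rep_add)

lemma free_rep_adjoint_pair: "adjoint_pair (free_rep q x) (free_rep q (free_star x))"
proof (induction x rule: free_star_algebra_induct)
  case (single w c)
  show ?case
    using adjoint_pair_scale[OF word_op_adjoint_pair[of w], of c]
    by (simp add: free_star_single adjoint_pair_def free_rep_single)
next
  case (add x y)
  show ?case using adjoint_pair_plus[OF add] by (simp add: free_star_add adjoint_pair_def
      free_rep_add)
qed

lemma Rep_letter_ops:
  "Rep_ell2 (letter_op q (GenA, False) v) (i, j, k) = complex_of_real (sqrt (1 - t ^ i)) *
      Rep_ell2 v (i - 1, j, k)"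
  "Rep_ell2 (letter_op q (GenA, True) v) (i, j, k) = complex_of_real (sqrt (1 - t ^ Suc i)) *
      Rep_ell2 v (Suc i, j, k)"
  "Rep_ell2 (letter_op q (GenB, False) v) (i, j, k) = q ^ i * Rep_ell2 v (i, j - 1, k)"
  "Rep_ell2 (letter_op q (GenB, True) v) (i, j, k) = cnj q ^ i * Rep_ell2 v (i, j + 1, k)"
  "Rep_ell2 (letter_op q (GenD, False) v) (i, j, k) = dphase q j * Rep_ell2 v (i, j, k - 1)"
  "Rep_ell2 (letter_op q (GenD, True) v) (i, j, k) = cnj (dphase q j) * Rep_ell2 v (i, j, k + 1)"
  by (simp_all add: Rep_letter_op t_def)

lemma q_power_cnj:
  "q ^ i * (cnj q ^ i * x) = complex_of_real (t ^ i) * x" "cnj q ^ i * (q ^ i * x) =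
      complex_of_real (t ^ i) * x"
  by (simp_all flip: power_mult_distrib mult.assoc add: q_cnj)

lemma sqrt_weight_sq:
  "complex_of_real (sqrt (1 - t ^ i)) * (complex_of_real (sqrt (1 - t ^ i)) * x) = (1 -
      complex_of_real (t ^ i)) * x"
  using t_power_le[of i] by (simp flip: of_real_mult mult.assoc del: of_real_power)

lemma letter_op_relations:
  "letter_op q (GenB, False) (letter_op q (GenA, False) v) = q *\<^sub>C letter_op q (GenA, False)
      (letter_op q (GenB, False) v)"
  "letter_op q (GenA, True) (letter_op q (GenB, False) v) = q *\<^sub>C letter_op q (GenB, False)
      (letter_op q (GenA, True) v)"
  "letter_op q (GenB, False) (letter_op q (GenB, True) v) = letter_op q (GenB, True) (letter_op q
      (GenB, False) v)"
  "letter_op q (GenA, False) (letter_op q (GenA, True) v) + letter_op q (GenB, False) (letter_op q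
      (GenB, True) v) = v"
  "letter_op q (GenA, False) (letter_op q (GenD, False) v) = letter_op q (GenD, False) (letter_op
      q (GenA, False) v)"
  "letter_op q (GenB, False) (letter_op q (GenD, False) v)
    = (q\<^sup>2 / complex_of_real ((cmod q)\<^sup>2)) *\<^sub>C letter_op q (GenD, False) (letter_op q (GenB, False) v)"
  "letter_op q (GenD, False) (letter_op q (GenD, True) v) = v"
  "letter_op q (GenD, True) (letter_op q (GenD, False) v) = v"
  "letter_op q (GenA, True) (letter_op q (GenA, False) v)
    + complex_of_real ((cmod q)\<^sup>2) *\<^sub>C letter_op q (GenB, True) (letter_op q (GenB, False) v) = v"
proof -
  note L = Rep_letter_ops plus_ell2.rep_eq scaleC_ell2.rep_eq
  show "letter_op q (GenB, False) (letter_op q (GenA, False) v) = q *\<^sub>C letter_op q (GenA, False)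
      (letter_op q (GenB, False) v)"
  proof (rule ell2_eqI)
    fix y :: "nat \<times> int \<times> int"
    obtain i j k where "y = (i, j, k)" by (metis prod_cases3)
    thus "Rep_ell2 (letter_op q (GenB, False) (letter_op q (GenA, False) v)) y = Rep_ell2 (q *\<^sub>C
        letter_op q (GenA, False) (letter_op q (GenB, False) v)) y"
      by (cases i) (simp_all only: L, simp_all)
  qed
  show "letter_op q (GenA, True) (letter_op q (GenB, False) v) = q *\<^sub>C letter_op q (GenB, False)
      (letter_op q (GenA, True) v)"
    "letter_op q (GenB, False) (letter_op q (GenB, True) v) = letter_op q (GenB, True) (letter_op
        q (GenB, False) v)"
    "letter_op q (GenA, False) (letter_op q (GenD, False) v) = letter_op q (GenD, False)
        (letter_op q (GenA, False) v)"
    by (rule ell2_eqI, unfold split_paired_all L, simp add: mult_ac)+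
  show "letter_op q (GenD, False) (letter_op q (GenD, True) v) = v"
    "letter_op q (GenD, True) (letter_op q (GenD, False) v) = v"
    by (rule ell2_eqI, unfold split_paired_all L, simp flip: mult.assoc)+
  show "letter_op q (GenA, False) (letter_op q (GenA, True) v) + letter_op q (GenB, False)
      (letter_op q (GenB, True) v) = v"
  proof (rule ell2_eqI)
    fix y :: "nat \<times> int \<times> int"
    obtain i j k where "y = (i, j, k)" by (metis prod_cases3)
    \<comment> \<open>At i = 0 the first term vanishes and the second acts as 1; for i > 0 they
      contribute 1 - t^i and t^i.\<close>
    thus "Rep_ell2 (letter_op q (GenA, False) (letter_op q (GenA, True) v) + letter_op q (GenB,
        False) (letter_op q (GenB, True) v)) y = Rep_ell2 v y"
      by (cases i) (simp_all only: L q_power_cnj, simp_all only: One_nat_def diff_Suc_Suc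
          diff_zero sqrt_weight_sq,
          simp_all add: algebra_simps)
  qed
  show "letter_op q (GenA, True) (letter_op q (GenA, False) v)
    + complex_of_real ((cmod q)\<^sup>2) *\<^sub>C letter_op q (GenB, True) (letter_op q (GenB, False) v) = v"
    by (rule ell2_eqI, unfold split_paired_all L t_def[symmetric] diff_Suc_1 One_nat_def
        sqrt_weight_sq q_power_cnj, simp add: algebra_simps)
  show "letter_op q (GenB, False) (letter_op q (GenD, False) v)
    = (q\<^sup>2 / complex_of_real ((cmod q)\<^sup>2)) *\<^sub>C letter_op q (GenD, False) (letter_op q (GenB, False) v)"
    by (rule ell2_eqI, unfold split_paired_all L dphase_diff_one[OF q_nonzero], simp add: mult_ac)
qed

lemma free_rep_relation: assumes "r \<in> R" shows "free_rep q r v = 0"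
  using assms letter_op_relations[of v]
  by (auto simp: uq2_relations_def Let_def free_gen_eq_letter free_star_letter free_rep_add
      free_rep_diff
      free_rep_mult free_rep_scale free_rep_letter free_rep_one)

definition op_norm :: "uq2_generator free_star_algebra \<Rightarrow> real"
  where "op_norm z = onorm (free_rep q z)"

lemma free_rep_norm_le: "norm (free_rep q z v) \<le> op_norm z * norm v"
  unfolding op_norm_def by (rule bounded_clinear_norm_le[OF free_rep_bounded_clinear])

lemma op_norm_bounded_linear: "bounded_linear (free_rep q z)"
  by (rule bounded_clinear_bounded_linear[OF free_rep_bounded_clinear])

lemma op_norm_eq_0: "op_norm z = 0 \<longleftrightarrow> (\<forall>v. free_rep q z v = 0)"
  unfolding op_norm_def by (rule onorm_eq_0[OF op_norm_bounded_linear])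

lemma op_norm_cstar: "cstar_seminorm op_norm"
  unfolding cstar_seminorm_def
proof (intro conjI allI)
  fix x y c
  show "0 \<le> op_norm x" unfolding op_norm_def by (rule onorm_pos_le[OF op_norm_bounded_linear])
  show "op_norm (x + y) \<le> op_norm x + op_norm y"
    unfolding op_norm_def free_rep_add[abs_def]
      by (rule onorm_triangle[OF op_norm_bounded_linear op_norm_bounded_linear])
  show "op_norm (free_scale c x) = cmod c * op_norm x"
    unfolding op_norm_def free_rep_scale[abs_def]
      by (rule onorm_scaleC[OF free_rep_bounded_clinear])
  show "op_norm (x * y) \<le> op_norm x * op_norm y"
    unfolding op_norm_def free_rep_mult[abs_def]
    using onorm_compose[OF op_norm_bounded_linear op_norm_bounded_linear] by (simp add: o_def)
  show "op_norm (free_star x * x) = (op_norm x)\<^sup>2"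
    unfolding op_norm_def free_rep_mult[abs_def]
    using onorm_adjoint_comp[OF free_rep_adjoint_pair free_rep_bounded_clinear] by (simp add: o_def)
qed

lemma op_norm_relation: "r \<in> R \<Longrightarrow> op_norm r = 0"
  by (simp add: op_norm_eq_0 free_rep_relation)

text \<open>The operator norm is itself an admissible seminorm. Hence congruences hold in the
  representation, and the general estimates for seminorms apply to \<open>op_norm\<close>
  too.\<close>

sublocale op_norm: uq2_seminorm q op_norm
  by unfold_locales (simp_all add: op_norm_cstar op_norm_relation)

lemma free_rep_cong: "x \<doteq> y \<Longrightarrow> free_rep q x = free_rep q y"
proof
  fix v assume "x \<doteq> y"
  hence "op_norm (x - y) = 0"
    by (rule rel_congD[OF _ op_norm.cstar_seminorm_loc_axioms op_norm.relations])
  thus "free_rep q x v = free_rep q y v" by (simp add: op_norm_eq_0 free_rep_diff)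
qed

text \<open>The points t^i of the algebraic estimate are the eigenvalues of \<open>b * b'\<close>;
  this links \<open>p_free_poly_le\<close> to operator norms.\<close>

lemma free_rep_poly_ket: "free_rep q (free_poly bb f) (ket (i, j, k)) = poly f (complex_of_real (t
    ^ i)) *\<^sub>C ket (i, j, k)"
proof (induction f)
  case (pCons c f)
  have bb: "free_rep q bb (ket (i, j, k)) = complex_of_real (t ^ i) *\<^sub>C ket (i, j, k)"
    by (rule ell2_eqI, unfold split_paired_all)
      (auto simp: free_rep_mult free_rep_letter Rep_letter_ops q_power_cnj Rep_ell2_ket)
  show ?case
    by (simp add: free_poly_pCons free_rep_add free_rep_scale free_rep_one free_rep_mult[of bb]
        pCons.IH
        bounded_clinear_scaleC[OF free_rep_bounded_clinear] bb scaleC_scaleC scaleC_add_left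
            mult.commute)
qed simp

lemma letter_shift_deg:
  assumes "letter_weight q l y \<noteq> 0" shows "index_deg y = index_deg (letter_shift l y) + letter_deg
      l"
proof -
  obtain g s i j k where [simp]: "l = (g, s)" "y = (i, j, k)" by (metis prod_cases3 surj_pair)
  show ?thesis using assms by (cases g; cases s; cases i) auto
qed

lemma word_op_support:
  assumes "Rep_ell2 (word_op q w v) y \<noteq> 0"
  shows "\<exists>x. Rep_ell2 v x \<noteq> 0 \<and> index_deg y = index_deg x + word_deg w"
proof -
  have "Rep_ell2 (word_op q (Star_Word ls) v) y \<noteq> 0 \<Longrightarrow>
      \<exists>x. Rep_ell2 v x \<noteq> 0 \<and> index_deg y = index_deg x + word_deg (Star_Word ls)" for ls y
  proof (induction ls arbitrary: y)
    case Nil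
    thus ?case by (intro exI[of _ y]) (simp add: word_op_Nil)
  next
    case (Cons l ls)
    hence w: "letter_weight q l y \<noteq> 0" and "Rep_ell2 (word_op q (Star_Word ls) v) (letter_shift l
        y) \<noteq> 0"
      by (auto simp: word_op_Cons Rep_letter_op)
    with Cons.IH obtain x where "Rep_ell2 v x \<noteq> 0"
      "index_deg (letter_shift l y) = index_deg x + word_deg (Star_Word ls)" by blast
    with letter_shift_deg[OF w] show ?case by (intro exI[of _ x]) (simp add: algebra_simps)
  qed
  from this[of "letters w"] assms show ?thesis by simp
qed

lemma word_op_ket_eq_0:
  "index_deg y \<noteq> index_deg x + word_deg w \<Longrightarrow> Rep_ell2 (word_op q w (ket x)) y = 0"
  using word_op_support[of w "ket x" y] by (metis Rep_ell2_ket)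

definition component :: "int \<times> int \<times> int \<Rightarrow> uq2_generator free_star_algebra \<Rightarrow> uq2_generator
    free_star_algebra"
  where "component \<alpha> z = Poly_Mapping.mapp (\<lambda>w c. if word_deg w = \<alpha> then c else 0) z"

lemma lookup_component:
  "Poly_Mapping.lookup (component \<alpha> z) w = (if word_deg w = \<alpha> then Poly_Mapping.lookup z w else 0)"
  by (auto simp: component_def lookup_mapp when_def in_keys_iff)

lemma component_keys: "w \<in> Poly_Mapping.keys (component \<alpha> z) \<Longrightarrow> word_deg w = \<alpha>"
  by (auto simp: in_keys_iff lookup_component split: if_splits)

lemma component_sum: "z = (\<Sum>\<alpha>\<in>word_deg ` Poly_Mapping.keys z. component \<alpha> z)"
proof (rule poly_mapping_eqI)
  fix w
  have "(\<Sum>\<alpha>\<in>word_deg ` Poly_Mapping.keys z. Poly_Mapping.lookup (component \<alpha> z) w)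
      = (if w \<in> Poly_Mapping.keys z then Poly_Mapping.lookup z w else 0)"
    by (auto simp: lookup_component sum.delta in_keys_iff)
  thus "Poly_Mapping.lookup z w = Poly_Mapping.lookup (\<Sum>\<alpha>\<in>word_deg ` Poly_Mapping.keys z.
      component \<alpha> z) w"
    by (simp add: lookup_sum in_keys_iff)
qed

lemma Rep_free_rep: "Rep_ell2 (free_rep q z v) y
    = (\<Sum>w\<in>Poly_Mapping.keys z. Poly_Mapping.lookup z w * Rep_ell2 (word_op q w v) y)"
  by (simp add: free_rep_def)

text \<open>A word sends a basis vector only to the index shifted by its degree, so passing to a
  component deletes coordinates of the image of \<open>ket x\<close>. On basis vectors this bounds
  the projection to one degree without integrating over the torus.\<close>

lemma component_coordinate:
  "Rep_ell2 (free_rep q (component \<alpha> z) (ket x)) y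
    = (if index_deg y = index_deg x + \<alpha> then Rep_ell2 (free_rep q z (ket x)) y else 0)"
proof -
  have sub: "Poly_Mapping.keys (component \<alpha> z) \<subseteq> Poly_Mapping.keys z"
    unfolding component_def by (rule keys_mapp_subset)
  have "Rep_ell2 (free_rep q (component \<alpha> z) (ket x)) y
      = (\<Sum>w\<in>Poly_Mapping.keys z. Poly_Mapping.lookup (component \<alpha> z) w * Rep_ell2 (word_op q w
          (ket x)) y)"
    by (simp add: free_rep_eq_sum[OF _ sub])
  also have "\<dots> = (\<Sum>w\<in>Poly_Mapping.keys z. if index_deg y = index_deg x + \<alpha>
      then Poly_Mapping.lookup z w * Rep_ell2 (word_op q w (ket x)) y else 0)"
    by (rule sum.cong) (auto simp: lookup_component word_op_ket_eq_0)
  finally show ?thesis by (simp add: Rep_free_rep)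
qed

lemma component_norm_le: "norm (free_rep q (component \<alpha> z) (ket x)) \<le> op_norm z"
proof -
  have "(norm (free_rep q (component \<alpha> z) (ket x)))\<^sup>2 \<le> (norm (free_rep q z (ket x)))\<^sup>2"
    unfolding norm_ell2_sq
    by (rule infsum_mono[OF Rep_ell2_summable Rep_ell2_summable]) (simp add: component_coordinate)
  hence "norm (free_rep q (component \<alpha> z) (ket x)) \<le> norm (free_rep q z (ket x))"
    by (rule power2_le_imp_le) simp
  also have "\<dots> \<le> op_norm z" using free_rep_norm_le[of z "ket x"] by simp
  finally show ?thesis .
qed

end

section \<open>Comparison of an arbitrary C*-seminorm with the operator norm\<close>

lemma card_degree_box:
  assumes "\<And>n m l. (n, m, l) \<in> S \<Longrightarrow> \<bar>n\<bar> \<le> int L \<and> \<bar>m\<bar> \<le> int L \<and> \<bar>l\<bar> \<le> int L"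
  shows "card S \<le> (2 * L + 1) ^ 3"
proof -
  let ?I = "{- int L..int L}"
  have "S \<subseteq> ?I \<times> ?I \<times> ?I" using assms by (force simp: abs_le_iff)
  hence "card S \<le> card (?I \<times> ?I \<times> ?I)" by (rule card_mono[rotated]) simp
  also have "\<dots> = (2 * L + 1) ^ 3"
    by (simp add: card_cartesian_product power3_eq_cube nat_add_distrib nat_mult_distrib)
  finally show ?thesis .
qed

lemma word_deg_le_length:
  assumes "word_deg w = (n, m, l)" and "length (letters w) \<le> L"
  shows "\<bar>n\<bar> \<le> int L \<and> \<bar>m\<bar> \<le> int L \<and> \<bar>l\<bar> \<le> int L"
proof -
  have "word_deg (Star_Word ls) = (n, m, l) \<Longrightarrow> \<bar>n\<bar> + \<bar>m\<bar> + \<bar>l\<bar> \<le> int (length ls)" for ls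
  proof (induction ls arbitrary: n m l)
    case (Cons x ls)
    obtain n' m' l' where d: "word_deg (Star_Word ls) = (n', m', l')" by (metis prod_cases3)
    obtain g s where x: "x = (g, s)" by (cases x)
    from Cons.IH[OF d] Cons.prems show ?case
      by (cases g; cases s) (auto simp: d x)
  qed (simp add: zero_prod_def)
  from this[of "letters w"] assms have "\<bar>n\<bar> + \<bar>m\<bar> + \<bar>l\<bar> \<le> int L" by simp
  thus ?thesis by linarith
qed

lemma length_keys_power:
  fixes h :: "'g free_star_algebra"
  assumes "\<And>w. w \<in> Poly_Mapping.keys h \<Longrightarrow> length (letters w) \<le> d" and "w \<in> Poly_Mapping.keys (h ^ m)"
  shows "length (letters w) \<le> d * m"
  using assms(2)
proof (induction m arbitrary: w)
  case 0
  thus ?case by (simp add: zero_star_word_def)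
next
  case (Suc m)
  then obtain v u where "w = v + u" "v \<in> Poly_Mapping.keys h" "u \<in> Poly_Mapping.keys (h ^ m)"
    using keys_mult[of h "h ^ m"] by auto
  with assms(1)[of v] Suc.IH[of u] show ?case by (simp add: plus_star_word_def)
qed

context uq2_seminorm
begin

text \<open>The degree-zero element \<open>z\<^sub>\<alpha>\<^sup>* z\<^sub>\<alpha>\<close> is a polynomial in \<open>b b\<^sup>*\<close>, whose value at \<open>t\<^sup>k\<close> is the squared
  norm of the image of a basis vector.\<close>

lemma p_component_le: "p (component \<alpha> z) \<le> op_norm z"
proof -
  define y where "y = component \<alpha> z"
  have "word_deg w = 0" if "w \<in> Poly_Mapping.keys (free_star y * y)" for w
  proof -
    from that obtain v u where "w = v + u" "v \<in> word_star ` Poly_Mapping.keys y" "u \<in>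
        Poly_Mapping.keys y"
      using keys_mult[of "free_star y" y] unfolding keys_free_star by blast
    thus ?thesis by (auto simp: word_deg_plus word_deg_star y_def component_keys)
  qed
  then obtain f where f: "free_star y * y \<doteq> free_poly bb f" using degree_zero_poly by blast
  have "(p y)\<^sup>2 = p (free_poly bb f)" using p_cong[OF f] by (simp add: star_mult)
  also have "\<dots> \<le> (op_norm z)\<^sup>2"
  proof (rule p_free_poly_le)
    have "free_star (free_poly bb f) \<doteq> free_star (free_star y * y)"
      by (rule rel_cong_star[OF rel_cong_sym[OF f]])
    also have "\<dots> = free_star y * y" by (simp add: free_star_mult)
    also note f
    finally show "free_star (free_poly bb f) \<doteq> free_poly bb f" .
    fix k :: nat
    \<comment> \<open>A unit eigenvector of \<open>b * b'\<close> for t^k; the other two indices may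
      be fixed arbitrarily.\<close>
    let ?e = "ket (k, 0, 0)"
    have "poly f (complex_of_real (t ^ k)) = cinner (free_rep q (free_poly bb f) ?e) ?e"
      unfolding free_rep_poly_ket by (simp add: Rep_ell2_ket)
    also have "\<dots> = cinner (free_rep q (free_star y) (free_rep q y ?e)) ?e"
      by (simp add: free_rep_cong[OF f, symmetric] free_rep_mult)
    also have "\<dots> = cinner (free_rep q y ?e) (free_rep q y ?e)"
      by (rule adjoint_pairD[OF adjoint_pair_sym[OF free_rep_adjoint_pair]])
    finally have "cmod (poly f (complex_of_real (t ^ k))) = (norm (free_rep q y ?e))\<^sup>2"
      by (simp add: cinner_self norm_power del: of_real_power)
    also have "\<dots> \<le> (op_norm z)\<^sup>2"
      unfolding y_def by (intro power_mono component_norm_le) simp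
    finally show "cmod (poly f (complex_of_real (t ^ k))) \<le> (op_norm z)\<^sup>2" .
  qed
  finally show ?thesis unfolding y_def by (rule power2_le_imp_le) simp
qed

lemma p_le_card: "p z \<le> real (card (word_deg ` Poly_Mapping.keys z)) * op_norm z"
proof -
  have "p z \<le> (\<Sum>\<alpha>\<in>word_deg ` Poly_Mapping.keys z. p (component \<alpha> z))"
    by (subst component_sum) (rule sum_le)
  also have "\<dots> \<le> (\<Sum>\<alpha>\<in>word_deg ` Poly_Mapping.keys z. op_norm z)"
    by (intro sum_mono p_component_le)
  finally show ?thesis by simp
qed

theorem p_le_op_norm: "p z \<le> op_norm z"
proof -
  define h where "h = free_star z * z"
  \<comment> \<open>Word length bounds the degree and adds up in products, so the degrees of h^m lie
    in a box whose side grows linearly in m. The inserted 0 covers h = 0, where the set of lengths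
    is empty.\<close>
  define d where "d = Max (insert 0 ((\<lambda>w. length (letters w)) ` Poly_Mapping.keys h))"
  have d: "length (letters w) \<le> d" if "w \<in> Poly_Mapping.keys h" for w
    unfolding d_def using that by (intro Max_ge) auto
  have sa: "free_star h = h" by (simp add: h_def free_star_mult)
  have "p h \<le> op_norm h"
  proof (rule le_from_powers[where K = "real (2 * d + 1) ^ 3"])
    fix k
    let ?m = "(2 :: nat) ^ k"
    let ?D = "word_deg ` Poly_Mapping.keys (h ^ ?m)"
    have m: "1 \<le> ?m" by simp
    have "card ?D \<le> (2 * (d * ?m) + 1) ^ 3"
    proof (rule card_degree_box)
      fix n m l assume "(n, m, l) \<in> ?D"
      then obtain w where w: "word_deg w = (n, m, l)" "w \<in> Poly_Mapping.keys (h ^ ?m)" by force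
      have "length (letters w) \<le> d * ?m" by (rule length_keys_power[OF d w(2)])
      with w(1) show "\<bar>n\<bar> \<le> int (d * ?m) \<and> \<bar>m\<bar> \<le> int (d * ?m) \<and> \<bar>l\<bar> \<le> int (d * ?m)"
        by (rule word_deg_le_length)
    qed
    also have "2 * (d * ?m) + 1 \<le> (2 * d + 1) * ?m" using m by (simp add: algebra_simps)
    finally have "real (card ?D) \<le> real (((2 * d + 1) * ?m) ^ 3)"
      by (simp only: of_nat_le_iff power_mono)
    hence c: "real (card ?D) \<le> real (2 * d + 1) ^ 3 * real ?m ^ 3"
      by (simp only: of_nat_power of_nat_mult power_mult_distrib)
    have "p h ^ ?m = p (h ^ ?m)" by (rule power_two_power[symmetric]) (simp add: sa)
    also have "\<dots> \<le> real (card ?D) * op_norm (h ^ ?m)" by (rule p_le_card)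
    also have "\<dots> \<le> (real (2 * d + 1) ^ 3 * real ?m ^ 3) * op_norm h ^ ?m"
      by (intro mult_mono c op_norm.power_le) auto
    finally show "p h ^ ?m \<le> real (2 * d + 1) ^ 3 * real ?m ^ 3 * op_norm h ^ ?m" .
  qed simp_all
  hence "(p z)\<^sup>2 \<le> (op_norm z)\<^sup>2" by (simp add: h_def star_mult op_norm.star_mult)
  thus ?thesis by (rule power2_le_imp_le) simp
qed

end

text \<open>The supremum is a maximum, attained at the operator norm. This also settles that the
  admissible seminorms are pointwise bounded, without which \<open>Sup\<close> would carry no
  information.\<close>

lemma (in uq2) universal_seminorm_eq: "universal_seminorm R = op_norm"
proof
  fix x
  show "universal_seminorm R x = op_norm x"
    unfolding universal_seminorm_def
  proof (rule cSup_eq_maximum)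
    show "op_norm x \<in> {p x |p. cstar_seminorm p \<and> (\<forall>r\<in>R. p r = 0)}"
      using op_norm_cstar op_norm_relation by blast
    fix y assume "y \<in> {p x |p. cstar_seminorm p \<and> (\<forall>r\<in>R. p r = 0)}"
    then obtain p where p: "y = p x" "cstar_seminorm p" "\<forall>r\<in>R. p r = 0" by blast
    then interpret uq2_seminorm q p by unfold_locales auto
    show "y \<le> op_norm x" unfolding p(1) by (rule p_le_op_norm)
  qed
qed

section \<open>The completion of a free *-algebra\<close>

text \<open>Kept apart from the C*-algebra locale because completeness, one of its axioms, is stated
  through this metric; the completion needs the metric before that axiom is available.\<close>

lemma cstar_Metric_space:
  assumes ring: "Ring.ring A"
    and nonneg: "\<And>x. x \<in> carrier A \<Longrightarrow> 0 \<le> cnorm A x"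
    and eq_0: "\<And>x. x \<in> carrier A \<Longrightarrow> cnorm A x = 0 \<longleftrightarrow> x = \<zero>\<^bsub>A\<^esub>"
    and add: "\<And>x y. x \<in> carrier A \<Longrightarrow> y \<in> carrier A \<Longrightarrow> cnorm A (x \<oplus>\<^bsub>A\<^esub> y) \<le> cnorm A x + cnorm A y"
    and minus: "\<And>x. x \<in> carrier A \<Longrightarrow> cnorm A (\<ominus>\<^bsub>A\<^esub> x) = cnorm A x"
  shows "Metric_space (carrier A) (cstar_dist A)"
proof -
  interpret Ring.ring A by (rule ring)
  show ?thesis
  proof
    fix x y z
    show "0 \<le> cstar_dist A x y" by (simp add: cstar_dist_def nonneg)
    show "cstar_dist A x y = cstar_dist A y x"
    proof (cases "x \<in> carrier A \<and> y \<in> carrier A")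
      case True
      hence "\<ominus>\<^bsub>A\<^esub> (x \<ominus>\<^bsub>A\<^esub> y) = y \<ominus>\<^bsub>A\<^esub> x" by (simp add: a_minus_def minus_add a_comm)
      thus ?thesis using True minus[of "x \<ominus>\<^bsub>A\<^esub> y"] by (simp add: cstar_dist_def)
    qed (auto simp: cstar_dist_def)
    assume xy: "x \<in> carrier A" "y \<in> carrier A"
    show "cstar_dist A x y = 0 \<longleftrightarrow> x = y"
      using xy minus_equality[of x "\<ominus>\<^bsub>A\<^esub> y"] minus_minus[of y] r_neg[of y]
      by (auto simp: cstar_dist_def eq_0 a_minus_def)
    assume z: "z \<in> carrier A"
    have "x \<ominus>\<^bsub>A\<^esub> z = (x \<ominus>\<^bsub>A\<^esub> y) \<oplus>\<^bsub>A\<^esub> (y \<ominus>\<^bsub>A\<^esub> z)"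
      using xy z by (simp add: a_minus_def a_assoc r_neg1)
    thus "cstar_dist A x z \<le> cstar_dist A x y + cstar_dist A y z"
      using xy z add[of "x \<ominus>\<^bsub>A\<^esub> y" "y \<ominus>\<^bsub>A\<^esub> z"] by (simp add: cstar_dist_def)
  qed
qed

context unital_cstar_algebra
begin

lemma minus_eq_cscale: assumes "x \<in> carrier A" shows "\<ominus> x = cscale A (- 1) x"
proof (rule minus_equality)
  have "cscale A (- 1) x \<oplus> x = cscale A 0 x"
    using cscale_add_left[OF assms, of "- 1" 1] assms by (simp add: cscale_one)
  also have "\<dots> = \<zero>" using cnorm_cscale[OF assms, of 0] assms by (simp add: cnorm_eq_0 cscale_closed)
  finally show "cscale A (- 1) x \<oplus> x = \<zero>" .
qed (use assms in \<open>simp_all add: cscale_closed\<close>)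

lemma cnorm_minus: "x \<in> carrier A \<Longrightarrow> cnorm A (\<ominus> x) = cnorm A x"
  by (simp add: minus_eq_cscale cnorm_cscale)

sublocale Metric_space "carrier A" "cstar_dist A"
  by (rule cstar_Metric_space) (unfold_locales, auto simp: cnorm_nonneg cnorm_eq_0 cnorm_add
      cnorm_minus)

lemma cstar_dist_eq: "x \<in> carrier A \<Longrightarrow> y \<in> carrier A \<Longrightarrow> cstar_dist A x y = cnorm A (x \<ominus> y)"
  by (simp add: cstar_dist_def)

end

text \<open>The construction of the completion rests on this property of the universal seminorm,
  which for a general \<open>R\<close> can fail because the supremum need not be finite.\<close>

locale cstar_completion =
  fixes R :: "'g free_star_algebra set"
  assumes seminorm: "cstar_seminorm (universal_seminorm R)"
begin

abbreviation u where "u \<equiv> universal_seminorm R"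
abbreviation cauchy where "cauchy \<equiv> universal_Cauchy R"
abbreviation cls where "cls \<equiv> completion_class R"
abbreviation \<A> where "\<A> \<equiv> universal_cstar_algebra R"

sublocale u: cstar_seminorm_loc u by unfold_locales (rule seminorm)

lemma cauchyI: "(\<And>e. e > 0 \<Longrightarrow> \<exists>M. \<forall>m\<ge>M. \<forall>n\<ge>M. u (x m - x n) < e) \<Longrightarrow> cauchy x"
  by (auto simp: universal_Cauchy_def)

lemma cauchyD: "cauchy x \<Longrightarrow> e > 0 \<Longrightarrow> \<exists>M. \<forall>m\<ge>M. \<forall>n\<ge>M. u (x m - x n) < e"
  by (auto simp: universal_Cauchy_def)

lemma cauchy_const: "cauchy (\<lambda>_. z)"
  by (rule cauchyI) simp

text \<open>Sums, multiples, adjoints and products of Cauchy sequences all satisfy such an estimate;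
  for products the constant comes from bounds of the two sequences.\<close>

lemma cauchy_dominated:
  assumes "cauchy x" "cauchy y" "K \<ge> 0"
    and le: "\<And>m n. u (z m - z n) \<le> K * (u (x m - x n) + u (y m - y n))"
  shows "cauchy z"
proof (rule cauchyI)
  fix e :: real assume e: "e > 0"
  \<comment> \<open>The \<open>+ 1\<close> keeps the denominator positive for K = 0 and makes the
    final inequality strict.\<close>
  define \<delta> where "\<delta> = e / (2 * (K + 1))"
  have \<delta>: "\<delta> > 0" "K * (\<delta> + \<delta>) < e"
  proof -
    show pos: "\<delta> > 0" using e assms(3) by (simp add: \<delta>_def)
    have "2 * (K + 1) * \<delta> = e" using assms(3) by (simp add: \<delta>_def)
    thus "K * (\<delta> + \<delta>) < e" using pos by (simp add: algebra_simps)
  qed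
  obtain M1 M2 where "\<forall>m\<ge>M1. \<forall>n\<ge>M1. u (x m - x n) < \<delta>" "\<forall>m\<ge>M2. \<forall>n\<ge>M2. u (y m - y n) < \<delta>"
    using cauchyD[OF assms(1) \<delta>(1)] cauchyD[OF assms(2) \<delta>(1)] by blast
  hence "u (x m - x n) + u (y m - y n) \<le> \<delta> + \<delta>" if "m \<ge> max M1 M2" "n \<ge> max M1 M2" for m n
    using that by (intro add_mono less_imp_le) auto
  hence "u (z m - z n) < e" if "m \<ge> max M1 M2" "n \<ge> max M1 M2" for m n
    using that le[of m n] \<delta>(2) mult_left_mono[OF _ assms(3)] by (meson le_less_trans order_trans)
  thus "\<exists>M. \<forall>m\<ge>M. \<forall>n\<ge>M. u (z m - z n) < e" by blast
qed

lemma cauchy_bounded: assumes "cauchy x" obtains B where "B \<ge> 0" "\<And>n. u (x n) \<le> B"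
proof -
  obtain M where M: "\<forall>m\<ge>M. \<forall>n\<ge>M. u (x m - x n) < 1" using cauchyD[OF assms, of 1] by auto
  define B where "B = (\<Sum>n\<le>M. u (x n)) + 1"
  have le: "u (x n) \<le> (\<Sum>n\<le>M. u (x n))" if "n \<le> M" for n
    using that by (intro member_le_sum) auto
  have "u (x n) \<le> B" for n
  proof (cases "n \<le> M")
    case False
    hence "u (x n - x M) < 1" using M by simp
    thus ?thesis using u.le_add_diff[of "x n" "x M"] le[of M] by (simp add: B_def)
  qed (use le in \<open>force simp: B_def\<close>)
  moreover have "B \<ge> 0" by (simp add: B_def sum_nonneg add_nonneg_nonneg)
  ultimately show thesis using that by blast
qed

lemma cauchy_add: assumes "cauchy x" "cauchy y" shows "cauchy (\<lambda>n. x n + y n)"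
proof (rule cauchy_dominated[OF assms, of 1])
  show "u (x m + y m - (x n + y n)) \<le> 1 * (u (x m - x n) + u (y m - y n))" for m n
    using u.add_le[of "x m - x n" "y m - y n"] by (simp add: algebra_simps)
qed simp

lemma cauchy_scale: assumes "cauchy x" shows "cauchy (\<lambda>n. free_scale c (x n))"
proof (rule cauchy_dominated[OF assms assms, of "cmod c"])
  show "u (free_scale c (x m) - free_scale c (x n)) \<le> cmod c * (u (x m - x n) + u (x m - x n))"
      for m n
    by (simp flip: free_scale_diff_right add: u.scale mult_left_mono)
qed simp

lemma cauchy_minus: "cauchy x \<Longrightarrow> cauchy (\<lambda>n. - x n)"
  using cauchy_scale[of x "- 1"] by (simp add: free_scale_minus_one)

lemma cauchy_star: assumes "cauchy x" shows "cauchy (\<lambda>n. free_star (x n))"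
  by (rule cauchy_dominated[OF assms assms, of 1]) (simp_all flip: free_star_diff)

lemma mult_diff_le: "u (x * y - x' * y') \<le> u (x - x') * u y + u x' * u (y - y')"
proof -
  have "u (x * y - x' * y') = u ((x - x') * y + x' * (y - y'))" by (simp add: algebra_simps)
  also have "\<dots> \<le> u (x - x') * u y + u x' * u (y - y')"
    by (intro order_trans[OF u.add_le] add_mono u.mult_le)
  finally show ?thesis .
qed

lemma cauchy_mult: assumes "cauchy x" "cauchy y" shows "cauchy (\<lambda>n. x n * y n)"
proof -
  obtain B C where B: "B \<ge> 0" "\<And>n. u (x n) \<le> B" and C: "C \<ge> 0" "\<And>n. u (y n) \<le> C"
    using cauchy_bounded[OF assms(1)] cauchy_bounded[OF assms(2)] by metis
  show ?thesis
  proof (rule cauchy_dominated[OF assms, of "B + C"])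
    fix m n
    have "u (x m * y m - x n * y n) \<le> u (x m - x n) * C + B * u (y m - y n)"
      by (intro order_trans[OF mult_diff_le] add_mono mult_left_mono mult_right_mono B C) auto
    also have "\<dots> \<le> (B + C) * (u (x m - x n) + u (y m - y n))"
      using B(1) C(1) by (simp add: algebra_simps add_nonneg_nonneg)
    finally show "u (x m * y m - x n * y n) \<le> (B + C) * (u (x m - x n) + u (y m - y n))" .
  qed (use B C in simp)
qed

lemma cls_self: "cauchy x \<Longrightarrow> x \<in> cls x"
  by (simp add: completion_class_def)

lemma null_trans:
  assumes "(\<lambda>n. u (x n - y n)) \<longlonglongrightarrow> 0" "(\<lambda>n. u (y n - z n)) \<longlonglongrightarrow> 0"
  shows "(\<lambda>n. u (x n - z n)) \<longlonglongrightarrow> 0"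
proof (rule tendsto_sandwich[OF _ _ tendsto_const])
  show "(\<lambda>n. u (x n - y n) + u (y n - z n)) \<longlonglongrightarrow> 0" using tendsto_add[OF assms] by simp
qed (simp_all add: u.diff_trans)

lemma null_sym: "(\<lambda>n. u (x n - y n)) \<longlonglongrightarrow> 0 \<Longrightarrow> (\<lambda>n. u (y n - x n)) \<longlonglongrightarrow> 0"
  by (erule Lim_transform_eventually) (simp add: u.diff_commute)

lemma cls_eqI: "(\<lambda>n. u (x n - y n)) \<longlonglongrightarrow> 0 \<Longrightarrow> cls x = cls y"
proof -
  assume xy: "(\<lambda>n. u (x n - y n)) \<longlonglongrightarrow> 0"
  have "(\<lambda>n. u (x n - z n)) \<longlonglongrightarrow> 0 \<longleftrightarrow> (\<lambda>n. u (y n - z n)) \<longlonglongrightarrow> 0" for z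
    using null_trans[OF xy] null_trans[OF null_sym[OF xy]] by blast
  thus ?thesis by (simp add: completion_class_def)
qed

text \<open>The operations of \<open>universal_cstar_algebra\<close> act on representatives picked
  by \<open>SOME\<close>. Since the picked one differs from any given one by a null sequence, one
  can compute with arbitrary representatives.\<close>

lemma rep_cls:
  assumes "cauchy x"
  shows "cauchy (completion_rep (cls x))" "(\<lambda>n. u (completion_rep (cls x) n - x n)) \<longlonglongrightarrow> 0"
proof -
  have "completion_rep (cls x) \<in> cls x"
    unfolding completion_rep_def by (rule someI[of _ x]) (rule cls_self[OF assms])
  hence "cauchy (completion_rep (cls x)) \<and> (\<lambda>n. u (x n - completion_rep (cls x) n)) \<longlonglongrightarrow> 0"
    unfolding completion_class_def by blast
  thus "cauchy (completion_rep (cls x))" "(\<lambda>n. u (completion_rep (cls x) n - x n)) \<longlonglongrightarrow> 0"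
    using null_sym by blast+
qed

lemma carrier_eq: "carrier \<A> = cls ` {x. cauchy x}"
  by (simp add: universal_cstar_algebra_def)

lemma cls_closed [simp]: "cauchy x \<Longrightarrow> cls x \<in> carrier \<A>"
  by (simp add: carrier_eq)

lemma carrierE: assumes "X \<in> carrier \<A>" obtains x where "cauchy x" "X = cls x"
  using assms by (auto simp: carrier_eq)

lemma one_eq: "\<one>\<^bsub>\<A>\<^esub> = cls (\<lambda>_. 1)" and zero_eq: "\<zero>\<^bsub>\<A>\<^esub> = cls (\<lambda>_. 0)"
  by (simp_all add: universal_cstar_algebra_def)

lemma add_cls: assumes "cauchy x" "cauchy y" shows "cls x \<oplus>\<^bsub>\<A>\<^esub> cls y = cls (\<lambda>n. x n + y n)"
proof -
  let ?x = "completion_rep (cls x)" and ?y = "completion_rep (cls y)"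
  have "(\<lambda>n. u (?x n + ?y n - (x n + y n))) \<longlonglongrightarrow> 0"
  proof (rule tendsto_sandwich[OF _ _ tendsto_const])
    show "(\<lambda>n. u (?x n - x n) + u (?y n - y n)) \<longlonglongrightarrow> 0"
      using tendsto_add[OF rep_cls(2)[OF assms(1)] rep_cls(2)[OF assms(2)]] by simp
    have "u (?x n + ?y n - (x n + y n)) \<le> u (?x n - x n) + u (?y n - y n)" for n
      using u.add_le[of "?x n - x n" "?y n - y n"] by (simp add: algebra_simps)
    thus "\<forall>\<^sub>F n in sequentially. u (?x n + ?y n - (x n + y n)) \<le> u (?x n - x n) + u (?y n - y n)"
        by simp
  qed simp
  thus ?thesis by (simp add: universal_cstar_algebra_def cls_eqI)
qed

lemma mult_cls: assumes "cauchy x" "cauchy y" shows "cls x \<otimes>\<^bsub>\<A>\<^esub> cls y = cls (\<lambda>n. x n * y n)"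
proof -
  let ?x = "completion_rep (cls x)" and ?y = "completion_rep (cls y)"
  obtain B C where B: "\<And>n. u (?y n) \<le> B" and C: "\<And>n. u (x n) \<le> C"
    using cauchy_bounded[OF assms(1)] cauchy_bounded[OF rep_cls(1)[OF assms(2)]] by metis
  have "(\<lambda>n. u (?x n * ?y n - x n * y n)) \<longlonglongrightarrow> 0"
  proof (rule tendsto_sandwich[OF _ _ tendsto_const])
    show "(\<lambda>n. u (?x n - x n) * B + C * u (?y n - y n)) \<longlonglongrightarrow> 0"
      using tendsto_add[OF tendsto_mult_right[OF rep_cls(2)[OF assms(1)], of B]
          tendsto_mult_left[OF rep_cls(2)[OF assms(2)], of C]] by simp
    have "u (?x n * ?y n - x n * y n) \<le> u (?x n - x n) * B + C * u (?y n - y n)" for n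
      by (intro order_trans[OF mult_diff_le] add_mono mult_left_mono mult_right_mono B C) auto
    thus "\<forall>\<^sub>F n in sequentially. u (?x n * ?y n - x n * y n) \<le> u (?x n - x n) * B + C * u (?y n - y
        n)" by simp
  qed simp
  thus ?thesis by (simp add: universal_cstar_algebra_def cls_eqI)
qed

lemma cscale_cls: assumes "cauchy x" shows "cscale \<A> c (cls x) = cls (\<lambda>n. free_scale c (x n))"
proof -
  have "(\<lambda>n. u (free_scale c (completion_rep (cls x) n) - free_scale c (x n))) \<longlonglongrightarrow> 0"
    using tendsto_mult_left[OF rep_cls(2)[OF assms], of "cmod c"]
    by (simp flip: free_scale_diff_right add: u.scale)
  thus ?thesis by (simp add: universal_cstar_algebra_def cls_eqI)
qed

lemma involution_cls: assumes "cauchy x" shows "involution \<A> (cls x) = cls (\<lambda>n. free_star (x n))"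
proof -
  have "(\<lambda>n. u (free_star (completion_rep (cls x) n) - free_star (x n))) \<longlonglongrightarrow> 0"
    using rep_cls(2)[OF assms] by (simp flip: free_star_diff)
  thus ?thesis by (simp add: universal_cstar_algebra_def cls_eqI)
qed

text \<open>The \<open>lim\<close> in the definition runs along the chosen representative; by the
  reverse triangle inequality the limit exists and is the same along every representative.\<close>

lemma cnorm_cls: assumes "cauchy x" shows "(\<lambda>n. u (x n)) \<longlonglongrightarrow> cnorm \<A> (cls x)"
proof -
  let ?x = "completion_rep (cls x)"
  have "Cauchy (\<lambda>n. u (x n))"
  proof (rule metric_CauchyI)
    fix e :: real assume "e > 0"
    then obtain M where "\<forall>m\<ge>M. \<forall>n\<ge>M. u (x m - x n) < e" using cauchyD[OF assms] by blast
    thus "\<exists>M. \<forall>m\<ge>M. \<forall>n\<ge>M. dist (u (x m)) (u (x n)) < e"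
      using u.abs_diff_le by (metis dist_real_def order_le_less_trans)
  qed
  then obtain l where l: "(\<lambda>n. u (x n)) \<longlonglongrightarrow> l" using Cauchy_convergent convergent_def by blast
  have "(\<lambda>n. u (?x n) - u (x n)) \<longlonglongrightarrow> 0"
    by (rule tendsto_rabs_zero_cancel, rule tendsto_sandwich[OF _ _ tendsto_const rep_cls(2)[OF
        assms]])
      (simp_all add: u.abs_diff_le)
  from tendsto_add[OF this l] have "(\<lambda>n. u (?x n)) \<longlonglongrightarrow> l" by simp
  hence "cnorm \<A> (cls x) = l" by (simp add: universal_cstar_algebra_def limI)
  with l show ?thesis by simp
qed

lemma cnorm_cls_eqI: "cauchy x \<Longrightarrow> (\<lambda>n. u (x n)) \<longlonglongrightarrow> l \<Longrightarrow> cnorm \<A> (cls x) = l"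
  using LIMSEQ_unique cnorm_cls by blast

lemma cnorm_const: "cnorm \<A> (cls (\<lambda>_. z)) = u z"
  by (rule cnorm_cls_eqI[OF cauchy_const]) simp

lemmas cauchy_intros = cauchy_const cauchy_add cauchy_mult cauchy_scale cauchy_star cauchy_minus
lemmas cls_simps = one_eq zero_eq add_cls mult_cls cscale_cls involution_cls

lemma ring: "Ring.ring \<A>"
proof (rule ringI)
  show "abelian_group \<A>"
  proof (rule abelian_groupI)
    fix X Y Z assume "X \<in> carrier \<A>" "Y \<in> carrier \<A>" "Z \<in> carrier \<A>"
    then obtain x y z where [simp]: "X = cls x" "Y = cls y" "Z = cls z" "cauchy x" "cauchy y"
        "cauchy z"
      by (metis carrierE)
    show "X \<oplus>\<^bsub>\<A>\<^esub> Y \<in> carrier \<A>" "X \<oplus>\<^bsub>\<A>\<^esub> Y \<oplus>\<^bsub>\<A>\<^esub> Z = X \<oplus>\<^bsub>\<A>\<^esub> (Y \<oplus>\<^bsub>\<A>\<^esub> Z)" "X \<oplus>\<^bsub>\<A>\<^esub> Y = Y \<oplus>\<^bsub>\<A>\<^esub> X"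
      "\<zero>\<^bsub>\<A>\<^esub> \<oplus>\<^bsub>\<A>\<^esub> X = X"
      by (simp_all add: cls_simps cauchy_intros algebra_simps)
    have "cls (\<lambda>n. - x n) \<oplus>\<^bsub>\<A>\<^esub> X = \<zero>\<^bsub>\<A>\<^esub>" by (simp add: cls_simps cauchy_intros)
    thus "\<exists>W\<in>carrier \<A>. W \<oplus>\<^bsub>\<A>\<^esub> X = \<zero>\<^bsub>\<A>\<^esub>"
      using cls_closed[OF cauchy_minus[OF \<open>cauchy x\<close>]] by blast
  qed (simp add: zero_eq cauchy_const)
  show "Group.monoid \<A>"
  proof (rule monoidI)
    fix X Y Z assume "X \<in> carrier \<A>" "Y \<in> carrier \<A>" "Z \<in> carrier \<A>"
    then obtain x y z where [simp]: "X = cls x" "Y = cls y" "Z = cls z" "cauchy x" "cauchy y"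
        "cauchy z"
      by (metis carrierE)
    show "X \<otimes>\<^bsub>\<A>\<^esub> Y \<in> carrier \<A>" "X \<otimes>\<^bsub>\<A>\<^esub> Y \<otimes>\<^bsub>\<A>\<^esub> Z = X \<otimes>\<^bsub>\<A>\<^esub> (Y \<otimes>\<^bsub>\<A>\<^esub> Z)"
      "\<one>\<^bsub>\<A>\<^esub> \<otimes>\<^bsub>\<A>\<^esub> X = X" "X \<otimes>\<^bsub>\<A>\<^esub> \<one>\<^bsub>\<A>\<^esub> = X"
      by (simp_all add: cls_simps cauchy_intros mult.assoc)
  qed (simp add: one_eq cauchy_const)
next
  fix X Y Z assume "X \<in> carrier \<A>" "Y \<in> carrier \<A>" "Z \<in> carrier \<A>"
  then obtain x y z where [simp]: "X = cls x" "Y = cls y" "Z = cls z" "cauchy x" "cauchy y"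
      "cauchy z"
    by (metis carrierE)
  show "(X \<oplus>\<^bsub>\<A>\<^esub> Y) \<otimes>\<^bsub>\<A>\<^esub> Z = X \<otimes>\<^bsub>\<A>\<^esub> Z \<oplus>\<^bsub>\<A>\<^esub> Y \<otimes>\<^bsub>\<A>\<^esub> Z"
    "Z \<otimes>\<^bsub>\<A>\<^esub> (X \<oplus>\<^bsub>\<A>\<^esub> Y) = Z \<otimes>\<^bsub>\<A>\<^esub> X \<oplus>\<^bsub>\<A>\<^esub> Z \<otimes>\<^bsub>\<A>\<^esub> Y"
    by (simp_all add: cls_simps cauchy_intros distrib_left distrib_right)
qed

lemma uminus_cls: assumes "cauchy x" shows "\<ominus>\<^bsub>\<A>\<^esub> cls x = cls (\<lambda>n. - x n)"
proof -
  interpret Ring.ring \<A> by (rule ring)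
  show ?thesis
    by (rule minus_equality) (simp_all add: cls_simps cauchy_intros assms)
qed

lemma minus_cls: assumes "cauchy x" "cauchy y" shows "cls x \<ominus>\<^bsub>\<A>\<^esub> cls y = cls (\<lambda>n. x n - y n)"
  using assms by (simp add: a_minus_def uminus_cls add_cls cauchy_intros)

lemma cauchy_diff: "cauchy x \<Longrightarrow> cauchy y \<Longrightarrow> cauchy (\<lambda>n. x n - y n)"
  using cauchy_add[of x "\<lambda>n. - y n"] by (simp add: cauchy_minus)

lemma norm_axioms:
  assumes "X \<in> carrier \<A>"
  shows "0 \<le> cnorm \<A> X" "cnorm \<A> X = 0 \<longleftrightarrow> X = \<zero>\<^bsub>\<A>\<^esub>" "cnorm \<A> (\<ominus>\<^bsub>\<A>\<^esub> X) = cnorm \<A> X"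
    "Y \<in> carrier \<A> \<Longrightarrow> cnorm \<A> (X \<oplus>\<^bsub>\<A>\<^esub> Y) \<le> cnorm \<A> X + cnorm \<A> Y"
proof -
  from assms obtain x where x: "cauchy x" "X = cls x" by (rule carrierE)
  note lim = cnorm_cls[OF x(1)]
  show "0 \<le> cnorm \<A> X" unfolding x by (rule tendsto_lowerbound[OF lim]) auto
  show "cnorm \<A> X = 0 \<longleftrightarrow> X = \<zero>\<^bsub>\<A>\<^esub>"
  proof
    assume "cnorm \<A> X = 0"
    thus "X = \<zero>\<^bsub>\<A>\<^esub>" using lim by (simp add: x zero_eq cls_eqI)
  qed (simp add: zero_eq cnorm_const)
  show "cnorm \<A> (\<ominus>\<^bsub>\<A>\<^esub> X) = cnorm \<A> X"
    unfolding x uminus_cls[OF x(1)] using lim by (intro cnorm_cls_eqI) (simp_all add: cauchy_minus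
        x)
  assume "Y \<in> carrier \<A>"
  then obtain y where y: "cauchy y" "Y = cls y" by (rule carrierE)
  show "cnorm \<A> (X \<oplus>\<^bsub>\<A>\<^esub> Y) \<le> cnorm \<A> X + cnorm \<A> Y"
    unfolding x y add_cls[OF x(1) y(1)]
    by (rule tendsto_le[OF _ tendsto_add[OF lim cnorm_cls[OF y(1)]] cnorm_cls[OF cauchy_add[OF
        x(1) y(1)]]])
      (simp_all add: u.add_le)
qed

interpretation M: Metric_space "carrier \<A>" "cstar_dist \<A>"
  by (rule cstar_Metric_space) (simp_all add: ring norm_axioms)

lemma dist_cls: "cauchy x \<Longrightarrow> cauchy y \<Longrightarrow> cstar_dist \<A> (cls x) (cls y) = cnorm \<A> (cls (\<lambda>n. x n - y n))"
  by (simp add: cstar_dist_def minus_cls)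

lemma dist_const: "cstar_dist \<A> (cls (\<lambda>_. y)) (cls (\<lambda>_. z)) = u (y - z)"
  by (simp add: dist_cls cauchy_const cnorm_const)

text \<open>A class is approximated by the constant sequences formed from its own terms; this is the
  density of the image of the free algebra.\<close>

lemma dist_to_const:
  assumes "cauchy x" "e > 0" shows "\<exists>M. \<forall>m\<ge>M. cstar_dist \<A> (cls x) (cls (\<lambda>_. x m)) < e"
proof -
  obtain M where M: "\<forall>m\<ge>M. \<forall>n\<ge>M. u (x m - x n) < e / 2"
    using cauchyD[OF assms(1), of "e / 2"] assms(2) by auto
  have "cstar_dist \<A> (cls x) (cls (\<lambda>_. x m)) \<le> e / 2" if "m \<ge> M" for m
    unfolding dist_cls[OF assms(1) cauchy_const]
  proof (rule tendsto_upperbound[OF cnorm_cls])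
    show "cauchy (\<lambda>n. x n - x m)" by (intro cauchy_diff assms cauchy_const)
    show "\<forall>\<^sub>F n in sequentially. u (x n - x m) \<le> e / 2"
      using M that by (auto intro!: eventually_sequentiallyI[of M] less_imp_le)
  qed simp
  moreover have "e / 2 < e" using assms(2) by simp
  ultimately show ?thesis by (meson le_less_trans)
qed

text \<open>Replace the n-th term by a constant class at distance less than 1/(n+1). The underlying
  free elements form a Cauchy sequence, and its class is the limit.\<close>

lemma mcomplete: "M.mcomplete"
  unfolding M.mcomplete_def
proof (intro allI impI)
  fix \<sigma> assume "M.MCauchy \<sigma>"
  hence \<sigma>: "\<And>n. \<sigma> n \<in> carrier \<A>"
    and C: "\<And>e. e > 0 \<Longrightarrow> \<exists>N. \<forall>n n'. N \<le> n \<longrightarrow> N \<le> n' \<longrightarrow> cstar_dist \<A> (\<sigma> n) (\<sigma> n') < e"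
    by (auto simp: M.MCauchy_def)
  have "\<exists>z. cstar_dist \<A> (\<sigma> n) (cls (\<lambda>_. z)) < inverse (Suc n)" for n
  proof -
    obtain x where "cauchy x" "\<sigma> n = cls x" using carrierE[OF \<sigma>] by blast
    thus ?thesis using dist_to_const[of x "inverse (Suc n)"] by auto
  qed
  then obtain z where z: "\<And>n. cstar_dist \<A> (\<sigma> n) (cls (\<lambda>_. z n)) < inverse (Suc n)" by metis
  have small: "\<exists>N. \<forall>n\<ge>N. inverse (Suc n) < e" if "e > 0" for e :: real
  proof -
    obtain N where "inverse (Suc N) < e" using reals_Archimedean[OF \<open>e > 0\<close>] by blast
    moreover have "inverse (Suc n) \<le> inverse (Suc N)" if "n \<ge> N" for n
      using that by (simp add: divide_simps)
    ultimately show ?thesis by (meson le_less_trans)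
  qed
  have cc: "cls (\<lambda>_. y) \<in> carrier \<A>" for y by (simp add: cauchy_const)
  have cz: "cauchy z"
  proof (rule cauchyI)
    fix e :: real assume "e > 0"
    hence e: "e / 3 > 0" by simp
    obtain N1 where N1: "\<forall>n n'. N1 \<le> n \<longrightarrow> N1 \<le> n' \<longrightarrow> cstar_dist \<A> (\<sigma> n) (\<sigma> n') < e / 3"
      using C[OF e] by blast
    obtain N2 where N2: "\<forall>n\<ge>N2. inverse (Suc n) < e / 3" using small[OF e] by blast
    have "u (z m - z n) < e" if "m \<ge> max N1 N2" "n \<ge> max N1 N2" for m n
    proof -
      have "u (z m - z n) = cstar_dist \<A> (cls (\<lambda>_. z m)) (cls (\<lambda>_. z n))" by (simp add: dist_const)
      also have "\<dots> \<le> cstar_dist \<A> (cls (\<lambda>_. z m)) (\<sigma> m) + cstar_dist \<A> (\<sigma> m) (cls (\<lambda>_. z n))"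
        by (intro M.triangle cc \<sigma>)
      also have "\<dots> \<le> cstar_dist \<A> (cls (\<lambda>_. z m)) (\<sigma> m) + (cstar_dist \<A> (\<sigma> m) (\<sigma> n) + cstar_dist \<A>
          (\<sigma> n) (cls (\<lambda>_. z n)))"
        by (intro add_left_mono M.triangle cc \<sigma>)
      also have "cstar_dist \<A> (cls (\<lambda>_. z m)) (\<sigma> m) = cstar_dist \<A> (\<sigma> m) (cls (\<lambda>_. z m))"
          by (rule M.commute)
      finally have "u (z m - z n) \<le> cstar_dist \<A> (\<sigma> m) (cls (\<lambda>_. z m))
          + (cstar_dist \<A> (\<sigma> m) (\<sigma> n) + cstar_dist \<A> (\<sigma> n) (cls (\<lambda>_. z n)))" .
      moreover have "cstar_dist \<A> (\<sigma> m) (\<sigma> n) < e / 3" using N1 that by simp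
      moreover have "inverse (real (Suc m)) < e / 3" "inverse (real (Suc n)) < e / 3"
        using N2 that by simp_all
      ultimately show ?thesis using z[of m] z[of n] by linarith
    qed
    thus "\<exists>M. \<forall>m\<ge>M. \<forall>n\<ge>M. u (z m - z n) < e" by blast
  qed
  have "limitin M.mtopology \<sigma> (cls z) sequentially"
    unfolding M.limitin_metric
  proof (intro conjI allI impI)
    show "cls z \<in> carrier \<A>" using cz by simp
    fix e :: real assume "e > 0"
    hence e: "e / 2 > 0" by simp
    obtain N1 where N1: "\<forall>n\<ge>N1. cstar_dist \<A> (cls z) (cls (\<lambda>_. z n)) < e / 2"
      using dist_to_const[OF cz e] by blast
    obtain N2 where N2: "\<forall>n\<ge>N2. inverse (Suc n) < e / 2" using small[OF e] by blast
    have "cstar_dist \<A> (\<sigma> n) (cls z) < e" if "n \<ge> max N1 N2" for n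
    proof -
      have "cstar_dist \<A> (\<sigma> n) (cls z) \<le> cstar_dist \<A> (\<sigma> n) (cls (\<lambda>_. z n)) + cstar_dist \<A> (cls
          (\<lambda>_. z n)) (cls z)"
        using cz by (intro M.triangle cc \<sigma>) simp
      moreover have "cstar_dist \<A> (cls (\<lambda>_. z n)) (cls z) < e / 2"
        using N1 that by (simp add: M.commute)
      moreover have "inverse (real (Suc n)) < e / 2" using N2 that by simp
      ultimately show ?thesis using z[of n] by simp
    qed
    thus "\<forall>\<^sub>F n in sequentially. \<sigma> n \<in> carrier \<A> \<and> cstar_dist \<A> (\<sigma> n) (cls z) < e"
      using \<sigma> by (intro eventually_sequentiallyI[of "max N1 N2"]) auto
  qed
  thus "\<exists>x. limitin M.mtopology \<sigma> x sequentially" by blast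
qed

theorem unital_cstar_algebra: "unital_cstar_algebra \<A>"
proof -
  interpret A: Ring.ring \<A> by (rule ring)
  show ?thesis
  proof
    fix X Y c d assume X: "X \<in> carrier \<A>"
    then obtain x where x [simp]: "X = cls x" "cauchy x" by (metis carrierE)
    show "cscale \<A> c X \<in> carrier \<A>" "cscale \<A> (c + d) X = cscale \<A> c X \<oplus>\<^bsub>\<A>\<^esub> cscale \<A> d X"
      "cscale \<A> c (cscale \<A> d X) = cscale \<A> (c * d) X" "cscale \<A> 1 X = X" "involution \<A> X \<in>
          carrier \<A>"
      "involution \<A> (involution \<A> X) = X" "involution \<A> (cscale \<A> c X) = cscale \<A> (cnj c)
          (involution \<A> X)"
      by (simp_all add: cls_simps cauchy_intros free_scale_add_left free_star_scale)
    show "0 \<le> cnorm \<A> X" "cnorm \<A> X = 0 \<longleftrightarrow> X = \<zero>\<^bsub>\<A>\<^esub>" by (rule norm_axioms[OF X])+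
    show "cnorm \<A> (cscale \<A> c X) = cmod c * cnorm \<A> X"
      unfolding x(1) cscale_cls[OF x(2)]
      by (rule cnorm_cls_eqI) (simp_all add: cauchy_intros u.scale tendsto_mult_left cnorm_cls)
    show "cnorm \<A> (involution \<A> X \<otimes>\<^bsub>\<A>\<^esub> X) = (cnorm \<A> X)\<^sup>2"
      unfolding x(1) involution_cls[OF x(2)] mult_cls[OF cauchy_star[OF x(2)] x(2)]
      by (rule cnorm_cls_eqI) (simp_all add: cauchy_intros u.star_mult tendsto_power cnorm_cls)
    assume Y: "Y \<in> carrier \<A>"
    then obtain y where y [simp]: "Y = cls y" "cauchy y" by (metis carrierE)
    show "cscale \<A> c (X \<oplus>\<^bsub>\<A>\<^esub> Y) = cscale \<A> c X \<oplus>\<^bsub>\<A>\<^esub> cscale \<A> c Y"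
      "cscale \<A> c X \<otimes>\<^bsub>\<A>\<^esub> Y = cscale \<A> c (X \<otimes>\<^bsub>\<A>\<^esub> Y)" "X \<otimes>\<^bsub>\<A>\<^esub> cscale \<A> c Y = cscale \<A> c (X \<otimes>\<^bsub>\<A>\<^esub> Y)"
      "involution \<A> (X \<oplus>\<^bsub>\<A>\<^esub> Y) = involution \<A> X \<oplus>\<^bsub>\<A>\<^esub> involution \<A> Y"
      "involution \<A> (X \<otimes>\<^bsub>\<A>\<^esub> Y) = involution \<A> Y \<otimes>\<^bsub>\<A>\<^esub> involution \<A> X"
      by (simp_all add: cls_simps cauchy_intros free_scale_add_right free_star_add free_star_mult)
    show "cnorm \<A> (X \<oplus>\<^bsub>\<A>\<^esub> Y) \<le> cnorm \<A> X + cnorm \<A> Y" by (rule norm_axioms(4)[OF X Y])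
    show "cnorm \<A> (X \<otimes>\<^bsub>\<A>\<^esub> Y) \<le> cnorm \<A> X * cnorm \<A> Y"
      unfolding x(1) y(1) mult_cls[OF x(2) y(2)]
      by (rule tendsto_le[OF _ tendsto_mult[OF cnorm_cls[OF x(2)] cnorm_cls[OF y(2)]] cnorm_cls[OF
          cauchy_mult[OF x(2) y(2)]]])
        (simp_all add: u.mult_le)
  qed (rule mcomplete)
qed

end

section \<open>Representations of C*-algebras\<close>

context
  fixes A :: "('a, 'm) cstar_struct_scheme" and S :: "'a set"
    and \<rho> :: "'a \<Rightarrow> 'h::complex_hilbert_space \<Rightarrow> 'h"
  assumes rep: "star_representation_on A S \<rho>"
begin

lemma rep_bounded_clinear: "x \<in> S \<Longrightarrow> bounded_clinear (\<rho> x)"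
  and rep_one: "\<rho> \<one>\<^bsub>A\<^esub> = id"
  and rep_add: "x \<in> S \<Longrightarrow> y \<in> S \<Longrightarrow> \<rho> (x \<oplus>\<^bsub>A\<^esub> y) \<xi> = \<rho> x \<xi> + \<rho> y \<xi>"
  and rep_mult: "x \<in> S \<Longrightarrow> y \<in> S \<Longrightarrow> \<rho> (x \<otimes>\<^bsub>A\<^esub> y) = \<rho> x \<circ> \<rho> y"
  and rep_cscale: "x \<in> S \<Longrightarrow> \<rho> (cscale A c x) \<xi> = c *\<^sub>C \<rho> x \<xi>"
  and rep_involution: "x \<in> S \<Longrightarrow> \<rho> (involution A x) = cadjoint (\<rho> x)"
  using rep by (auto simp: star_representation_on_def)

end

context unital_cstar_algebra
begin

text \<open>\<open>Z\<close> is a left inverse of 1 - y, found as the fixed point of the contraction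
  that sends Z to 1 + Z y instead of as a geometric series.\<close>

lemma neumann:
  assumes y: "y \<in> carrier A" "cnorm A y < 1"
  obtains Z where "Z \<in> carrier A" "Z = \<one> \<oplus> Z \<otimes> y"
proof -
  have "\<exists>Z. Z \<in> carrier A \<and> \<one> \<oplus> Z \<otimes> y = Z"
  proof (rule Banach_fixedpoint_thm[OF complete, of "\<lambda>Z. \<one> \<oplus> Z \<otimes> y" "cnorm A y"])
    fix V W assume VW: "V \<in> carrier A" "W \<in> carrier A"
    have "(\<one> \<oplus> V \<otimes> y) \<ominus> (\<one> \<oplus> W \<otimes> y) = (V \<ominus> W) \<otimes> y"
      using VW y by algebra
    thus "cstar_dist A (\<one> \<oplus> V \<otimes> y) (\<one> \<oplus> W \<otimes> y) \<le> cnorm A y * cstar_dist A V W"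
      using VW y cnorm_mult[of "V \<ominus> W" y] by (simp add: cstar_dist_eq mult.commute)
  qed (use y in auto)
  thus thesis using that by metis
qed

text \<open>If \<open>\<tau> = \<parallel>\<rho> x\<parallel>\<^sup>2\<close> exceeded \<open>\<parallel>x\<^sup>* x\<parallel>\<close>, then \<open>\<tau> - x\<^sup>* x\<close> would be invertible, so that
  \<open>\<tau> - (\<rho> x)\<^sup>* (\<rho> x)\<close> would be bounded below.\<close>

theorem star_representation_contractive:
  fixes \<rho> :: "'a \<Rightarrow> 'i ell2 \<Rightarrow> 'i ell2"
  assumes rep: "star_representation A \<rho>" and x: "x \<in> carrier A"
  shows "onorm (\<rho> x) \<le> cnorm A x"
proof (rule ccontr)
  assume "\<not> onorm (\<rho> x) \<le> cnorm A x"
  hence less: "cnorm A x < onorm (\<rho> x)" by simp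
  define S S' \<tau> where "S = \<rho> x" and "S' = cadjoint S" and "\<tau> = (onorm S)\<^sup>2"
  have S: "bounded_clinear S" unfolding S_def by (rule rep_bounded_clinear[OF rep x])
  have adj: "adjoint_pair S S'" unfolding S'_def by (rule ell2_adjoint_pair[OF S])
  have S': "bounded_clinear S'" "onorm S' \<le> onorm S"
      by (rule adjoint_pair_bounded_clinear[OF adj S])+
  have "(cnorm A x)\<^sup>2 < \<tau>"
    unfolding \<tau>_def S_def by (rule power_strict_mono[OF less]) (simp_all add: cnorm_nonneg x)
  hence \<tau>: "\<tau> > 0" "(cnorm A x)\<^sup>2 < \<tau>" using zero_le_power2[of "cnorm A x"] by linarith+
  define h where "h = involution A x \<otimes> x"
  have h: "h \<in> carrier A" unfolding h_def using x by (simp add: involution_closed)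
  have nh: "cnorm A h < \<tau>" unfolding h_def cstar_identity[OF x] by (rule \<tau>(2))
  define y where "y = cscale A (complex_of_real (1 / \<tau>)) h"
  have y: "y \<in> carrier A" "cnorm A y < 1"
    using nh \<tau> by (simp_all add: y_def h cscale_closed cnorm_cscale norm_divide)
  have \<rho>y: "\<rho> y \<xi> = (1 / \<tau>) *\<^sub>R S' (S \<xi>)" for \<xi>
    unfolding y_def h_def using x h[unfolded h_def]
    by (simp add: rep_cscale[OF rep] rep_mult[OF rep] rep_involution[OF rep] involution_closed
        S_def S'_def
        scaleC_of_real del: of_real_divide)
  obtain Z where Z: "Z \<in> carrier A" "Z = \<one> \<oplus> Z \<otimes> y" by (rule neumann[OF y])
  have Z': "bounded_clinear (\<rho> Z)" by (rule rep_bounded_clinear[OF rep Z(1)])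
  \<comment> \<open>The maximum with 1 gives K > 0 and makes 1 - 1 / K^2 a factor in [0, 1).\<close>
  define K where "K = max 1 (onorm (\<rho> Z))"
  have K: "K \<ge> 1" "onorm (\<rho> Z) \<le> K" by (simp_all add: K_def)
  have bound: "norm (S \<xi>) \<le> sqrt (\<tau> * (1 - 1 / K\<^sup>2)) * norm \<xi>" for \<xi>
  proof -
    \<comment> \<open>w is (1 - S' S / \<tau>) applied to \<xi>, and \<open>\<rho> Z\<close> undoes
      this operator, so w cannot be much shorter than \<xi>; on the other hand w is short when S
      \<xi> is long.\<close>
    define w where "w = \<xi> - (1 / \<tau>) *\<^sub>R S' (S \<xi>)"
    have "\<rho> Z \<xi> = \<rho> (\<one> \<oplus> Z \<otimes> y) \<xi>" using Z(2) by simp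
    also have "\<dots> = \<xi> + \<rho> Z (\<rho> y \<xi>)"
      using Z(1) y by (simp add: rep_add[OF rep] rep_mult[OF rep] rep_one[OF rep])
    finally have "\<rho> Z w = \<xi>" by (simp add: w_def \<rho>y bounded_clinear_diff[OF Z'])
    hence "norm \<xi> \<le> onorm (\<rho> Z) * norm w" using bounded_clinear_norm_le[OF Z', of w] by simp
    also have "\<dots> \<le> K * norm w" by (rule mult_right_mono[OF K(2)]) simp
    finally have 1: "(norm \<xi>)\<^sup>2 \<le> K\<^sup>2 * (norm w)\<^sup>2"
      using power_mono[of "norm \<xi>" "K * norm w" 2] by (simp add: power_mult_distrib)
    have "inner \<xi> (S' (S \<xi>)) = (norm (S \<xi>))\<^sup>2"
      unfolding inner_eq_Re_cinner by (simp add: cinner_self flip: adjoint_pairD[OF adj])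
    hence "(norm w)\<^sup>2 = (norm \<xi>)\<^sup>2 - 2 / \<tau> * (norm (S \<xi>))\<^sup>2 + (norm (S' (S \<xi>)))\<^sup>2 / \<tau>\<^sup>2"
    proof -
      assume e: "inner \<xi> (S' (S \<xi>)) = (norm (S \<xi>))\<^sup>2"
      have "(norm w)\<^sup>2 = (norm \<xi>)\<^sup>2 - 2 * ((1 / \<tau>) * inner \<xi> (S' (S \<xi>))) + (1 / \<tau>)\<^sup>2 * (norm (S' (S
          \<xi>)))\<^sup>2"
        unfolding w_def power2_norm_eq_inner by (simp add: inner_diff_left inner_diff_right
            inner_commute power2_eq_square)
      thus ?thesis unfolding e by (simp add: power_divide)
    qed
    moreover have "(norm (S' (S \<xi>)))\<^sup>2 \<le> \<tau> * (norm (S \<xi>))\<^sup>2"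
    proof -
      have "norm (S' (S \<xi>)) \<le> onorm S * norm (S \<xi>)"
        by (rule order_trans[OF bounded_clinear_norm_le[OF S'(1)] mult_right_mono[OF S'(2)]]) simp
      from power_mono[OF this, of 2] show ?thesis by (simp add: \<tau>_def power_mult_distrib)
    qed
    hence "(norm (S' (S \<xi>)))\<^sup>2 / \<tau>\<^sup>2 \<le> (norm (S \<xi>))\<^sup>2 / \<tau>"
      using \<tau> by (simp add: divide_simps power2_eq_square mult_ac)
    ultimately have 2: "(norm w)\<^sup>2 \<le> (norm \<xi>)\<^sup>2 - (norm (S \<xi>))\<^sup>2 / \<tau>" by simp
    have "(norm \<xi>)\<^sup>2 \<le> K\<^sup>2 * ((norm \<xi>)\<^sup>2 - (norm (S \<xi>))\<^sup>2 / \<tau>)"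
      using order_trans[OF 1 mult_left_mono[OF 2]] by simp
    hence "(norm (S \<xi>))\<^sup>2 \<le> \<tau> * (1 - 1 / K\<^sup>2) * (norm \<xi>)\<^sup>2"
      using \<tau> K by (simp add: field_simps)
    hence "(norm (S \<xi>))\<^sup>2 \<le> (sqrt (\<tau> * (1 - 1 / K\<^sup>2)) * norm \<xi>)\<^sup>2"
      using \<tau> K by (simp add: power_mult_distrib divide_le_eq)
    thus ?thesis by (rule power2_le_imp_le) (use \<tau> K in \<open>simp add: divide_le_eq\<close>)
  qed
  have pos: "0 \<le> \<tau> * (1 - 1 / K\<^sup>2)" using \<tau> K by (simp add: divide_le_eq)
  have "onorm S \<le> sqrt (\<tau> * (1 - 1 / K\<^sup>2))"
    using bound pos by (intro onorm_bound) auto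
  hence "\<tau> \<le> \<tau> * (1 - 1 / K\<^sup>2)"
    unfolding \<tau>_def using power_mono[of "onorm S" "sqrt (\<tau> * (1 - 1 / K\<^sup>2))" 2] pos
    by (simp add: onorm_pos_le bounded_clinear_bounded_linear S \<tau>_def)
  moreover have "\<tau> * (1 / K\<^sup>2) > 0" using \<tau> K by simp
  ultimately show False by (simp add: right_diff_distrib)
qed

lemma rep_diff_le:
  fixes \<rho> :: "'a \<Rightarrow> 'i ell2 \<Rightarrow> 'i ell2"
  assumes rep: "star_representation A \<rho>" and xy: "x \<in> carrier A" "y \<in> carrier A"
  shows "norm (\<rho> x \<xi> - \<rho> y \<xi>) \<le> cstar_dist A x y * norm \<xi>"
proof -
  have d: "x \<ominus> y \<in> carrier A" using xy by simp
  have "\<rho> (x \<ominus> y) \<xi> = \<rho> x \<xi> - \<rho> y \<xi>"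
    using xy by (simp add: a_minus_def minus_eq_cscale rep_add[OF rep] rep_cscale[OF rep]
        cscale_closed
        complex_vector.scale_minus_left scaleC_one)
  moreover have "norm (\<rho> (x \<ominus> y) \<xi>) \<le> onorm (\<rho> (x \<ominus> y)) * norm \<xi>"
    by (rule bounded_clinear_norm_le[OF rep_bounded_clinear[OF rep d]])
  moreover have "onorm (\<rho> (x \<ominus> y)) * norm \<xi> \<le> cnorm A (x \<ominus> y) * norm \<xi>"
    by (intro mult_right_mono star_representation_contractive[OF rep d]) simp
  ultimately show ?thesis using xy by (simp add: cstar_dist_eq)
qed

end

section \<open>The representation and the torus action\<close>

context uq2
begin

sublocale cstar_completion R
  by unfold_locales (simp add: universal_seminorm_eq op_norm_cstar)

lemma u_eq: "u = op_norm" by (rule universal_seminorm_eq)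

abbreviation emb where "emb z \<equiv> cls (\<lambda>_. z)"

lemma C_Uq2_eq: "C_Uq2 q = \<A>" by (simp add: C_Uq2_def)

sublocale C: unital_cstar_algebra \<A> by (rule unital_cstar_algebra)

lemma gens_eq: "uq2_a q = emb a" "uq2_b q = emb b" "uq2_D q = emb d"
  by (simp_all add: uq2_a_def uq2_b_def uq2_D_def universal_gen_def free_gen_eq_letter)

lemma emb_subalgebra: "unital_star_subalgebra \<A> (range emb)"
  unfolding unital_star_subalgebra_def
  by (auto simp: cls_simps cauchy_intros)

text \<open>Constant classes are closed under the operations, and every free element is built from
  letters; so \<open>A_f q\<close> is the image of the free algebra and involves no limits.\<close>

lemma A_f_eq: "A_f q = range emb"
proof
  have "{emb a, emb b, emb d} \<subseteq> range emb" by blast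
  thus "A_f q \<subseteq> range emb"
    unfolding A_f_def generated_star_subalgebra_def C_Uq2_eq gens_eq
    using emb_subalgebra by (intro Inter_lower) simp
  show "range emb \<subseteq> A_f q"
    unfolding A_f_def generated_star_subalgebra_def C_Uq2_eq gens_eq
  proof (intro Inter_greatest subsetI)
    fix S X assume S: "S \<in> {S. unital_star_subalgebra \<A> S \<and> {emb a, emb b, emb d} \<subseteq> S}"
      and "X \<in> range emb"
    then obtain z where X: "X = emb z" by blast
    from S have S1: "emb 1 \<in> S" and S2: "\<And>x y. emb x \<in> S \<Longrightarrow> emb y \<in> S
      \<Longrightarrow> emb (x + y) \<in> S \<and> emb (x * y) \<in> S"
      and S3: "\<And>x. emb x \<in> S \<Longrightarrow> (\<forall>c. emb (free_scale c x) \<in> S) \<and> emb (free_star x) \<in> S"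
      and gens: "emb a \<in> S" "emb b \<in> S" "emb d \<in> S"
    proof -
      from S have sub: "unital_star_subalgebra \<A> S" and "{emb a, emb b, emb d} \<subseteq> S" by simp_all
      thus "emb a \<in> S" "emb b \<in> S" "emb d \<in> S" by simp_all
      note sub = sub[unfolded unital_star_subalgebra_def one_eq]
      show "emb 1 \<in> S" using sub by blast
      show "emb (x + y) \<in> S \<and> emb (x * y) \<in> S" if "emb x \<in> S" "emb y \<in> S" for x y
      proof -
        have "emb x \<oplus>\<^bsub>\<A>\<^esub> emb y \<in> S \<and> emb x \<otimes>\<^bsub>\<A>\<^esub> emb y \<in> S" using sub that by blast
        thus ?thesis by (simp add: cls_simps cauchy_const)
      qed
      show "(\<forall>c. emb (free_scale c x) \<in> S) \<and> emb (free_star x) \<in> S" if "emb x \<in> S" for x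
      proof -
        have "(\<forall>c. cscale \<A> c (emb x) \<in> S) \<and> involution \<A> (emb x) \<in> S" using sub that by blast
        thus ?thesis by (simp add: cls_simps cauchy_const)
      qed
    qed
    have letter: "emb (free_letter l) \<in> S" for l
    proof -
      obtain g s where l: "l = (g, s)" by (cases l)
      have "emb (free_letter (g, False)) \<in> S" using gens by (cases g) auto
      with S3[OF this] show ?thesis unfolding l by (cases s) (auto simp: free_star_letter)
    qed
    have "emb (Poly_Mapping.single (Star_Word ls) 1) \<in> S" for ls
      by (induction ls) (simp_all add: single_Star_Word_Nil single_Star_Word_Cons S1 S2 letter)
    hence "emb (Poly_Mapping.single w 1) \<in> S" for w by (metis star_word.collapse)
    hence "emb z \<in> S"
      by (induction z rule: free_star_algebra_induct) (use S2 S3 single_eq_free_scale in metis)+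
    thus "X \<in> S" using X by simp
  qed
qed

text \<open>The set of agreement is a *-subalgebra and so contains \<open>A_f q\<close>. Continuity
  is not part of the definition of a representation; automatic contractivity of both representations
  carries the agreement to limits.\<close>

lemma star_representation_unique:
  fixes \<rho> \<rho>' :: "uq2_carrier \<Rightarrow> 'i ell2 \<Rightarrow> 'i ell2"
  assumes \<rho>: "star_representation \<A> \<rho>" and \<rho>': "star_representation \<A> \<rho>'"
    and eq: "\<rho> (emb a) = \<rho>' (emb a)" "\<rho> (emb b) = \<rho>' (emb b)" "\<rho> (emb d) = \<rho>' (emb d)"
    and X: "X \<in> carrier \<A>"
  shows "\<rho> X = \<rho>' X"
proof -
  let ?S = "{X \<in> carrier \<A>. \<rho> X = \<rho>' X}"
  have "unital_star_subalgebra \<A> ?S"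
    unfolding unital_star_subalgebra_def
    by (auto simp: C.cscale_closed C.involution_closed rep_one[OF \<rho>] rep_one[OF \<rho>']
        rep_add[OF \<rho>] rep_add[OF \<rho>'] rep_mult[OF \<rho>] rep_mult[OF \<rho>'] rep_cscale[OF \<rho>] rep_cscale[OF
            \<rho>']
        rep_involution[OF \<rho>] rep_involution[OF \<rho>'] intro!: ext)
  moreover have "{emb a, emb b, emb d} \<subseteq> ?S" using eq by (simp add: cauchy_const)
  ultimately have "A_f q \<subseteq> ?S"
    unfolding A_f_def generated_star_subalgebra_def C_Uq2_eq gens_eq by (intro Inter_lower) simp
  hence emb: "\<rho> (emb z) = \<rho>' (emb z)" for z unfolding A_f_eq by blast
  obtain x where x: "cauchy x" "X = cls x" using X by (rule carrierE)
  show ?thesis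
  proof
    fix \<xi>
    have "norm (\<rho> X \<xi> - \<rho>' X \<xi>) \<le> 0"
    proof (rule field_le_epsilon)
      fix e :: real assume "e > 0"
      define \<delta> where "\<delta> = e / (2 * norm \<xi> + 1)"
      have \<delta>: "\<delta> > 0" using \<open>e > 0\<close> by (simp add: \<delta>_def add_nonneg_pos)
      then obtain m where m: "cstar_dist \<A> X (emb (x m)) < \<delta>" using dist_to_const[OF x(1)] x(2)
        by blast
      have E: "emb (x m) \<in> carrier \<A>" by (simp add: cauchy_const)
      have "norm (\<rho> X \<xi> - \<rho>' X \<xi>) = norm ((\<rho> X \<xi> - \<rho> (emb (x m)) \<xi>) - (\<rho>' X \<xi> - \<rho>' (emb (x m)) \<xi>))"
        by (simp add: emb)
      also have "\<dots> \<le> \<delta> * norm \<xi> + \<delta> * norm \<xi>"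
      proof (rule order_trans[OF norm_triangle_ineq4 add_mono])
        have le: "cstar_dist \<A> X (emb (x m)) * norm \<xi> \<le> \<delta> * norm \<xi>"
          using m by (intro mult_right_mono) auto
        show "norm (\<rho> X \<xi> - \<rho> (emb (x m)) \<xi>) \<le> \<delta> * norm \<xi>"
          by (rule order_trans[OF C.rep_diff_le[OF \<rho> X E] le])
        show "norm (\<rho>' X \<xi> - \<rho>' (emb (x m)) \<xi>) \<le> \<delta> * norm \<xi>"
          by (rule order_trans[OF C.rep_diff_le[OF \<rho>' X E] le])
      qed
      also have "\<dots> \<le> \<delta> * (2 * norm \<xi> + 1)" using \<delta> by (simp add: algebra_simps)
      also have "\<dots> = e"
      proof -
        have "2 * norm \<xi> + 1 \<noteq> 0" using norm_ge_zero[of \<xi>] by linarith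
        thus ?thesis by (simp add: \<delta>_def)
      qed
      finally show "norm (\<rho> X \<xi> - \<rho>' X \<xi>) \<le> 0 + e" by simp
    qed
    thus "\<rho> X \<xi> = \<rho>' X \<xi>" by simp
  qed
qed

definition free_blinfun :: "uq2_generator free_star_algebra \<Rightarrow> uq2_space \<Rightarrow>\<^sub>L uq2_space"
  where "free_blinfun z = Blinfun (free_rep q z)"

text \<open>Bounded operators form a Banach space, and the universal seminorm is the operator norm,
  so a Cauchy sequence of free elements has a norm limit there.\<close>

definition ext_rep :: "uq2_carrier \<Rightarrow> uq2_space \<Rightarrow>\<^sub>L uq2_space"
  where "ext_rep X = lim (\<lambda>n. free_blinfun (completion_rep X n))"

lemma free_blinfun_apply [simp]: "blinfun_apply (free_blinfun z) = free_rep q z"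
  by (simp add: free_blinfun_def bounded_linear_Blinfun_apply op_norm_bounded_linear)

lemma norm_free_blinfun: "norm (free_blinfun z) = u z"
  by (simp add: norm_blinfun.rep_eq u_eq op_norm_def)

lemma free_blinfun_diff: "free_blinfun (x - y) = free_blinfun x - free_blinfun y"
  by (rule blinfun_eqI) (simp add: free_rep_diff blinfun.diff_left)

lemma ext_rep_cls: assumes x: "cauchy x" shows "(\<lambda>n. free_blinfun (x n)) \<longlonglongrightarrow> ext_rep (cls x)"
proof -
  let ?x = "completion_rep (cls x)"
  have "Cauchy (\<lambda>n. free_blinfun (x n))"
  proof (rule metric_CauchyI)
    fix e :: real assume "e > 0"
    from cauchyD[OF x this] show "\<exists>M. \<forall>m\<ge>M. \<forall>n\<ge>M. dist (free_blinfun (x m)) (free_blinfun (x n)) <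
        e"
      by (simp add: dist_norm norm_free_blinfun flip: free_blinfun_diff)
  qed
  then obtain L where L: "(\<lambda>n. free_blinfun (x n)) \<longlonglongrightarrow> L"
    using Cauchy_convergent convergent_def by blast
  have "(\<lambda>n. free_blinfun (?x n) - free_blinfun (x n)) \<longlonglongrightarrow> 0"
    by (rule tendsto_norm_zero_cancel)
      (simp add: norm_free_blinfun rep_cls(2)[OF x] flip: free_blinfun_diff)
  from tendsto_add[OF this L] have "ext_rep (cls x) = L" by (simp add: ext_rep_def limI)
  with L show ?thesis by simp
qed

lemma ext_rep_eqI: "cauchy x \<Longrightarrow> (\<lambda>n. free_blinfun (x n)) \<longlonglongrightarrow> L \<Longrightarrow> ext_rep (cls x) = L"
  using LIMSEQ_unique ext_rep_cls by blast

lemma ext_rep_emb: "ext_rep (emb z) = free_blinfun z"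
  by (rule ext_rep_eqI[OF cauchy_const]) simp

lemma ext_rep_cls_apply: "cauchy x \<Longrightarrow> (\<lambda>n. free_rep q (x n) v) \<longlonglongrightarrow> ext_rep (cls x) v"
  using blinfun.tendsto[OF ext_rep_cls tendsto_const, of x v] by simp

text \<open>Isometry, and with it faithfulness, is the equality of universal seminorm and operator
  norm passed to limits.\<close>

lemma norm_ext_rep: assumes "X \<in> carrier \<A>" shows "norm (ext_rep X) = cnorm \<A> X"
proof -
  obtain x where x: "cauchy x" "X = cls x" using assms by (rule carrierE)
  have "(\<lambda>n. u (x n)) \<longlonglongrightarrow> norm (ext_rep X)"
    using tendsto_norm[OF ext_rep_cls[OF x(1)]] by (simp add: norm_free_blinfun x)
  thus ?thesis using cnorm_cls_eqI x by metis
qed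

lemma ext_rep_add:
  assumes "X \<in> carrier \<A>" "Y \<in> carrier \<A>"
  shows "ext_rep (X \<oplus>\<^bsub>\<A>\<^esub> Y) = ext_rep X + ext_rep Y" "ext_rep (X \<otimes>\<^bsub>\<A>\<^esub> Y) = ext_rep X o\<^sub>L ext_rep Y"
proof -
  obtain x y where x: "cauchy x" "X = cls x" and y: "cauchy y" "Y = cls y" using assms
    by (metis carrierE)
  have 1: "free_blinfun (v + w) = free_blinfun v + free_blinfun w" for v w
    by (rule blinfun_eqI) (simp add: free_rep_add blinfun.add_left)
  have 2: "free_blinfun (v * w) = free_blinfun v o\<^sub>L free_blinfun w" for v w
    by (rule blinfun_eqI) (simp add: free_rep_mult)
  show "ext_rep (X \<oplus>\<^bsub>\<A>\<^esub> Y) = ext_rep X + ext_rep Y"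
    unfolding x y add_cls[OF x(1) y(1)]
    by (rule ext_rep_eqI) (simp_all add: cauchy_intros x y 1 tendsto_add ext_rep_cls)
  show "ext_rep (X \<otimes>\<^bsub>\<A>\<^esub> Y) = ext_rep X o\<^sub>L ext_rep Y"
    unfolding x y mult_cls[OF x(1) y(1)]
    by (rule ext_rep_eqI)
      (simp_all add: cauchy_intros x y 2 bounded_bilinear.tendsto[OF
          bounded_bilinear_blinfun_compose] ext_rep_cls)
qed

lemma ext_rep_cscale: assumes "X \<in> carrier \<A>" shows "ext_rep (cscale \<A> c X) v = c *\<^sub>C ext_rep X v"
proof -
  obtain x where x: "cauchy x" "X = cls x" using assms by (rule carrierE)
  have "(\<lambda>n. free_rep q (free_scale c (x n)) v) \<longlonglongrightarrow> c *\<^sub>C ext_rep X v"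
    unfolding free_rep_scale x by (intro tendsto_scaleC tendsto_const ext_rep_cls_apply x)
  thus ?thesis
    unfolding x cscale_cls[OF x(1)] using ext_rep_cls_apply[OF cauchy_scale[OF x(1)]]
        LIMSEQ_unique by blast
qed

lemma ext_rep_bounded_clinear: assumes "X \<in> carrier \<A>" shows "bounded_clinear (ext_rep X)"
  unfolding bounded_clinear_def
proof (intro conjI allI blinfun.bounded_linear_right)
  fix c v
  obtain x where x: "cauchy x" "X = cls x" using assms by (rule carrierE)
  have "(\<lambda>n. free_rep q (x n) (c *\<^sub>C v)) \<longlonglongrightarrow> c *\<^sub>C ext_rep X v"
    unfolding bounded_clinear_scaleC[OF free_rep_bounded_clinear] x
    by (intro tendsto_scaleC tendsto_const ext_rep_cls_apply x)
  thus "ext_rep X (c *\<^sub>C v) = c *\<^sub>C ext_rep X v"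
    unfolding x using ext_rep_cls_apply[OF x(1)] LIMSEQ_unique by blast
qed

lemma ext_rep_adjoint_pair:
  assumes "X \<in> carrier \<A>" shows "adjoint_pair (ext_rep X) (ext_rep (involution \<A> X))"
  unfolding adjoint_pair_def
proof (intro allI)
  fix v w
  obtain x where x: "cauchy x" "X = cls x" using assms by (rule carrierE)
  have "(\<lambda>n. cinner (free_rep q (x n) v) w) \<longlonglongrightarrow> cinner (ext_rep X v) w"
    unfolding x by (intro tendsto_cinner tendsto_const ext_rep_cls_apply x)
  moreover have "(\<lambda>n. cinner (free_rep q (x n) v) w) \<longlonglongrightarrow> cinner v (ext_rep (involution \<A> X) w)"
    unfolding x involution_cls[OF x(1)] adjoint_pairD[OF free_rep_adjoint_pair]
    by (intro tendsto_cinner tendsto_const ext_rep_cls_apply cauchy_star x)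
  ultimately show "cinner (ext_rep X v) w = cinner v (ext_rep (involution \<A> X) w)"
    by (rule LIMSEQ_unique)
qed

lemma ext_rep_one: "blinfun_apply (ext_rep \<one>\<^bsub>\<A>\<^esub>) = id"
  by (simp add: one_eq ext_rep_emb free_rep_one)

lemma star_representation_ext_rep: "star_representation \<A> (\<lambda>X. blinfun_apply (ext_rep X))"
  unfolding star_representation_on_def
  by (auto simp: ext_rep_bounded_clinear ext_rep_one ext_rep_add blinfun.add_left ext_rep_cscale
      cadjoint_eqI[OF ext_rep_adjoint_pair])

lemma ext_rep_inj: assumes "X \<in> carrier \<A>" "Y \<in> carrier \<A>" "ext_rep X = ext_rep Y" shows "X = Y"
proof -
  have "cnorm \<A> (X \<ominus>\<^bsub>\<A>\<^esub> Y) = norm (ext_rep (X \<ominus>\<^bsub>\<A>\<^esub> Y))" using assms by (simp add: norm_ext_rep)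
  also have "ext_rep (X \<ominus>\<^bsub>\<A>\<^esub> Y) = 0"
    using assms by (intro blinfun_eqI)
      (simp add: a_minus_def C.minus_eq_cscale ext_rep_add ext_rep_cscale C.cscale_closed
          blinfun.add_left
        complex_vector.scale_minus_left scaleC_one)
  finally have "cstar_dist \<A> X Y = 0" using assms by (simp add: C.cstar_dist_eq)
  thus ?thesis using assms by simp
qed

lemma letter_op_ket:
  "letter_op q (GenA, False) (ket (i, j, k)) = complex_of_real (sqrt (1 - cmod q ^ (2 * i + 2)))
      *\<^sub>C ket (i + 1, j, k)"
  "letter_op q (GenB, False) (ket (i, j, k)) = q ^ i *\<^sub>C ket (i, j + 1, k)"
  "letter_op q (GenD, False) (ket (i, j, k)) = dphase q j *\<^sub>C ket (i, j, k + 1)"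
proof -
  have t: "cmod q ^ (2 * i + 2) = t ^ (i + 1)" unfolding t_def power_mult[symmetric] by simp
  show "letter_op q (GenA, False) (ket (i, j, k)) = complex_of_real (sqrt (1 - cmod q ^ (2 * i +
      2))) *\<^sub>C ket (i + 1, j, k)"
  proof (rule ell2_eqI)
    fix y :: "nat \<times> int \<times> int"
    obtain i' j' k' where "y = (i', j', k')" by (metis prod_cases3)
    thus "Rep_ell2 (letter_op q (GenA, False) (ket (i, j, k))) y
        = Rep_ell2 (complex_of_real (sqrt (1 - cmod q ^ (2 * i + 2))) *\<^sub>C ket (i + 1, j, k)) y"
      unfolding t by (cases i') (auto simp: Rep_letter_ops Rep_ell2_ket)
  qed
  show "letter_op q (GenB, False) (ket (i, j, k)) = q ^ i *\<^sub>C ket (i, j + 1, k)"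
    "letter_op q (GenD, False) (ket (i, j, k)) = dphase q j *\<^sub>C ket (i, j, k + 1)"
    by (rule ell2_eqI, unfold split_paired_all, auto simp: Rep_letter_ops Rep_ell2_ket)+
qed

text \<open>\<open>ext_rep\<close> gives existence for the definite description; uniqueness reduces
  to generators and basis vectors. The restriction matches the \<open>extensional\<close> clause,
  which fixes the values outside the carrier.\<close>

lemma uq2_rep_eq: "uq2_rep q = restrict (\<lambda>X. blinfun_apply (ext_rep X)) (carrier \<A>)"
proof -
  let ?P = "\<lambda>\<pi> :: uq2_carrier \<Rightarrow> uq2_space \<Rightarrow> uq2_space. \<pi> \<in> extensional (carrier \<A>) \<and>
      star_representation \<A> \<pi> \<and>
     (\<forall>i j k.
        \<pi> (emb a) (ket (i, j, k)) = complex_of_real (sqrt (1 - cmod q ^ (2 * i + 2))) *\<^sub>C ket (i +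
            1, j, k) \<and>
        \<pi> (emb b) (ket (i, j, k)) = q ^ i *\<^sub>C ket (i, j + 1, k) \<and>
        \<pi> (emb d) (ket (i, j, k)) = dphase q j *\<^sub>C ket (i, j, k + 1))"
  let ?\<pi> = "restrict (\<lambda>X. blinfun_apply (ext_rep X)) (carrier \<A>)"
  have E: "emb z \<in> carrier \<A>" for z by (simp add: cauchy_const)
  have "star_representation \<A> ?\<pi>"
    using star_representation_ext_rep
    by (simp add: star_representation_on_def C.cscale_closed C.involution_closed)
  hence P: "?P ?\<pi>" by (simp add: E ext_rep_emb free_rep_letter letter_op_ket)
  moreover have "\<pi> = ?\<pi>" if \<pi>: "?P \<pi>" for \<pi>
  proof (rule extensionalityI)
    from \<pi> P have reps: "star_representation \<A> \<pi>" "star_representation \<A> ?\<pi>" by blast+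
    have eq: "\<pi> (emb z) = ?\<pi> (emb z)" if "\<And>x. \<pi> (emb z) (ket x) = ?\<pi> (emb z) (ket x)" for z
      by (rule bounded_clinear_eq_on_ket[OF rep_bounded_clinear[OF reps(1) E]
          rep_bounded_clinear[OF reps(2) E] that])
    show "\<pi> X = ?\<pi> X" if "X \<in> carrier \<A>" for X
    proof (rule star_representation_unique[OF reps eq eq eq that])
      fix x :: "nat \<times> int \<times> int"
      obtain i j k where x: "x = (i, j, k)" by (metis prod_cases3)
      from \<pi> P show "\<pi> (emb a) (ket x) = ?\<pi> (emb a) (ket x)" "\<pi> (emb b) (ket x) = ?\<pi> (emb b) (ket
          x)"
        "\<pi> (emb d) (ket x) = ?\<pi> (emb d) (ket x)"
        unfolding x by metis+
    qed
    show "\<pi> \<in> extensional (carrier \<A>)" "?\<pi> \<in> extensional (carrier \<A>)" using \<pi> P by simp_all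
  qed
  ultimately have "(THE \<pi>. ?P \<pi>) = ?\<pi>" by (rule the_equality)
  thus ?thesis unfolding uq2_rep_def C_Uq2_eq gens_eq dphase_def by simp
qed

end

section \<open>The torus and its unitary representation\<close>

lemma circle_group: "Group.group circle_group"
proof (rule groupI)
  fix x assume "x \<in> carrier circle_group"
  hence "cnj x \<in> carrier circle_group \<and> cnj x \<otimes>\<^bsub>circle_group\<^esub> x = \<one>\<^bsub>circle_group\<^esub>"
    by (simp add: circle_group_def complex_norm_square[symmetric] mult.commute[of "cnj x"])
  thus "\<exists>y\<in>carrier circle_group. y \<otimes>\<^bsub>circle_group\<^esub> x = \<one>\<^bsub>circle_group\<^esub>" by blast
qed (auto simp: circle_group_def norm_mult)

lemma torus3_simps:
  "carrier torus3 = sphere 0 1 \<times> sphere 0 1 \<times> sphere 0 1"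
  "(x1, x2, x3) \<otimes>\<^bsub>torus3\<^esub> (y1, y2, y3) = (x1 * y1, x2 * y2, x3 * y3)"
  "\<one>\<^bsub>torus3\<^esub> = (1, 1, 1)"
  by (simp_all add: torus3_def circle_group_def DirProd_def)

lemma torus3_group: "Group.group torus3"
  unfolding torus3_def by (intro DirProd_group circle_group)

lemma torus3_inv:
  assumes "g \<in> carrier torus3"
  shows "inv\<^bsub>torus3\<^esub> g = (cnj (fst g), cnj (fst (snd g)), cnj (snd (snd g)))"
proof (rule group.inv_equality[OF torus3_group])
  show "(cnj (fst g), cnj (fst (snd g)), cnj (snd (snd g))) \<otimes>\<^bsub>torus3\<^esub> g = \<one>\<^bsub>torus3\<^esub>"
    using assms by (cases g) (auto simp: torus3_simps complex_norm_square[symmetric]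
        mult.commute[of "cnj _"])
qed (use assms in \<open>auto simp: torus3_simps\<close>)

lemma torus3_compact_group: "compact_group torus3 (top_of_set (carrier torus3))"
proof -
  let ?T = "carrier torus3" and ?X = "top_of_set (carrier torus3)"
  have "compact ?T" unfolding torus3_simps by (intro compact_Times) auto
  hence c: "compact_space ?X" by (simp add: compact_space_subtopology)
  have mult: "continuous_map (prod_topology ?X ?X) ?X (\<lambda>(g, h). g \<otimes>\<^bsub>torus3\<^esub> h)"
  proof -
    let ?m = "\<lambda>p. (fst (fst p) * fst (snd p), fst (snd (fst p)) * fst (snd (snd p)), snd (snd (fst
        p)) * snd (snd (snd p)))"
    have "(\<lambda>(g, h). g \<otimes>\<^bsub>torus3\<^esub> h) = ?m"
      by (rule ext) (simp add: case_prod_unfold torus3_simps(2)[symmetric])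
    moreover have "continuous_on (?T \<times> ?T) ?m" by (intro continuous_intros)
    moreover have "?m \<in> ?T \<times> ?T \<rightarrow> ?T" by (auto simp: torus3_simps norm_mult)
    moreover have "prod_topology ?X ?X = top_of_set (?T \<times> ?T)"
      by (simp flip: subtopology_Times euclidean_product_topology)
    ultimately show ?thesis by simp
  qed
  have inv: "continuous_map ?X ?X (\<lambda>g. inv\<^bsub>torus3\<^esub> g)"
  proof (rule continuous_map_eq)
    show "continuous_map ?X ?X (\<lambda>g. (cnj (fst g), cnj (fst (snd g)), cnj (snd (snd g))))"
      by (auto simp: torus3_simps intro!: continuous_intros)
  qed (simp add: torus3_inv)
  show ?thesis
    unfolding compact_group_def
    using torus3_group c mult inv by (simp add: Hausdorff_space_subtopology)
qed

text \<open>The characters of T^3, indexed by Z^3 in the form in which \<open>word_deg\<close> and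
  \<open>index_deg\<close> take their values.\<close>

fun torus_char :: "complex \<times> complex \<times> complex \<Rightarrow> int \<times> int \<times> int \<Rightarrow> complex" where
  "torus_char (z1, z2, z3) (n, m, l) = z1 powi n * z2 powi m * z3 powi l"

lemma torus_char_add: "g \<in> carrier torus3 \<Longrightarrow> torus_char g (\<alpha> + \<beta>) = torus_char g \<alpha> * torus_char g \<beta>"
proof -
  assume "g \<in> carrier torus3"
  moreover obtain z1 z2 z3 where "g = (z1, z2, z3)" by (metis prod_cases3)
  ultimately have g: "g = (z1, z2, z3)" "z1 \<noteq> 0" "z2 \<noteq> 0" "z3 \<noteq> 0" by (auto simp: torus3_simps)
  show ?thesis by (cases \<alpha>; cases \<beta>) (simp add: g power_int_add mult_ac)
qed

lemma torus_char_mult: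
  "torus_char (g \<otimes>\<^bsub>torus3\<^esub> h) \<alpha> = torus_char g \<alpha> * torus_char h \<alpha>"
  by (cases g; cases h; cases \<alpha>) (simp add: torus3_simps power_int_mult_distrib)

lemma torus_char_one: "torus_char \<one>\<^bsub>torus3\<^esub> \<alpha> = 1"
  by (cases \<alpha>) (simp add: torus3_simps)

lemma cmod_torus_char: "g \<in> carrier torus3 \<Longrightarrow> cmod (torus_char g \<alpha>) = 1"
  by (cases g; cases \<alpha>) (auto simp: torus3_simps norm_mult norm_power_int)

lemma torus_char_cnj: "g \<in> carrier torus3 \<Longrightarrow> torus_char g \<alpha> * cnj (torus_char g \<alpha>) = 1"
  by (simp add: complex_norm_square[symmetric] cmod_torus_char)

lemma continuous_on_torus_char: "continuous_on (carrier torus3) (\<lambda>g. torus_char g \<alpha>)"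
proof -
  obtain n m l where \<alpha>: "\<alpha> = (n, m, l)" by (metis prod_cases3)
  have "continuous_on (carrier torus3) (\<lambda>g. fst g powi n * fst (snd g) powi m * snd (snd g) powi l)"
    by (intro continuous_intros) (auto simp: torus3_simps)
  moreover have "torus_char g \<alpha> = fst g powi n * fst (snd g) powi m * snd (snd g) powi l" for g
    by (cases g) (simp add: \<alpha>)
  ultimately show ?thesis by simp
qed

context
  fixes g :: "complex \<times> complex \<times> complex"
  assumes g: "g \<in> carrier torus3"
begin

lemma torus_unitary_eq: "torus_unitary g = diag_op (\<lambda>x. torus_char g (index_deg x))"
proof -
  obtain z1 z2 z3 where z: "g = (z1, z2, z3)" by (metis prod_cases3)
  let ?V = "diag_op (\<lambda>x. torus_char g (index_deg x))"
  have le: "cmod (torus_char g (index_deg x)) \<le> 1" for x by (simp add: cmod_torus_char g)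
  have b: "bounded_clinear ?V" by (rule diag_op_bounded_clinear[OF le])
  have ket: "?V (ket (i, j, k)) = (z1 ^ i * z2 powi j * z3 powi k) *\<^sub>C ket (i, j, k)" for i j k
    by (rule ell2_eqI) (simp add: Rep_diag_op[OF le] Rep_ell2_ket, simp add: z)
  show ?thesis
    unfolding torus_unitary_def z
  proof (simp, rule the_equality)
    show "bounded_clinear (diag_op (\<lambda>x. torus_char (z1, z2, z3) (index_deg x))) \<and>
      (\<forall>i j k. diag_op (\<lambda>x. torus_char (z1, z2, z3) (index_deg x)) (ket (i, j, k))
        = (z1 ^ i * z2 powi j * z3 powi k) *\<^sub>C ket (i, j, k))"
      using b ket by (simp add: z)
    fix V assume V: "bounded_clinear V \<and> (\<forall>i j k. V (ket (i, j, k)) = (z1 ^ i * z2 powi j * z3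
        powi k) *\<^sub>C ket (i, j, k))"
    show "V = diag_op (\<lambda>x. torus_char (z1, z2, z3) (index_deg x))"
    proof (rule bounded_clinear_eq_on_ket)
      fix x :: "nat \<times> int \<times> int"
      show "V (ket x) = diag_op (\<lambda>x. torus_char (z1, z2, z3) (index_deg x)) (ket x)"
        using V ket[unfolded z] by (cases x) simp
    qed (use V b z in simp_all)
  qed
qed

lemma Rep_torus_unitary: "Rep_ell2 (torus_unitary g v) x = torus_char g (index_deg x) * Rep_ell2 v
    x"
  unfolding torus_unitary_eq by (rule Rep_diag_op[of _ 1]) (simp add: cmod_torus_char g)

lemma torus_unitary_bounded_clinear: "bounded_clinear (torus_unitary g)"
  unfolding torus_unitary_eq by (rule diag_op_bounded_clinear[of _ 1]) (simp add: cmod_torus_char g)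

lemma torus_unitary_adjoint:
  "adjoint_pair (torus_unitary g) (cadjoint (torus_unitary g))"
  by (rule ell2_adjoint_pair[OF torus_unitary_bounded_clinear])

lemma cadjoint_torus_unitary: "cadjoint (torus_unitary g) = diag_op (\<lambda>x. cnj (torus_char g
    (index_deg x)))"
  unfolding torus_unitary_eq by (rule cadjoint_eqI[OF adjoint_pair_diag_op[of _ 1]]) (simp add:
      cmod_torus_char g)

lemma Rep_cadjoint_torus_unitary:
  "Rep_ell2 (cadjoint (torus_unitary g) v) x = cnj (torus_char g (index_deg x)) * Rep_ell2 v x"
  unfolding cadjoint_torus_unitary by (rule Rep_diag_op[of _ 1]) (simp add: cmod_torus_char g)

lemma torus_unitary_inverse:
  "torus_unitary g (cadjoint (torus_unitary g) v) = v" "cadjoint (torus_unitary g) (torus_unitary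
      g v) = v"
  by (rule ell2_eqI; simp add: Rep_torus_unitary Rep_cadjoint_torus_unitary torus_char_cnj[OF g]
      mult.commute[of "cnj _"] flip: mult.assoc)+

lemma norm_torus_unitary: "norm (torus_unitary g v) = norm v"
proof -
  have "(norm (torus_unitary g v))\<^sup>2 = (norm v)\<^sup>2"
    unfolding norm_ell2_sq by (simp add: Rep_torus_unitary norm_mult cmod_torus_char g)
  thus ?thesis by simp
qed

lemma torus_unitary2_eq: "torus_unitary2 g = map_prod (torus_unitary g) (torus_unitary g)"
  by (auto simp: torus_unitary2_def)

lemma torus_unitary2_adjoint:
  "cadjoint (torus_unitary2 g) = map_prod (cadjoint (torus_unitary g)) (cadjoint (torus_unitary g))"
  unfolding torus_unitary2_eq by (intro cadjoint_eqI map_prod_adjoint_pair torus_unitary_adjoint)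

lemma unitary_torus_unitary2: "unitary (torus_unitary2 g)"
  unfolding unitary_def torus_unitary2_adjoint
  unfolding torus_unitary2_eq
  by (auto intro: map_prod_bounded_clinear torus_unitary_bounded_clinear simp:
      torus_unitary_inverse)

end

lemma torus_unitary_mult:
  assumes "g \<in> carrier torus3" "h \<in> carrier torus3"
  shows "torus_unitary (g \<otimes>\<^bsub>torus3\<^esub> h) v = torus_unitary g (torus_unitary h v)"
proof -
  have "g \<otimes>\<^bsub>torus3\<^esub> h \<in> carrier torus3"
    using assms by (intro monoid.m_closed group.is_monoid torus3_group)
  thus ?thesis by (intro ell2_eqI) (simp add: Rep_torus_unitary assms torus_char_mult mult.assoc)
qed

lemma torus_unitary_one: "torus_unitary \<one>\<^bsub>torus3\<^esub> v = v"
proof -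
  have "\<one>\<^bsub>torus3\<^esub> \<in> carrier torus3" by (simp add: torus3_simps)
  thus ?thesis by (intro ell2_eqI) (simp add: Rep_torus_unitary torus_char_one)
qed

text \<open>On a finite truncation of v only finitely many characters occur, so continuity is clear
  there; unitarity makes the truncation error uniform in the group element.\<close>

lemma continuous_on_torus_unitary: "continuous_on (carrier torus3) (\<lambda>g. torus_unitary g v)"
  unfolding continuous_on_iff
proof (intro ballI allI impI)
  fix g and e :: real assume g: "g \<in> carrier torus3" and e: "e > 0"
  obtain F where F: "finite F" "norm (v - ell2_restrict F v) < e / 3"
    using ell2_restrict_approx[of "e / 3"] e by auto
  let ?w = "ell2_restrict F v"
  have w: "torus_unitary h ?w = (\<Sum>x\<in>F. (Rep_ell2 v x * torus_char h (index_deg x)) *\<^sub>C ket x)"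
    if h: "h \<in> carrier torus3" for h
    by (rule ell2_eqI) (auto simp: Rep_torus_unitary[OF h] ell2_restrict_sum F(1) Rep_ell2_ket
        if_distrib[of "(*) _"] sum.delta' mult.commute cong: if_cong)
  have "continuous_on (carrier torus3) (\<lambda>h. \<Sum>x\<in>F. (Rep_ell2 v x * torus_char h (index_deg x)) *\<^sub>C
      ket x)"
    by (intro continuous_intros continuous_on_torus_char
        bounded_bilinear.continuous_on[OF bounded_bilinear_scaleC])
  hence "continuous_on (carrier torus3) (\<lambda>h. torus_unitary h ?w)"
    by (rule continuous_on_eq) (simp add: w)
  then obtain \<delta> where \<delta>: "\<delta> > 0"
    "\<And>h. h \<in> carrier torus3 \<Longrightarrow> dist h g < \<delta> \<Longrightarrow> dist (torus_unitary h ?w) (torus_unitary g ?w) < e / 3"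
    using g e unfolding continuous_on_iff by (metis divide_pos_pos zero_less_numeral)
  have "dist (torus_unitary h v) (torus_unitary g v) < e"
      if h: "h \<in> carrier torus3" "dist h g < \<delta>" for h
  proof -
    have close: "dist (torus_unitary k v) (torus_unitary k ?w) < e / 3" if k: "k \<in> carrier torus3"
        for k
      unfolding dist_norm bounded_clinear_diff[OF torus_unitary_bounded_clinear[OF k], symmetric]
      using F(2) by (simp add: norm_torus_unitary[OF k])
    have "dist (torus_unitary h v) (torus_unitary g v) \<le> dist (torus_unitary h v) (torus_unitary h
        ?w)
        + dist (torus_unitary h ?w) (torus_unitary g ?w) + dist (torus_unitary g v) (torus_unitary
            g ?w)"
      by metric
    thus ?thesis using close[OF h(1)] close[OF g] \<delta>(2)[OF h] by simp
  qed
  thus "\<exists>\<delta>>0. \<forall>h\<in>carrier torus3. dist h g < \<delta> \<longrightarrow> dist (torus_unitary h v) (torus_unitary g v) < e"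
    using \<delta>(1) by blast
qed

lemma torus_unitary_representation:
  "unitary_representation torus3 (top_of_set (carrier torus3)) torus_unitary2"
  unfolding unitary_representation_def
proof (intro conjI ballI allI)
  show "continuous_map (top_of_set (carrier torus3)) euclidean (\<lambda>g. torus_unitary2 g \<xi>)" for \<xi>
    by (cases \<xi>) (simp add: torus_unitary2_def continuous_on_Pair continuous_on_torus_unitary)
  fix g h assume "g \<in> carrier torus3" "h \<in> carrier torus3"
  thus "torus_unitary2 (g \<otimes>\<^bsub>torus3\<^esub> h) = torus_unitary2 g \<circ> torus_unitary2 h"
    by (auto simp: torus_unitary2_def torus_unitary_mult)
qed (rule unitary_torus_unitary2)

section \<open>The torus action on the C*-algebra\<close>

context uq2
begin

definition free_torus :: "complex \<times> complex \<times> complex \<Rightarrow> uq2_generator free_star_algebra \<Rightarrow>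
    uq2_generator free_star_algebra"
  where "free_torus g x = Poly_Mapping.mapp (\<lambda>w c. torus_char g (word_deg w) * c) x"

lemma lookup_free_torus:
  "Poly_Mapping.lookup (free_torus g x) w = torus_char g (word_deg w) * Poly_Mapping.lookup x w"
  by (auto simp: free_torus_def lookup_mapp when_def in_keys_iff)

lemma free_torus_add: "free_torus g (x + y) = free_torus g x + free_torus g y"
  and free_torus_diff: "free_torus g (x - y) = free_torus g x - free_torus g y"
  by (rule poly_mapping_eqI; simp add: lookup_free_torus lookup_add lookup_minus algebra_simps)+

lemma free_torus_single:
  "free_torus g (Poly_Mapping.single w c) = free_scale (torus_char g (word_deg w))
      (Poly_Mapping.single w c)"
  by (rule poly_mapping_eqI) (simp add: lookup_free_torus lookup_free_scale lookup_single when_def)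

definition torus_act :: "complex \<times> complex \<times> complex \<Rightarrow> uq2_carrier \<Rightarrow> uq2_carrier"
  where "torus_act g x = cls (\<lambda>n. free_torus g (completion_rep x n))"

context
  fixes g :: "complex \<times> complex \<times> complex"
  assumes g: "g \<in> carrier torus3"
begin

lemma torus_unitary_letter_op:
  "torus_unitary g (letter_op q l v) = torus_char g (letter_deg l) *\<^sub>C letter_op q l (torus_unitary
      g v)"
proof (rule ell2_eqI)
  fix y
  show "Rep_ell2 (torus_unitary g (letter_op q l v)) y
      = Rep_ell2 (torus_char g (letter_deg l) *\<^sub>C letter_op q l (torus_unitary g v)) y"
    using letter_shift_deg[of l y]
    by (cases "letter_weight q l y = 0")
      (simp_all add: Rep_torus_unitary[OF g] Rep_letter_op torus_char_add[OF g] mult_ac)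
qed

lemma torus_unitary_word_op:
  "torus_unitary g (word_op q w v) = torus_char g (word_deg w) *\<^sub>C word_op q w (torus_unitary g v)"
proof -
  have "torus_unitary g (word_op q (Star_Word ls) v)
      = torus_char g (word_deg (Star_Word ls)) *\<^sub>C word_op q (Star_Word ls) (torus_unitary g v)"
        for ls
  proof (induction ls)
    case Nil
    have "torus_char g 0 = 1" by (cases g) (simp add: zero_prod_def)
    thus ?case by (simp add: word_op_Nil scaleC_one)
  next
    case (Cons l ls)
    thus ?case
      by (simp add: word_op_Cons torus_unitary_letter_op torus_char_add[OF g]
          bounded_clinear_scaleC[OF letter_op_bounded_clinear] scaleC_scaleC)
  qed
  thus ?thesis by (metis star_word.collapse)
qed

text \<open>The action is implemented by conjugation with \<open>torus_unitary g\<close>. Hence it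
  does not increase the operator norm, extends to the completion, and inherits its algebraic
  properties from conjugation.\<close>

lemma free_rep_torus: "free_rep q (free_torus g x) (torus_unitary g v) = torus_unitary g (free_rep
    q x v)"
proof (induction x rule: free_star_algebra_induct)
  case (single w c)
  note U = torus_unitary_bounded_clinear[OF g]
  show ?case
    by (simp add: free_torus_single free_rep_scale free_rep_single torus_unitary_word_op
        bounded_clinear_scaleC[OF U] scaleC_scaleC mult.commute)
qed (simp add: free_torus_add free_rep_add bounded_clinear_add[OF torus_unitary_bounded_clinear[OF
    g]])

lemma u_free_torus_le: "u (free_torus g x) \<le> u x"
  unfolding u_eq op_norm_def[of "free_torus g x"]
proof (rule onorm_bound)
  fix v
  have "norm (free_rep q (free_torus g x) (torus_unitary g (cadjoint (torus_unitary g) v)))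
      \<le> op_norm x * norm (torus_unitary g (cadjoint (torus_unitary g) v))"
    unfolding free_rep_torus norm_torus_unitary[OF g] by (rule free_rep_norm_le)
  thus "norm (free_rep q (free_torus g x) v) \<le> op_norm x * norm v"
    by (simp add: torus_unitary_inverse[OF g])
qed simp

lemma cauchy_free_torus: "cauchy x \<Longrightarrow> cauchy (\<lambda>n. free_torus g (x n))"
  by (rule cauchy_dominated[of x x 1])
    (simp_all flip: free_torus_diff add: order_trans[OF u_free_torus_le])

lemma torus_act_cls: assumes x: "cauchy x" shows "torus_act g (cls x) = cls (\<lambda>n. free_torus g (x
    n))"
  unfolding torus_act_def
proof (rule cls_eqI, rule tendsto_sandwich[OF _ _ tendsto_const rep_cls(2)[OF x]])
  show "\<forall>\<^sub>F n in sequentially. u (free_torus g (completion_rep (cls x) n) - free_torus g (x n))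
      \<le> u (completion_rep (cls x) n - x n)"
    by (simp flip: free_torus_diff add: u_free_torus_le)
qed simp

lemma torus_act_closed: "x \<in> carrier \<A> \<Longrightarrow> torus_act g x \<in> carrier \<A>"
  by (metis carrierE torus_act_cls cauchy_free_torus cls_closed)

lemma ext_rep_torus_act:
  assumes "x \<in> carrier \<A>" shows "ext_rep (torus_act g x) (torus_unitary g v) = torus_unitary g
      (ext_rep x v)"
proof -
  obtain y where y: "cauchy y" "x = cls y" using assms by (rule carrierE)
  have "(\<lambda>n. torus_unitary g (free_rep q (y n) v)) \<longlonglongrightarrow> torus_unitary g (ext_rep x v)"
    unfolding y(2)
    by (intro bounded_linear.tendsto[OF bounded_clinear_bounded_linear[OF
        torus_unitary_bounded_clinear[OF g]]]
        ext_rep_cls_apply y)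
  moreover have "(\<lambda>n. torus_unitary g (free_rep q (y n) v)) \<longlonglongrightarrow> ext_rep (torus_act g x)
      (torus_unitary g v)"
    unfolding y(2) torus_act_cls[OF y(1)] free_rep_torus[symmetric]
    by (intro ext_rep_cls_apply cauchy_free_torus y)
  ultimately show ?thesis by (rule LIMSEQ_unique[symmetric])
qed

text \<open>Faithfulness of \<open>ext_rep\<close> lets identities in the algebra be checked on
  operators, where the action is conjugation by a unitary.\<close>

lemma torus_act_eqI:
  assumes "x \<in> carrier \<A>" "y \<in> carrier \<A>"
    and "\<And>v. ext_rep y (torus_unitary g v) = torus_unitary g (ext_rep x v)"
  shows "torus_act g x = y"
proof (rule ext_rep_inj[OF torus_act_closed[OF assms(1)] assms(2)], rule blinfun_eqI)
  fix v
  show "ext_rep (torus_act g x) v = ext_rep y v"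
    using ext_rep_torus_act[OF assms(1), of "cadjoint (torus_unitary g) v"]
      assms(3)[of "cadjoint (torus_unitary g) v"]
    by (simp add: torus_unitary_inverse[OF g])
qed

lemma torus_act_hom: "unital_star_hom \<A> \<A> (torus_act g)"
  unfolding unital_star_hom_def
proof (intro conjI ballI allI)
  note U = torus_unitary_bounded_clinear[OF g]
  show "torus_act g \<in> ring_hom \<A> \<A>"
  proof (rule ring_hom_memI)
    fix x y assume xy: "x \<in> carrier \<A>" "y \<in> carrier \<A>"
    show "torus_act g (x \<otimes>\<^bsub>\<A>\<^esub> y) = torus_act g x \<otimes>\<^bsub>\<A>\<^esub> torus_act g y"
      "torus_act g (x \<oplus>\<^bsub>\<A>\<^esub> y) = torus_act g x \<oplus>\<^bsub>\<A>\<^esub> torus_act g y"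
      by (rule torus_act_eqI; simp add: xy torus_act_closed ext_rep_add ext_rep_torus_act
          blinfun.add_left bounded_clinear_add[OF U])+
  next
    show "torus_act g \<one>\<^bsub>\<A>\<^esub> = \<one>\<^bsub>\<A>\<^esub>"
      by (rule torus_act_eqI) (simp_all add: ext_rep_one)
  qed (rule torus_act_closed)
  fix x c assume x: "x \<in> carrier \<A>"
  show "torus_act g (cscale \<A> c x) = cscale \<A> c (torus_act g x)"
    by (rule torus_act_eqI)
      (simp_all add: x torus_act_closed C.cscale_closed ext_rep_cscale ext_rep_torus_act
          bounded_clinear_scaleC[OF U])
  show "torus_act g (involution \<A> x) = involution \<A> (torus_act g x)"
  proof (rule torus_act_eqI)
    fix v
    note adj = adjoint_pair_sym[OF ext_rep_adjoint_pair]
    show "ext_rep (involution \<A> (torus_act g x)) (torus_unitary g v) = torus_unitary g (ext_rep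
        (involution \<A> x) v)"
    proof (rule cinner_eqI)
      fix w
      let ?w = "cadjoint (torus_unitary g) w"
      have "cinner w (ext_rep (involution \<A> (torus_act g x)) (torus_unitary g v))
          = cinner (ext_rep (torus_act g x) (torus_unitary g ?w)) (torus_unitary g v)"
        by (simp add: adjoint_pairD[OF ext_rep_adjoint_pair[OF torus_act_closed[OF x]]]
            torus_unitary_inverse[OF g])
      also have "\<dots> = cinner (ext_rep x ?w) v"
        by (simp only: ext_rep_torus_act[OF x] adjoint_pairD[OF torus_unitary_adjoint[OF g]]
            torus_unitary_inverse(2)[OF g])
      also have "\<dots> = cinner w (torus_unitary g (ext_rep (involution \<A> x) v))"
        by (simp add: adjoint_pairD[OF ext_rep_adjoint_pair[OF x]]
            adjoint_pairD[OF adjoint_pair_sym[OF torus_unitary_adjoint[OF g]]])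
      finally show "cinner w (ext_rep (involution \<A> (torus_act g x)) (torus_unitary g v))
          = cinner w (torus_unitary g (ext_rep (involution \<A> x) v))" .
    qed
  qed (simp_all add: x torus_act_closed C.involution_closed)
qed

lemma torus_act_emb: "torus_act g (emb z) = emb (free_torus g z)"
  by (rule torus_act_cls[OF cauchy_const])

lemma cnorm_torus_act_le: assumes "x \<in> carrier \<A>" shows "cnorm \<A> (torus_act g x) \<le> cnorm \<A> x"
  unfolding norm_ext_rep[OF torus_act_closed[OF assms], symmetric]
proof (rule norm_blinfun_bound)
  fix v
  have "norm (ext_rep (torus_act g x) (torus_unitary g (cadjoint (torus_unitary g) v)))
      \<le> norm (ext_rep x) * norm (torus_unitary g (cadjoint (torus_unitary g) v))"
    unfolding ext_rep_torus_act[OF assms] norm_torus_unitary[OF g] by (rule norm_blinfun)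
  thus "norm (ext_rep (torus_act g x) v) \<le> cnorm \<A> x * norm v"
    by (simp add: torus_unitary_inverse[OF g] norm_ext_rep[OF assms])
qed (simp add: C.cnorm_nonneg assms)

lemma dist_torus_act_le:
  assumes "x \<in> carrier \<A>" "y \<in> carrier \<A>"
  shows "cstar_dist \<A> (torus_act g x) (torus_act g y) \<le> cstar_dist \<A> x y"
proof -
  from torus_act_hom have h: "torus_act g \<in> ring_hom \<A> \<A>"
    and s: "\<And>x c. x \<in> carrier \<A> \<Longrightarrow> torus_act g (cscale \<A> c x) = cscale \<A> c (torus_act g x)"
    by (auto simp: unital_star_hom_def)
  have "torus_act g x \<ominus>\<^bsub>\<A>\<^esub> torus_act g y = torus_act g (x \<ominus>\<^bsub>\<A>\<^esub> y)"
    using assms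
    by (simp add: a_minus_def C.minus_eq_cscale torus_act_closed ring_hom_add[OF h] s
        C.cscale_closed)
  thus ?thesis
    using cnorm_torus_act_le[of "x \<ominus>\<^bsub>\<A>\<^esub> y"] assms by (simp add: C.cstar_dist_eq torus_act_closed)
qed

text \<open>Composition with \<open>ext_rep\<close> turns an endomorphism into a representation, so
  endomorphisms that agree on the generators coincide by \<open>star_representation_unique\<close>
  and faithfulness.\<close>

lemma star_representation_hom:
  assumes "unital_star_hom \<A> \<A> \<phi>" shows "star_representation \<A> (\<lambda>x. blinfun_apply (ext_rep (\<phi> x)))"
proof -
  note r = star_representation_ext_rep
  from assms have h: "\<phi> \<in> ring_hom \<A> \<A>"
    and s: "\<And>x c. x \<in> carrier \<A> \<Longrightarrow> \<phi> (cscale \<A> c x) = cscale \<A> c (\<phi> x)"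
      "\<And>x. x \<in> carrier \<A> \<Longrightarrow> \<phi> (involution \<A> x) = involution \<A> (\<phi> x)"
    by (auto simp: unital_star_hom_def)
  note hs = ring_hom_closed[OF h] ring_hom_add[OF h] ring_hom_mult[OF h] ring_hom_one[OF h] s
  show ?thesis
    unfolding star_representation_on_def
    by (auto simp: hs ext_rep_one ext_rep_add ext_rep_cscale ext_rep_bounded_clinear
        blinfun.add_left
        cadjoint_eqI[OF ext_rep_adjoint_pair])
qed

lemma torus_act_restrict_hom: "unital_star_hom \<A> \<A> (restrict (torus_act g) (carrier \<A>))"
  using torus_act_hom
  by (simp add: unital_star_hom_def ring_hom_def Pi_iff C.cscale_closed C.involution_closed)

lemma torus_action_eq: "torus_action q g = restrict (torus_act g) (carrier \<A>)"
proof -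
  obtain z1 z2 z3 where z: "g = (z1, z2, z3)" by (metis prod_cases3)
  let ?P = "\<lambda>\<phi>. \<phi> \<in> extensional (carrier \<A>) \<and> unital_star_hom \<A> \<A> \<phi> \<and>
     \<phi> (emb a) = cscale \<A> z1 (emb a) \<and> \<phi> (emb b) = cscale \<A> z2 (emb b) \<and> \<phi> (emb d) = cscale \<A> z3
         (emb d)"
  let ?\<phi> = "restrict (torus_act g) (carrier \<A>)"
  have E: "emb y \<in> carrier \<A>" for y by (simp add: cauchy_const)
  note hom = torus_act_restrict_hom
  have "free_torus g (free_letter l) = free_scale (torus_char g (letter_deg l)) (free_letter l)"
      for l
    by (simp add: free_letter_def free_torus_single)
  hence "?\<phi> (emb (free_letter l)) = cscale \<A> (torus_char g (letter_deg l)) (emb (free_letter l))"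
      for l
    by (simp add: E torus_act_emb cscale_cls cauchy_const)
  hence P: "?P ?\<phi>" using hom by (simp add: z)
  moreover have "\<phi> = ?\<phi>" if \<phi>: "?P \<phi>" for \<phi>
  proof (rule extensionalityI)
    show "\<phi> \<in> extensional (carrier \<A>)" "?\<phi> \<in> extensional (carrier \<A>)" using \<phi> by simp_all
    fix x assume x: "x \<in> carrier \<A>"
    have "blinfun_apply (ext_rep (\<phi> x)) = blinfun_apply (ext_rep (?\<phi> x))"
      by (rule star_representation_unique[OF _ _ _ _ _ x])
        (use \<phi> P in \<open>auto intro: star_representation_hom simp only:\<close>)
    moreover have "\<phi> x \<in> carrier \<A>" "?\<phi> x \<in> carrier \<A>"
      using \<phi> hom x by (auto simp only: unital_star_hom_def intro: ring_hom_closed)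
    ultimately show "\<phi> x = ?\<phi> x" by (metis ext_rep_inj blinfun_apply_inject)
  qed
  ultimately have "(THE \<phi>. ?P \<phi>) = ?\<phi>" by (rule the_equality)
  thus ?thesis unfolding torus_action_def C_Uq2_eq gens_eq z by simp
qed

end

lemma torus_act_mult:
  assumes "g \<in> carrier torus3" "h \<in> carrier torus3" "x \<in> carrier \<A>"
  shows "torus_act (g \<otimes>\<^bsub>torus3\<^esub> h) x = torus_act g (torus_act h x)"
proof (rule torus_act_eqI)
  show "g \<otimes>\<^bsub>torus3\<^esub> h \<in> carrier torus3"
    using assms by (intro monoid.m_closed group.is_monoid torus3_group)
qed (use assms in \<open>simp_all add: torus_act_closed torus_unitary_mult ext_rep_torus_act\<close>)

lemma torus_act_one: "x \<in> carrier \<A> \<Longrightarrow> torus_act \<one>\<^bsub>torus3\<^esub> x = x"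
  by (rule torus_act_eqI) (simp_all add: torus_unitary_one, simp add: torus3_simps)

text \<open>Every group element acts without increasing distances, so it suffices to control a
  constant class close to x.\<close>

lemma torus_act_continuous:
  assumes x: "x \<in> carrier \<A>"
  shows "continuous_map (top_of_set (carrier torus3)) C.mtopology (\<lambda>g. torus_act g x)"
  unfolding C.continuous_map_to_metric
proof (intro ballI allI impI)
  fix g and e :: real assume "g \<in> topspace (top_of_set (carrier torus3))" and e: "e > 0"
  hence g: "g \<in> carrier torus3" by simp
  obtain y where y: "cauchy y" "x = cls y" using x by (rule carrierE)
  obtain m where m: "cstar_dist \<A> x (emb (y m)) < e / 3"
    using dist_to_const[OF y(1), of "e / 3"] e y(2) by auto
  define z where "z = y m"
  \<comment> \<open>For the fixed free element z this finite sum bounds the distance between its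
    images under h and g; it is continuous in h and vanishes at h = g.\<close>
  define F where "F h = (\<Sum>w\<in>Poly_Mapping.keys z. cmod (torus_char h (word_deg w) - torus_char g
      (word_deg w))
      * u (Poly_Mapping.single w (Poly_Mapping.lookup z w)))" for h
  have "continuous_on (carrier torus3) F"
    unfolding F_def by (intro continuous_intros continuous_on_torus_char)
  hence op: "openin (top_of_set (carrier torus3)) (carrier torus3 \<inter> F -` {..<e / 3})"
    by (rule continuous_openin_preimage_gen) simp
  have Fg: "F g = 0" by (simp add: F_def)
  have E: "emb v \<in> carrier \<A>" for v by (simp add: cauchy_const)
  have F: "u (free_torus h z - free_torus g z) \<le> F h" for h
  proof -
    have zero: "free_torus k 0 = 0" for k by (rule poly_mapping_eqI) (simp add: lookup_free_torus)
    have ft: "free_torus k z = (\<Sum>w\<in>Poly_Mapping.keys z. free_scale (torus_char k (word_deg w))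
        (Poly_Mapping.single w (Poly_Mapping.lookup z w)))" for k
    proof -
      have "free_torus k (\<Sum>w\<in>W. Poly_Mapping.single w (Poly_Mapping.lookup z w))
          = (\<Sum>w\<in>W. free_scale (torus_char k (word_deg w)) (Poly_Mapping.single w
              (Poly_Mapping.lookup z w)))" for W
        by (induction W rule: infinite_finite_induct) (simp_all add: zero free_torus_add
            free_torus_single)
      thus ?thesis by (metis free_star_algebra_expand)
    qed
    have "free_torus h z - free_torus g z = (\<Sum>w\<in>Poly_Mapping.keys z.
        free_scale (torus_char h (word_deg w) - torus_char g (word_deg w)) (Poly_Mapping.single w
            (Poly_Mapping.lookup z w)))"
      unfolding ft sum_subtractf[symmetric]
      by (rule sum.cong) (simp_all add: free_scale_single left_diff_distrib single_diff)
    also have "u \<dots> \<le> F h"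
      unfolding F_def by (rule order_trans[OF u.sum_le]) (simp add: u.scale)
    finally show ?thesis .
  qed
  have "torus_act h x \<in> C.mball (torus_act g x) e" if h: "h \<in> carrier torus3" "F h < e / 3" for h
  proof -
    have close: "cstar_dist \<A> (torus_act k x) (torus_act k (emb z)) < e / 3"
        if "k \<in> carrier torus3" for k
      using dist_torus_act_le[OF that x E, of z] m by (simp add: z_def)
    have "cstar_dist \<A> (torus_act h (emb z)) (torus_act g (emb z)) < e / 3"
      using F[of h] h(2) by (simp add: torus_act_emb h(1) g dist_const)
    moreover have "cstar_dist \<A> (torus_act g x) (torus_act h x)
        \<le> cstar_dist \<A> (torus_act g x) (torus_act g (emb z)) + cstar_dist \<A> (torus_act g (emb z))
            (torus_act h x)"
      by (intro C.triangle torus_act_closed g h E x)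
    moreover have "cstar_dist \<A> (torus_act g (emb z)) (torus_act h x)
        \<le> cstar_dist \<A> (torus_act g (emb z)) (torus_act h (emb z)) + cstar_dist \<A> (torus_act h
            (emb z)) (torus_act h x)"
      by (intro C.triangle torus_act_closed g h E x)
    ultimately have "cstar_dist \<A> (torus_act g x) (torus_act h x) < e"
      using close[OF g] close[OF h(1)]
      by (simp add: C.commute[of "torus_act g (emb z)" "torus_act h (emb z)"] C.commute[of
          "torus_act h (emb z)" "torus_act h x"])
    thus ?thesis by (simp add: torus_act_closed g h x)
  qed
  thus "\<exists>U. openin (top_of_set (carrier torus3)) U \<and> g \<in> U \<and> (\<forall>h\<in>U. torus_act h x \<in> C.mball
      (torus_act g x) e)"
    using op g e Fg by (intro exI[of _ "carrier torus3 \<inter> F -` {..<e / 3}"]) auto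
qed

lemma torus_cstar_dynamical_system:
  "cstar_dynamical_system \<A> torus3 (top_of_set (carrier torus3)) (torus_action q)"
  unfolding cstar_dynamical_system_def
proof (intro conjI ballI)
  fix g assume g: "g \<in> carrier torus3"
  show "unital_star_hom \<A> \<A> (torus_action q g)"
    unfolding torus_action_eq[OF g] by (rule torus_act_restrict_hom[OF g])
  let ?i = "inv\<^bsub>torus3\<^esub> g"
  note G = torus3_group
  have i: "?i \<in> carrier torus3" "?i \<otimes>\<^bsub>torus3\<^esub> g = \<one>\<^bsub>torus3\<^esub>" "g \<otimes>\<^bsub>torus3\<^esub> ?i = \<one>\<^bsub>torus3\<^esub>"
    using g by (simp_all add: group.inv_closed[OF G] group.l_inv[OF G] group.r_inv[OF G])
  have "bij_betw (torus_act g) (carrier \<A>) (carrier \<A>)"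
    by (rule bij_betw_byWitness[where f' = "torus_act ?i"])
      (auto simp: torus_act_closed g i torus_act_one simp flip: torus_act_mult)
  thus "bij_betw (torus_action q g) (carrier \<A>) (carrier \<A>)"
    by (rule bij_betw_cong[THEN iffD1, rotated]) (simp add: torus_action_eq[OF g])
  fix h x assume h: "h \<in> carrier torus3" and x: "x \<in> carrier \<A>"
  have gh: "g \<otimes>\<^bsub>torus3\<^esub> h \<in> carrier torus3"
    using g h by (intro monoid.m_closed group.is_monoid G)
  show "torus_action q (g \<otimes>\<^bsub>torus3\<^esub> h) x = torus_action q g (torus_action q h x)"
    by (simp add: torus_action_eq g h gh x torus_act_closed torus_act_mult)
next
  fix x assume x: "x \<in> carrier \<A>"
  show "continuous_map (top_of_set (carrier torus3)) (cstar_topology \<A>) (\<lambda>g. torus_action q g x)"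
    unfolding cstar_topology_def
    by (rule continuous_map_eq[OF torus_act_continuous[OF x]]) (simp add: torus_action_eq x)
qed (rule unital_cstar_algebra torus3_compact_group)+

section \<open>Equivariance, faithfulness and density on the doubled space\<close>

lemma equivariance:
  assumes "g \<in> carrier torus3" "x \<in> carrier \<A>"
  shows "pi_eq q (torus_action q g x) = torus_unitary2 g \<circ> pi_eq q x \<circ> cadjoint (torus_unitary2 g)"
proof -
  have "uq2_rep q (torus_action q g x) v = torus_unitary g (uq2_rep q x (cadjoint (torus_unitary
      g) v))" for v
    using ext_rep_torus_act[OF assms, of "cadjoint (torus_unitary g) v"]
    by (simp add: uq2_rep_eq torus_action_eq assms torus_act_closed torus_unitary_inverse)
  thus ?thesis
    unfolding torus_unitary2_adjoint[OF assms(1)] unfolding torus_unitary2_eq[OF assms(1)]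
    by (auto simp: pi_eq_def)
qed

lemma pi_eq_map_prod: "pi_eq q x = map_prod (uq2_rep q x) (uq2_rep q x)"
  by (auto simp: pi_eq_def)

lemma star_representation_pi_eq: "star_representation \<A> (pi_eq q)"
proof -
  have adj: "adjoint_pair (pi_eq q x) (pi_eq q (involution \<A> x))" if "x \<in> carrier \<A>" for x
    unfolding pi_eq_map_prod using that
    by (intro map_prod_adjoint_pair) (simp_all add: uq2_rep_eq C.involution_closed
        ext_rep_adjoint_pair)
  show ?thesis
    unfolding star_representation_on_def
  proof (intro conjI ballI allI)
    fix x assume x: "x \<in> carrier \<A>"
    show "bounded_clinear (pi_eq q x)"
      unfolding pi_eq_map_prod using x
      by (intro map_prod_bounded_clinear) (simp_all add: uq2_rep_eq ext_rep_bounded_clinear)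
    show "pi_eq q (involution \<A> x) = cadjoint (pi_eq q x)"
        by (rule cadjoint_eqI[OF adj[OF x], symmetric])
    show "pi_eq q (cscale \<A> c x) \<xi> = c *\<^sub>C pi_eq q x \<xi>" for c \<xi>
      by (cases \<xi>) (simp add: pi_eq_def uq2_rep_eq x C.cscale_closed ext_rep_cscale scaleC_prod_def)
    fix y assume y: "y \<in> carrier \<A>"
    show "pi_eq q (x \<oplus>\<^bsub>\<A>\<^esub> y) \<xi> = pi_eq q x \<xi> + pi_eq q y \<xi>" for \<xi>
      by (cases \<xi>) (simp add: pi_eq_def uq2_rep_eq x y ext_rep_add blinfun.add_left)
    show "pi_eq q (x \<otimes>\<^bsub>\<A>\<^esub> y) = pi_eq q x \<circ> pi_eq q y"
      by (auto simp: pi_eq_def uq2_rep_eq x y ext_rep_add)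
  next
    show "pi_eq q \<one>\<^bsub>\<A>\<^esub> = id" by (auto simp: pi_eq_def uq2_rep_eq ext_rep_one)
  qed
qed

lemma pi_eq_inj: "inj_on (pi_eq q) (carrier \<A>)"
proof (rule inj_onI)
  fix x y assume xy: "x \<in> carrier \<A>" "y \<in> carrier \<A>" and eq: "pi_eq q x = pi_eq q y"
  have "ext_rep x v = ext_rep y v" for v
    using fun_cong[OF eq, of "(v, v)"] xy by (simp add: pi_eq_def uq2_rep_eq)
  thus "x = y" using xy by (intro ext_rep_inj blinfun_eqI)
qed

lemma pi_eq_emb: "pi_eq q (emb z) = map_prod (free_rep q z) (free_rep q z)"
  by (simp add: pi_eq_map_prod uq2_rep_eq cauchy_const ext_rep_emb)

lemma A_f_subalgebra: "unital_star_subalgebra \<A> (A_f q)"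
  unfolding A_f_eq by (rule emb_subalgebra)

lemma A_f_dense: "cstar_topology \<A> closure_of A_f q = carrier \<A>"
proof -
  have "\<exists>y\<in>A_f q. y \<in> C.mball x r" if "x \<in> carrier \<A>" "r > 0" for x r
  proof -
    obtain y where y: "cauchy y" "x = cls y" using \<open>x \<in> carrier \<A>\<close> by (rule carrierE)
    obtain m where "cstar_dist \<A> x (emb (y m)) < r" using dist_to_const[OF y(1) \<open>r > 0\<close>] y(2)
      by blast
    thus ?thesis using that by (auto simp: A_f_eq cauchy_const)
  qed
  thus ?thesis unfolding cstar_topology_def C.metric_closure_of by blast
qed

end

section \<open>Pairs of square-summable families\<close>

text \<open>The dense set consists of finite combinations with rational real and imaginary parts,
  indexed by lists: these form a countable type, and appending lists adds vectors, so the closure is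
  stable under sums.\<close>

lemma separable_ell2: "separable_space (euclidean :: ('a::countable) ell2 topology)"
proof -
  define f :: "('a \<times> rat \<times> rat) list \<Rightarrow> 'a ell2" where
    "f l = (\<Sum>(x, r, s)\<leftarrow>l. Complex (of_rat r) (of_rat s) *\<^sub>C ket x)" for l
  have append: "f (l @ m) = f l + f m" for l m by (simp add: f_def)
  have ket: "c *\<^sub>C ket x \<in> closure (range f)" for c x
    unfolding closure_approachable
  proof (intro allI impI)
    fix e :: real assume e: "e > 0"
    hence e2: "e / 2 > 0" by simp
    obtain r where "Re c - e / 2 < of_rat r" "of_rat r < Re c + e / 2"
      using of_rat_dense[of "Re c - e / 2" "Re c + e / 2"] e2 by auto
    hence r: "\<bar>of_rat r - Re c\<bar> < e / 2" by linarith
    obtain s where "Im c - e / 2 < of_rat s" "of_rat s < Im c + e / 2"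
      using of_rat_dense[of "Im c - e / 2" "Im c + e / 2"] e2 by auto
    hence s: "\<bar>of_rat s - Im c\<bar> < e / 2" by linarith
    have "f [(x, r, s)] - c *\<^sub>C ket x = (Complex (of_rat r) (of_rat s) - c) *\<^sub>C ket x"
      by (simp add: f_def scaleC_diff_left)
    hence "dist (f [(x, r, s)]) (c *\<^sub>C ket x) = cmod (Complex (of_rat r) (of_rat s) - c)"
      by (simp add: dist_norm)
    also have "\<dots> \<le> \<bar>of_rat r - Re c\<bar> + \<bar>of_rat s - Im c\<bar>"
      using cmod_le[of "Complex (of_rat r) (of_rat s) - c"] by simp
    finally have "dist (f [(x, r, s)]) (c *\<^sub>C ket x) < e" using r s by simp
    thus "\<exists>y\<in>range f. dist y (c *\<^sub>C ket x) < e" by blast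
  qed
  have zero: "0 \<in> closure (range f)"
    by (rule closure_subset[THEN subsetD]) (auto simp: f_def intro!: image_eqI[of _ _ "[]"])
  have add: "v + w \<in> closure (range f)" if "v \<in> closure (range f)" "w \<in> closure (range f)" for v w
  proof -
    from that obtain a b where ab: "\<And>n. a n \<in> range f" "\<And>n. b n \<in> range f" "a \<longlonglongrightarrow> v" "b \<longlonglongrightarrow> w"
      unfolding closure_sequential by blast
    have "a n + b n \<in> range f" for n
    proof -
      obtain l m where "a n = f l" "b n = f m" using ab(1)[of n] ab(2)[of n] by blast
      thus ?thesis by (simp flip: append)
    qed
    moreover have "(\<lambda>n. a n + b n) \<longlonglongrightarrow> v + w" by (intro tendsto_add ab)
    ultimately show ?thesis
      unfolding closure_sequential by (intro exI[of _ "\<lambda>n. a n + b n"] conjI allI)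
  qed
  have "(\<Sum>x\<in>F. c x *\<^sub>C ket x) \<in> closure (range f)" for F c
    by (induction F rule: infinite_finite_induct) (auto intro: zero add ket)
  hence restr: "ell2_restrict F v \<in> closure (range f)" if "finite F" for F v
    by (simp add: ell2_restrict_sum that)
  have "v \<in> closure (closure (range f))" for v
    unfolding closure_approachable[of v "closure (range f)"]
  proof (intro allI impI)
    fix e :: real assume "e > 0"
    then obtain F where "finite F" "norm (v - ell2_restrict F v) < e" by (rule ell2_restrict_approx)
    thus "\<exists>y\<in>closure (range f). dist y v < e"
      using restr[of F v] by (intro bexI[of _ "ell2_restrict F v"]) (auto simp: dist_norm
          norm_minus_commute)
  qed
  hence "closure (range f) = UNIV" by auto
  moreover have "countable (range f)" by simp
  ultimately show ?thesis unfolding separable_space_def by (intro exI[of _ "range f"]) simp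
qed

lemma separable_prod:
  assumes "separable_space (euclidean :: 'a::topological_space topology)"
    and "separable_space (euclidean :: 'b::topological_space topology)"
  shows "separable_space (euclidean :: ('a \<times> 'b) topology)"
proof -
  from assms obtain A :: "'a set" and B :: "'b set" where
    "countable A" "closure A = UNIV" "countable B" "closure B = UNIV"
    unfolding separable_space_def by auto
  hence "countable (A \<times> B)" "closure (A \<times> B) = UNIV" by (auto simp: closure_Times)
  thus ?thesis unfolding separable_space_def by (intro exI[of _ "A \<times> B"]) simp
qed

type_synonym 'a ell2_pair = "'a ell2 \<times> 'a ell2"

text \<open>A pair is read as one family over \<open>bool \<times> 'a\<close>, with
  \<open>True\<close> for the first component, so that a two-by-two matrix of operators becomes a
  single matrix.\<close>

definition pcoord :: "'a ell2_pair \<Rightarrow> bool \<times> 'a \<Rightarrow> complex"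
  where "pcoord u y = Rep_ell2 (if fst y then fst u else snd u) (snd y)"

definition pket :: "bool \<times> 'a \<Rightarrow> 'a ell2_pair"
  where "pket y = (if fst y then (ket (snd y), 0) else (0, ket (snd y)))"

lemma pcoord_simps [simp]:
  "pcoord (u + v) y = pcoord u y + pcoord v y" "pcoord (u - v) y = pcoord u y - pcoord v y"
  "pcoord (- u) y = - pcoord u y" "pcoord 0 y = 0" "pcoord (c *\<^sub>C u) y = c * pcoord u y"
  by (simp_all add: pcoord_def scaleC_prod_def)

lemma pcoord_sum [simp]: "pcoord (\<Sum>i\<in>I. f i) y = (\<Sum>i\<in>I. pcoord (f i) y)"
  by (induction I rule: infinite_finite_induct) simp_all

lemma pcoord_pket: "pcoord (pket x) y = (if y = x then 1 else 0)"
  by (auto simp: pcoord_def pket_def Rep_ell2_ket prod_eq_iff)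

lemma pcoord_eqI: "(\<And>y. pcoord u y = pcoord v y) \<Longrightarrow> u = v"
proof -
  assume eq: "\<And>y. pcoord u y = pcoord v y"
  have "fst u = fst v" using eq[of "(True, _)"] by (intro ell2_eqI) (simp add: pcoord_def)
  moreover have "snd u = snd v" using eq[of "(False, _)"] by (intro ell2_eqI) (simp add: pcoord_def)
  ultimately show ?thesis by (rule prod_eqI)
qed

lemma UNIV_bool_Times: "(UNIV :: (bool \<times> 'a) set) = Pair True ` UNIV \<union> Pair False ` UNIV"
  by auto

lemma pcoord_sum_le: assumes "finite F" shows "(\<Sum>y\<in>F. (cmod (pcoord u y))\<^sup>2) \<le> (norm u)\<^sup>2"
proof -
  let ?G = "snd ` F"
  have "(\<Sum>y\<in>F. (cmod (pcoord u y))\<^sup>2) \<le> (\<Sum>y\<in>UNIV \<times> ?G. (cmod (pcoord u y))\<^sup>2)"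
    using assms by (intro sum_mono2) (auto intro: rev_image_eqI)
  also have "\<dots> = (\<Sum>s\<in>UNIV. \<Sum>x\<in>?G. (cmod (pcoord u (s, x)))\<^sup>2)"
    by (simp add: sum.cartesian_product)
  also have "\<dots> = (\<Sum>x\<in>?G. (cmod (Rep_ell2 (snd u) x))\<^sup>2) + (\<Sum>x\<in>?G. (cmod (Rep_ell2 (fst u) x))\<^sup>2)"
    by (simp add: UNIV_bool pcoord_def)
  also have "\<dots> \<le> (norm (snd u))\<^sup>2 + (norm (fst u))\<^sup>2"
    using assms by (intro add_mono sum_le_norm_ell2) auto
  also have "\<dots> = (norm u)\<^sup>2" by (simp add: norm_prod_def)
  finally show ?thesis .
qed

lemma pcoord_summable: "(\<lambda>y. (cmod (pcoord u y))\<^sup>2) summable_on S"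
  by (rule nonneg_bdd_above_summable_on)
    (auto simp: bdd_above_def intro!: exI[of _ "(norm u)\<^sup>2"] pcoord_sum_le)

lemma cinner_pcoord: "cinner u v = (\<Sum>\<^sub>\<infinity>y. pcoord u y * cnj (pcoord v y))"
proof -
  let ?f = "\<lambda>y. pcoord u y * cnj (pcoord v y)"
  have inj: "inj_on (Pair s) UNIV" for s :: bool by (simp add: inj_on_def)
  have s: "?f summable_on UNIV" by (rule ell2_prod_summable[OF pcoord_summable pcoord_summable])
  have "infsum ?f UNIV = infsum ?f (Pair True ` UNIV) + infsum ?f (Pair False ` UNIV)"
    unfolding UNIV_bool_Times
    by (rule infsum_Un_disjoint) (auto intro: summable_on_subset_banach[OF s])
  also have "\<dots> = cinner u v"
    by (simp add: infsum_reindex[OF inj] o_def cinner_prod_def cinner_ell2_eq pcoord_def)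
  finally show ?thesis by simp
qed

lemma norm_pcoord: "(norm u)\<^sup>2 = (\<Sum>\<^sub>\<infinity>y. (cmod (pcoord u y))\<^sup>2)"
proof -
  have "(norm u)\<^sup>2 = Re (\<Sum>\<^sub>\<infinity>y. pcoord u y * cnj (pcoord u y))"
    by (simp add: power2_norm_eq_inner inner_eq_Re_cinner cinner_pcoord)
  thus ?thesis by (simp only: ell2_self_inner[OF pcoord_summable])
qed

lemma cinner_pket [simp]: "cinner u (pket y) = pcoord u y" "cinner (pket y) u = cnj (pcoord u y)"
proof -
  show 1: "cinner u (pket y) = pcoord u y" for u y
    by (cases y) (auto simp: cinner_prod_def pket_def pcoord_def)
  show "cinner (pket y) u = cnj (pcoord u y)" by (subst cinner_commute) (simp add: 1)
qed

text \<open>The counterpart of \<open>wshift\<close> on pairs, meaningful for bounded c and for g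
  injective where c does not vanish.\<close>

definition pair_shift :: "(bool \<times> 'a \<Rightarrow> bool \<times> 'a) \<Rightarrow> (bool \<times> 'a \<Rightarrow> complex) \<Rightarrow> 'a ell2_pair \<Rightarrow> 'a
    ell2_pair"
  where "pair_shift g c u =
    (Abs_ell2 (\<lambda>x. c (True, x) * pcoord u (g (True, x))), Abs_ell2 (\<lambda>x. c (False, x) * pcoord u (g
        (False, x))))"

context
  fixes g :: "bool \<times> 'a \<Rightarrow> bool \<times> 'a" and c :: "bool \<times> 'a \<Rightarrow> complex" and K :: real
  assumes inj: "inj_on g {y. c y \<noteq> 0}" and bound: "\<And>y. cmod (c y) \<le> K"
begin

lemma pair_shift_sum_le:
  assumes "finite F"
  shows "(\<Sum>y\<in>F. (cmod (c y * pcoord u (g y)))\<^sup>2) \<le> (K * norm u)\<^sup>2"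
proof -
  let ?F = "F \<inter> {y. c y \<noteq> 0}"
  have "(\<Sum>y\<in>F. (cmod (c y * pcoord u (g y)))\<^sup>2) = (\<Sum>y\<in>?F. (cmod (c y * pcoord u (g y)))\<^sup>2)"
    by (rule sum.mono_neutral_right) (use assms in auto)
  also have "\<dots> \<le> (\<Sum>y\<in>?F. K\<^sup>2 * (cmod (pcoord u (g y)))\<^sup>2)"
    by (intro sum_mono) (auto simp: norm_mult power_mult_distrib intro!: mult_right_mono
        power_mono bound)
  also have "\<dots> = K\<^sup>2 * (\<Sum>x\<in>g ` ?F. (cmod (pcoord u x))\<^sup>2)"
    by (subst sum.reindex) (auto simp: sum_distrib_left intro: inj_on_subset[OF inj])
  also have "\<dots> \<le> K\<^sup>2 * (norm u)\<^sup>2"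
    using assms by (intro mult_left_mono pcoord_sum_le) auto
  finally show ?thesis by (simp add: power_mult_distrib)
qed

lemma pcoord_pair_shift: "pcoord (pair_shift g c u) y = c y * pcoord u (g y)"
proof -
  have "(\<lambda>x. (cmod (c (s, x) * pcoord u (g (s, x))))\<^sup>2) summable_on UNIV" for s
  proof (rule nonneg_bdd_above_summable_on)
    have "(\<Sum>x\<in>F. (cmod (c (s, x) * pcoord u (g (s, x))))\<^sup>2) \<le> (K * norm u)\<^sup>2" if "finite F" for F
      using pair_shift_sum_le[of "Pair s ` F" u] that by (simp add: sum.reindex inj_on_def)
    thus "bdd_above (sum (\<lambda>x. (cmod (c (s, x) * pcoord u (g (s, x))))\<^sup>2) ` {F. F \<subseteq> UNIV \<and> finite F})"
      by (auto simp: bdd_above_def)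
  qed simp
  thus ?thesis by (cases y) (simp add: pair_shift_def pcoord_def[of "(_, _)"] Abs_ell2_inverse)
qed

lemma pair_shift_norm_le: "norm (pair_shift g c u) \<le> K * norm u"
proof (rule power2_le_imp_le)
  show "(norm (pair_shift g c u))\<^sup>2 \<le> (K * norm u)\<^sup>2"
    unfolding norm_pcoord[of "pair_shift g c u"]
    by (rule infsum_le_finite_sums[OF pcoord_summable]) (simp add: pcoord_pair_shift
        pair_shift_sum_le)
  show "0 \<le> K * norm u" using order_trans[OF norm_ge_zero bound] by simp
qed

lemma pair_shift_bounded_clinear: "bounded_clinear (pair_shift g c)"
  by (rule bounded_clinearI[OF _ _ pair_shift_norm_le]; rule pcoord_eqI)
    (simp_all only: pcoord_pair_shift pcoord_simps distrib_left mult_ac)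

end

definition pair_restrict :: "(bool \<times> 'a) set \<Rightarrow> 'a ell2_pair \<Rightarrow> 'a ell2_pair"
  where "pair_restrict F u = (\<Sum>y\<in>F. pcoord u y *\<^sub>C pket y)"

lemma pcoord_pair_restrict: "finite F \<Longrightarrow> pcoord (pair_restrict F u) y = (if y \<in> F then pcoord u y
    else 0)"
  by (simp add: pair_restrict_def pcoord_pket if_distrib[of "(*) _"] sum.delta' cong: if_cong)

lemma norm_pair_restrict_diff_le:
  assumes F: "finite F" and e: "0 \<le> e"
    and le: "\<And>E. finite E \<Longrightarrow> E \<inter> F = {} \<Longrightarrow> (\<Sum>y\<in>E. (cmod (pcoord u y))\<^sup>2) \<le> e\<^sup>2"
  shows "norm (u - pair_restrict F u) \<le> e"
proof (rule power2_le_imp_le[OF _ e])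
  have "(norm (u - pair_restrict F u))\<^sup>2 = (\<Sum>\<^sub>\<infinity>y\<in>-F. (cmod (pcoord u y))\<^sup>2)"
    unfolding norm_pcoord by (rule infsum_cong_neutral) (auto simp: pcoord_pair_restrict F)
  also have "\<dots> \<le> e\<^sup>2"
    by (rule infsum_le_finite_sums[OF pcoord_summable]) (intro le, auto)
  finally show "(norm (u - pair_restrict F u))\<^sup>2 \<le> e\<^sup>2" .
qed

lemma compact_coordinate_box:
  assumes "finite F"
  obtains C :: "'a ell2_pair set" where "compact C"
    "\<And>c. (\<And>y. y \<in> F \<Longrightarrow> cmod (c y) \<le> K) \<Longrightarrow> (\<Sum>y\<in>F. c y *\<^sub>C pket y) \<in> C"
proof -
  have "\<exists>C :: 'a ell2_pair set. compact C \<and> (\<forall>c. (\<forall>y\<in>F. cmod (c y) \<le> K) \<longrightarrow> (\<Sum>y\<in>F. c y *\<^sub>C pket y) \<in>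
      C)"
    using assms
  proof (induction F rule: finite_induct)
    case empty
    show ?case by (rule exI[of _ "{0}"]) simp
  next
    case (insert x F)
    then obtain C :: "'a ell2_pair set" where C: "compact C"
      "\<And>c. (\<forall>y\<in>F. cmod (c y) \<le> K) \<Longrightarrow> (\<Sum>y\<in>F. c y *\<^sub>C pket y) \<in> C" by auto
    let ?B = "(\<lambda>z. z *\<^sub>C pket x) ` cball (0 :: complex) K"
    have "compact ?B"
      by (intro compact_continuous_image compact_cball linear_continuous_on
          bounded_bilinear.bounded_linear_left[OF bounded_bilinear_scaleC])
    hence "compact {v + w |v w. v \<in> ?B \<and> w \<in> C}" by (rule compact_sums[OF _ C(1)])
    moreover have "(\<Sum>y\<in>insert x F. c y *\<^sub>C pket y) \<in> {v + w |v w. v \<in> ?B \<and> w \<in> C}"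
      if "\<forall>y\<in>insert x F. cmod (c y) \<le> K" for c
    proof -
      have "c x *\<^sub>C pket x \<in> ?B" using that by (intro imageI) simp
      moreover have "(\<Sum>y\<in>F. c y *\<^sub>C pket y) \<in> C" using that by (intro C(2)) simp
      ultimately show ?thesis unfolding sum.insert[OF insert.hyps] by blast
    qed
    ultimately show ?case by blast
  qed
  thus thesis using that by blast
qed

text \<open>Uniformly small tails reduce the set to its truncations, which lie in a compact box of
  finite dimension; total boundedness and completeness then give compactness.\<close>

lemma relatively_compactI:
  fixes S :: "'a ell2_pair set"
  assumes bound: "\<And>u. u \<in> S \<Longrightarrow> norm u \<le> K"
    and tail: "\<And>e. e > 0 \<Longrightarrow> \<exists>F. finite F \<and> (\<forall>u\<in>S. norm (u - pair_restrict F u) \<le> e)"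
  shows "compact (closure S)"
  unfolding compact_eq_totally_bounded
proof (intro conjI allI impI)
  show "complete (closure S)" by (simp add: complete_eq_closed)
  fix e :: real assume "e > 0"
  \<comment> \<open>Three errors of this size add up: the approximation from the closure, the
    truncation, and the net of the box.\<close>
  hence e: "e / 4 > 0" by simp
  obtain F where F: "finite F" "\<And>u. u \<in> S \<Longrightarrow> norm (u - pair_restrict F u) \<le> e / 4" using tail[OF e]
    by blast
  obtain C :: "'a ell2_pair set" where C: "compact C"
    "\<And>c. (\<And>y. y \<in> F \<Longrightarrow> cmod (c y) \<le> K) \<Longrightarrow> (\<Sum>y\<in>F. c y *\<^sub>C pket y) \<in> C"
    using compact_coordinate_box[OF F(1)] by blast
  obtain k where k: "finite k" "C \<subseteq> (\<Union>x\<in>k. ball x (e / 4))"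
    using C(1) e unfolding compact_eq_totally_bounded by meson
  have "u \<in> (\<Union>x\<in>k. ball x e)" if "u \<in> closure S" for u
  proof -
    obtain v where v: "v \<in> S" "dist v u < e / 4" using \<open>u \<in> closure S\<close> e closure_approachable
      by blast
    have "cmod (pcoord v y) \<le> K" for y
    proof -
      have "(cmod (pcoord v y))\<^sup>2 \<le> (norm v)\<^sup>2" using pcoord_sum_le[of "{y}" v] by simp
      hence "cmod (pcoord v y) \<le> norm v" by (rule power2_le_imp_le) simp
      thus ?thesis using bound[OF v(1)] by simp
    qed
    hence "pair_restrict F v \<in> C" unfolding pair_restrict_def by (rule C(2))
    then obtain x where x: "x \<in> k" "dist x (pair_restrict F v) < e / 4" using k(2) by auto
    have "dist v (pair_restrict F v) \<le> e / 4" using F(2)[OF v(1)] by (simp add: dist_norm)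
    moreover have "dist x u \<le> dist x (pair_restrict F v) + dist v (pair_restrict F v) + dist v u"
        by metric
    ultimately have "dist x u < e" using x(2) v(2) e by linarith
    thus ?thesis using x(1) by auto
  qed
  thus "\<exists>k. finite k \<and> closure S \<subseteq> (\<Union>x\<in>k. ball x e)" using k(1) by blast
qed

section \<open>Unbounded operators with monomial matrices\<close>

text \<open>The domain is maximal: it contains every u for which the prescribed coordinates belong
  to some vector of the space. With this domain the adjoint can be read off from basis
  vectors.\<close>

definition monomial_op :: "(bool \<times> 'a \<Rightarrow> bool \<times> 'a) \<Rightarrow> (bool \<times> 'a \<Rightarrow> complex) \<Rightarrow> ('a ell2_pair)
    unbounded_op"
  where "monomial_op \<sigma> m = {(u, v). \<forall>y. pcoord v y = m y * pcoord u (\<sigma> y)}"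

lemma op_adjoint_antimono: "S \<subseteq> T \<Longrightarrow> op_adjoint T \<subseteq> op_adjoint S"
  by (auto simp: op_adjoint_def)

lemma monomial_opI: "(\<And>y. pcoord v y = m y * pcoord u (\<sigma> y)) \<Longrightarrow> (u, v) \<in> monomial_op \<sigma> m"
  and monomial_opD: "(u, v) \<in> monomial_op \<sigma> m \<Longrightarrow> pcoord v y = m y * pcoord u (\<sigma> y)"
  unfolding monomial_op_def by blast+

lemma csubspace_monomial_op: "csubspace (monomial_op \<sigma> m)"
  unfolding complex_vector.subspace_def
proof (intro conjI ballI allI)
  show "0 \<in> monomial_op \<sigma> m" unfolding zero_prod_def[where 'a = "'a ell2_pair"]
      by (rule monomial_opI) simp
  fix p c assume p: "p \<in> monomial_op \<sigma> m"
  obtain u v where p': "p = (u, v)" by (cases p)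
  note uv = monomial_opD[OF p[unfolded p']]
  show "c *\<^sub>C p \<in> monomial_op \<sigma> m"
    unfolding p' scaleC_prod_def fst_conv snd_conv
    by (rule monomial_opI) (simp add: scaleC_prod_def[symmetric] uv del: split_paired_All)
  fix p2 assume p2: "p2 \<in> monomial_op \<sigma> m"
  obtain u2 v2 where p2': "p2 = (u2, v2)" by (cases p2)
  show "p + p2 \<in> monomial_op \<sigma> m"
    unfolding p' p2' add_Pair
    by (rule monomial_opI) (simp add: uv monomial_opD[OF p2[unfolded p2']] distrib_left)
qed

lemma single_valued_monomial_op: "single_valued (monomial_op \<sigma> m)"
proof (rule single_valuedI)
  fix u v w assume "(u, v) \<in> monomial_op \<sigma> m" "(u, w) \<in> monomial_op \<sigma> m"
  thus "v = w" by (intro pcoord_eqI) (simp only: monomial_opD)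
qed

text \<open>The two assumptions say that the matrix with entry \<open>m y\<close> in row
  \<open>y\<close> and column \<open>\<sigma> y\<close> is Hermitian.\<close>

locale monomial_operator =
  fixes \<sigma> :: "bool \<times> 'a \<Rightarrow> bool \<times> 'a" and m :: "bool \<times> 'a \<Rightarrow> complex"
  assumes invol: "\<sigma> (\<sigma> y) = y" and sym: "m (\<sigma> y) = cnj (m y)"
begin

abbreviation G where "G \<equiv> monomial_op \<sigma> m"

lemma sigma_eq: "\<sigma> y = z \<longleftrightarrow> y = \<sigma> z"
  using invol by metis

lemma sigma_inj: "inj_on \<sigma> S"
  by (rule inj_onI) (metis invol)

lemma sigma_bij: "bij \<sigma>"
  by (rule o_bij[of \<sigma>]) (auto simp: invol fun_eq_iff)

lemma cmod_sym: "cmod (m (\<sigma> y)) = cmod (m y)"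
  by (simp add: sym)

lemma pket_mem: "(pket y, m (\<sigma> y) *\<^sub>C pket (\<sigma> y)) \<in> G"
  by (rule monomial_opI) (auto simp: pcoord_pket sigma_eq)

lemma symmetric: "G \<subseteq> op_adjoint G"
proof -
  have "cinner v u' = cinner u v'" if "(u, v) \<in> G" "(u', v') \<in> G" for u v u' v'
  proof -
    have "cinner v u' = (\<Sum>\<^sub>\<infinity>y. m y * pcoord u (\<sigma> y) * cnj (pcoord u' y))"
      by (simp add: cinner_pcoord monomial_opD[OF that(1)])
    also have "\<dots> = (\<Sum>\<^sub>\<infinity>y. m (\<sigma> y) * pcoord u (\<sigma> (\<sigma> y)) * cnj (pcoord u' (\<sigma> y)))"
      by (rule infsum_reindex_bij_betw[OF sigma_bij, symmetric])
    also have "\<dots> = cinner u v'"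
      by (simp add: cinner_pcoord monomial_opD[OF that(2)] invol sym mult_ac)
    finally show ?thesis .
  qed
  thus ?thesis by (auto simp: op_adjoint_def)
qed

text \<open>Pairing with basis vectors prescribes every coordinate of the image, and membership in
  the maximal operator demands just these coordinates.\<close>

lemma adjoint_core:
  assumes "\<And>y. (pket y, m (\<sigma> y) *\<^sub>C pket (\<sigma> y)) \<in> T"
  shows "op_adjoint T \<subseteq> G"
proof clarify
  fix u v u' v' assume "((u, v), (u', v')) \<in> op_adjoint T"
  hence adj: "cinner (m (\<sigma> y) *\<^sub>C pket (\<sigma> y)) (u, v) = cinner (pket y) (u', v')" for y
    using assms[of y] unfolding op_adjoint_def by blast
  show "((u, v), (u', v')) \<in> G"
  proof (rule monomial_opI)
    fix y
    have "cnj (m (\<sigma> y) * cnj (pcoord (u, v) (\<sigma> y))) = cnj (cnj (pcoord (u', v') y))"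
      using adj[of y] by (simp add: cinner_scaleC_left)
    thus "pcoord (u', v') y = m y * pcoord (u, v) (\<sigma> y)" by (simp add: sym)
  qed
qed

lemma op_adjoint_eq: "op_adjoint G = G"
  using symmetric adjoint_core[OF pket_mem] by blast

text \<open>Density from basis vectors is available for subspaces of \<open>ell2\<close>, so the two
  components of the domain are treated separately and recombined by additivity.\<close>

lemma closure_Domain: "closure (Domain G) = UNIV"
proof -
  have sub: "csubspace (Domain G)"
    unfolding complex_vector.subspace_def
  proof (intro conjI ballI allI)
    note G = csubspace_monomial_op[of \<sigma> m]
    show "0 \<in> Domain G"
      using complex_vector.subspace_0[OF G] unfolding zero_prod_def[where 'a = "'a ell2_pair"]
        by (rule DomainI)
    fix u c assume "u \<in> Domain G"
    then obtain v where uv: "(u, v) \<in> G" by blast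
    have "c *\<^sub>C (u, v) \<in> G" by (rule complex_vector.subspace_scale[OF G uv])
    thus "c *\<^sub>C u \<in> Domain G" unfolding scaleC_prod_def[of c "(u, v)"] by auto
    fix u' assume "u' \<in> Domain G"
    then obtain v' where uv': "(u', v') \<in> G" by blast
    have "(u, v) + (u', v') \<in> G" by (rule complex_vector.subspace_add[OF G uv uv'])
    thus "u + u' \<in> Domain G" unfolding add_Pair by blast
  qed
  have pk: "pket y \<in> Domain G" for y using pket_mem by blast
  define S1 S2 where "S1 = {\<xi>. (\<xi>, 0) \<in> Domain G}" and "S2 = {\<eta>. (0, \<eta>) \<in> Domain G}"
  have pair: "(\<xi>, 0) + (\<xi>', 0) = (\<xi> + \<xi>', 0 :: 'a ell2)" "(0, \<xi>) + (0, \<xi>') = (0 :: 'a ell2, \<xi> + \<xi>')"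
    "c *\<^sub>C (\<xi>, 0) = (c *\<^sub>C \<xi>, 0 :: 'a ell2)" "c *\<^sub>C (0, \<xi>) = (0 :: 'a ell2, c *\<^sub>C \<xi>)"
    for \<xi> \<xi>' :: "'a ell2" and c by (simp_all add: scaleC_prod_def)
  note D = complex_vector.subspace_0[OF sub, unfolded zero_prod_def]
      complex_vector.subspace_add[OF sub]
    complex_vector.subspace_scale[OF sub]
  have S1: "csubspace S1"
    unfolding S1_def complex_vector.subspace_def mem_Collect_eq pair[symmetric] by (blast intro: D)
  have S2: "csubspace S2"
    unfolding S2_def complex_vector.subspace_def mem_Collect_eq pair[symmetric] by (blast intro: D)
  have kets: "range ket \<subseteq> S1" "range ket \<subseteq> S2"
    using pk[of "(True, _)"] pk[of "(False, _)"] by (auto simp: S1_def S2_def pket_def)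
  have "cspan (range ket) \<subseteq> S1" "cspan (range ket) \<subseteq> S2"
    by (rule complex_vector.span_minimal[OF kets(1) S1], rule complex_vector.span_minimal[OF
        kets(2) S2])
  hence "closure S1 = UNIV" "closure S2 = UNIV" by (simp_all add: closure_csubspace_ket)
  hence "closure (S1 \<times> S2) = UNIV" by (simp add: closure_Times)
  moreover have "S1 \<times> S2 \<subseteq> Domain G"
  proof clarify
    fix \<xi> \<eta> assume "\<xi> \<in> S1" "\<eta> \<in> S2"
    hence "(\<xi>, 0) + (0, \<eta>) \<in> Domain G" by (intro complex_vector.subspace_add[OF sub]) (simp_all
        only: S1_def S2_def mem_Collect_eq)
    thus "(\<xi>, \<eta>) \<in> Domain G" by simp
  qed
  ultimately show ?thesis using closure_mono by blast
qed

lemma self_adjoint: "self_adjoint_op G"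
  by (simp add: self_adjoint_op_def csubspace_monomial_op single_valued_monomial_op closure_Domain
      op_adjoint_eq)

text \<open>T equals its adjoint, which \<open>adjoint_core\<close> places inside G; passing to
  adjoints reverses the inclusion. This is essential self-adjointness of the restriction to the span
  of the basis.\<close>

lemma self_adjoint_unique:
  assumes T: "self_adjoint_op T" and core: "\<And>y. (pket y, m (\<sigma> y) *\<^sub>C pket (\<sigma> y)) \<in> T"
  shows "T = G"
proof -
  have adj: "op_adjoint T = T" using T by (simp add: self_adjoint_op_def)
  hence "T \<subseteq> G" using adjoint_core[OF core] by simp
  moreover from op_adjoint_antimono[OF this] have "G \<subseteq> T" by (simp add: adj op_adjoint_eq)
  ultimately show ?thesis by blast
qed

text \<open>Where |m| exceeds N, coordinates of u are at most 1/N times coordinates of its image, so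
  a bound on u and its image makes the tails uniformly small.\<close>

lemma relatively_compact_bounded_graph:
  assumes fin: "\<And>N. finite {y. cmod (m y) \<le> N}"
    and S: "\<And>u. u \<in> S \<Longrightarrow> norm u \<le> K \<and> (\<exists>v. (u, v) \<in> G \<and> norm v \<le> K)"
  shows "compact (closure S)"
proof (rule relatively_compactI)
  show "norm u \<le> K" if "u \<in> S" for u using S[OF that] by simp
  fix e :: real assume e: "e > 0"
  \<comment> \<open>N is chosen so that |K| = N e. It is 0 only for K = 0, when S contains at most
    the zero vector; that case is separated below.\<close>
  define N where "N = \<bar>K\<bar> / e"
  have N: "N \<ge> 0" "K\<^sup>2 \<le> (N * e)\<^sup>2" using e by (simp_all add: N_def)
  let ?F = "{y. cmod (m y) \<le> N}"
  have "norm (u - pair_restrict ?F u) \<le> e" if u: "u \<in> S" for u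
  proof (rule norm_pair_restrict_diff_le[OF fin])
    obtain v where v: "(u, v) \<in> G" "norm v \<le> K" using S[OF u] by blast
    fix E assume E: "finite E" "E \<inter> ?F = {}"
    show "(\<Sum>y\<in>E. (cmod (pcoord u y))\<^sup>2) \<le> e\<^sup>2"
    proof (cases "E = {}")
      case False
      then obtain y0 where "y0 \<in> E" by blast
      have "N\<^sup>2 * (\<Sum>y\<in>E. (cmod (pcoord u y))\<^sup>2) \<le> (\<Sum>y\<in>E. (cmod (pcoord v (\<sigma> y)))\<^sup>2)"
        unfolding sum_distrib_left
      proof (rule sum_mono)
        fix y assume "y \<in> E"
        hence "N \<le> cmod (m y)" using E(2) by fastforce
        hence "N * cmod (pcoord u y) \<le> cmod (pcoord v (\<sigma> y))"
          by (simp add: monomial_opD[OF v(1)] invol norm_mult cmod_sym mult_right_mono)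
        from power_mono[OF this, of 2] N(1)
        show "N\<^sup>2 * (cmod (pcoord u y))\<^sup>2 \<le> (cmod (pcoord v (\<sigma> y)))\<^sup>2"
            by (simp add: power_mult_distrib)
      qed
      also have "\<dots> = (\<Sum>y\<in>\<sigma> ` E. (cmod (pcoord v y))\<^sup>2)" by (simp add: sum.reindex[OF sigma_inj])
      also have "\<dots> \<le> (norm v)\<^sup>2" by (rule pcoord_sum_le) (simp add: E)
      also have "\<dots> \<le> K\<^sup>2" using v(2) by (intro power_mono) auto
      also have "\<dots> \<le> N\<^sup>2 * e\<^sup>2" using N by (simp add: power_mult_distrib)
      finally have le: "N\<^sup>2 * (\<Sum>y\<in>E. (cmod (pcoord u y))\<^sup>2) \<le> N\<^sup>2 * e\<^sup>2" .
      show ?thesis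
      proof (cases "N = 0")
        case True
        hence "norm u \<le> 0" using S[OF u] e by (simp add: N_def)
        thus ?thesis by simp
      qed (use le N in simp)
    qed simp
  qed (use e in simp)
  thus "\<exists>F. finite F \<and> (\<forall>u\<in>S. norm (u - pair_restrict F u) \<le> e)" using fin by blast
qed

text \<open>The resolvent at the imaginary unit is (G + i) (G^2 + 1)^(-1), where G^2 is diagonal
  with entries |m y|^2; this is Q, with denominators \<open>n y\<close>. Any bounded resolvent maps
  the unit ball to vectors that are bounded together with their images under G, hence to a
  relatively compact set.\<close>

lemma compact_resolvent:
  assumes fin: "\<And>N. finite {y. cmod (m y) \<le> N}"
  shows "has_compact_resolvent G"
  unfolding has_compact_resolvent_def
proof (intro conjI allI impI)
  have pos: "1 + (cmod (m y))\<^sup>2 > 0" for y by (simp add: add_pos_nonneg)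
  have nz: "1 + complex_of_real ((cmod (m y))\<^sup>2) \<noteq> 0" for y
    using pos[of y] by (metis of_real_1 of_real_add of_real_eq_0_iff less_irrefl)
  define n where "n y = 1 + complex_of_real ((cmod (m y))\<^sup>2)" for y
  have n: "n y \<noteq> 0" "cmod (n y) = 1 + (cmod (m y))\<^sup>2" "n (\<sigma> y) = n y" for y
  proof -
    show "n y \<noteq> 0" using nz by (simp add: n_def)
    have "n y = complex_of_real (1 + (cmod (m y))\<^sup>2)" by (simp add: n_def)
    thus "cmod (n y) = 1 + (cmod (m y))\<^sup>2" using pos[of y] by (simp only: norm_of_real)
    show "n (\<sigma> y) = n y" by (simp add: n_def cmod_sym)
  qed
  have mm: "m y * cnj (m y) = n y - 1" for y by (simp add: n_def complex_norm_square del: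
      of_real_power)
  have b1: "cmod (\<i> / n y) \<le> 1" for y using pos[of y] by (simp add: norm_divide n(2))
  have b2: "cmod (m y / n y) \<le> 1" for y
  proof -
    have "cmod (m y) \<le> 1 + (cmod (m y))\<^sup>2"
      using sum_squares_bound[of 1 "cmod (m y)"]
        by (simp add: power2_eq_square) (smt (verit) norm_ge_zero)
    thus ?thesis using pos[of y] by (simp add: norm_divide n(2))
  qed
  define Q where "Q w = pair_shift (\<lambda>y. y) (\<lambda>y. \<i> / n y) w + pair_shift \<sigma> (\<lambda>y. m y / n y) w"
    for w :: "'a ell2_pair"
  have Q: "pcoord (Q w) y = (\<i> * pcoord w y + m y * pcoord w (\<sigma> y)) / n y" for w y
    by (simp add: Q_def pcoord_pair_shift[OF _ b1] pcoord_pair_shift[OF sigma_inj b2]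
        add_divide_distrib)
  have "bounded_clinear Q"
    unfolding Q_def
    by (intro bounded_clinear_plus pair_shift_bounded_clinear[OF _ b1]
        pair_shift_bounded_clinear[OF sigma_inj b2]) auto
  moreover have "op_graph Q = resolvent_graph G \<i>"
  proof
    show "op_graph Q \<subseteq> resolvent_graph G \<i>"
    proof
      fix p assume "p \<in> op_graph Q"
      then obtain w where p: "p = (w, Q w)" by (auto simp: op_graph_def)
      have "(Q w, w + \<i> *\<^sub>C Q w) \<in> G"
      proof (rule monomial_opI)
        fix y
        have "m y * pcoord (Q w) (\<sigma> y) = (\<i> * m y * pcoord w (\<sigma> y) + (m y * cnj (m y)) * pcoord w
            y) / n y"
          by (simp add: Q n(3) invol sym algebra_simps add_divide_distrib)
        also have "\<dots> = pcoord w y + \<i> * ((\<i> * pcoord w y + m y * pcoord w (\<sigma> y)) / n y)"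
          unfolding mm using n(1)[of y] by (simp add: field_simps)
        finally show "pcoord (w + \<i> *\<^sub>C Q w) y = m y * pcoord (Q w) (\<sigma> y)" by (simp add: Q)
      qed
      moreover have "w = (w + \<i> *\<^sub>C Q w) - \<i> *\<^sub>C Q w" by simp
      ultimately show "p \<in> resolvent_graph G \<i>" unfolding resolvent_graph_def p by blast
    qed
    show "resolvent_graph G \<i> \<subseteq> op_graph Q"
    proof
      fix p assume "p \<in> resolvent_graph G \<i>"
      then obtain u v where p: "p = (v - \<i> *\<^sub>C u, u)" and uv: "(u, v) \<in> G"
        by (auto simp: resolvent_graph_def)
      have "Q (v - \<i> *\<^sub>C u) = u"
      proof (rule pcoord_eqI)
        fix y
        have "pcoord (Q (v - \<i> *\<^sub>C u)) y = (pcoord u y + (m y * cnj (m y)) * pcoord u y) / n y"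
          by (simp add: Q monomial_opD[OF uv] invol sym algebra_simps)
        also have "\<dots> = pcoord u y" unfolding mm using n(1)[of y] by (simp add: field_simps)
        finally show "pcoord (Q (v - \<i> *\<^sub>C u)) y = pcoord u y" .
      qed
      thus "p \<in> op_graph Q" unfolding p op_graph_def by force
    qed
  qed
  ultimately show "\<exists>z R. bounded_clinear R \<and> op_graph R = resolvent_graph G z" by blast
next
  fix z R assume "bounded_clinear R \<and> op_graph R = resolvent_graph G z"
  hence R: "bounded_clinear R" and graph: "op_graph R = resolvent_graph G z" by auto
  define K where "K = 1 + onorm R + cmod z * onorm R"
  have o: "onorm R \<ge> 0" by (rule onorm_pos_le[OF bounded_clinear_bounded_linear[OF R]])
  have "compact (closure (R ` ball 0 1))"
  proof (rule relatively_compact_bounded_graph[OF fin])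
    fix u assume "u \<in> R ` ball 0 1"
    then obtain x where x: "u = R x" "norm x \<le> 1" by auto
    have u: "norm u \<le> onorm R"
      using bounded_clinear_norm_le[OF R, of x] mult_left_mono[OF x(2) o] by (simp add: x(1))
    have "(x, u) \<in> resolvent_graph G z" unfolding graph[symmetric] op_graph_def x(1) by blast
    then obtain v where v: "x = v - z *\<^sub>C u" "(u, v) \<in> G" by (auto simp: resolvent_graph_def)
    have "v = x + z *\<^sub>C u" by (simp add: v(1))
    hence "norm v \<le> norm x + cmod z * norm u" using norm_triangle_ineq[of x "z *\<^sub>C u"] by simp
    also have "\<dots> \<le> 1 + cmod z * onorm R" using x(2) u by (intro add_mono mult_left_mono) auto
    finally have "norm v \<le> K" using o by (simp add: K_def)
    moreover have "norm u \<le> K" using u o by (simp add: K_def add_nonneg_nonneg add_increasing2)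
    ultimately show "norm u \<le> K \<and> (\<exists>v. (u, v) \<in> G \<and> norm v \<le> K)" using v(2) by blast
  qed
  thus "compact_operator R" using R by (simp add: compact_operator_def)
qed

section \<open>The absolute value of a monomial operator\<close>

abbreviation absm :: "bool \<times> 'a \<Rightarrow> complex" where "absm y \<equiv> complex_of_real (cmod (m y))"
abbreviation A where "A \<equiv> monomial_op (\<lambda>y. y) absm"

interpretation abs: monomial_operator "\<lambda>y. y" absm
  by unfold_locales simp_all

lemma abs_positive: "positive_op A"
  unfolding positive_op_def
proof (intro conjI abs.self_adjoint)
  have "0 \<le> Re (cinner v u)" if "(u, v) \<in> A" for u v
  proof -
    have s: "(\<lambda>y. pcoord v y * cnj (pcoord u y)) summable_on UNIV"
      by (rule ell2_prod_summable[OF pcoord_summable pcoord_summable])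
    have "Re (cinner v u) = (\<Sum>\<^sub>\<infinity>y. Re (pcoord v y * cnj (pcoord u y)))"
      unfolding cinner_pcoord by (rule infsum_Re[OF s, symmetric])
    also have "\<dots> \<ge> 0"
      by (rule infsum_nonneg) (simp add: monomial_opD[OF that] mult.assoc
          complex_norm_square[symmetric] del: of_real_power)
    finally show ?thesis .
  qed
  thus "\<forall>(u, v)\<in>A. 0 \<le> Re (cinner v u)" by blast
qed

text \<open>Both squares multiply coordinates by |m y|^2, but their domains have to match too. The
  intermediate vectors A u and G u differ by partial isometries built from the phases of m, which
  are bounded and so stay within the space.\<close>

lemma abs_square: "A O A = G O G"
proof -
  have b1: "cmod (if m y = 0 then 0 else m y / absm y) \<le> 1" for y by (simp add: norm_divide)
  have b2: "cmod (if m y = 0 then 0 else absm y / m (\<sigma> y)) \<le> 1" for y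
      by (simp add: norm_divide cmod_sym)
  show ?thesis
  proof (intro equalityI subrelI)
    fix u w assume "(u, w) \<in> A O A"
    then obtain v where v: "(u, v) \<in> A" "(v, w) \<in> A" by blast
    let ?v = "pair_shift \<sigma> (\<lambda>y. if m y = 0 then 0 else m y / absm y) v"
    have "(u, ?v) \<in> G"
      by (rule monomial_opI) (simp add: pcoord_pair_shift[OF sigma_inj b1] monomial_opD[OF v(1)]
          cmod_sym)
    moreover have "(?v, w) \<in> G"
    proof (rule monomial_opI)
      fix y
      show "pcoord w y = m y * pcoord ?v (\<sigma> y)"
        using complex_norm_square[of "m y"]
        by (simp add: pcoord_pair_shift[OF sigma_inj b1] monomial_opD[OF v(2)] invol sym
            field_simps power2_eq_square)
    qed
    ultimately show "(u, w) \<in> G O G" by blast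
  next
    fix u w assume "(u, w) \<in> G O G"
    then obtain v where v: "(u, v) \<in> G" "(v, w) \<in> G" by blast
    let ?v = "pair_shift \<sigma> (\<lambda>y. if m y = 0 then 0 else absm y / m (\<sigma> y)) v"
    have "(u, ?v) \<in> A"
      by (rule monomial_opI) (simp add: pcoord_pair_shift[OF sigma_inj b2] monomial_opD[OF v(1)]
          invol sym)
    moreover have "(?v, w) \<in> A"
    proof (rule monomial_opI)
      fix y
      show "pcoord w y = absm y * pcoord ?v y"
        using complex_norm_square[of "m y"]
        by (simp add: pcoord_pair_shift[OF sigma_inj b2] monomial_opD[OF v(2)] sym
            field_simps power2_eq_square)
    qed
    ultimately show "(u, w) \<in> A O A" by blast
  qed
qed

text \<open>A positive square root \<open>P\<close> of \<open>G\<^sup>2\<close> maps each basis vector \<open>e\<close> with \<open>G\<^sup>2 e = s\<^sup>2 e\<close> to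
  \<open>s e\<close>, because \<open>P (P e - s e) = - s (P e - s e)\<close>.\<close>

lemma op_abs_eq: "op_abs G = A"
  unfolding op_abs_def op_adjoint_eq
proof (rule the_equality)
  show "positive_op A \<and> A O A = G O G" by (simp add: abs_positive abs_square)
  fix P assume P: "positive_op P \<and> P O P = G O G"
  hence sa: "self_adjoint_op P" and pos: "\<And>u v. (u, v) \<in> P \<Longrightarrow> 0 \<le> Re (cinner v u)"
    and sq: "P O P = A O A" by (auto simp: positive_op_def abs_square)
  from sa have sub: "csubspace P" and adj: "op_adjoint P = P" by (auto simp: self_adjoint_op_def)
  have "(pket y, absm y *\<^sub>C pket y) \<in> P" for y
  proof -
    let ?s = "cmod (m y)" and ?e = "pket y"
    have "(?e, absm y *\<^sub>C ?e) \<in> A" "(absm y *\<^sub>C ?e, absm y *\<^sub>C absm y *\<^sub>C ?e) \<in> A"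
      by (rule monomial_opI; auto simp: pcoord_pket)+
    hence "(?e, absm y *\<^sub>C absm y *\<^sub>C ?e) \<in> P O P" unfolding sq by blast
    then obtain f where f: "(?e, f) \<in> P" "(f, absm y *\<^sub>C absm y *\<^sub>C ?e) \<in> P" by blast
    define g where "g = f - absm y *\<^sub>C ?e"
    have "g = 0"
    proof (cases "m y = 0")
      case True
      \<comment> \<open>For eigenvalue 0 the argument is symmetry: |P e|^2 = <P e, f> = <e, P f> =
        0.\<close>
      with f(2) have f0: "(f, 0) \<in> P" by simp
      have "cinner f f = cinner ?e 0"
        using f(1) f0 adj unfolding op_adjoint_def by blast
      thus ?thesis using True by (simp add: g_def cinner_self)
    next
      case False
      have "(f, absm y *\<^sub>C absm y *\<^sub>C ?e) - absm y *\<^sub>C (?e, f) \<in> P"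
        by (intro complex_vector.subspace_diff[OF sub] complex_vector.subspace_scale[OF sub] f)
      moreover have "(f, absm y *\<^sub>C absm y *\<^sub>C ?e) - absm y *\<^sub>C (?e, f) = (g, - (absm y *\<^sub>C g))"
        by (simp add: g_def scaleC_prod_def scaleC_diff_right)
      ultimately have "0 \<le> Re (cinner (- (absm y *\<^sub>C g)) g)" by (intro pos) metis
      hence "?s * (norm g)\<^sup>2 \<le> 0" by (simp add: cinner_scaleC_left cinner_self del: of_real_power
          flip: of_real_mult)
      thus ?thesis using False by (simp add: mult_le_0_iff)
    qed
    thus ?thesis using f(1) by (simp add: g_def)
  qed
  thus "P = A" by (intro abs.self_adjoint_unique[OF sa]) simp
qed

end

section \<open>Singular values of the inverse cube\<close>

lemma harm_le_ln: assumes "n > 0" shows "harm n \<le> 1 + ln (real n)"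
proof -
  obtain k where k: "n = Suc k" using assms gr0_implies_Suc by blast
  have "harm (Suc k) - ln (real (Suc k)) \<le> harm (Suc 0) - ln (real (Suc 0))"
    using decseq_harm_diff_ln[THEN decseqD, of 0 k] by simp
  thus ?thesis by (simp add: k harm_expand)
qed

lemma relpow_3: "(u, v) \<in> r ^^ 3 \<longleftrightarrow> (\<exists>a b. (u, a) \<in> r \<and> (a, b) \<in> r \<and> (b, v) \<in> r)"
  by (auto simp: eval_nat_numeral relcomp_unfold)

lemma singular_value_le:
  assumes "0 \<le> t" "finite b" "card b \<le> k"
    and "\<And>s x. t < s \<Longrightarrow> cadjoint B (B x) = complex_of_real (s\<^sup>2) *\<^sub>C x \<Longrightarrow> x \<in> cspan b"
  shows "singular_value B k \<le> t"
  unfolding singular_value_def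
  by (rule cInf_lower) (use assms in \<open>auto simp: bdd_below_def\<close>)

text \<open>\<open>gap\<close> keeps the entries of the inverse cube at most 1, and
  \<open>count\<close> is the growth of order r^3 that decides summability. The indices of the
  kernel are included in the count.\<close>

locale summable_monomial_operator = monomial_operator +
  fixes C :: real
  assumes gap: "m y \<noteq> 0 \<Longrightarrow> 1 \<le> cmod (m y)"
    and finite_level: "finite {y. cmod (m y) \<le> r}"
    and count: "1 \<le> r \<Longrightarrow> real (card {y. cmod (m y) < r}) \<le> C * r ^ 3"
begin

text \<open>Since \<open>inverse 0 = 0\<close>, this vanishes on indices of the kernel, which is the
  extension by zero built into \<open>op_abs_inverse_power\<close>.\<close>

definition \<beta> :: "bool \<times> 'a \<Rightarrow> real" where "\<beta> y = inverse (cmod (m y)) ^ 3"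

definition B :: "'a ell2_pair \<Rightarrow> 'a ell2_pair" where "B = pair_shift (\<lambda>y. y) (\<lambda>y. complex_of_real
    (\<beta> y))"

lemma inverse_power_le: "cmod (complex_of_real (inverse (cmod (m y)) ^ n)) \<le> 1"
proof (cases "m y = 0")
  case False
  hence "inverse (cmod (m y)) \<le> 1" using gap by (simp add: inverse_le_1_iff)
  hence "inverse (cmod (m y)) ^ n \<le> 1" by (intro power_le_one) auto
  thus ?thesis by (simp only: norm_of_real) simp
qed (simp add: power_0_left)

lemma beta_le: "cmod (complex_of_real (\<beta> y)) \<le> 1"
  unfolding \<beta>_def by (rule inverse_power_le)

lemma beta_nonneg: "0 \<le> \<beta> y" by (simp add: \<beta>_def)

lemma beta_mult: "m y \<noteq> 0 \<Longrightarrow> cmod (m y) ^ 3 * \<beta> y = 1"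
  by (simp add: \<beta>_def power_inverse)

lemma pcoord_B: "pcoord (B u) y = complex_of_real (\<beta> y) * pcoord u y"
  unfolding B_def by (rule pcoord_pair_shift[of _ _ 1]) (simp_all only: beta_le inj_on_def, simp)

lemma B_bounded_clinear: "bounded_clinear B"
  unfolding B_def by (rule pair_shift_bounded_clinear[of _ _ 1]) (simp_all only: beta_le
      inj_on_def, simp)

lemma cadjoint_B: "cadjoint B = B"
  by (rule cadjoint_eqI) (simp add: adjoint_pair_def cinner_pcoord pcoord_B mult_ac)

lemma beta_level: assumes "0 < s" shows "{y. s < \<beta> y} \<subseteq> {y. m y \<noteq> 0 \<and> cmod (m y) < root 3 (1 / s)}"
proof clarify
  fix y assume s: "s < \<beta> y"
  hence my: "m y \<noteq> 0" using assms by (auto simp: \<beta>_def)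
  hence "cmod (m y) ^ 3 * s < cmod (m y) ^ 3 * \<beta> y" using s by simp
  hence "cmod (m y) ^ 3 < 1 / s" using beta_mult[OF my] assms by (simp add: less_divide_eq)
  hence "root 3 (cmod (m y) ^ 3) < root 3 (1 / s)" by simp
  thus "m y \<noteq> 0 \<and> cmod (m y) < root 3 (1 / s)" using my by (simp add: real_root_power_cancel)
qed

lemma finite_beta_level: "0 < s \<Longrightarrow> finite {y. s < \<beta> y}"
  using finite_subset[OF beta_level finite_subset[OF _ finite_level[of "root 3 (1 / s)"]]] by force

lemma C_nonneg: "0 \<le> C"
  using order_trans[OF of_nat_0_le_iff count[of 1]] by simp

text \<open>The level s of \<beta> is the level r = s^(-1/3) of |m|, where the count C r^3 equals C
  / s. If r < 1, the gap leaves no index at all.\<close>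

lemma card_beta_level: assumes "0 < s" shows "real (card {y. s < \<beta> y}) \<le> C / s"
proof (cases "1 \<le> root 3 (1 / s)")
  case True
  let ?r = "root 3 (1 / s)"
  have "finite {y. cmod (m y) < ?r}" by (rule finite_subset[OF _ finite_level[of ?r]]) auto
  hence "card {y. s < \<beta> y} \<le> card {y. cmod (m y) < ?r}" using beta_level[OF assms]
      by (intro card_mono) auto
  hence "real (card {y. s < \<beta> y}) \<le> C * ?r ^ 3" using count[OF True] by linarith
  thus ?thesis using assms by simp
next
  case False
  have "\<not> s < \<beta> y" for y
  proof
    assume "s < \<beta> y"
    hence "m y \<noteq> 0" "cmod (m y) < root 3 (1 / s)" using beta_level[OF assms] by blast+
    thus False using False gap[of y] by linarith
  qed
  hence empty: "{y. s < \<beta> y} = {}" by blast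
  show ?thesis unfolding empty using assms C_nonneg by simp
qed

text \<open>The square of B is diagonal, so an eigenvector for r^2 with r > s is supported where
  \<beta> = r; the finitely many basis vectors with \<beta> > s span all these eigenspaces.\<close>

lemma singular_value_B_le:
  assumes s: "0 < s" and k: "card {y. s < \<beta> y} \<le> k" shows "singular_value B k \<le> s"
proof (rule singular_value_le)
  let ?F = "{y. s < \<beta> y}"
  show "finite (pket ` ?F)" using finite_beta_level[OF s] by simp
  show "card (pket ` ?F) \<le> k" using card_image_le[OF finite_beta_level[OF s], of pket] k by simp
  fix r x assume r: "s < r" and x: "cadjoint B (B x) = complex_of_real (r\<^sup>2) *\<^sub>C x"
  have "y \<in> ?F" if "pcoord x y \<noteq> 0" for y
  proof -
    have "complex_of_real ((\<beta> y)\<^sup>2) * pcoord x y = complex_of_real (r\<^sup>2) * pcoord x y"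
      using arg_cong[OF x, of "\<lambda>u. pcoord u y"] unfolding cadjoint_B
        by (simp add: pcoord_B power2_eq_square)
    hence "(\<beta> y)\<^sup>2 = r\<^sup>2" using that by (simp del: of_real_power)
    hence "\<beta> y = r" using beta_nonneg[of y] r s by simp
    thus ?thesis using r by simp
  qed
  hence "x = pair_restrict ?F x"
    by (intro pcoord_eqI) (auto simp: pcoord_pair_restrict finite_beta_level[OF s])
  also have "\<dots> \<in> cspan (pket ` ?F)"
    unfolding pair_restrict_def
    by (intro complex_vector.span_sum complex_vector.span_scale complex_vector.span_base imageI)
  finally show "x \<in> cspan (pket ` ?F)" .
qed (use s in simp)

lemma B_compact: "compact_operator B"
  unfolding compact_operator_def
proof (intro conjI B_bounded_clinear relatively_compactI)
  show "norm u \<le> 1" if u: "u \<in> B ` ball 0 1" for u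
  proof -
    obtain x where "u = B x" "x \<in> ball 0 1" using u by blast
    hence x: "u = B x" "norm x \<le> 1" by simp_all
    have "norm (B x) \<le> 1 * norm x"
      unfolding B_def by (rule pair_shift_norm_le) (simp_all only: beta_le inj_on_def, simp)
    thus ?thesis using x by simp
  qed
  fix e :: real assume e: "e > 0"
  let ?F = "{y. e < \<beta> y}"
  have "norm (u - pair_restrict ?F u) \<le> e" if u: "u \<in> B ` ball 0 1" for u
  proof (rule norm_pair_restrict_diff_le[OF finite_beta_level[OF e]])
    obtain x where "u = B x" "x \<in> ball 0 1" using u by blast
    hence x: "u = B x" "norm x \<le> 1" by simp_all
    fix E assume E: "finite E" "E \<inter> ?F = {}"
    have "(\<Sum>y\<in>E. (cmod (pcoord u y))\<^sup>2) \<le> (\<Sum>y\<in>E. e\<^sup>2 * (cmod (pcoord x y))\<^sup>2)"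
    proof (rule sum_mono)
      fix y assume "y \<in> E"
      hence "\<beta> y \<le> e" using E(2) by fastforce
      hence "cmod (pcoord u y) \<le> e * cmod (pcoord x y)"
        by (simp add: x(1) pcoord_B norm_mult beta_nonneg mult_right_mono)
      from power_mono[OF this, of 2] show "(cmod (pcoord u y))\<^sup>2 \<le> e\<^sup>2 * (cmod (pcoord x y))\<^sup>2"
        by (simp add: power_mult_distrib)
    qed
    also have "\<dots> \<le> e\<^sup>2 * (norm x)\<^sup>2"
      unfolding sum_distrib_left[symmetric] by (intro mult_left_mono pcoord_sum_le E) simp
    also have "\<dots> \<le> e\<^sup>2" using x(2) by (simp add: mult_left_le power_le_one)
    finally show "(\<Sum>y\<in>E. (cmod (pcoord u y))\<^sup>2) \<le> e\<^sup>2" .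
  qed (use e in simp)
  thus "\<exists>F. finite F \<and> (\<forall>u\<in>B ` ball 0 1. norm (u - pair_restrict F u) \<le> e)"
    using finite_beta_level[OF e] by blast
qed

text \<open>At the level C' / k at most k indices remain, so the singular value with index k is at
  most C' / k and partial sums grow like harmonic numbers. The maximum with 1 makes the level
  positive, and index 0 is bounded separately by 1.\<close>

lemma B_dixmier: "B \<in> dixmier_ideal"
proof -
  note C = C_nonneg
  define C' where "C' = max C 1"
  have C': "C' \<ge> 1" "C \<le> C'" by (simp_all add: C'_def)
  have s0: "singular_value B 0 \<le> 1"
  proof (rule singular_value_B_le)
    have "\<not> 1 < \<beta> y" for y using beta_le[of y] beta_nonneg[of y] by simp
    hence empty: "{y. 1 < \<beta> y} = {}" by blast
    show "card {y. 1 < \<beta> y} \<le> 0" unfolding empty by simp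
  qed simp
  have sk: "singular_value B k \<le> C' * inverse (real k)" if "k > 0" for k
  proof (rule singular_value_B_le)
    show pos: "0 < C' * inverse (real k)" using C' that by simp
    have "real (card {y. C' * inverse (real k) < \<beta> y}) \<le> C / (C' * inverse (real k))"
      by (rule card_beta_level[OF pos])
    also have "\<dots> \<le> real k" using C C' that by (simp add: divide_simps mult_left_mono)
    finally show "card {y. C' * inverse (real k) < \<beta> y} \<le> k" by simp
  qed
  have "(\<Sum>k<n. singular_value B k) / ln (real n) \<le> (1 + C') / ln 2 + C'" if n: "n \<ge> 2" for n
  proof -
    have "(\<Sum>k<n. singular_value B k) = singular_value B 0 + (\<Sum>k\<in>{1..<n}. singular_value B k)"
      using n by (simp add: lessThan_atLeast0 sum.atLeast_Suc_lessThan)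
    also have "\<dots> \<le> 1 + (\<Sum>k\<in>{1..<n}. C' * inverse (real k))"
      by (intro add_mono s0 sum_mono sk) auto
    also have "(\<Sum>k\<in>{1..<n}. C' * inverse (real k)) \<le> (\<Sum>k\<in>{1..n}. C' * inverse (real k))"
      using C' by (intro sum_mono2) auto
    also have "\<dots> = C' * harm n" by (simp add: harm_def sum_distrib_left)
    also have "\<dots> \<le> C' * (1 + ln (real n))" using harm_le_ln[of n] n C'
        by (intro mult_left_mono) auto
    finally have le: "(\<Sum>k<n. singular_value B k) \<le> (1 + C') + C' * ln (real n)"
        by (simp add: algebra_simps)
    have ln: "ln 2 \<le> ln (real n)" "0 < ln (2 :: real)" "0 < ln (real n)" using n by simp_all
    have "(\<Sum>k<n. singular_value B k) / ln (real n) \<le> ((1 + C') + C' * ln (real n)) / ln (real n)"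
      using le ln by (intro divide_right_mono) linarith+
    also have "\<dots> = (1 + C') / ln (real n) + C'" using ln(3) by (simp add: add_divide_distrib)
    also have "\<dots> \<le> (1 + C') / ln 2 + C'"
      using ln C' by (intro add_right_mono divide_left_mono mult_pos_pos) auto
    finally show ?thesis .
  qed
  thus ?thesis
    unfolding dixmier_ideal_def using B_compact
    by (auto simp: bdd_above_def intro!: exI[of _ "(1 + C') / ln 2 + C'"])
qed

lemma kernel_iff: "k \<in> op_kernel G \<longleftrightarrow> (\<forall>y. m y \<noteq> 0 \<longrightarrow> pcoord k y = 0)"
proof
  assume "k \<in> op_kernel G"
  hence k: "(k, 0) \<in> G" by (simp add: op_kernel_def)
  show "\<forall>y. m y \<noteq> 0 \<longrightarrow> pcoord k y = 0"
  proof (intro allI impI)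
    fix y assume "m y \<noteq> 0"
    moreover have "0 = m (\<sigma> y) * pcoord k (\<sigma> (\<sigma> y))" using monomial_opD[OF k, of "\<sigma> y"] by simp
    ultimately show "pcoord k y = 0" by (simp add: sym invol)
  qed
next
  assume k: "\<forall>y. m y \<noteq> 0 \<longrightarrow> pcoord k y = 0"
  have "m y * pcoord k (\<sigma> y) = 0" for y
    using k[rule_format, of "\<sigma> y"] by (cases "m y = 0") (simp_all add: sym)
  thus "k \<in> op_kernel G" unfolding op_kernel_def
      by (auto intro: monomial_opI simp del: split_paired_All)
qed

lemma B_graph: "op_graph B = op_abs_inverse_power G 3"
proof (intro equalityI subrelI)
  fix x u assume "(x, u) \<in> op_graph B"
  hence u: "u = B x" unfolding op_graph_def by blast
  \<comment> \<open>The kernel summand of x: its projection to the coordinates where m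
    vanishes.\<close>
  define w where "w = pair_shift (\<lambda>y. y) (\<lambda>y. if m y = 0 then 1 else 0) x"
  have pw: "pcoord w y = (if m y = 0 then pcoord x y else 0)" for y
    unfolding w_def by (subst pcoord_pair_shift[of _ _ 1]) (simp_all add: inj_on_def)
  \<comment> \<open>The stations |G|^(-2) x and |G|^(-1) x between u and x - w, which place u in the
    domain of the cube; \<open>inverse 0 = 0\<close> makes them vanish on the kernel.\<close>
  define a where "a n = pair_shift (\<lambda>y. y) (\<lambda>y. complex_of_real (inverse (cmod (m y)) ^ n)) x" for n
  have pa: "pcoord (a n) y = complex_of_real (inverse (cmod (m y)) ^ n) * pcoord x y" for n y
    unfolding a_def by (rule pcoord_pair_shift[of _ _ 1]) (simp_all only: inverse_power_le
        inj_on_def, simp)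
  have "(u, a 2) \<in> A" "(a 2, a 1) \<in> A"
  proof -
    show "(u, a 2) \<in> A"
    proof (rule monomial_opI)
      show "pcoord (a 2) y = absm y * pcoord u y" for y
        by (cases "m y = 0") (simp_all add: u pcoord_B \<beta>_def pa power2_eq_square power3_eq_cube)
    qed
    show "(a 2, a 1) \<in> A"
    proof (rule monomial_opI)
      show "pcoord (a 1) y = absm y * pcoord (a 2) y" for y
        by (cases "m y = 0") (simp_all add: pa power2_eq_square)
    qed
  qed
  moreover have "(a 1, x - w) \<in> A"
    by (rule monomial_opI) (simp add: pw pa)
  ultimately have "(u, x - w) \<in> op_abs G ^^ 3" unfolding op_abs_eq relpow_3 by blast
  moreover have "w \<in> op_kernel G" unfolding kernel_iff pw by simp
  moreover have "cinner u k = 0" if k: "k \<in> op_kernel G" for k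
  proof -
    have "pcoord u y * cnj (pcoord k y) = 0" for y
      using k[unfolded kernel_iff, rule_format, of y]
        by (cases "m y = 0") (simp_all add: u pcoord_B \<beta>_def)
    thus ?thesis unfolding cinner_pcoord by (simp only: infsum_0_simp)
  qed
  moreover have "x = (x - w) + w" by simp
  ultimately show "(x, u) \<in> op_abs_inverse_power G 3" unfolding op_abs_inverse_power_def by blast
next
  fix x u assume "(x, u) \<in> op_abs_inverse_power G 3"
  then obtain v w where x: "x = v + w" and uv: "(u, v) \<in> op_abs G ^^ 3"
    and orth: "\<And>k. k \<in> op_kernel G \<Longrightarrow> cinner u k = 0" and w: "w \<in> op_kernel G"
    unfolding op_abs_inverse_power_def by blast
  obtain a b where ab: "(u, a) \<in> A" "(a, b) \<in> A" "(b, v) \<in> A" using uv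
    unfolding op_abs_eq relpow_3 by blast
  have v: "pcoord v y = complex_of_real (cmod (m y) ^ 3) * pcoord u y" for y
    by (simp add: monomial_opD[OF ab(1)] monomial_opD[OF ab(2)] monomial_opD[OF ab(3)]
        power3_eq_cube mult.assoc)
  have "B x = u"
  proof (rule pcoord_eqI)
    fix y
    show "pcoord (B x) y = pcoord u y"
    proof (cases "m y = 0")
      case True
      hence "pket y \<in> op_kernel G" unfolding kernel_iff by (auto simp: pcoord_pket)
      from orth[OF this] True show ?thesis by (simp add: pcoord_B \<beta>_def)
    next
      case False
      hence "pcoord w y = 0" using w kernel_iff by blast
      hence "pcoord (B x) y = complex_of_real (cmod (m y) ^ 3 * \<beta> y) * pcoord u y"
        by (simp add: pcoord_B x v)
      thus ?thesis by (simp only: beta_mult[OF False]) simp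
    qed
  qed
  thus "(x, u) \<in> op_graph B" unfolding op_graph_def by blast
qed

lemma p_plus_summable: "p_plus_summable 3 G"
  unfolding p_plus_summable_def using B_dixmier B_graph by blast

end

section \<open>The Dirac operator\<close>

fun dcoef :: "nat \<times> int \<times> int \<Rightarrow> complex" where
  "dcoef (i, j, k) = d_coeff i j k"

text \<open>With \<open>True\<close> for the first component, row \<open>True\<close> of the matrix
  carries the adjoint of T and row \<open>False\<close> carries T; the flip exchanges components and
  keeps the basis index.\<close>

fun dirac_flip :: "bool \<times> nat \<times> int \<times> int \<Rightarrow> bool \<times> nat \<times> int \<times> int" where
  "dirac_flip (s, x) = (\<not> s, x)"

fun dirac_weight :: "bool \<times> nat \<times> int \<times> int \<Rightarrow> complex" where
  "dirac_weight (s, x) = (if s then cnj (dcoef x) else dcoef x)"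

text \<open>The sign of i in d follows the sign of j, so i and |j| add up in the real part instead
  of cancelling. This is what makes the number of eigenvalues in a disc finite.\<close>

lemma cmod_dcoef: "(cmod (dcoef (i, j, k)))\<^sup>2 = real_of_int ((int i + \<bar>j\<bar>)\<^sup>2 + k\<^sup>2)"
  unfolding cmod_power2 by (auto simp: d_coeff_def power2_eq_square algebra_simps)

lemma cmod_dirac_weight: "cmod (dirac_weight (s, x)) = cmod (dcoef x)"
  by simp

lemma dirac_level_subset:
  assumes "0 \<le> r"
  shows "{y. cmod (dirac_weight y) \<le> r}
    \<subseteq> UNIV \<times> {..nat \<lfloor>r\<rfloor>} \<times> {- int (nat \<lfloor>r\<rfloor>)..int (nat \<lfloor>r\<rfloor>)} \<times> {- int (nat \<lfloor>r\<rfloor>)..int (nat \<lfloor>r\<rfloor>)}"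
proof (rule subsetI)
  fix y assume y: "y \<in> {y. cmod (dirac_weight y) \<le> r}"
  obtain s i j k where ys: "y = (s, i, j, k)" by (metis prod_cases4)
  have "cmod (dirac_weight (s, i, j, k)) \<le> r" using y unfolding ys by blast
  hence "(cmod (dcoef (i, j, k)))\<^sup>2 \<le> r\<^sup>2" unfolding cmod_dirac_weight by (intro power_mono) auto
  hence le: "(real i + \<bar>real_of_int j\<bar>)\<^sup>2 + (real_of_int k)\<^sup>2 \<le> r\<^sup>2" unfolding cmod_dcoef by simp
  have "(real i + \<bar>real_of_int j\<bar>)\<^sup>2 \<le> r\<^sup>2" using le zero_le_power2[of "real_of_int k"] by linarith
  hence ij: "real i + \<bar>real_of_int j\<bar> \<le> r" by (rule power2_le_imp_le[OF _ assms])
  have "\<bar>real_of_int k\<bar>\<^sup>2 \<le> r\<^sup>2" using le zero_le_power2[of "real i + \<bar>real_of_int j\<bar>"]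
    unfolding power2_abs by linarith
  hence k: "\<bar>real_of_int k\<bar> \<le> r" by (rule power2_le_imp_le[OF _ assms])
  have "int i \<le> \<lfloor>r\<rfloor>" "\<bar>j\<bar> \<le> \<lfloor>r\<rfloor>" "\<bar>k\<bar> \<le> \<lfloor>r\<rfloor>" using ij k by (simp_all add: le_floor_iff)
  thus "y \<in> UNIV \<times> {..nat \<lfloor>r\<rfloor>} \<times> {- int (nat \<lfloor>r\<rfloor>)..int (nat \<lfloor>r\<rfloor>)} \<times> {- int (nat \<lfloor>r\<rfloor>)..int (nat
      \<lfloor>r\<rfloor>)}"
    using assms by (auto simp: ys)
qed

text \<open>The gap holds because |d|^2 is an integer. The constant 36 is 2 times 2 times 3 times 3:
  two components, N + 1 <= 2 r values of i, and 2 N + 1 <= 3 r values for each of j and k, with N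
  the integer part of r >= 1.\<close>

interpretation dirac: summable_monomial_operator dirac_flip dirac_weight 36
proof
  show "dirac_flip (dirac_flip y) = y" "dirac_weight (dirac_flip y) = cnj (dirac_weight y)" for y
    by (cases y; simp)+
  show "1 \<le> cmod (dirac_weight y)" if "dirac_weight y \<noteq> 0" for y
  proof -
    obtain s i j k where y: "y = (s, i, j, k)" by (metis prod_cases4)
    let ?n = "(int i + \<bar>j\<bar>)\<^sup>2 + k\<^sup>2"
    have "(cmod (dcoef (i, j, k)))\<^sup>2 \<noteq> 0" using that unfolding y by (auto split: if_splits)
    hence "?n \<noteq> 0" unfolding cmod_dcoef by linarith
    moreover have "?n \<ge> 0" by simp
    ultimately have "1 \<le> real_of_int ?n" by linarith
    hence "1\<^sup>2 \<le> (cmod (dcoef (i, j, k)))\<^sup>2" unfolding cmod_dcoef by simp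
    thus ?thesis unfolding y cmod_dirac_weight by (rule power2_le_imp_le) simp
  qed
  show "finite {y. cmod (dirac_weight y) \<le> r}" for r
  proof (cases "0 \<le> r")
    case True
    show ?thesis by (rule finite_subset[OF dirac_level_subset[OF True]]) simp
  next
    case False
    hence "\<not> cmod (dirac_weight y) \<le> r" for y using norm_ge_zero[of "dirac_weight y"] by linarith
    hence "{y. cmod (dirac_weight y) \<le> r} = {}" by blast
    thus ?thesis by (metis finite.emptyI)
  qed
  show "real (card {y. cmod (dirac_weight y) < r}) \<le> 36 * r ^ 3" if r: "1 \<le> r" for r
  proof -
    define N where "N = nat \<lfloor>r\<rfloor>"
    have N: "real N \<le> r" using r by (simp add: N_def)
    let ?S = "(UNIV :: bool set) \<times> {..N} \<times> {- int N..int N} \<times> {- int N..int N}"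
    have "{y. cmod (dirac_weight y) < r} \<subseteq> ?S"
    proof -
      have "{y. cmod (dirac_weight y) < r} \<subseteq> {y. cmod (dirac_weight y) \<le> r}"
        by (rule Collect_mono) (rule impI, rule less_imp_le)
      also have "\<dots> \<subseteq> ?S" unfolding N_def by (rule dirac_level_subset) (use r in simp)
      finally show ?thesis .
    qed
    hence "card {y. cmod (dirac_weight y) < r} \<le> card ?S" by (rule card_mono[rotated]) simp
    also have "card ?S = 2 * ((N + 1) * ((2 * N + 1) * (2 * N + 1)))"
      by (simp add: card_cartesian_product nat_add_distrib nat_mult_distrib)
    finally have "real (card {y. cmod (dirac_weight y) < r}) \<le> real (2 * ((N + 1) * ((2 * N + 1) *
        (2 * N + 1))))"
      by (simp only: of_nat_le_iff)
    also have "\<dots> = 2 * ((real N + 1) * ((2 * real N + 1) * (2 * real N + 1)))"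
        by (simp add: algebra_simps)
    also have "\<dots> \<le> 2 * ((2 * r) * ((3 * r) * (3 * r)))"
      using N r by (intro mult_left_mono mult_mono) auto
    also have "\<dots> = 36 * r ^ 3" by (simp add: power3_eq_cube)
    finally show ?thesis .
  qed
qed

abbreviation dirac_graph where "dirac_graph \<equiv> monomial_op dirac_flip dirac_weight"

lemma T_op_ket: "(ket x, dcoef x *\<^sub>C ket x) \<in> T_op"
proof -
  obtain i j k where x: "x = (i, j, k)" by (metis prod_cases3)
  show ?thesis unfolding T_op_def x by (intro complex_vector.span_base) auto
qed

lemma T_op_coordinates: assumes "(u, v) \<in> T_op" shows "Rep_ell2 v x = dcoef x * Rep_ell2 u x"
proof -
  let ?S = "{(u, v). \<forall>x. Rep_ell2 v x = dcoef x * Rep_ell2 u x}"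
  have "csubspace ?S"
    unfolding complex_vector.subspace_def by (auto simp: zero_prod_def scaleC_prod_def
        algebra_simps)
  hence "T_op \<subseteq> ?S" unfolding T_op_def
    by (intro complex_vector.span_minimal) (auto simp: Rep_ell2_ket)
  thus ?thesis using assms by blast
qed

lemma T_op_zero: "(0, 0) \<in> T_op"
  unfolding T_op_def zero_prod_def[symmetric] by (rule complex_vector.span_zero)

lemma op_adjoint_zero: "(0, 0) \<in> op_adjoint S"
  by (simp add: op_adjoint_def)

lemma T_op_adjoint_ket: "(ket x, cnj (dcoef x) *\<^sub>C ket x) \<in> op_adjoint T_op"
  unfolding op_adjoint_def using T_op_coordinates[of _ _ x]
  by (auto simp: cinner_scaleC_right simp del: dcoef.simps split_paired_All)

lemma T_op_adjoint_coordinates: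
  assumes "(u, v) \<in> op_adjoint T_op" shows "Rep_ell2 v x = cnj (dcoef x) * Rep_ell2 u x"
proof -
  have "cinner (dcoef x *\<^sub>C ket x) u = cinner (ket x) v"
    using assms T_op_ket[of x] unfolding op_adjoint_def by blast
  hence "cnj (dcoef x * cnj (Rep_ell2 u x)) = cnj (cnj (Rep_ell2 v x))"
      by (simp add: cinner_scaleC_left)
  thus ?thesis by simp
qed

lemma Dirac_core_subset: "Dirac_core \<subseteq> dirac_graph"
proof (intro subsetI)
  fix p assume "p \<in> Dirac_core"
  then obtain \<xi> \<eta> \<zeta> \<omega> where p: "p = ((\<xi>, \<eta>), (\<zeta>, \<omega>))"
    and T: "(\<eta>, \<zeta>) \<in> op_adjoint T_op" "(\<xi>, \<omega>) \<in> T_op" unfolding Dirac_core_def by blast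
  show "p \<in> dirac_graph"
    unfolding p
  proof (rule monomial_opI)
    show "pcoord (\<zeta>, \<omega>) y = dirac_weight y * pcoord (\<xi>, \<eta>) (dirac_flip y)" for y
      by (cases y) (simp add: pcoord_def T_op_coordinates[OF T(2)] T_op_adjoint_coordinates[OF
          T(1)])
  qed
qed

lemma Dirac_core_ket:
  "(pket y, dirac_weight (dirac_flip y) *\<^sub>C pket (dirac_flip y)) \<in> Dirac_core"
proof -
  obtain s x where y: "y = (s, x)" by (cases y)
  have ket: "ket x \<in> cspan (range ket)" "0 \<in> cspan (range (ket :: _ \<Rightarrow> uq2_space))"
    by (auto intro: complex_vector.span_base complex_vector.span_zero)
  show ?thesis
  proof (cases s)
    case True
    have "((ket x, 0), (0, dcoef x *\<^sub>C ket x)) \<in> Dirac_core"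
      unfolding Dirac_core_def using ket op_adjoint_zero T_op_ket[of x] by blast
    thus ?thesis using True by (simp add: y pket_def scaleC_prod_def)
  next
    case False
    have "((0, ket x), (cnj (dcoef x) *\<^sub>C ket x, 0)) \<in> Dirac_core"
      unfolding Dirac_core_def using ket T_op_zero T_op_adjoint_ket[of x] by blast
    thus ?thesis using False by (simp add: y pket_def scaleC_prod_def)
  qed
qed

lemma Dirac_eq: "Dirac = dirac_graph"
  unfolding Dirac_def
proof (rule the_equality)
  show "self_adjoint_op dirac_graph \<and> Dirac_core \<subseteq> dirac_graph"
    using dirac.self_adjoint Dirac_core_subset by blast
  fix S assume S: "self_adjoint_op S \<and> Dirac_core \<subseteq> S"
  show "S = dirac_graph"
    by (rule dirac.self_adjoint_unique) (use S Dirac_core_ket in blast)+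
qed

text \<open>The factor c depends on the basis index only, whereas \<open>dirac_flip\<close> changes
  only the component; so W commutes with the flip and with the weights.\<close>

lemma dirac_graph_diagonal:
  assumes W: "\<And>u s x. pcoord (W u) (s, x) = c x * pcoord u (s, x)" and uv: "(u, v) \<in> dirac_graph"
  shows "(W u, W v) \<in> dirac_graph"
proof (rule monomial_opI)
  show "pcoord (W v) y = dirac_weight y * pcoord (W u) (dirac_flip y)" for y
    using monomial_opD[OF uv, of y] by (cases y) (simp add: W)
qed

lemma pcoord_map_prod:
  assumes "\<And>v x. Rep_ell2 (f v) x = c x * Rep_ell2 v (g x)"
  shows "pcoord (map_prod f f u) (s, x) = c x * pcoord u (s, g x)"
  using assms by (cases u) (simp add: pcoord_def)

lemma torus_dirac:
  assumes g: "g \<in> carrier torus3"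
  shows "{(torus_unitary2 g u, torus_unitary2 g v) |u v. (u, v) \<in> dirac_graph} = dirac_graph"
proof (intro equalityI subsetI)
  let ?U = "torus_unitary2 g" and ?U' = "cadjoint (torus_unitary2 g)"
  have c1: "pcoord (?U u) (s, x) = torus_char g (index_deg x) * pcoord u (s, x)" for u s x
    unfolding torus_unitary2_eq[OF g] by (rule pcoord_map_prod[OF Rep_torus_unitary[OF g]])
  have c2: "pcoord (?U' u) (s, x) = cnj (torus_char g (index_deg x)) * pcoord u (s, x)" for u s x
    unfolding torus_unitary2_adjoint[OF g] by (rule pcoord_map_prod[OF
        Rep_cadjoint_torus_unitary[OF g]])
  have inv: "?U (?U' u) = u" for u
    using unitary_torus_unitary2[OF g] unfolding unitary_def by (metis comp_apply id_apply)
  {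
    fix p assume "p \<in> {(?U u, ?U v) |u v. (u, v) \<in> dirac_graph}"
    thus "p \<in> dirac_graph" using dirac_graph_diagonal[OF c1] by blast
  next
    fix p assume p: "p \<in> dirac_graph"
    obtain u v where uv: "p = (u, v)" by (cases p)
    have "(?U' u, ?U' v) \<in> dirac_graph" by (rule dirac_graph_diagonal[OF c2 p[unfolded uv]])
    moreover have "p = (?U (?U' u), ?U (?U' v))" by (simp only: uv inv)
    ultimately show "p \<in> {(?U u, ?U v) |u v. (u, v) \<in> dirac_graph}" by blast
  }
qed

lemma pcoord_grading: "pcoord (grading u) (s, x) = (if s then 1 else - 1) * pcoord u (s, x)"
  by (cases u) (simp add: grading_def pcoord_def)

lemma grading_dirac: "(u, v) \<in> dirac_graph \<Longrightarrow> (grading u, - grading v) \<in> dirac_graph"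
proof (rule monomial_opI)
  assume uv: "(u, v) \<in> dirac_graph"
  show "pcoord (- grading v) y = dirac_weight y * pcoord (grading u) (dirac_flip y)" for y
    using monomial_opD[OF uv, of y] by (cases y) (simp add: pcoord_grading)
qed

lemma grading_eq: "grading = map_prod id uminus"
  by (auto simp: grading_def)

lemma grading_bounded_clinear: "bounded_clinear grading"
  unfolding grading_eq
  using bounded_clinear_minus[OF bounded_clinear_id(2)]
    by (intro map_prod_bounded_clinear bounded_clinear_id) simp

lemma cadjoint_grading: "cadjoint grading = grading"
  unfolding grading_eq by (intro cadjoint_eqI map_prod_adjoint_pair) (simp_all add:
      adjoint_pair_def)

text \<open>The critical neighbours are j = -1 and j = 0, where the coefficient of i changes sign
  and d jumps by 2 i + 1; between all other neighbours d changes by modulus 1.\<close>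

lemma cmod_dcoef_diff_le:
  "cmod (dcoef (i, j, k) - dcoef (i + 1, j, k)) \<le> 1" "cmod (dcoef (i + 1, j, k) - dcoef (i, j, k))
      \<le> 1"
  "cmod (dcoef (i, j, k) - dcoef (i, j - 1, k)) \<le> 2 * real i + 1"
  "cmod (dcoef (i, j, k) - dcoef (i, j + 1, k)) \<le> 2 * real i + 1"
  "cmod (dcoef (i, j, k) - dcoef (i, j, k - 1)) \<le> 1" "cmod (dcoef (i, j, k) - dcoef (i, j, k + 1))
      \<le> 1"
proof -
  show "cmod (dcoef (i, j, k) - dcoef (i + 1, j, k)) \<le> 1" "cmod (dcoef (i + 1, j, k) - dcoef (i,
      j, k)) \<le> 1"
    "cmod (dcoef (i, j, k) - dcoef (i, j, k - 1)) \<le> 1" "cmod (dcoef (i, j, k) - dcoef (i, j, k +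
        1)) \<le> 1"
    by (simp_all add: d_coeff_def cmod_def)
  have real: "dcoef (i, j, k) - dcoef (i, l, k)
      = complex_of_real ((if j \<ge> 0 then real i else - real i) + real_of_int j - ((if l \<ge> 0 then
          real i else - real i) + real_of_int l))" for l
    by (simp add: d_coeff_def)
  show "cmod (dcoef (i, j, k) - dcoef (i, j - 1, k)) \<le> 2 * real i + 1"
    "cmod (dcoef (i, j, k) - dcoef (i, j + 1, k)) \<le> 2 * real i + 1"
    unfolding real norm_of_real by (auto simp: abs_if)
qed

section \<open>Boundedness of the commutators\<close>

context uq2
begin

definition bounded_commutator :: "uq2_generator free_star_algebra \<Rightarrow> bool"
  where "bounded_commutator z \<longleftrightarrow> (\<exists>C. bounded_clinear C \<and>
    (\<forall>(u, v)\<in>dirac_graph. (pi_eq q (emb z) u, pi_eq q (emb z) v + C u) \<in> dirac_graph))"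

lemma pi_eq_emb_bounded_clinear: "bounded_clinear (pi_eq q (emb z))"
  by (rule rep_bounded_clinear[OF star_representation_pi_eq]) (simp add: cauchy_const)

text \<open>For a and D the coefficients of neighbours differ by 1 and the weights are at most 1.
  For b the jump 2 i + 1 is multiplied by |q|^i, and this product tends to 0. At i = 0 the product
  for a vanishes.\<close>

lemma letter_weight_diff_bounded:
  obtains K where "\<And>x. cmod (letter_weight q l x * (dcoef x - dcoef (letter_shift l x))) \<le> K"
proof -
  have "(\<lambda>i. (2 * real i + 1) * cmod q ^ i) \<longlonglongrightarrow> 0"
    using tendsto_add[OF tendsto_mult_left[OF powser_times_n_limit_0[of "cmod q"], of 2]
        LIMSEQ_realpow_zero[of "cmod q"]] q_less
    by (simp add: algebra_simps)
  hence "Bseq (\<lambda>i. (2 * real i + 1) * cmod q ^ i)" by (intro convergent_imp_Bseq convergentI)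
  then obtain K where K: "\<And>i. \<bar>(2 * real i + 1) * cmod q ^ i\<bar> \<le> K" by (auto simp: Bseq_def)
  obtain g s where l: "l = (g, s)" by (cases l)
  have "cmod (letter_weight q l x * (dcoef x - dcoef (letter_shift l x))) \<le> max 1 K" for x
  proof -
    obtain i j k where x: "x = (i, j, k)" by (metis prod_cases3)
    have le1: "cmod (letter_weight q l x * z) \<le> 1" if "cmod z \<le> 1" for z
      using mult_mono[OF letter_weight_le[of l x] that] by (simp add: norm_mult)
    have leK: "cmod (w * z) \<le> K" if "cmod w = cmod q ^ i" "cmod z \<le> 2 * real i + 1" for w z
      using mult_right_mono[OF that(2), of "cmod q ^ i"] K[of i] that(1)
        by (simp add: norm_mult mult.commute)
    show ?thesis
    proof (cases g)
      case GenA
      show ?thesis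
      proof (cases s)
        case False
        show ?thesis
        proof (cases i)
          case 0
          thus ?thesis using False GenA by (simp add: l x)
        next
          case (Suc n)
          have "cmod (dcoef x - dcoef (letter_shift l x)) \<le> 1"
            using cmod_dcoef_diff_le(2)[of n j k] False GenA Suc by (simp add: l x)
          thus ?thesis using le1 by (simp add: le_max_iff_disj)
        qed
      next
        case True
        have "cmod (dcoef x - dcoef (letter_shift l x)) \<le> 1"
          using cmod_dcoef_diff_le(1)[of i j k] True GenA by (simp add: l x)
        thus ?thesis using le1 by (simp add: le_max_iff_disj)
      qed
    next
      case GenB
      have "cmod (dcoef x - dcoef (letter_shift l x)) \<le> 2 * real i + 1"
        using cmod_dcoef_diff_le(3,4)[of i j k] GenB by (simp add: l x del: dcoef.simps)
      moreover have "cmod (letter_weight q l x) = cmod q ^ i" using GenB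
        by (simp add: l x norm_power)
      ultimately show ?thesis using leK by (simp add: le_max_iff_disj)
    next
      case GenD
      have "cmod (dcoef x - dcoef (letter_shift l x)) \<le> 1"
        using cmod_dcoef_diff_le(5,6)[of i j k] GenD by (simp add: l x del: dcoef.simps)
      thus ?thesis using le1 by (simp add: le_max_iff_disj)
    qed
  qed
  thus thesis by (rule that)
qed

lemma bounded_commutator_letter: "bounded_commutator (free_letter l)"
proof -
  obtain K where K: "\<And>x. cmod (letter_weight q l x * (dcoef x - dcoef (letter_shift l x))) \<le> K"
    by (rule letter_weight_diff_bounded[of l]) blast
  \<comment> \<open>The commutator is again a weighted shift: it shifts the index as the letter does
    and flips the component, with the weight of the letter times a difference of entries of the
    Dirac operator.\<close>
  define g where "g y = dirac_flip (fst y, letter_shift l (snd y))" for y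
  define c where "c y = letter_weight q l (snd y) * (dirac_weight y - dirac_weight (fst y,
      letter_shift l (snd y)))" for y
  have inj: "inj_on g {y. c y \<noteq> 0}"
  proof (rule inj_onI)
    fix y y' assume c: "y \<in> {y. c y \<noteq> 0}" "y' \<in> {y. c y \<noteq> 0}" and eq: "g y = g y'"
    have "letter_shift l (snd y) = letter_shift l (snd y')" "fst y = fst y'" using eq
        by (simp_all add: g_def)
    with c letter_shift_inj[of l, THEN inj_onD, of "snd y" "snd y'"] show "y = y'"
      by (auto simp: c_def intro: prod_eqI)
  qed
  have bound: "cmod (c y) \<le> K" for y
  proof -
    have "cmod (dirac_weight y - dirac_weight (fst y, letter_shift l (snd y))) = cmod (dcoef (snd
        y) - dcoef (letter_shift l (snd y)))"
      by (cases y) (auto simp flip: complex_cnj_diff)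
    thus ?thesis using K[of "snd y"] by (simp add: c_def norm_mult)
  qed
  let ?C = "pair_shift g c"
  have p: "pcoord (pi_eq q (emb (free_letter l)) u) (s, x) = letter_weight q l x * pcoord u (s,
      letter_shift l x)" for u s x
    unfolding pi_eq_emb free_rep_letter by (rule pcoord_map_prod[OF Rep_letter_op])
  have "(pi_eq q (emb (free_letter l)) u, pi_eq q (emb (free_letter l)) v + ?C u) \<in> dirac_graph"
    if uv: "(u, v) \<in> dirac_graph" for u v
  proof (rule monomial_opI)
    fix y :: "bool \<times> nat \<times> int \<times> int"
    obtain s x where y: "y = (s, x)" by (cases y)
    show "pcoord (pi_eq q (emb (free_letter l)) v + ?C u) y
        = dirac_weight y * pcoord (pi_eq q (emb (free_letter l)) u) (dirac_flip y)"
      using monomial_opD[OF uv, of "(s, letter_shift l x)"]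
      by (simp add: y p pcoord_pair_shift[OF inj bound] c_def g_def algebra_simps del:
          dirac_weight.simps)
  qed
  thus ?thesis
    unfolding bounded_commutator_def using pair_shift_bounded_clinear[OF inj bound] by blast
qed

lemma pi_eq_simps:
  "pi_eq q (emb (y + z)) \<xi> = pi_eq q (emb y) \<xi> + pi_eq q (emb z) \<xi>"
  "pi_eq q (emb (y * z)) \<xi> = pi_eq q (emb y) (pi_eq q (emb z) \<xi>)"
  "pi_eq q (emb (free_scale c z)) \<xi> = c *\<^sub>C pi_eq q (emb z) \<xi>"
  "pi_eq q (emb 1) \<xi> = \<xi>"
  by (cases \<xi>; simp add: pi_eq_emb free_rep_add free_rep_mult free_rep_scale free_rep_one
      scaleC_prod_def)+

lemma bounded_commutator_one: "bounded_commutator 1"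
  unfolding bounded_commutator_def
  by (rule exI[of _ "\<lambda>_. 0"]) (simp add: bounded_clinear_const_zero pi_eq_simps)

lemma bounded_commutator_mult:
  assumes "bounded_commutator y" "bounded_commutator z" shows "bounded_commutator (y * z)"
proof -
  from assms obtain C C' where C: "bounded_clinear C"
    "\<And>u v. (u, v) \<in> dirac_graph \<Longrightarrow> (pi_eq q (emb y) u, pi_eq q (emb y) v + C u) \<in> dirac_graph"
    and C': "bounded_clinear C'"
    "\<And>u v. (u, v) \<in> dirac_graph \<Longrightarrow> (pi_eq q (emb z) u, pi_eq q (emb z) v + C' u) \<in> dirac_graph"
    unfolding bounded_commutator_def by blast
  \<comment> \<open>The Leibniz rule [D, y z] = y [D, z] + [D, y] z.\<close>
  let ?C = "\<lambda>u. pi_eq q (emb y) (C' u) + C (pi_eq q (emb z) u)"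
  have "bounded_clinear ?C"
    by (intro bounded_clinear_plus bounded_clinear_compose[OF pi_eq_emb_bounded_clinear C'(1)]
        bounded_clinear_compose[OF C(1) pi_eq_emb_bounded_clinear])
  moreover have "(pi_eq q (emb (y * z)) u, pi_eq q (emb (y * z)) v + ?C u) \<in> dirac_graph"
    if "(u, v) \<in> dirac_graph" for u v
    using C(2)[OF C'(2)[OF that]]
    by (simp only: pi_eq_simps bounded_clinear_add[OF pi_eq_emb_bounded_clinear] add.assoc)
  ultimately show ?thesis unfolding bounded_commutator_def by blast
qed

lemma bounded_commutator_add:
  assumes "bounded_commutator y" "bounded_commutator z" shows "bounded_commutator (y + z)"
proof -
  from assms obtain C C' where C: "bounded_clinear C"
    "\<And>u v. (u, v) \<in> dirac_graph \<Longrightarrow> (pi_eq q (emb y) u, pi_eq q (emb y) v + C u) \<in> dirac_graph"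
    and C': "bounded_clinear C'"
    "\<And>u v. (u, v) \<in> dirac_graph \<Longrightarrow> (pi_eq q (emb z) u, pi_eq q (emb z) v + C' u) \<in> dirac_graph"
    unfolding bounded_commutator_def by blast
  have "(pi_eq q (emb (y + z)) u, pi_eq q (emb (y + z)) v + (C u + C' u)) \<in> dirac_graph"
    if uv: "(u, v) \<in> dirac_graph" for u v
    using complex_vector.subspace_add[OF csubspace_monomial_op C(2)[OF uv] C'(2)[OF uv]]
    by (simp only: pi_eq_simps add_Pair add_ac)
  thus ?thesis
    unfolding bounded_commutator_def using bounded_clinear_plus[OF C(1) C'(1)] by blast
qed

lemma bounded_commutator_scale:
  assumes "bounded_commutator z" shows "bounded_commutator (free_scale c z)"
proof -
  from assms obtain C where C: "bounded_clinear C"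
    "\<And>u v. (u, v) \<in> dirac_graph \<Longrightarrow> (pi_eq q (emb z) u, pi_eq q (emb z) v + C u) \<in> dirac_graph"
    unfolding bounded_commutator_def by blast
  have "(pi_eq q (emb (free_scale c z)) u, pi_eq q (emb (free_scale c z)) v + c *\<^sub>C C u) \<in>
      dirac_graph"
    if uv: "(u, v) \<in> dirac_graph" for u v
    using complex_vector.subspace_scale[OF csubspace_monomial_op C(2)[OF uv], of c]
    unfolding scaleC_prod_def[of c "(_, _)"] fst_conv snd_conv
      by (simp only: pi_eq_simps scaleC_add_right)
  thus ?thesis
    unfolding bounded_commutator_def using bounded_clinear_scale[OF C(1)] by blast
qed

lemma bounded_commutator: "bounded_commutator z"
proof (induction z rule: free_star_algebra_induct)
  case (single w c)
  have "bounded_commutator (Poly_Mapping.single (Star_Word ls) 1)" for ls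
    by (induction ls)
      (simp_all only: single_Star_Word_Nil single_Star_Word_Cons bounded_commutator_one
        bounded_commutator_mult bounded_commutator_letter)
  hence "bounded_commutator (Poly_Mapping.single w 1)" by (metis star_word.collapse)
  thus ?case by (subst single_eq_free_scale) (rule bounded_commutator_scale)
qed (rule bounded_commutator_add)

lemma even_spectral_triple: "even_spectral_triple \<A> (A_f q) (pi_eq q) Dirac grading"
proof -
  have A: "A_f q \<subseteq> carrier \<A>" using A_f_subalgebra by (simp add: unital_star_subalgebra_def)
  have rep: "star_representation_on \<A> (A_f q) (pi_eq q)"
    using star_representation_pi_eq A unfolding star_representation_on_def by blast
  have comm: "\<exists>C. bounded_clinear C \<and> (\<forall>(u, v)\<in>Dirac. (pi_eq q x u, pi_eq q x v + C u) \<in> Dirac)"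
    if x: "x \<in> A_f q" for x
  proof -
    obtain z where "x = emb z" using x unfolding A_f_eq by blast
    thus ?thesis using bounded_commutator[of z] unfolding bounded_commutator_def Dirac_eq by blast
  qed
  have gr: "grading \<circ> grading = id" by (auto simp: grading_def)
  have "grading \<circ> pi_eq q x = pi_eq q x \<circ> grading" if x: "x \<in> A_f q" for x
  proof -
    have neg: "uq2_rep q x (- v) = - uq2_rep q x v" for v
      using A x by (auto simp: uq2_rep_eq blinfun.minus_right)
    show ?thesis by (auto simp: grading_def pi_eq_def neg)
  qed
  thus ?thesis
    unfolding even_spectral_triple_def
    using unital_cstar_algebra A_f_subalgebra A_f_dense separable_prod[OF separable_ell2
        separable_ell2]
      rep dirac.self_adjoint dirac.compact_resolvent[OF dirac.finite_level] comm
      grading_bounded_clinear cadjoint_grading gr grading_dirac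
    unfolding Dirac_eq by blast
qed

lemma equivariant_even_spectral_triple:
  "equivariant_even_spectral_triple \<A> torus3 (top_of_set (carrier torus3)) (torus_action q) (A_f q)
    (pi_eq q) torus_unitary2 Dirac grading"
proof -
  have "torus_unitary2 g \<circ> grading = grading \<circ> torus_unitary2 g" if g: "g \<in> carrier torus3" for g
  proof -
    have "torus_unitary g (- v) = - torus_unitary g v" for v
      by (rule ell2_eqI) (simp add: Rep_torus_unitary[OF g])
    thus ?thesis by (auto simp: grading_def torus_unitary2_def)
  qed
  thus ?thesis
    unfolding equivariant_even_spectral_triple_def
    using torus_cstar_dynamical_system star_representation_pi_eq torus_unitary_representation
        equivariance
      pi_eq_inj even_spectral_triple torus_dirac unfolding Dirac_eq by blast
qed

end

theorem theorem5p8: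
  fixes q :: complex
  assumes "0 < cmod q" and "cmod q < 1"
  shows "equivariant_even_spectral_triple (C_Uq2 q) torus3 (top_of_set (carrier torus3))
           (torus_action q) (A_f q) (pi_eq q) torus_unitary2 Dirac grading
         \<and> p_plus_summable 3 Dirac"
proof -
  interpret uq2 q using assms by unfold_locales
  show ?thesis
    using equivariant_even_spectral_triple dirac.p_plus_summable by (simp add: C_Uq2_eq Dirac_eq)
qed

end
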